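(* Let $N \geq 2$ and $s>0$. Then for all $u \in C_{0}^{\infty}(\mathbb{R}^{N})$, $$\left(\int_{\mathbb{R}^{N}}\left|(-\Delta)^{s/2}u\right|^{2}dx\right)^{\frac{1}{2}}\left(\int_{\mathbb{R}^{N}}|x|^{2}|\nabla u|^{2}\,dx\right)^{\frac{1}{2}}\geq \frac{N+s}{2}\int_{\mathbb{R}^{N}}\left|(-\Delta)^{s/4}u\right|^{2}dx,$$ and the constant $\frac{N+s}{2}$ is sharp. Moreover, equality in this inequality is attained exactly by the profiles $\alpha\,G_{s,\lambda}$ with $\alpha \in \mathbb{C}\setminus\{0\}$ and $\lambda>0$, and one has, for all $u \in C_{0}^{\infty}(\mathbb{R}^{N})$, the sharp stability estimate $$\left(\int_{\mathbb{R}^{N}}\left|(-\Delta)^{s/2}u\right|^{2}dx\right)^{\frac{1}{2}}\left(\int_{\mathbb{R}^{N}}|x|^{2}|\nabla u|^{2}\,dx\right)^{\frac{1}{2}}-\frac{N+s}{2}\int_{\mathbb{R}^{N}}\left|(-\Delta)^{s/4}u\right|^{2}dx\geq\frac{\min\left\{2s,\,\sqrt{N^{2}+4N-4}-N\right\}}{2}\inf_{\alpha \in \mathbb{C},\,\lambda>0}\int_{\mathbb{R}^{N}}\left|(-\Delta)^{s/4}\left(u-\alpha\,G_{s,\lambda}\right)\right|^{2}dx,$$ and this constant is also sharp.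
   Context: Functions may be complex-valued. The Fourier transform is $\mathcal{F}(f)(\xi)=\widehat f(\xi)=\int_{\mathbb{R}^N} f(x)e^{-2\pi i x\cdot\xi}\,dx$, with inverse $\mathcal{F}^{-1}$. For $\kappa\in\mathbb{R}$, $(-\Delta)^{\kappa/2}$ is defined by $\mathcal{F}((-\Delta)^{\kappa/2}u)(\xi)=(2\pi|\xi|)^{\kappa}\widehat u(\xi)$, so that $\int_{\mathbb{R}^N}|(-\Delta)^{\kappa/2}u|^2dx=(2\pi)^{2\kappa}\int_{\mathbb{R}^N}|\xi|^{2\kappa}|\widehat u(\xi)|^2d\xi$. For $\sigma>0$ and $\lambda>0$, $G_{\sigma,\lambda}:=\mathcal{F}^{-1}\left(e^{-\lambda|\xi|^{\sigma}/\sigma}\right)$. The equality statement refers to nonzero functions in the completion of $C_0^\infty(\mathbb{R}^N)$ under the norm $\left(\int|(-\Delta)^{s/2}u|^2dx+\int|x|^2|\nabla u|^2dx\right)^{1/2}$, to which the inequalities extend by continuity. *)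

theory Defs
  imports "HOL-Analysis.Analysis"
begin

subsection \<open>Test functions\<close>

definition partial_deriv :: "'a::euclidean_space \<Rightarrow> ('a \<Rightarrow> complex) \<Rightarrow> 'a \<Rightarrow> complex" where
  "partial_deriv b f x = frechet_derivative f (at x) b"

text \<open>Being \<open>C\<^sup>\<infinity>\<close> means that all iterated partial derivatives (along the standard basis) exist and
  are themselves (Frechet) differentiable, hence continuous.\<close>

definition smooth_fun :: "('a::euclidean_space \<Rightarrow> complex) \<Rightarrow> bool" where
  "smooth_fun f \<longleftrightarrow>
     (\<forall>bs. set bs \<subseteq> Basis \<longrightarrow> (\<forall>x. foldr partial_deriv bs f differentiable (at x)))"

definition test_fun :: "('a::euclidean_space \<Rightarrow> complex) \<Rightarrow> bool" where
  "test_fun f \<longleftrightarrow> smooth_fun f \<and> compact (closure {x. f x \<noteq> 0})"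


subsection \<open>The Fourier transform\<close>

definition square_int :: "('a::euclidean_space \<Rightarrow> complex) \<Rightarrow> bool" where
  "square_int f \<longleftrightarrow> f \<in> borel_measurable lborel \<and> integrable lborel (\<lambda>x. (cmod (f x))\<^sup>2)"

definition l2sq :: "('a::euclidean_space \<Rightarrow> complex) \<Rightarrow> real" where
  "l2sq f = (LINT x|lborel. (cmod (f x))\<^sup>2)"

definition fourier :: "('a::euclidean_space \<Rightarrow> complex) \<Rightarrow> 'a \<Rightarrow> complex" where
  "fourier f \<xi> = (LINT x|lborel. f x * exp (- 2 * of_real pi * \<i> * of_real (x \<bullet> \<xi>)))"

definition inv_fourier :: "('a::euclidean_space \<Rightarrow> complex) \<Rightarrow> 'a \<Rightarrow> complex" where
  "inv_fourier g x = (LINT \<xi>|lborel. g \<xi> * exp (2 * of_real pi * \<i> * of_real (x \<bullet> \<xi>)))"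

text \<open>\<open>has_fourier_L2 f g\<close> says that \<open>g\<close> represents the Fourier transform of \<open>f \<in> L\<^sup>2\<close>: the
  continuous extension of \<^const>\<open>fourier\<close> from \<open>L\<^sup>1 \<inter> L\<^sup>2\<close> to \<open>L\<^sup>2\<close> (Plancherel). The limit \<open>g\<close> is
  determined only up to null sets.\<close>

definition has_fourier_L2 :: "('a::euclidean_space \<Rightarrow> complex) \<Rightarrow> ('a \<Rightarrow> complex) \<Rightarrow> bool" where
  "has_fourier_L2 f g \<longleftrightarrow> square_int f \<and> square_int g \<and>
     (\<exists>h. (\<forall>n. integrable lborel (h n) \<and> square_int (h n)) \<and>
          (\<lambda>n::nat. l2sq (\<lambda>x. h n x - f x)) \<longlonglongrightarrow> 0 \<and>
          (\<lambda>n. l2sq (\<lambda>\<xi>. fourier (h n) \<xi> - g \<xi>)) \<longlonglongrightarrow> 0)"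


subsection \<open>Fractional Laplacian\<close>

text \<open>\<open>has_frac_lap p u w\<close> says that \<open>w = (-\<Delta>)\<^sup>p u\<close>, i.e. the operator with Fourier multiplier
  \<open>(2 \<pi> |\<xi>|)\<^bsup>2 p\<^esup>\<close>, with \<open>u\<close> and \<open>w\<close> in \<open>L\<^sup>2\<close>. As \<open>w\<close> is unique up to null sets, the choice made in
  \<open>frac_lap\<close> is immaterial below, where it is used only under integrals.\<close>

definition has_frac_lap :: "real \<Rightarrow> ('a::euclidean_space \<Rightarrow> complex) \<Rightarrow> ('a \<Rightarrow> complex) \<Rightarrow> bool" where
  "has_frac_lap p u w \<longleftrightarrow>
     (\<exists>v. has_fourier_L2 u v \<and>
          has_fourier_L2 w (\<lambda>\<xi>. of_real ((2 * pi * norm \<xi>) powr (2 * p)) * v \<xi>))"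

definition frac_lap :: "real \<Rightarrow> ('a::euclidean_space \<Rightarrow> complex) \<Rightarrow> 'a \<Rightarrow> complex" where
  "frac_lap p u = (SOME w. has_frac_lap p u w)"

definition lap_energy :: "real \<Rightarrow> ('a::euclidean_space \<Rightarrow> complex) \<Rightarrow> real" where
  "lap_energy p u = (LINT x|lborel. (cmod (frac_lap p u x))\<^sup>2)"

definition grad_energy :: "('a::euclidean_space \<Rightarrow> complex) \<Rightarrow> real" where
  "grad_energy u =
     (LINT x|lborel. (norm x)\<^sup>2 * (\<Sum>b\<in>Basis. (cmod (partial_deriv b u x))\<^sup>2))"

definition G :: "real \<Rightarrow> real \<Rightarrow> 'a::euclidean_space \<Rightarrow> complex" where
  "G \<sigma> \<mu> = inv_fourier (\<lambda>\<xi>. of_real (exp (- \<mu> * norm \<xi> powr \<sigma> / \<sigma>)))"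


subsection \<open>The completion of the test functions\<close>

definition energy_norm :: "real \<Rightarrow> ('a::euclidean_space \<Rightarrow> complex) \<Rightarrow> real" where
  "energy_norm s u = sqrt (lap_energy (s / 2) u + grad_energy u)"

text \<open>By Hardy's inequality \<open>(N\<^sup>2 / 4) \<integral> |u|\<^sup>2 \<le> \<integral> |x|\<^sup>2 |\<nabla>u|\<^sup>2\<close> every sequence of test functions that is
  Cauchy in the energy norm converges in \<open>L\<^sup>2\<close>, and the \<open>L\<^sup>2\<close> limit determines its class in the
  completion. So elements of the completion are realised as \<open>L\<^sup>2\<close> functions, modulo null sets.\<close>

definition approximates ::
    "real \<Rightarrow> (nat \<Rightarrow> 'a::euclidean_space \<Rightarrow> complex) \<Rightarrow> ('a \<Rightarrow> complex) \<Rightarrow> bool" where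
  "approximates s \<phi> u \<longleftrightarrow>
     (\<forall>n. test_fun (\<phi> n)) \<and>
     (\<forall>e>0. \<exists>M. \<forall>m\<ge>M. \<forall>n\<ge>M. energy_norm s (\<lambda>x. \<phi> m x - \<phi> n x) < e) \<and>
     square_int u \<and> (\<lambda>n. l2sq (\<lambda>x. \<phi> n x - u x)) \<longlonglongrightarrow> 0"

definition completion :: "real \<Rightarrow> ('a::euclidean_space \<Rightarrow> complex) set" where
  "completion s = {u. \<exists>\<phi>. approximates s \<phi> u}"

text \<open>Value at \<open>u\<close> of the continuous extension of a functional \<open>Q\<close> from the test functions to their
  completion.\<close>

definition extend :: "real \<Rightarrow> (('a::euclidean_space \<Rightarrow> complex) \<Rightarrow> real) \<Rightarrow> ('a \<Rightarrow> complex) \<Rightarrow> real" where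
  "extend s Q u = (THE l. \<forall>\<phi>. approximates s \<phi> u \<longrightarrow> (\<lambda>n. Q (\<phi> n)) \<longlonglongrightarrow> l)"

text \<open>The nonzero elements of the completion at which the extended inequality
  \<open>(\<integral>|(-\<Delta>)\<^bsup>s/2\<^esup> u|\<^sup>2)\<^bsup>1/2\<^esup> (\<integral>|x|\<^sup>2 |\<nabla>u|\<^sup>2)\<^bsup>1/2\<^esup> \<ge> C \<integral>|(-\<Delta>)\<^bsup>s/4\<^esup> u|\<^sup>2\<close> is an equality.\<close>

definition equality_case :: "real \<Rightarrow> real \<Rightarrow> ('a::euclidean_space \<Rightarrow> complex) \<Rightarrow> bool" where
  "equality_case s C u \<longleftrightarrow>
     u \<in> completion s \<and> \<not> (AE x in lborel. u x = 0) \<and>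
     sqrt (extend s (lap_energy (s / 2)) u) * sqrt (extend s grad_energy u)
       = C * extend s (lap_energy (s / 4)) u"

text \<open>\<open>\<integral>|(-\<Delta>)\<^bsup>s/4\<^esup> (u - \<alpha> G\<^bsub>s,\<mu>\<^esub>)|\<^sup>2\<close>, minimised over \<open>\<alpha> \<in> \<complex>\<close> and \<open>\<mu> > 0\<close>.\<close>

definition dist_to_profiles :: "real \<Rightarrow> ('a::euclidean_space \<Rightarrow> complex) \<Rightarrow> real" where
  "dist_to_profiles s u =
     (INF (\<alpha>, \<mu>) \<in> UNIV \<times> {0<..}. lap_energy (s / 4) (\<lambda>x. u x - \<alpha> * G s \<mu> x))"

end

theory Submission
 imports Defs "HOL-Probability.Probability"
begin

text \<open>On the Fourier side, with \<open>v\<close> the transform of \<open>u\<close>, \<open>R = x \<bullet> \<nabla>\<close> and \<open>N\<close> the dimension, integration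
 by parts along dilations gives, for every \<open>mu > 0\<close>,
 \<open>\<integral>|x|\<^sup>2|\<nabla>v|\<^sup>2 + mu\<^sup>2 \<integral>|x|\<^bsup>2s\<^esup>|v|\<^sup>2 - mu (N + s) \<integral>|x|\<^sup>s|v|\<^sup>2 = \<integral>|R v + mu |x|\<^sup>s v|\<^sup>2 + A(v)\<close>,
 where \<open>A(v)\<close> is the energy of the angular derivatives. The right-hand side vanishes exactly on the multiples
 of \<open>exp (- mu |x|\<^sup>s / s)\<close>; choosing \<open>mu\<close> optimally turns the sum of the two energies into their geometric mean.
 For the stability estimate split \<open>v\<close> into its spherical mean and a remainder \<open>w\<close>. For \<open>w\<close> combine
 \<open>A(w) >= (N - 1) \<integral>|w|\<^sup>2\<close>, the Poincare inequality of the sphere (obtained from the Gaussian one, proved by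
 rotating two independent copies into each other), with \<open>\<integral>|R w + mu |x|\<^sup>s w - a w|\<^sup>2 >= 0\<close>, where \<open>a\<^sup>2 + N a = N - 1\<close>.
 For the radial part subtract the multiple of the profile that creates a zero on a suitable sphere and use a
 Riccati multiplier that is singular there; this gives the gap \<open>2 s\<close>. Both gaps are attained to leading order
 by perturbations of the profile.\<close>

text \<open>The angular energy controls the plain mass of the nonradial part w, whereas the distance
  to the profiles is weighted by |x|^s. The number a converts one into the other: expanding |R w +
  mu |x|^s w - a w|^2 and integrating by parts costs a^2 + N a plain masses and yields 2 a mu
  weighted ones, so the Poincare constant N - 1 is used up exactly; the discriminant of a^2 + N a =
  N - 1 is N^2 + 4 N - 4. On radial functions, dividing by the profile gives a Laguerre operator in
  |x|^s with first excited state h = |x|^s - (N + s) / (2 mu); the Riccati multiplier is R h / h.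
  For the optimal mu the quadratic expression is 2 mu times the deficit of the product, which halves
  the gap. The profiles are in general not smooth at the origin, so the identities are proved for
  functions differentiable off the origin, and test functions enter as truncations of inverse
  transforms. The equality case comes out of the stability estimate: along an approximating sequence
  the deficit tends to 0, and the multiples of a fixed profile supplied by the estimate
  subconverge.\<close>

section \<open>Notation; Lebesgue measure under affine maps\<close>

abbreviation nn_lborel :: "('a::euclidean_space => ennreal) => ennreal"  (binder "NN " 10)
 where "nn_lborel f \<equiv> nn_integral lborel f"

abbreviation integral_lborel :: "('a::euclidean_space => 'b::{banach, second_countable_topology}) => 'b"  (binder "LI " 10)
 where "integral_lborel f \<equiv> integral\<^sup>L lborel f"

abbreviation integ :: "('a::euclidean_space => 'b::{banach, second_countable_topology}) => bool"
 where "integ f \<equiv> integrable lborel f"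

abbreviation tends_to :: "(nat => 'a::topological_space) => 'a => bool"  (infix "---->" 60)
 where "X ----> l \<equiv> X \<longlonglongrightarrow> l"

abbreviation scaleR_dot :: "real => 'a::real_normed_vector => 'a"  (infixr "*." 75)
 where "r *. x \<equiv> scaleR r x"

abbreviation bmeas :: "('a::topological_space => 'b::topological_space) set"
 where "bmeas \<equiv> borel_measurable borel"

lemmas integrable_bound = Bochner_Integration.integrable_bound

abbreviation csq :: "complex => real" where "csq z \<equiv> (cmod z)\<^sup>2"

lemma integral_lborel_shift:
 fixes f :: "'a::euclidean_space => 'b::{banach, second_countable_topology}"
 shows "(LI x. f (x + c)) = (LI x. f x)"
proof (cases "f \<in> bmeas")
 case True
 then have "(LINT x|distr lborel borel ((+) c). f x) = (LI x. f (c + x))"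
 by (intro integral_distr) auto
 then show ?thesis by (simp add: lborel_distr_plus add.commute)
next
 \<comment> \<open>For a nonmeasurable function neither side is integrable, so both integrals have
   the default value 0; this is why the identity carries no hypothesis.\<close>
 case False
 have "(%x. f (x + c)) \<notin> bmeas"
 proof
 assume "(%x. f (x + c)) \<in> bmeas"
 then have "(%x. f (x - c + c)) \<in> bmeas"
 by measurable
 with False show False by simp
 qed
 with False have "\<not> integ f" "\<not> integ (%x. f (x + c))"
 using borel_measurable_integrable by force+
 then show ?thesis by (simp add: not_integrable_integral_eq)
qed

lemma integrable_lborel_shift:
 fixes f :: "'a::euclidean_space => 'b::{banach, second_countable_topology}"
 assumes "integ f"
 shows "integ (%x. f (x + c))"
proof -
 have "integrable (distr lborel borel ((+) c)) f"
 using assms by (simp add: lborel_distr_plus)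
 then have "integ (%x. f (c + x))"
 using assms by (subst (asm) integrable_distr_eq) auto
 then show ?thesis by (simp add: add.commute)
qed

lemma nn_integral_lborel_shift:
 fixes f :: "'a::euclidean_space => ennreal"
 assumes [measurable]: "f \<in> bmeas"
 shows "(NN x. f (x + c)) = (NN x. f x)"
proof -
 have "(\<integral>\<^sup>+x. f x \<partial>distr lborel borel ((+) c)) = (NN x. f (c + x))"
 by (intro nn_integral_distr) auto
 then show ?thesis by (simp add: lborel_distr_plus add.commute)
qed

lemma nn_integral_lborel_scale:
 fixes f :: "'a::euclidean_space => ennreal"
 assumes [measurable]: "f \<in> bmeas" and c: "c ~= 0"
 shows "(NN x. f (c *. x)) = ennreal (1 / \<bar>c\<bar> ^ DIM('a)) * (NN x. f x)"
proof -
 have "(NN x. f x) = (NN x. ennreal (\<bar>c\<bar> ^ DIM('a)) * f (c *. x))"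
 by (subst lborel_affine[OF c, of 0])
 (simp add: nn_integral_density nn_integral_distr)
 also have "... = ennreal (\<bar>c\<bar> ^ DIM('a)) * (NN x. f (c *. x))"
 by (subst nn_integral_cmult) auto
 finally show ?thesis
 using c by (simp add: mult.assoc[symmetric] ennreal_mult'[symmetric])
qed

lemma integral_lborel_reflect:
 fixes f :: "'a::euclidean_space => 'b::{banach, second_countable_topology}"
 assumes [measurable]: "f \<in> bmeas"
 shows "(LI x. f (- x)) = (LI x. f x)"
proof -
 have "lborel = distr lborel borel (uminus :: 'a => 'a)"
 using lborel_affine[of "-1" "0::'a"] by (simp add: density_1)
 then have "(LI x. f x) = (LINT x|distr lborel borel (uminus :: 'a => 'a). f x)"
 by simp
 also have "... = (LI x. f (- x))"
 by (intro integral_distr) auto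
 finally show ?thesis by simp
qed

lemma nn_integral_inverse_1_plus_square: "(NN x. ennreal (1 / (1 + x\<^sup>2))) < \<infinity>"
proof -
 have "integ (%x::real. inverse (1 + x\<^sup>2))"
 using integrable_inverse_1_plus_square by (simp add: set_integrable_def)
 then show ?thesis
 by (simp add: integrable_iff_bounded inverse_eq_divide)
qed

text \<open>The exponent 2 N is chosen so that the function lies below the product over the
  coordinates of 1 / (1 + (x \<bullet> b)^2), whose integral factorises. It is the standard majorant
  for dominated convergence throughout.\<close>

lemma integrable_inverse_power_norm:
 "integ (%x::'a::euclidean_space. 1 / (1 + norm x) ^ (2 * DIM('a)))"
proof (rule integrableI_bounded)
 have "(NN (x::'a). ennreal (norm (1 / (1 + norm x) ^ (2 * DIM('a)))))
 <= (NN (x::'a). (\<Prod>b\<in>Basis. ennreal (1 / (1 + (x \<bullet> b)\<^sup>2))))"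
 proof (rule nn_integral_mono)
 fix x :: 'a
 have "(\<Prod>b\<in>(Basis::'a set). 1 / (1 + norm x)\<^sup>2) <= (\<Prod>b\<in>(Basis::'a set). 1 / (1 + (x \<bullet> b)\<^sup>2))"
 proof (rule prod_mono)
 fix b :: 'a assume b: "b \<in> Basis"
 have "(x \<bullet> b)\<^sup>2 <= (norm x)\<^sup>2"
 using power_mono[OF Basis_le_norm[OF b, of x], of 2] by simp
 then have "1 + (x \<bullet> b)\<^sup>2 <= (1 + norm x)\<^sup>2"
 by (simp add: power2_sum) (smt (verit) norm_ge_zero)
 then show "0 <= 1 / (1 + norm x)\<^sup>2 \<and> 1 / (1 + norm x)\<^sup>2 <= 1 / (1 + (x \<bullet> b)\<^sup>2)"
 by (auto intro!: divide_left_mono mult_pos_pos zero_less_power add_pos_nonneg)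
 qed
 then have "1 / (1 + norm x) ^ (2 * DIM('a)) <= (\<Prod>b\<in>(Basis::'a set). 1 / (1 + (x \<bullet> b)\<^sup>2))"
 by (simp add: power_divide power_mult)
 then show "ennreal (norm (1 / (1 + norm x) ^ (2 * DIM('a))))
 <= (\<Prod>b\<in>Basis. ennreal (1 / (1 + (x \<bullet> b)\<^sup>2)))"
 by (subst prod_ennreal) (auto intro!: ennreal_leI)
 qed
 also have "... = (\<Prod>b\<in>(Basis::'a set). (NN x. ennreal (1 / (1 + x\<^sup>2))))"
 by (rule nn_integral_lborel_prod) auto
 also have "... < \<infinity>"
 using nn_integral_inverse_1_plus_square by (simp add: power_less_top_ennreal)
 finally show "(NN (x::'a). ennreal (norm (1 / (1 + norm x) ^ (2 * DIM('a))))) < \<infinity>" .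
qed simp

subsection \<open>Rapidly decreasing functions\<close>

text \<open>Decay without smoothness: the profiles decay faster than every power but are in general
  not smooth at the origin, so regularity is tracked separately by \<open>nice\<close>.\<close>

definition rapid :: "('a::euclidean_space => complex) => bool" where
 "rapid f \<longleftrightarrow> f \<in> bmeas \<and> (\<forall>k. \<exists>C. \<forall>x. cmod (f x) * (1 + norm x) ^ k <= C)"

lemma rapidD_measurable[measurable_dest]: "rapid f ==> f \<in> bmeas"
 by (simp add: rapid_def)

lemma rapid_bound:
 assumes "rapid f"
 obtains C where "C >= 0" "!!x. cmod (f x) <= C / (1 + norm x) ^ k"
proof -
 from assms obtain C where C: "!!x. cmod (f x) * (1 + norm x) ^ k <= C"
 unfolding rapid_def by blast
 have "0 <= C" using C[of 0] by (smt (verit) mult_nonneg_nonneg norm_ge_zero zero_le_power)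
 moreover have "cmod (f x) <= C / (1 + norm x) ^ k" for x
 using C[of x] by (subst pos_le_divide_eq) (auto intro!: zero_less_power add_pos_nonneg)
 ultimately show ?thesis using that by blast
qed

text \<open>A polynomial factor is absorbed by raising the exponent in the decay bound. Most closure
  properties below are instances.\<close>

lemma rapid_dominated:
 assumes "rapid f" and [measurable]: "g \<in> bmeas"
 and "!!x. cmod (g x) <= C * (1 + norm x) ^ j * cmod (f x)"
 shows "rapid g"
 unfolding rapid_def
proof safe
 fix k
 from rapid_bound[OF assms(1), of "j + k"] obtain D
 where D: "D >= 0" "!!x. cmod (f x) <= D / (1 + norm x) ^ (j + k)" by blast
 have "cmod (g x) * (1 + norm x) ^ k <= \<bar>C\<bar> * D" for x
 proof -
 have p: "(1 + norm x) ^ i > 0" for i by (intro zero_less_power add_pos_nonneg) auto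
 have "cmod (g x) * (1 + norm x) ^ k <= C * (1 + norm x) ^ j * cmod (f x) * (1 + norm x) ^ k"
 using assms(3)[of x] p[of k] by (intro mult_right_mono) auto
 also have "... = C * (cmod (f x) * (1 + norm x) ^ (j + k))"
 by (simp add: power_add)
 also have "... <= \<bar>C\<bar> * (cmod (f x) * (1 + norm x) ^ (j + k))"
 using p[of "j+k"] by (intro mult_right_mono) auto
 also have "... <= \<bar>C\<bar> * D"
 using D(2)[of x] p[of "j+k"] by (intro mult_left_mono) (auto simp: pos_le_divide_eq)
 finally show ?thesis .
 qed
 then show "\<exists>C. \<forall>x. cmod (g x) * (1 + norm x) ^ k <= C" by blast
qed (fact assms(2))

lemma rapid_integrable:
 assumes "rapid f" shows "integ f"
proof -
 from rapid_bound[OF assms, of "2 * DIM('a)"] obtain C where C: "C >= 0"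
 "!!x. cmod (f x) <= C / (1 + norm x) ^ (2 * DIM('a))" by blast
 have "integ (%x::'a. C * (1 / (1 + norm x) ^ (2 * DIM('a))))"
 using integrable_inverse_power_norm by (rule integrable_mult_right)
 then show ?thesis
 by (rule integrable_bound)
 (use assms C in \<open>auto simp: rapid_def intro!: order.trans[OF C(2)]\<close>)
qed

lemma rapid_add:
 assumes "rapid f" "rapid g" shows "rapid (%x. f x + g x)"
 unfolding rapid_def
proof safe
 fix k
 from rapid_bound[OF assms(1), of k] obtain C where C: "!!x. cmod (f x) <= C / (1 + norm x) ^ k" by blast
 from rapid_bound[OF assms(2), of k] obtain D where D: "!!x. cmod (g x) <= D / (1 + norm x) ^ k" by blast
 have "cmod (f x + g x) * (1 + norm x) ^ k <= C + D" for x
 proof -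
 have "cmod (f x + g x) <= C / (1 + norm x) ^ k + D / (1 + norm x) ^ k"
 using C[of x] D[of x] norm_triangle_ineq[of "f x" "g x"] by linarith
 also have "... = (C + D) / (1 + norm x) ^ k" by (simp add: add_divide_distrib)
 finally show ?thesis
 by (subst (asm) pos_le_divide_eq) (auto intro!: zero_less_power add_pos_nonneg)
 qed
 then show "\<exists>C. \<forall>x. cmod (f x + g x) * (1 + norm x) ^ k <= C" by blast
qed (use assms in \<open>auto simp: rapid_def\<close>)

lemma rapid_cmult: assumes "rapid f" shows "rapid (%x. c * f x)"
 by (rule rapid_dominated[OF assms, where C="cmod c" and j=0])
 (use assms in \<open>auto simp: rapid_def norm_mult\<close>)

lemma rapid_zero[simp]: "rapid (%_. 0)"
 by (auto simp: rapid_def)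

lemma rapid_diff:
 assumes "rapid f" "rapid g" shows "rapid (%x. f x - g x)"
 using rapid_add[OF assms(1) rapid_cmult[OF assms(2), of "-1"]] by simp

lemma rapid_sum:
 "(!!i. i \<in> I ==> rapid (f i)) ==> rapid (%x. \<Sum>i\<in>I. f i x)"
 by (induction I rule: infinite_finite_induct) (auto intro: rapid_add)

lemma one_plus_le_power: "x >= 0 ==> x powr p <= (1 + x) ^ nat \<lceil>p\<rceil>" if "p >= 0" for x p :: real
proof -
 assume x: "x >= 0"
 have "x powr p <= (1 + x) powr p" using x that by (intro powr_mono2) auto
 also have "... <= (1 + x) powr real (nat \<lceil>p\<rceil>)" using x by (intro powr_mono) linarith+
 also have "... = (1 + x) ^ nat \<lceil>p\<rceil>" using x by (intro powr_realpow) auto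
 finally show ?thesis .
qed

lemma rapid_powr_mult:
 assumes "rapid f" "p >= 0" shows "rapid (%x. of_real (norm x powr p) * f x)"
 by (rule rapid_dominated[OF assms(1), where C=1 and j="nat \<lceil>p\<rceil>"])
 (use assms in \<open>auto simp: rapid_def norm_mult intro!: mult_right_mono one_plus_le_power\<close>)

lemma rapid_inner_mult:
 assumes "rapid f" shows "rapid (%x. of_real (x \<bullet> b) * f x)"
proof (rule rapid_dominated[OF assms, where C="norm b" and j=1])
 fix x
 have "\<bar>x \<bullet> b\<bar> <= norm b * (1 + norm x) ^ 1"
 using Cauchy_Schwarz_ineq2[of x b] by (simp add: algebra_simps) (smt (verit) norm_ge_zero)
 then show "cmod (of_real (x \<bullet> b) * f x) <= norm b * (1 + norm x) ^ 1 * cmod (f x)"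
 by (simp add: norm_mult mult_right_mono)
qed (use assms in \<open>auto simp: rapid_def\<close>)

lemma rapid_mult_bounded:
 assumes "rapid f" and [measurable]: "g \<in> bmeas" and "!!x. cmod (g x) <= C"
 shows "rapid (%x. g x * f x)"
 by (rule rapid_dominated[OF assms(1), where C=C and j=0])
 (use assms in \<open>auto simp: rapid_def norm_mult intro!: mult_right_mono\<close>)

lemma rapid_bounded:
 assumes "rapid f" obtains C where "C >= 0" "!!x. cmod (f x) <= C"
 using rapid_bound[OF assms, of 0] by auto

lemma rapid_mult: assumes "rapid f" "rapid g" shows "rapid (%x. f x * g x)"
proof -
 obtain C where "!!x. cmod (f x) <= C" using rapid_bounded[OF assms(1)] by blast
 then show ?thesis by (intro rapid_mult_bounded assms) (use assms in \<open>auto simp: rapid_def\<close>)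
qed

lemma rapid_norm2: assumes "rapid f" shows "rapid (%x. of_real (csq (f x)))"
proof -
 obtain C where "!!x. cmod (f x) <= C" using rapid_bounded[OF assms(1)] by blast
 then show ?thesis
 by (intro rapid_dominated[OF assms, where C=C and j=0])
 (use assms in \<open>auto simp: rapid_def norm_mult norm_power power2_eq_square intro!: mult_right_mono\<close>)
qed

lemma rapid_square_int: assumes "rapid f" shows "square_int f"
proof -
 have "integ (%x. Re (of_real (csq (f x))))"
 using rapid_integrable[OF rapid_norm2[OF assms]] by (rule integrable_Re)
 then show ?thesis using assms by (simp add: square_int_def rapid_def)
qed

section \<open>Norms and limits in L^2\<close>

text \<open>Optimising over the parameter gives \<open>et = sqrt b / sqrt a\<close>; adding
  \<open>e\<close> to both numbers keeps this quotient meaningful when one of them vanishes, and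
  \<open>e\<close> is sent to 0 afterwards. The hypothesis is what integrating
  \<open>norm_add_square_le\<close> produces, so triangle inequalities follow without
  Cauchy-Schwarz.\<close>

lemma quadratic_triangle:
 fixes a b c :: real
 assumes "a >= 0" "b >= 0" and le: "!!et. et > 0 ==> c <= (1 + et) * a + (1 + 1 / et) * b"
 shows "sqrt c <= sqrt a + sqrt b"
proof -
 have "c <= (sqrt (a + e) + sqrt (b + e))\<^sup>2" if "e > 0" for e
 proof -
 define p q where "p = sqrt (a + e)" and "q = sqrt (b + e)"
 have pq: "p > 0" "q > 0" "p\<^sup>2 = a + e" "q\<^sup>2 = b + e"
 using assms that by (auto simp: p_def q_def)
 have "c <= (1 + q / p) * a + (1 + 1 / (q / p)) * b"
 using pq by (intro le) auto
 also have "... <= (1 + q / p) * p\<^sup>2 + (1 + 1 / (q / p)) * q\<^sup>2"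
 using pq that by (intro add_mono mult_left_mono) auto
 also have "... = (p + q)\<^sup>2"
 using pq(1,2) by (simp add: field_simps power2_eq_square)
 finally show ?thesis by (simp add: p_def q_def)
 qed
 moreover have "((%e. (sqrt (a + e) + sqrt (b + e))\<^sup>2) \<longlongrightarrow> (sqrt (a + 0) + sqrt (b + 0))\<^sup>2) (at_right 0)"
 by (intro tendsto_intros)
 ultimately have "c <= (sqrt (a + 0) + sqrt (b + 0))\<^sup>2"
 by (intro tendsto_lowerbound[where F="at_right (0::real)"])
 (auto simp: eventually_at_filter)
 then show ?thesis
 using assms by (intro real_le_lsqrt) auto
qed

lemma norm_add_square_le:
 fixes a b :: "'a::real_inner"
 assumes "et > 0"
 shows "(norm (a + b))\<^sup>2 <= (1 + et) * (norm a)\<^sup>2 + (1 + 1 / et) * (norm b)\<^sup>2"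
proof -
 have "0 <= (norm (et *. a - b))\<^sup>2" by simp
 also have "... = et\<^sup>2 * (norm a)\<^sup>2 - 2 * et * (a \<bullet> b) + (norm b)\<^sup>2"
 by (simp add: power2_norm_eq_inner inner_diff_left inner_diff_right inner_commute[of b a])
 (simp add: power2_eq_square algebra_simps)
 finally have "et * (2 * (a \<bullet> b)) <= et * (et * (norm a)\<^sup>2 + (norm b)\<^sup>2 / et)"
 using assms by (simp add: distrib_left power2_eq_square)
 then have "2 * (a \<bullet> b) <= et * (norm a)\<^sup>2 + (norm b)\<^sup>2 / et"
 using assms by (rule mult_left_le_imp_le)
 moreover have "(norm (a + b))\<^sup>2 = (norm a)\<^sup>2 + 2 * (a \<bullet> b) + (norm b)\<^sup>2"
 by (simp add: power2_norm_eq_inner inner_add_left inner_add_right inner_commute[of b a])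
 ultimately show ?thesis
 by (simp add: distrib_right)
qed

lemma cmod_add_square_le: "csq (a + b) <= 2 * csq a + 2 * csq b"
 using norm_add_square_le[of 1 a b] by simp

lemma square_intD:
 "square_int f ==> f \<in> bmeas"
 "square_int f ==> integ (%x. csq (f x))"
 by (auto simp: square_int_def)

lemma square_int_add:
 assumes "square_int f" "square_int g" shows "square_int (%x. f x + g x)"
proof -
 note [measurable] = square_intD(1)[OF assms(1)] square_intD(1)[OF assms(2)]
 have "integ (%x. 2 * csq (f x) + 2 * csq (g x))"
 using assms by (simp add: square_int_def)
 then have "integ (%x. csq (f x + g x))"
 by (rule integrable_bound) (auto simp: cmod_add_square_le)
 then show ?thesis by (simp add: square_int_def)
qed

lemma square_int_cmult: "square_int f ==> square_int (%x. c * f x)"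
 by (auto simp: square_int_def norm_mult power_mult_distrib)

lemma square_int_diff:
 assumes "square_int f" "square_int g" shows "square_int (%x. f x - g x)"
 using square_int_add[OF assms(1) square_int_cmult[OF assms(2), of "-1"]] by simp

lemma l2sq_nonneg[simp]: "l2sq f >= 0"
 by (simp add: l2sq_def)

lemma l2sq_cmult: "l2sq (%x. c * f x) = csq c * l2sq f"
 by (simp add: l2sq_def norm_mult power_mult_distrib)

lemma l2sq_minus_commute: "l2sq (%x. f x - g x) = l2sq (%x. g x - f x)"
 by (simp add: l2sq_def norm_minus_commute)

lemma l2sq_add_le:
 assumes "square_int f" "square_int g" "et > 0"
 shows "l2sq (%x. f x + g x) <= (1 + et) * l2sq f + (1 + 1 / et) * l2sq g"
proof -
 have "l2sq (%x. f x + g x) <= (LI x. (1 + et) * csq (f x) + (1 + 1 / et) * csq (g x))"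
 unfolding l2sq_def using assms square_int_add[OF assms(1,2)]
 by (intro integral_mono norm_add_square_le) (auto simp: square_int_def)
 also have "... = (1 + et) * l2sq f + (1 + 1 / et) * l2sq g"
 unfolding l2sq_def using assms
 by (subst Bochner_Integration.integral_add) (auto simp: square_int_def)
 finally show ?thesis .
qed

lemma l2_triangle:
 assumes "square_int f" "square_int g"
 shows "sqrt (l2sq (%x. f x + g x)) <= sqrt (l2sq f) + sqrt (l2sq g)"
 using l2sq_add_le[OF assms] by (intro quadratic_triangle) auto

lemma l2_triangle_diff:
 assumes "square_int f" "square_int g"
 shows "\<bar>sqrt (l2sq f) - sqrt (l2sq g)\<bar> <= sqrt (l2sq (%x. f x - g x))"
 using l2_triangle[OF square_int_diff[OF assms] assms(2)]
 l2_triangle[OF square_int_diff[OF assms(2,1)] assms(1)]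
 by (simp add: l2sq_minus_commute[of f g])

lemma l2sq_tendsto:
 assumes "!!n. square_int (h n)" "square_int f" "(%n::nat. l2sq (%x. h n x - f x)) ----> 0"
 shows "(%n. l2sq (h n)) ----> l2sq f"
proof -
 have 1: "(%n. sqrt (l2sq (%x. h n x - f x))) ----> 0"
 using tendsto_real_sqrt[OF assms(3)] by simp
 have "(%n. sqrt (l2sq (h n)) - sqrt (l2sq f)) ----> 0"
 by (rule Lim_null_comparison[OF _ 1]) (use l2_triangle_diff[OF assms(1,2)] in auto)
 then have "(%n. sqrt (l2sq (h n))) ----> sqrt (l2sq f)"
 by (simp add: LIM_zero_cancel)
 from tendsto_power[OF this, of 2] show ?thesis by simp
qed

lemma l2sq_zero_AE:
 assumes "square_int f" "l2sq f = 0" shows "AE x in lborel. f x = 0"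
 using assms unfolding l2sq_def square_int_def
 by (subst (asm) integral_nonneg_eq_0_iff_AE) auto

lemma l2sq_cong_AE:
 assumes "square_int f" "g \<in> bmeas" "AE x in lborel. f x = g x"
 shows "l2sq f = l2sq g"
 unfolding l2sq_def using assms by (intro integral_cong_AE) (auto simp: square_int_def)

lemma l2sq_limit_unique:
 assumes "!!n. square_int (h n)" "square_int f" "square_int g"
 and "(%n::nat. l2sq (%x. h n x - f x)) ----> 0" "(%n::nat. l2sq (%x. h n x - g x)) ----> 0"
 shows "AE x in lborel. f x = g x"
proof -
 have "l2sq (%x. f x - g x) <= 2 * l2sq (%x. h n x - f x) + 2 * l2sq (%x. h n x - g x)" for n
 using l2sq_add_le[OF square_int_diff[OF assms(2,1)] square_int_diff[OF assms(1,3)], of 1 n n]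
 by (simp add: l2sq_minus_commute[of f])
 moreover have "(%n. 2 * l2sq (%x. h n x - f x) + 2 * l2sq (%x. h n x - g x)) ----> 2 * 0 + 2 * 0"
 by (intro tendsto_intros assms)
 ultimately have "l2sq (%x. f x - g x) <= 0"
 by (intro LIMSEQ_le_const) auto
 then have "l2sq (%x. f x - g x) = 0"
 by (simp add: order_antisym)
 then show ?thesis
 using l2sq_zero_AE[OF square_int_diff[OF assms(2,3)]] by simp
qed

section \<open>Differentiation under the integral sign and integrals of derivatives\<close>

text \<open>Dominated convergence applied to the remainder of the first-order expansion.
  Differentiability is asked for at \<open>x0\<close> and for almost every \<open>t\<close>, with an
  integrable Lipschitz constant as majorant, because integrands below can fail to be differentiable
  where an argument hits the origin.\<close>

lemma has_derivative_integral:
 fixes f :: "'a::real_normed_vector => 'm => 'b::{banach, second_countable_topology}"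
 assumes int: "!!x. integrable M (f x)" and int': "!!h. integrable M (%t. f' t h)"
 and der: "AE t in M. ((%x. f x t) has_derivative f' t) (at x0)"
 and K: "integrable M K" and d: "d > 0"
 and lip: "AE t in M. \<forall>x\<in>ball x0 d. norm (f x t - f x0 t) <= K t * norm (x - x0)"
 and bd: "AE t in M. \<forall>h. norm (f' t h) <= K t * norm h"
 shows "((%x. LINT t|M. f x t) has_derivative (%h. LINT t|M. f' t h)) (at x0)"
 unfolding has_derivative_iff_norm
proof
 let ?D = "%h. LINT t|M. f' t h"
 have lin: "AE t in M. linear (f' t)"
 using der by eventually_elim (rule has_derivative_linear)
 have meas: "(%t. f' t h) \<in> borel_measurable M" for h
 using borel_measurable_integrable[OF int'] .
 have measf: "f x \<in> borel_measurable M" for x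
 using borel_measurable_integrable[OF int] .
 show "bounded_linear ?D"
 proof (rule bounded_linear_intro[where K="LINT t|M. K t"])
 fix x y
 have "?D (x + y) = (LINT t|M. f' t x + f' t y)"
 using lin by (intro integral_cong_AE) (auto intro!: meas borel_measurable_add elim!: AE_mp simp: linear_add)
 then show "?D (x + y) = ?D x + ?D y" using int' by simp
 next
 fix r x
 have "?D (r *. x) = (LINT t|M. r *. f' t x)"
 using lin by (intro integral_cong_AE) (auto intro!: meas borel_measurable_scaleR elim!: AE_mp simp: linear_scale)
 then show "?D (r *. x) = r *. ?D x" by simp
 next
 fix x
 have "norm (?D x) <= (LINT t|M. norm (f' t x))" by (rule integral_norm_bound)
 also have "... <= (LINT t|M. K t * norm x)"
 using bd int' K by (intro integral_mono_AE) (auto elim!: AE_mp)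
 finally show "norm (?D x) <= norm x * (LINT t|M. K t)" by (simp add: mult.commute)
 qed
 show "((%y. norm ((LINT t|M. f y t) - (LINT t|M. f x0 t) - ?D (y - x0)) / norm (y - x0)) \<longlongrightarrow> 0) (at x0)"
 unfolding tendsto_at_iff_sequentially comp_def
 proof safe
 fix X :: "nat => 'a" assume X: "\<forall>i. X i \<in> UNIV - {x0}" "X ----> x0"
 let ?R = "%i t. norm (f (X i) t - f x0 t - f' t (X i - x0)) / norm (X i - x0)"
 from X(2) d have "\<forall>\<^sub>F i in sequentially. dist (X i) x0 < d" by (rule tendstoD)
 then obtain n0 where n0: "!!i. i >= n0 ==> X i \<in> ball x0 d"
 by (auto simp: eventually_sequentially dist_commute)
 have iR: "integrable M (?R i)" for i
 using int int' by (intro integrable_divide integrable_norm Bochner_Integration.integrable_diff)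
 \<comment> \<open>The Lipschitz bound holds inside the ball only, hence the shift by
   \<open>n0\<close>.\<close>
 have "(%i. LINT t|M. ?R (i + n0) t) ----> (LINT t|M. 0)"
 proof (rule integral_dominated_convergence[where w="%t. 2 * K t"])
 show "AE t in M. (%i. ?R (i + n0) t) ----> 0"
 using der
 proof eventually_elim
 case (elim t)
 then have "((%y. norm (f y t - f x0 t - f' t (y - x0)) / norm (y - x0)) \<longlongrightarrow> 0) (at x0)"
 by (simp add: has_derivative_iff_norm)
 then have "(%i. ?R i t) ----> 0"
 using X unfolding tendsto_at_iff_sequentially comp_def by blast
 then show ?case by (rule LIMSEQ_ignore_initial_segment)
 qed
 show "AE t in M. norm (?R (i + n0) t) <= 2 * K t" for i
 using lip bd
 proof eventually_elim
 case (elim t)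
 let ?x = "X (i + n0)"
 have pos: "norm (?x - x0) > 0" using X(1) by auto
 have "norm (f ?x t - f x0 t - f' t (?x - x0)) <= K t * norm (?x - x0) + K t * norm (?x - x0)"
 using elim n0[of "i + n0"] norm_triangle_ineq4[of "f ?x t - f x0 t" "f' t (?x - x0)"]
 by (meson add_mono le_add2 order_trans)
 then show ?case using pos by (simp add: pos_divide_le_eq)
 qed
 qed (use K iR in auto)
 then have "(%i. LINT t|M. ?R (i + n0) t) ----> 0" by simp
 then have lim: "(%i. LINT t|M. ?R i t) ----> 0"
 by (rule LIMSEQ_offset)
 have le: "norm ((LINT t|M. f (X i) t) - (LINT t|M. f x0 t) - ?D (X i - x0)) / norm (X i - x0) <= (LINT t|M. ?R i t)" for i
 proof -
 have "(LINT t|M. f (X i) t) - (LINT t|M. f x0 t) - ?D (X i - x0) = (LINT t|M. f (X i) t - f x0 t - f' t (X i - x0))"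
 using int int' by simp
 also have "norm ... <= (LINT t|M. norm (f (X i) t - f x0 t - f' t (X i - x0)))"
 by (rule integral_norm_bound)
 finally show ?thesis by (simp add: divide_right_mono)
 qed
 show "(%i. norm ((LINT t|M. f (X i) t) - (LINT t|M. f x0 t) - ?D (X i - x0)) / norm (X i - x0)) ----> 0"
 by (rule tendsto_sandwich[OF always_eventually always_eventually[OF allI[OF le]] tendsto_const lim]) simp
 qed
qed

text \<open>The integral of a translate does not depend on the translation, and its derivative at
  \<open>t = 0\<close> is the integral of \<open>e\<close>. In this form integration by parts has no
  boundary terms.\<close>

lemma integral_line_derivative_eq_0:
 fixes f e :: "'a::euclidean_space => 'b::{banach, second_countable_topology}"
 assumes f: "integ f" and e: "integ e"
 and K: "integ K" "!!x t. \<bar>t\<bar> < 1 ==> norm (f (x + t *. w) - f x) <= K x * \<bar>t\<bar>"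
 and der: "AE x in lborel. ((%t. f (x + t *. w)) has_vector_derivative e x) (at 0)"
 shows "(LI x. e x) = 0"
proof -
 have [measurable]: "f \<in> bmeas" using f by simp
 \<comment> \<open>\<open>K\<close> bounds the difference quotients and \<open>norm (e x)\<close>
   the derivative itself; their sum serves as the single majorant.\<close>
 have "((%t. LI x. f (x + t *. w)) has_derivative (%h. LI x. h *. e x)) (at 0)"
 proof (rule has_derivative_integral[where K="%x. K x + norm (e x)" and d=1])
 show "AE x in lborel. \<forall>t\<in>ball 0 1. norm (f (x + t *. w) - f (x + 0 *. w)) <= (K x + norm (e x)) * norm (t - 0)"
 using K(2) by (auto simp: distrib_right intro!: AE_I2 add_increasing2)
 show "AE x in lborel. \<forall>h. norm (h *. e x) <= (K x + norm (e x)) * norm h"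
 using order_trans[OF norm_ge_zero K(2)[of "1/2"]] by (auto simp: distrib_right mult.commute[of "norm (e _)"])
 qed (use f e K(1) der integrable_lborel_shift[OF f] in \<open>auto simp: has_vector_derivative_def\<close>)
 then have "((%t::real. LI x. f x) has_derivative (%h. LI x. h *. e x)) (at 0)"
 by (simp add: integral_lborel_shift)
 from fun_cong[OF has_derivative_unique[OF this has_derivative_const], of 1] show ?thesis by simp
qed

text \<open>From 1 + |x| <= (1 + R) (1 + |x + y|). It supplies a majorant that is uniform over all
  translations of length at most \<open>R\<close>.\<close>

lemma rapid_shift_bound:
 assumes "rapid f" and R: "R >= 0"
 obtains C where "C >= 0" "!!x y. norm y <= R ==> cmod (f (x + y)) <= C * (1 / (1 + norm x) ^ m)"
proof -
 obtain C where C: "C >= 0" "!!x. cmod (f x) <= C / (1 + norm x) ^ m" using rapid_bound[OF assms(1)] by blast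
 have "cmod (f (x + y)) <= (C * (1 + R) ^ m) * (1 / (1 + norm x) ^ m)" if y: "norm y <= R" for x y
 proof -
 have "norm x <= norm (x + y) + R" using norm_triangle_ineq4[of "x + y" y] y by simp
 moreover have "0 <= R * norm (x + y)" using R by simp
 ultimately have "1 + norm x <= (1 + R) * (1 + norm (x + y))" by (simp add: algebra_simps)
 then have "(1 + norm x) ^ m <= ((1 + R) * (1 + norm (x + y))) ^ m" by (intro power_mono) auto
 from mult_left_mono[OF this C(1)]
 have "C / (1 + norm (x + y)) ^ m <= (C * (1 + R) ^ m) * (1 / (1 + norm x) ^ m)"
 unfolding power_mult_distrib by (subst pos_divide_le_eq) (auto simp: field_simps add_pos_nonneg intro!: zero_less_power)
 with C(2)[of "x + y"] show ?thesis by linarith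
 qed
 then show ?thesis using C(1) R by (intro that[of "C * (1 + R) ^ m"]) auto
qed

text \<open>The mean value theorem along \<open>b\<close> turns the decay of the derivative into the
  integrable Lipschitz constant that \<open>integral_line_derivative_eq_0\<close> asks for.\<close>

lemma integral_directional_derivative_eq_0:
 fixes F :: "'a::euclidean_space => complex"
 assumes F: "integ F" and der: "!!x. (F has_derivative D x) (at x)"
 and rap: "rapid (%x. D x b)" and b: "b \<in> Basis"
 shows "(LI x. D x b) = 0"
proof -
 obtain C where C: "C >= 0" "!!x y. norm y <= 1 ==> cmod (D (x + y) b) <= C * (1 / (1 + norm x) ^ (2 * DIM('a)))"
 by (rule rapid_shift_bound[OF rap, of 1 "2 * DIM('a)"]) auto
 have der': "((%s. F (x + s *. b)) has_derivative (%h. h *. D (x + t *. b) b)) (at t)" for x t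
 by (rule has_derivative_eq_rhs[OF has_derivative_compose[of "%s. x + s *. b" "%h. h *. b", OF _ der]])
 (auto intro!: derivative_eq_intros simp: linear_scale[OF has_derivative_linear[OF der]])
 show ?thesis
 proof (rule integral_line_derivative_eq_0[OF F rapid_integrable[OF rap]])
 show "integ (%x::'a. C * (1 / (1 + norm x) ^ (2 * DIM('a))))"
 using integrable_inverse_power_norm by (rule integrable_mult_right)
 show "AE x in lborel. ((%t. F (x + t *. b)) has_vector_derivative D x b) (at 0)"
 using der'[of _ 0] by (simp add: has_vector_derivative_def)
 fix x and t :: real assume t: "\<bar>t\<bar> < 1"
 have "norm (F (x + t *. b) - F (x + 0 *. b)) <= C * (1 / (1 + norm x) ^ (2 * DIM('a))) * norm (t - 0)"
 proof (rule differentiable_bound[of "ball 0 1" "%t. F (x + t *. b)" "%t h. h *. D (x + t *. b) b"])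
 fix s :: real assume s: "s \<in> ball 0 1"
 show "((%t. F (x + t *. b)) has_derivative (%h. h *. D (x + s *. b) b)) (at s within ball 0 1)"
 by (rule has_derivative_at_withinI[OF der'])
 show "onorm (%h. h *. D (x + s *. b) b) <= C * (1 / (1 + norm x) ^ (2 * DIM('a)))"
 using C(2)[of "s *. b" x] s b
 by (intro onorm_le) (simp only: norm_scaleR real_norm_def mult.commute[of "\<bar>_\<bar>"], rule mult_right_mono, auto)
 qed (use t in auto)
 then show "norm (F (x + t *. b) - F x) <= C * (1 / (1 + norm x) ^ (2 * DIM('a))) * \<bar>t\<bar>" by simp
 qed
qed

subsection \<open>Gaussians and the Fourier transform\<close>

text \<open>Normalised to be a probability density and its own Fourier transform; each coordinate
  has variance 1 / (2 pi).\<close>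

definition gauss :: "'a::euclidean_space => real" where
 "gauss x = exp (- pi * (norm x)\<^sup>2)"

lemma gauss_measurable[measurable]: "gauss \<in> bmeas"
 unfolding gauss_def by measurable

lemma gauss_pos[simp]: "gauss x > 0" and gauss_nonneg[simp]: "gauss x >= 0"
 and gauss_le_1[simp]: "gauss x <= 1" and gauss_minus[simp]: "gauss (- x) = gauss x"
 and gauss_0[simp]: "gauss 0 = 1"
 by (auto simp: gauss_def)

lemma gauss_eq_prod: "gauss x = (\<Prod>b\<in>Basis. gauss (x \<bullet> b))"
proof -
 have "(norm x)\<^sup>2 = (\<Sum>b\<in>Basis. (x \<bullet> b)\<^sup>2)"
 unfolding power2_norm_eq_inner by (subst euclidean_inner) (simp add: power2_eq_square)
 then have "gauss x = exp (\<Sum>b\<in>Basis. - pi * (x \<bullet> b)\<^sup>2)"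
 by (simp add: gauss_def sum_distrib_left)
 then show ?thesis by (simp add: exp_sum gauss_def)
qed

lemma nn_integral_gauss_real: "(NN t. ennreal (gauss (t::real))) = 1"
proof -
 have eq: "gauss t = normal_density 0 (1 / sqrt (2 * pi)) t" for t :: real
 by (simp add: gauss_def normal_density_def power_divide field_simps)
 have "integ (%t::real. gauss t)" "(LI t. gauss (t::real)) = 1"
 unfolding eq by simp_all
 then show ?thesis by (simp add: nn_integral_eq_integral)
qed

lemma nn_integral_gauss: "(NN x. ennreal (gauss (x::'a::euclidean_space))) = 1"
proof -
 have "(NN (x::'a). ennreal (gauss x)) = (NN (x::'a). (\<Prod>b\<in>Basis. ennreal (gauss (x \<bullet> b))))"
 by (simp add: gauss_eq_prod[of "_::'a"] prod_ennreal)
 also have "... = (\<Prod>b\<in>(Basis::'a set). (NN t. ennreal (gauss (t::real))))"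
 by (rule nn_integral_lborel_prod) auto
 finally show ?thesis by (simp add: nn_integral_gauss_real)
qed

lemma integrable_gauss[simp]: "integ (gauss :: 'a::euclidean_space => real)"
 by (rule integrableI_nonneg) (auto simp: nn_integral_gauss)

lemma integral_gauss[simp]: "(LI x. gauss (x::'a::euclidean_space)) = 1"
 by (simp add: integral_eq_nn_integral nn_integral_gauss)

lemma power_le_fact_exp: "x ^ k <= fact k * exp x" if "x >= 0" for x :: real
proof -
 have "(\<Sum>n\<in>{k}. x ^ n /\<^sub>R fact n) <= (\<Sum>n. x ^ n /\<^sub>R fact n)"
 by (rule sum_le_suminf) (use that in \<open>auto simp: summable_exp divide_inverse mult.commute\<close>)
 then have "x ^ k / fact k <= exp x" by (simp add: exp_def divide_inverse mult.commute)
 then show ?thesis by (simp add: pos_divide_le_eq mult.commute)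
qed

lemma rapid_gauss: "rapid (%x. of_real (gauss x))"
 unfolding rapid_def
proof safe
 fix k
 have "cmod (of_real (gauss x)) * (1 + norm x) ^ k <= fact k * exp 2" for x :: 'a
 proof -
 have "norm x <= 1 + pi * (norm x)\<^sup>2"
 proof (cases "norm x <= 1")
 case False
 then have "norm x * 1 <= norm x * norm x" by (intro mult_left_mono) auto
 also have "... <= pi * (norm x)\<^sup>2"
 using pi_ge_two mult_right_mono[of 1 pi "(norm x)\<^sup>2"] by (simp add: power2_eq_square)
 finally show ?thesis by simp
 qed (simp add: add_increasing2)
 then have "exp (1 + norm x) * gauss x <= exp 2"
 by (simp add: gauss_def flip: exp_add)
 moreover have "(1 + norm x) ^ k * gauss x <= fact k * exp (1 + norm x) * gauss x"
 by (intro mult_right_mono power_le_fact_exp) auto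
 ultimately have "(1 + norm x) ^ k * gauss x <= fact k * exp 2"
 by (smt (verit, ccfv_SIG) fact_ge_zero mult.assoc mult_left_mono)
 then show ?thesis by (simp add: mult.commute)
 qed
 then show "\<exists>C. \<forall>x::'a. cmod (of_real (gauss x)) * (1 + norm x) ^ k <= C" by blast
qed simp

text \<open>The character \<open>e\<^bsup>2 \<pi> i t\<^esup>\<close> of both Fourier integrals.\<close>

definition chr :: "real => complex" where "chr t = cis (2 * pi * t)"

lemma chr_measurable[measurable]: "chr \<in> bmeas"
 unfolding chr_def by (intro borel_measurable_continuous_onI continuous_intros)

lemma norm_chr[simp]: "cmod (chr t) = 1" by (simp add: chr_def)
lemma chr_0[simp]: "chr 0 = 1" by (simp add: chr_def)
lemma chr_add: "chr (s + t) = chr s * chr t" by (simp add: chr_def cis_mult distrib_left)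
lemma chr_minus: "chr (- t) = cnj (chr t)" by (simp add: chr_def cis_cnj)
lemma chr_diff: "chr (s - t) = chr s * cnj (chr t)"
 using chr_add[of s "-t"] by (simp add: chr_minus)
lemma cnj_chr: "cnj (chr t) = chr (- t)" by (simp add: chr_minus)

lemma inv_fourier_eq: "inv_fourier f x = (LI xi. f xi * chr (x \<bullet> xi))"
 by (simp add: inv_fourier_def chr_def cis_conv_exp mult_ac)

lemma fourier_eq: "fourier f xi = (LI x. f x * chr (- (x \<bullet> xi)))"
 by (simp add: fourier_def chr_def cis_conv_exp mult_ac)

lemma fourier_conv_inv_fourier: "fourier f xi = inv_fourier f (- xi)"
 by (simp add: inv_fourier_eq fourier_eq inner_commute)

lemma integrable_mult_chr:
 assumes "integ f"
 shows "integ (%xi::'a::euclidean_space. f xi * chr (x \<bullet> xi))"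
 using assms by (rule integrable_bound) (use assms in \<open>auto simp: norm_mult\<close>)

lemma inv_fourier_bound:
 assumes "integ f" shows "cmod (inv_fourier f x) <= (LI xi. cmod (f xi))"
 unfolding inv_fourier_eq by (rule order_trans[OF integral_norm_bound]) (simp add: norm_mult)

lemma inv_fourier_measurable[measurable]:
 assumes [measurable]: "f \<in> bmeas"
 shows "inv_fourier f \<in> bmeas"
proof -
 have "(%x. LI xi. f xi * chr (x \<bullet> xi)) \<in> bmeas"
 by measurable
 then show ?thesis by (simp add: inv_fourier_eq[abs_def])
qed

lemma fourier_measurable[measurable]:
 assumes [measurable]: "f \<in> bmeas"
 shows "fourier f \<in> bmeas"
 unfolding fourier_conv_inv_fourier[abs_def] by measurable

lemma inv_fourier_cmult: "inv_fourier (%xi. c * f xi) x = c * inv_fourier f x"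
 by (simp add: inv_fourier_eq mult.assoc)

lemma inv_fourier_diff:
 "integ f ==> integ g ==> inv_fourier (%xi. f xi - g xi) x = inv_fourier f x - inv_fourier g x"
 using integrable_mult_chr[of f x] integrable_mult_chr[of g x] by (simp add: inv_fourier_eq left_diff_distrib)

lemma fourier_diff:
 "integ f ==> integ g ==> fourier (%xi. f xi - g xi) x = fourier f x - fourier g x"
 by (simp add: fourier_conv_inv_fourier inv_fourier_diff)

lemma chr_has_derivative:
 "((%x::'a::euclidean_space. chr (x \<bullet> xi)) has_derivative (%h. 2 * of_real pi * \<i> * of_real (h \<bullet> xi) * chr (x \<bullet> xi))) (at x)"
proof -
 have chr_exp: "chr t = exp (of_real (2 * pi * t) * \<i>)" for t
 by (simp add: chr_def cis_conv_exp mult.commute)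
 have "((%x. of_real (2 * pi * (x \<bullet> xi)) * \<i>) has_derivative (%h. of_real (2 * pi * (h \<bullet> xi)) * \<i>)) (at x)"
 by (auto intro!: derivative_eq_intros)
 from has_derivative_compose[OF this DERIV_exp[unfolded has_field_derivative_def]]
 show ?thesis
 unfolding chr_exp by (simp add: mult_ac)
qed

lemma cmod_chr_diff_le: "cmod (chr s - chr t) <= 2 * pi * \<bar>s - t\<bar>"
proof -
 have "norm (chr s - chr t) <= 2 * pi * norm (s - t)"
 proof (rule differentiable_bound[of UNIV _ "%s h. 2 * of_real pi * \<i> * of_real h * chr s"])
 show "(chr has_derivative (%h. 2 * of_real pi * \<i> * of_real h * chr s)) (at s)" for s
 using chr_has_derivative[of 1 s] by simp
 show "onorm (%h. 2 * of_real pi * \<i> * of_real h * chr s) <= 2 * pi" for s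
 by (rule onorm_le) (auto simp: norm_mult)
 qed auto
 then show ?thesis by simp
qed

lemma inv_fourier_has_derivative:
 fixes f :: "'a::euclidean_space => complex"
 assumes f: "integ f" "integ (%xi. norm xi * cmod (f xi))"
 shows "(inv_fourier f has_derivative (%h. inv_fourier (%xi. 2 * of_real pi * \<i> * of_real (h \<bullet> xi) * f xi) x)) (at x)"
proof -
 have [measurable]: "f \<in> bmeas" using f by simp
 have "((%x. LI xi. f xi * chr (x \<bullet> xi)) has_derivative
 (%h. LI xi. f xi * (2 * of_real pi * \<i> * of_real (h \<bullet> xi) * chr (x \<bullet> xi)))) (at x)"
 proof (rule has_derivative_integral[where K="%xi. 2 * pi * (norm xi * cmod (f xi))" and d=1])
 fix h :: 'a
 have "integ (%xi. 2 * pi * norm h * (norm xi * cmod (f xi)))"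
 using f(2) by (rule integrable_mult_right)
 then show "integ (%xi. f xi * (2 * of_real pi * \<i> * of_real (h \<bullet> xi) * chr (x \<bullet> xi)))"
 proof (rule integrable_bound)
 show "AE xi in lborel. norm (f xi * (2 * of_real pi * \<i> * of_real (h \<bullet> xi) * chr (x \<bullet> xi))) <= norm (2 * pi * norm h * (norm xi * cmod (f xi)))"
 proof (rule AE_I2)
 fix xi
 have "cmod (f xi) * (2 * pi * \<bar>h \<bullet> xi\<bar>) <= cmod (f xi) * (2 * pi * (norm h * norm xi))"
 by (intro mult_left_mono Cauchy_Schwarz_ineq2) auto
 then show "norm (f xi * (2 * of_real pi * \<i> * of_real (h \<bullet> xi) * chr (x \<bullet> xi))) <= norm (2 * pi * norm h * (norm xi * cmod (f xi)))"
 by (simp add: norm_mult abs_mult mult_ac)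
 qed
 qed simp
 next
 show "AE xi in lborel. ((%x. f xi * chr (x \<bullet> xi)) has_derivative (%h. f xi * (2 * of_real pi * \<i> * of_real (h \<bullet> xi) * chr (x \<bullet> xi)))) (at x)"
 by (intro AE_I2 has_derivative_mult_right chr_has_derivative)
 show "AE xi in lborel. \<forall>y\<in>ball x 1. norm (f xi * chr (y \<bullet> xi) - f xi * chr (x \<bullet> xi)) <= 2 * pi * (norm xi * cmod (f xi)) * norm (y - x)"
 proof (intro AE_I2 ballI)
 fix xi y :: 'a
 have "cmod (f xi) * cmod (chr (y \<bullet> xi) - chr (x \<bullet> xi)) <= cmod (f xi) * (2 * pi * (norm (y - x) * norm xi))"
 using cmod_chr_diff_le[of "y \<bullet> xi" "x \<bullet> xi"] Cauchy_Schwarz_ineq2[of "y - x" xi]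
 by (intro mult_left_mono order_trans[OF cmod_chr_diff_le]) (auto simp: inner_diff_left)
 then show "norm (f xi * chr (y \<bullet> xi) - f xi * chr (x \<bullet> xi)) <= 2 * pi * (norm xi * cmod (f xi)) * norm (y - x)"
 by (simp add: norm_mult mult_ac flip: right_diff_distrib)
 qed
 show "AE xi in lborel. \<forall>h. norm (f xi * (2 * of_real pi * \<i> * of_real (h \<bullet> xi) * chr (x \<bullet> xi))) <= 2 * pi * (norm xi * cmod (f xi)) * norm h"
 proof (intro AE_I2 allI)
 fix xi h :: 'a
 have "cmod (f xi) * (2 * pi * \<bar>h \<bullet> xi\<bar>) <= cmod (f xi) * (2 * pi * (norm h * norm xi))"
 by (intro mult_left_mono Cauchy_Schwarz_ineq2) auto
 then show "norm (f xi * (2 * of_real pi * \<i> * of_real (h \<bullet> xi) * chr (x \<bullet> xi))) <= 2 * pi * (norm xi * cmod (f xi)) * norm h"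
 by (simp add: norm_mult mult_ac)
 qed
 qed (use f integrable_mult_chr in auto)
 then show ?thesis
 by (simp add: inv_fourier_eq[abs_def] mult_ac)
qed

lemma gauss_has_derivative:
 "(gauss has_derivative (%h. - 2 * pi * (x \<bullet> h) * gauss x)) (at (x::'a::euclidean_space))"
 unfolding gauss_def[abs_def] power2_norm_eq_inner
 by (auto intro!: derivative_eq_intros simp: inner_commute algebra_simps)

text \<open>Integrating the derivative of \<open>gauss xi * chr (x \<bullet> xi)\<close> over the
  whole space shows that the transform satisfies the differential equation of the Gaussian. Its
  quotient by the Gaussian is therefore constant, and the value at 0 is the total mass 1.\<close>

lemma inv_fourier_gauss: "inv_fourier (%xi. of_real (gauss xi)) x = of_real (gauss (x::'a::euclidean_space))"
proof -
 let ?g = "%xi::'a. complex_of_real (gauss xi)" and ?\<Phi> = "inv_fourier (%xi::'a. complex_of_real (gauss xi))"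
 have rg: "rapid ?g" by (rule rapid_gauss)
 have intg: "integ ?g" by (rule rapid_integrable[OF rg])
 have rb: "rapid (%xi. of_real (xi \<bullet> b) * ?g xi)" for b by (rule rapid_inner_mult[OF rg])
 have rn: "integ (%xi. norm xi * cmod (?g xi))"
 using rapid_integrable[OF rapid_powr_mult[OF rg, of 1], THEN integrable_norm] by (simp add: norm_mult)
 have key: "inv_fourier (%xi. of_real (b \<bullet> xi) * ?g xi) x = \<i> * of_real (x \<bullet> b) * ?\<Phi> x" if b: "b \<in> Basis" for b x
 proof -
 let ?D = "%xi h. of_real (- 2 * pi * (xi \<bullet> h)) * (?g xi * chr (x \<bullet> xi)) + 2 * of_real pi * \<i> * of_real (x \<bullet> h) * (?g xi * chr (x \<bullet> xi))"
 have der: "((%xi. ?g xi * chr (x \<bullet> xi)) has_derivative ?D xi) (at xi)" for xi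
 proof -
 have "((%xi. chr (x \<bullet> xi)) has_derivative (%h. 2 * of_real pi * \<i> * of_real (x \<bullet> h) * chr (x \<bullet> xi))) (at xi)"
 using chr_has_derivative[of x xi] by (simp add: inner_commute)
 from has_derivative_mult[OF has_derivative_of_real[OF gauss_has_derivative] this]
 show ?thesis
 by (rule has_derivative_eq_rhs) (simp add: fun_eq_iff algebra_simps)
 qed
 have D: "?D xi b = chr (x \<bullet> xi) * ((- 2 * of_real pi) * (of_real (xi \<bullet> b) * ?g xi) + 2 * of_real pi * \<i> * of_real (x \<bullet> b) * ?g xi)" for xi
 by (simp add: algebra_simps)
 have "rapid (%xi. ?D xi b)"
 unfolding D by (intro rapid_mult_bounded[where C=1] rapid_add rapid_cmult rb rg) auto
 from integral_directional_derivative_eq_0[OF integrable_mult_chr[OF intg] der this b]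
 have "0 = (LI xi. ?D xi b)" by simp
 also have "... = (LI xi. (- 2 * of_real pi) * ((of_real (b \<bullet> xi) * ?g xi) * chr (x \<bullet> xi)) + (2 * of_real pi * \<i> * of_real (x \<bullet> b)) * (?g xi * chr (x \<bullet> xi)))"
 by (intro Bochner_Integration.integral_cong) (auto simp: inner_commute algebra_simps)
 also have "... = (- 2 * of_real pi) * inv_fourier (%xi. of_real (b \<bullet> xi) * ?g xi) x + (2 * of_real pi * \<i> * of_real (x \<bullet> b)) * ?\<Phi> x"
 unfolding inv_fourier_eq
 using integrable_mult_chr[OF rapid_integrable[OF rb[of b]], of x] integrable_mult_chr[OF intg, of x]
 by (subst Bochner_Integration.integral_add) (auto simp: inner_commute)
 finally show ?thesis by (simp add: mult_ac)
 qed
 have lin: "inv_fourier (%xi. 2 * of_real pi * \<i> * of_real (h \<bullet> xi) * ?g xi) x = - 2 * of_real pi * of_real (x \<bullet> h) * ?\<Phi> x" for h x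
 proof -
 have "inv_fourier (%xi. 2 * of_real pi * \<i> * of_real (h \<bullet> xi) * ?g xi) x = (LI xi. (\<Sum>b\<in>Basis. (2 * of_real pi * \<i> * of_real (h \<bullet> b)) * ((of_real (b \<bullet> xi) * ?g xi) * chr (x \<bullet> xi))))"
 proof -
 have "2 * of_real pi * \<i> * of_real (h \<bullet> xi) * ?g xi * chr (x \<bullet> xi)
 = (\<Sum>b\<in>Basis. (2 * of_real pi * \<i> * of_real (h \<bullet> b)) * ((of_real (b \<bullet> xi) * ?g xi) * chr (x \<bullet> xi)))" for xi
 by (subst euclidean_inner) (simp add: sum_distrib_left sum_distrib_right inner_commute mult_ac)
 then show ?thesis
 by (simp only: inv_fourier_eq)
 qed
 also have "... = (\<Sum>b\<in>Basis. (2 * of_real pi * \<i> * of_real (h \<bullet> b)) * inv_fourier (%xi. of_real (b \<bullet> xi) * ?g xi) x)"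
 unfolding inv_fourier_eq
 using integrable_mult_chr[OF rapid_integrable[OF rb], of _ x]
 by (subst Bochner_Integration.integral_sum) (auto simp: inner_commute)
 also have "... = (\<Sum>b\<in>Basis. - 2 * of_real pi * of_real ((x \<bullet> b) * (h \<bullet> b)) * ?\<Phi> x)"
 by (intro sum.cong) (auto simp: key)
 also have "... = - 2 * of_real pi * of_real (x \<bullet> h) * ?\<Phi> x"
 by (subst (3) euclidean_inner) (simp add: sum_distrib_left sum_distrib_right mult_ac sum_negf)
 finally show ?thesis .
 qed
 have der: "(?\<Phi> has_derivative (%h. - 2 * of_real pi * of_real (x \<bullet> h) * ?\<Phi> x)) (at x)" for x
 using inv_fourier_has_derivative[OF intg rn, of x] by (simp add: lin)
 let ?q = "%x. ?\<Phi> x * of_real (exp (pi * (x \<bullet> x)))"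
 have "\<exists>c. \<forall>x\<in>UNIV. ?q x = c"
 proof (rule has_derivative_zero_constant)
 show "(?q has_derivative (%h. 0)) (at x)" for x
 proof -
 have "((%x::'a. pi * (x \<bullet> x)) has_derivative (%h. pi * (x \<bullet> h + h \<bullet> x))) (at x)"
 by (intro has_derivative_mult_right has_derivative_inner has_derivative_ident)
 from has_derivative_compose[OF this DERIV_exp[unfolded has_field_derivative_def]]
 have "((%x. exp (pi * (x \<bullet> x))) has_derivative (%h. exp (pi * (x \<bullet> x)) * (pi * (x \<bullet> h + h \<bullet> x)))) (at x)" .
 from has_derivative_mult[OF der has_derivative_of_real[OF this]] show ?thesis
 by (rule has_derivative_eq_rhs) (simp add: fun_eq_iff inner_commute algebra_simps)
 qed
 qed auto
 then obtain c where c: "!!x. ?q x = c" by blast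
 have "?\<Phi> 0 = 1"
 by (simp add: inv_fourier_eq flip: integral_complex_of_real)
 with c[of 0] have "c = 1" by simp
 with c[of x] have "?\<Phi> x * of_real (exp (pi * (x \<bullet> x))) * of_real (gauss x) = of_real (gauss x)" by simp
 moreover have "exp (pi * (x \<bullet> x)) * gauss x = 1"
 by (simp add: gauss_def power2_norm_eq_inner flip: exp_add)
 then have "of_real (exp (pi * (x \<bullet> x))) * of_real (gauss x) = (1::complex)"
 by (simp flip: of_real_mult)
 ultimately show ?thesis
 by (simp add: mult.assoc)
qed

section \<open>L^2 continuity of translations and Gaussian averages\<close>

lemma integral_lborel_affine:
 fixes f :: "'a::euclidean_space => 'b::{banach, second_countable_topology}"
 assumes [measurable]: "f \<in> bmeas" and c: "c > 0"
 shows "(LI x. f (t + c *. x)) = (1 / c ^ DIM('a)) *. (LI x. f x)"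
proof -
 let ?M = "density (distr lborel borel (%x::'a. t + c *. x)) (%_. ennreal (c ^ DIM('a)))"
 have "lborel = ?M" using lborel_affine[of c t] c by simp
 then have "(LI x. f x) = (LINT x|?M. f x)" by simp
 also have "... = (LINT x|distr lborel borel (%x::'a. t + c *. x). (c ^ DIM('a)) *. f x)"
 using c by (intro integral_density) auto
 also have "... = (LI x. (c ^ DIM('a)) *. f (t + c *. x))"
 by (intro integral_distr) auto
 finally show ?thesis using c by simp
qed

lemma square_int_shift: "square_int f ==> square_int (%x. f (x + h))"
 unfolding square_int_def using integrable_lborel_shift[of "%x. csq (f x)" h]
 by (auto intro!: measurable_compose[of "%x. x + h" lborel borel f borel])

lemma l2sq_shift: "l2sq (%x. f (x + h)) = l2sq f"
 unfolding l2sq_def by (rule integral_lborel_shift)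

lemma l2sq_uminus[simp]: "l2sq (%x. - f x) = l2sq f"
 by (simp add: l2sq_def)

text \<open>An \<open>L\<^sup>2\<close> function is approximated by continuous ones after truncation at a rapidly decaying height \<open>\<rho>\<close>.\<close>

lemma L2_translation:
 assumes f: "square_int f" and h: "h ----> 0"
 shows "(%n. l2sq (%x. f (x + h n) - f x)) ----> 0"
proof (rule LIMSEQ_I)
 fix e :: real assume e: "e > 0"
 have [measurable]: "f \<in> bmeas" using f by (simp add: square_int_def)
 \<comment> \<open>A measurable function is an almost everywhere limit of continuous functions.
   Nothing is known about their size, which is what the truncation \<open>T\<close> repairs.\<close>
 obtain N g where Ng: "negligible N" "!!n. continuous_on UNIV (g n)" "!!x. x \<notin> N ==> (%n::nat. g n x) ----> f x"
 using lebesgue_measurable_imp_measurable_on[of f UNIV] by (auto simp: measurable_on_def measurable_completion)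
 have N: "AE x in lborel. x \<notin> N"
 using Ng(1) by (metis AE_not_in negligible_iff_null_sets AE_completion_iff)
 define \<rho> where "\<rho> k x = real (Suc k) * gauss x" for k and x :: 'a
 \<comment> \<open>\<open>T k\<close> scales values of modulus above \<open>\<rho> k\<close> back to
   that height. It depends continuously on \<open>u\<close>, so it preserves both the continuity of
   \<open>g n\<close> and the pointwise convergence.\<close>
 define T where "T k u x = u x * of_real (\<rho> k x / max (\<rho> k x) (cmod (u x)))" for k and u :: "'a => complex" and x
 have \<rho>: "\<rho> k x > 0" for k x by (simp add: \<rho>_def)
 have \<rho>c: "continuous_on UNIV (\<rho> k)" for k
 unfolding \<rho>_def gauss_def by (intro continuous_intros)
 have [measurable]: "\<rho> k \<in> bmeas" for k by (intro borel_measurable_continuous_onI \<rho>c)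
 have \<rho>r: "rapid (%x. of_real (\<rho> k x))" for k
 using rapid_cmult[OF rapid_gauss, of "of_real (real (Suc k))"] by (simp add: \<rho>_def)
 have maxn: "max (\<rho> k x) c ~= 0" for k x c using \<rho>[of k x] by (simp add: max_def)
 have T\<rho>: "cmod (T k u x) <= \<rho> k x" for k u x
 using \<rho>[of k x] mult_left_mono[of "cmod (u x)" "max (\<rho> k x) (cmod (u x))" "\<rho> k x"]
 by (simp add: T_def norm_mult norm_divide divide_simps mult.commute)
 have Tf: "cmod (u x - T k u x) <= cmod (u x)" for k u x
 proof -
 have "0 <= \<rho> k x / max (\<rho> k x) (cmod (u x))" "\<rho> k x / max (\<rho> k x) (cmod (u x)) <= 1"
 using \<rho>[of k x] by (auto simp: divide_le_eq_1)
 moreover have "u x - T k u x = u x * of_real (1 - \<rho> k x / max (\<rho> k x) (cmod (u x)))" by (simp add: T_def algebra_simps)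
 ultimately show ?thesis by (simp only: norm_mult norm_of_real) (simp add: mult_left_le)
 qed
 have [measurable]: "T k f \<in> bmeas" for k unfolding T_def[abs_def] by measurable
 have Tc: "continuous_on UNIV (T k (g n))" for k n
 unfolding T_def using \<rho> by (intro continuous_intros \<rho>c Ng(2)) (simp add: maxn)
 have [measurable]: "T k (g n) \<in> bmeas" for k n by (intro borel_measurable_continuous_onI Tc)
 have Tr: "rapid (T k (g n))" for k n
 by (rule rapid_dominated[OF \<rho>r[of k], where C=1 and j=0]) (use T\<rho>[of k "g n"] \<rho> in \<open>auto simp: less_imp_le\<close>)
 have "(%k. l2sq (%x. f x - T k f x)) ----> (LI (x::'a). 0)"
 unfolding l2sq_def
 proof (rule integral_dominated_convergence[where w="%x. csq (f x)"])
 show "AE x in lborel. (%k. csq (f x - T k f x)) ----> 0"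
 proof (intro AE_I2 tendsto_eventually eventually_sequentiallyI)
 fix x k assume "k >= nat \<lceil>cmod (f x) / gauss x\<rceil>"
 then have "cmod (f x) / gauss x <= real (Suc k)" by linarith
 then have "max (\<rho> k x) (cmod (f x)) = \<rho> k x" by (simp add: \<rho>_def pos_divide_le_eq max_def)
 then show "csq (f x - T k f x) = 0" using \<rho>[of k x] by (simp add: T_def)
 qed
 show "AE x in lborel. norm (csq (f x - T k f x)) <= csq (f x)" for k
 using Tf by (auto intro: power_mono)
 qed (use square_intD(2)[OF f] in auto)
 \<comment> \<open>Error budget: two errors of \<open>e / 48\<close>, each doubled, give
   \<open>e / 12\<close> in \<open>fq\<close>, and the last estimate adds up ten twelfths of
   \<open>e\<close>.\<close>
 from LIMSEQ_D[OF this, of "e / 48"] e obtain k where "norm (l2sq (%x. f x - T k f x) - (LI (x::'a). 0)) < e / 48" by auto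
 then have k: "l2sq (%x. f x - T k f x) < e / 48" by simp
 have "(%n. l2sq (%x. T k f x - T k (g n) x)) ----> (LI (x::'a). 0)"
 unfolding l2sq_def
 proof (rule integral_dominated_convergence[where w="%x. 4 * csq (of_real (\<rho> k x))"])
 show "AE x in lborel. (%n. csq (T k f x - T k (g n) x)) ----> 0"
 using N
 proof eventually_elim
 case (elim x)
 have "(%n. csq (T k f x - T k (g n) x)) ----> csq (T k f x - T k f x)"
 unfolding T_def by (intro tendsto_intros Ng(3)[OF elim] maxn)
 then show ?case by simp
 qed
 show "AE x in lborel. norm (csq (T k f x - T k (g n) x)) <= 4 * csq (of_real (\<rho> k x))" for n
 proof (rule AE_I2)
 fix x
 have "cmod (T k f x - T k (g n) x) <= 2 * \<rho> k x"
 using norm_triangle_ineq4[of "T k f x" "T k (g n) x"] T\<rho>[of k f x] T\<rho>[of k "g n" x] by simp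
 from power_mono[OF this norm_ge_zero, of 2] show "norm (csq (T k f x - T k (g n) x)) <= 4 * csq (of_real (\<rho> k x))"
 by (simp add: power_mult_distrib)
 qed
 show "integ (%x::'a. 4 * csq (of_real (\<rho> k x)))"
 by (intro integrable_mult_right square_intD(2) rapid_square_int \<rho>r)
 qed measurable
 from LIMSEQ_D[OF this, of "e / 48"] e obtain n where "norm (l2sq (%x. T k f x - T k (g n) x) - (LI (x::'a). 0)) < e / 48" by auto
 then have n: "l2sq (%x. T k f x - T k (g n) x) < e / 48" by simp
 define q where "q = T k (g n)"
 have q: "rapid q" "continuous_on UNIV q" unfolding q_def by (rule Tr Tc)+
 have sT: "square_int (T k f)"
 unfolding square_int_def
 proof
 show "integ (%x. csq (T k f x))"
 by (rule integrable_bound[OF square_intD(2)[OF rapid_square_int[OF \<rho>r[of k]]]])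
 (use T\<rho>[of k f] in \<open>auto intro!: AE_I2 power_mono\<close>)
 qed measurable
 have fq: "l2sq (%x. f x - q x) < e / 12"
 using l2sq_add_le[OF square_int_diff[OF f sT] square_int_diff[OF sT rapid_square_int[OF q(1)]], of 1] k n by (simp add: q_def)
 obtain R where R: "!!n. norm (h n) <= R"
 using Bseq_def h convergent_imp_Bseq[of h] unfolding convergent_def by (metis BseqE)
 then have R0: "R >= 0" using order_trans[OF norm_ge_zero] by blast
 obtain C where C: "C >= 0" "!!x y. norm y <= R ==> cmod (q (x + y)) <= C * (1 / (1 + norm x) ^ (2 * DIM('a)))"
 by (rule rapid_shift_bound[OF q(1) R0]) auto
 have "(%n. l2sq (%x. q (x + h n) - q x)) ----> (LI (x::'a). 0)"
 unfolding l2sq_def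
 proof (rule integral_dominated_convergence[where w="%x. 4 * C\<^sup>2 * (1 / (1 + norm x) ^ (2 * DIM('a)))"])
 show "AE x in lborel. (%n. csq (q (x + h n) - q x)) ----> 0"
 proof (rule AE_I2)
 fix x
 have "(%n. x + h n) ----> x + 0" by (intro tendsto_intros h)
 then have "(%n. q (x + h n)) ----> q x"
 using q(2) by (intro isCont_tendsto_compose[of x q]) (auto simp: continuous_on_eq_continuous_at)
 then have "(%n. csq (q (x + h n) - q x)) ----> csq (q x - q x)" by (intro tendsto_intros)
 then show "(%n. csq (q (x + h n) - q x)) ----> 0" by simp
 qed
 show "AE x in lborel. norm (csq (q (x + h n) - q x)) <= 4 * C\<^sup>2 * (1 / (1 + norm x) ^ (2 * DIM('a)))" for n
 proof (rule AE_I2)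
 fix x :: 'a
 let ?p = "1 / (1 + norm x) ^ (2 * DIM('a))"
 have "cmod (q (x + h n) - q x) <= 2 * C * ?p"
 using norm_triangle_ineq4[of "q (x + h n)" "q x"] C(2)[OF R[of n], of x] C(2)[of 0 x] R0 by simp
 from power_mono[OF this norm_ge_zero, of 2] have "csq (q (x + h n) - q x) <= 4 * C\<^sup>2 * ?p\<^sup>2" by (simp add: power_mult_distrib power_divide)
 also have "?p\<^sup>2 <= ?p" unfolding power2_eq_square by (rule mult_left_le) (auto simp: divide_le_eq_1 one_le_power intro!: zero_less_power add_pos_nonneg)
 then have "4 * C\<^sup>2 * ?p\<^sup>2 <= 4 * C\<^sup>2 * ?p" by (intro mult_left_mono) auto
 finally show "norm (csq (q (x + h n) - q x)) <= 4 * C\<^sup>2 * ?p" by simp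
 qed
 show "integ (%x::'a. 4 * C\<^sup>2 * (1 / (1 + norm x) ^ (2 * DIM('a))))"
 using integrable_inverse_power_norm by (rule integrable_mult_right)
 qed (use rapidD_measurable[OF q(1)] in measurable)
 from LIMSEQ_D[OF this, of "e / 12"] e obtain M where M: "!!n. n >= M ==> \<bar>l2sq (%x. q (x + h n) - q x)\<bar> < e / 12" by auto
 show "\<exists>no. \<forall>n\<ge>no. norm (l2sq (%x. f (x + h n) - f x) - 0) < e"
 proof (intro exI[of _ M] allI impI)
 fix n assume n: "n >= M"
 note sq = rapid_square_int[OF q(1)] and sf = square_int_shift[OF f, of "h n"] and sqh = square_int_shift[OF rapid_square_int[OF q(1)], of "h n"]
 have "l2sq (%x. f (x + h n) - f x) <= 2 * l2sq (%x. f (x + h n) - q (x + h n)) + 2 * l2sq (%x. q (x + h n) - f x)"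
 using l2sq_add_le[OF square_int_diff[OF sf sqh] square_int_diff[OF sqh f], of 1] by simp
 also have "l2sq (%x. f (x + h n) - q (x + h n)) = l2sq (%x. f x - q x)" by (rule l2sq_shift)
 also have "l2sq (%x. q (x + h n) - f x) <= 2 * l2sq (%x. q (x + h n) - q x) + 2 * l2sq (%x. f x - q x)"
 using l2sq_add_le[OF square_int_diff[OF sqh sq] square_int_diff[OF sq f], of 1] by (simp add: l2sq_minus_commute[of f q])
 finally show "norm (l2sq (%x. f (x + h n) - f x) - 0) < e" using fq M[OF n] e by simp
 qed
qed

text \<open>\<open>quadratic_triangle\<close> is applied to \<open>l2sq f + l2sq g + 2 * I\<close>,
  where \<open>I\<close> is the integral of the product of the moduli: squaring its conclusion
  leaves the bound on \<open>I\<close>.\<close>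

lemma l2_cauchy_schwarz:
 assumes f: "square_int f" and g: "square_int g"
 shows "integ (%x. f x * g x)"
 and "cmod (LI x. f x * g x) <= sqrt (l2sq f) * sqrt (l2sq g)"
proof -
 have [measurable]: "f \<in> bmeas" "g \<in> bmeas"
 using f g by (auto simp: square_int_def)
 have am: "2 * (cmod a * cmod b) <= csq a + csq b" for a b :: complex
 using sum_squares_bound[of "cmod a" "cmod b"] by simp
 have "integ (%x. csq (f x) + csq (g x))"
 using f g by (simp add: square_int_def)
 then show int: "integ (%x. f x * g x)"
 proof (rule integrable_bound)
 show "AE x in lborel. cmod (f x * g x) <= norm (csq (f x) + csq (g x))"
 proof (rule AE_I2)
 fix x
 have "0 <= cmod (f x) * cmod (g x)" by simp
 with am[of "f x" "g x"] have "cmod (f x) * cmod (g x) <= csq (f x) + csq (g x)"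
 by linarith
 then show "cmod (f x * g x) <= norm (csq (f x) + csq (g x))"
 by (simp add: norm_mult)
 qed
 qed simp
 define I where "I = (LI x. cmod (f x) * cmod (g x))"
 have intn: "integ (%x. cmod (f x) * cmod (g x))"
 using integrable_norm[OF int] by (simp add: norm_mult)
 have "sqrt (l2sq f + l2sq g + 2 * I) <= sqrt (l2sq f) + sqrt (l2sq g)"
 proof (rule quadratic_triangle)
 fix et :: real assume et: "et > 0"
 have "2 * I = (LI x. 2 * (cmod (f x) * cmod (g x)))"
 by (simp add: I_def)
 also have "... <= (LI x. et * csq (f x) + 1 / et * csq (g x))"
 proof (rule integral_mono)
 fix x
 have "0 <= (et * cmod (f x) - cmod (g x))\<^sup>2 / et" using et by simp
 also have "... = et * csq (f x) + 1 / et * csq (g x) - 2 * (cmod (f x) * cmod (g x))"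
 using et by (simp add: power2_eq_square field_simps)
 finally show "2 * (cmod (f x) * cmod (g x)) <= et * csq (f x) + 1 / et * csq (g x)" by simp
 qed (use intn f g in \<open>auto simp: square_int_def\<close>)
 also have "... = et * l2sq f + 1 / et * l2sq g"
 unfolding l2sq_def using f g by (subst Bochner_Integration.integral_add) (auto simp: square_int_def)
 finally show "l2sq f + l2sq g + 2 * I <= (1 + et) * l2sq f + (1 + 1 / et) * l2sq g"
 by (simp add: distrib_right)
 qed auto
 moreover have "I >= 0" unfolding I_def by simp
 ultimately have "l2sq f + l2sq g + 2 * I <= (sqrt (l2sq f) + sqrt (l2sq g))\<^sup>2"
 by (simp add: sqrt_le_D)
 then have "I <= sqrt (l2sq f) * sqrt (l2sq g)"
 by (simp add: power2_sum)
 moreover have "cmod (LI x. f x * g x) <= I"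
 unfolding I_def using integral_norm_bound[of lborel "%x. f x * g x"] by (simp add: norm_mult)
 ultimately show "cmod (LI x. f x * g x) <= sqrt (l2sq f) * sqrt (l2sq g)" by linarith
qed

text \<open>The second claim says that the variance of \<open>f\<close> under the probability
  density \<open>gauss\<close> is nonnegative.\<close>

lemma jensen_gauss:
 fixes f :: "'a::euclidean_space => complex"
 assumes [measurable]: "f \<in> bmeas"
 and int: "integ (%y. gauss y * csq (f y))"
 shows "integ (%y. of_real (gauss y) * f y)"
 and "csq (LI y. of_real (gauss y) * f y) <= (LI y. gauss y * csq (f y))"
proof -
 have "integ (%y::'a. gauss y + gauss y * csq (f y))"
 using int by simp
 then show 1: "integ (%y. of_real (gauss y) * f y)"
 proof (rule integrable_bound)
 show "AE y in lborel. norm (of_real (gauss y) * f y) <= norm (gauss y + gauss y * csq (f y))"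
 proof (rule AE_I2)
 fix y :: 'a
 have "2 * cmod (f y) <= 1 + csq (f y)" using sum_squares_bound[of 1 "cmod (f y)"] by simp
 then have "cmod (f y) <= 1 + csq (f y)" using norm_ge_zero[of "f y"] by linarith
 then have "gauss y * cmod (f y) <= gauss y * (1 + csq (f y))" by (intro mult_left_mono) auto
 then show "norm (of_real (gauss y) * f y) <= norm (gauss y + gauss y * csq (f y))"
 by (simp add: norm_mult distrib_left)
 qed
 qed simp
 define m where "m = (LI y. of_real (gauss y) * f y)"
 define R where "R y = Re (cnj m * (of_real (gauss y) * f y))" for y
 have i2: "integ (%y. cnj m * (of_real (gauss y) * f y))" using 1 by simp
 have R: "integ R" "(LI y. R y) = Re (cnj m * m)"
 using integral_Re[OF i2] integrable_Re[OF i2] unfolding R_def[abs_def] by (simp_all add: m_def)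
 have exp: "gauss y * csq (f y - m) = gauss y * csq (f y) - 2 * R y + csq m * gauss y" for y
 unfolding cmod_power2 R_def by (simp add: power2_eq_square algebra_simps)
 have "0 <= (LI y. gauss y * csq (f y - m))"
 by (intro integral_nonneg_AE) auto
 also have "... = (LI y. gauss y * csq (f y)) - 2 * Re (cnj m * m) + csq m"
 unfolding exp R(2)[symmetric] using int R(1) by simp
 also have "Re (cnj m * m) = csq m"
 by (simp add: cmod_power2) (simp add: power2_eq_square)
 finally show "csq (LI y. of_real (gauss y) * f y) <= (LI y. gauss y * csq (f y))"
 by (simp add: m_def)
qed

text \<open>Convolution with a Gaussian of width \<open>c\<close> (the Gaussian being even), an
  approximate identity as \<open>c\<close> tends to 0. Written as an average of translates so that
  Jensen's inequality and the L^2 continuity of translations apply directly.\<close>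

definition gconv :: "real => ('a::euclidean_space => complex) => 'a => complex" where
 "gconv c f x = (LI y. of_real (gauss y) * f (x + c *. y))"

lemma gconv_measurable[measurable]:
 assumes [measurable]: "f \<in> bmeas"
 shows "gconv c f \<in> bmeas"
 unfolding gconv_def[abs_def] by measurable

text \<open>Jensen pointwise, then Fubini: the squared error is at most the Gaussian average of the
  translation modulus \<open>om\<close>. The bound \<open>4 * l2sq f\<close> on \<open>om\<close>
  provides the majorant when \<open>c\<close> tends to 0.\<close>

lemma gconv_L2_diff:
 assumes f: "square_int f"
 defines "om \<equiv> %h. l2sq (%x. f (x + h) - f x)"
 shows "square_int (%x. gconv c f x - f x)"
 and "integ (%y. gauss y * om (c *. y))"
 and "l2sq (%x. gconv c f x - f x) <= (LI y. gauss y * om (c *. y))"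
 and "om h <= 4 * l2sq f"
proof -
 have [measurable]: "f \<in> bmeas" using f by (simp add: square_int_def)
 show om: "om h <= 4 * l2sq f" for h
 using l2sq_add_le[OF square_int_shift[OF f, of h] square_int_cmult[OF f, of "-1"], of 1]
 by (simp add: om_def l2sq_shift l2sq_cmult)
 have om0: "om h >= 0" for h by (simp add: om_def)
 have [measurable]: "om \<in> bmeas"
 unfolding om_def l2sq_def by measurable
 let ?k = "%y x. gauss y * csq (f (x + c *. y) - f x)"
 have kx: "integ (?k y)" for y
 using square_intD(2)[OF square_int_diff[OF square_int_shift[OF f] f]] by simp
 have kx': "(LI x. ?k y x) = gauss y * om (c *. y)" for y
 by (simp add: om_def l2sq_def)
 show i1: "integ (%y. gauss y * om (c *. y))"
 proof (rule integrable_bound)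
 show "integ (%y::'a. 4 * l2sq f * gauss y)" by simp
 show "AE y in lborel. norm (gauss y * om (c *. y)) <= norm (4 * l2sq f * gauss y)"
 using om om0 by (auto intro!: AE_I2 mult_left_mono simp: abs_mult mult.commute[of _ "gauss _"])
 qed simp
 have k: "integrable (lborel \<Otimes>\<^sub>M lborel) (%(y, x). ?k y x)"
 proof (rule lborel_pair.Fubini_integrable)
 have kn: "(LI x. norm (?k y x)) = gauss y * om (c *. y)" for y
 by (simp only: kx'[symmetric]) (simp add: abs_mult)
 show "integ (%y. LI x. norm (case (y, x) of (y, x) => ?k y x))"
 unfolding split_conv kn by (rule i1)
 show "AE y in lborel. integ (%x. case (y, x) of (y, x) => ?k y x)"
 unfolding split_conv by (intro AE_I2 kx)
 qed measurable
 have swap: "(LI x. LI y. ?k y x) = (LI y. gauss y * om (c *. y))"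
 using lborel_pair.Fubini_integral[OF k] by (simp only: split_conv kx')
 have k2: "integrable (lborel \<Otimes>\<^sub>M lborel) (%(x, y). ?k y x)"
 using lborel_pair.integrable_product_swap[OF k] by (simp add: case_prod_beta)
 have AEk: "AE x in lborel. integ (%y. ?k y x)"
 using lborel_pair.AE_integrable_fst[OF k2] by simp
 have ik: "integ (%x. LI y. ?k y x)"
 using lborel_pair.integrable_fst[OF k2] by simp
 have le: "AE x in lborel. csq (gconv c f x - f x) <= (LI y. ?k y x)"
 using AEk
 proof eventually_elim
 case (elim x)
 note j = jensen_gauss[of "%y. f (x + c *. y) - f x", OF _ elim]
 have i: "integ (%y::'a. of_real (gauss y) * (f (x + c *. y) - f x))" by (rule j(1)) measurable
 have i0: "integ (%y::'a. of_real (gauss y) * f x)" by simp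
 have "gconv c f x = (LI y. of_real (gauss y) * (f (x + c *. y) - f x) + of_real (gauss y) * f x)"
 by (simp add: gconv_def algebra_simps)
 also have "... = (LI y. of_real (gauss y) * (f (x + c *. y) - f x)) + (LI (y::'a). of_real (gauss y) * f x)"
 using i i0 by (rule Bochner_Integration.integral_add)
 also have "(LI (y::'a). of_real (gauss y) * f x) = f x" by simp
 finally have "gconv c f x - f x = (LI y. of_real (gauss y) * (f (x + c *. y) - f x))" by simp
 then show ?case using j(2) by simp
 qed
 have sq: "integ (%x. csq (gconv c f x - f x))"
 using ik by (rule integrable_bound) (use le in auto)
 then show "square_int (%x. gconv c f x - f x)" by (simp add: square_int_def)
 show "l2sq (%x. gconv c f x - f x) <= (LI y. gauss y * om (c *. y))"
 unfolding l2sq_def swap[symmetric] using sq ik le by (rule integral_mono_AE)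
qed

lemma gconv_tendsto_L2:
 assumes f: "square_int f" and c: "c ----> 0"
 shows "(%n. l2sq (%x. gconv (c n) f x - f x)) ----> 0"
proof -
 define om where "om = (%h. l2sq (%x. f (x + h) - f x))"
 have [measurable]: "f \<in> bmeas" using f by (simp add: square_int_def)
 have [measurable]: "om \<in> bmeas"
 unfolding om_def l2sq_def by measurable
 have "(%n. LI (y::'a). gauss y * om (c n *. y)) ----> (LI (y::'a). 0)"
 proof (rule integral_dominated_convergence[where w="%y. 4 * l2sq f * gauss y"])
 show "AE y in lborel. (%n. gauss y * om (c n *. y)) ----> 0"
 proof (rule AE_I2)
 fix y :: 'a
 have "(%n. c n *. y) ----> 0" using tendsto_scaleR[OF c tendsto_const, of y] by simp
 from L2_translation[OF f this] have "(%n. gauss y * om (c n *. y)) ----> gauss y * 0"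
 unfolding om_def by (intro tendsto_mult tendsto_const)
 then show "(%n. gauss y * om (c n *. y)) ----> 0" by simp
 qed
 show "AE y in lborel. norm (gauss y * om (c n *. y)) <= 4 * l2sq f * gauss y" for n
 using gconv_L2_diff(4)[OF f] by (auto simp: om_def abs_mult mult.commute[of _ "gauss _"] intro!: mult_left_mono)
 qed auto
 then have lim: "(%n. LI (y::'a). gauss y * om (c n *. y)) ----> 0" by simp
 have le: "norm (l2sq (%x. gconv (c n) f x - f x)) <= (LI (y::'a). gauss y * om (c n *. y))" for n
 using gconv_L2_diff(3)[OF f, of "c n"] by (simp add: om_def)
 show ?thesis
 by (rule Lim_null_comparison[OF always_eventually[OF allI[OF le]] lim])
qed

lemma integrable_pair_mult:
 fixes f :: "'a::euclidean_space => complex" and g :: "'b::euclidean_space => complex"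
 assumes "integ f" "integ g"
 and [measurable]: "h \<in> borel_measurable (lborel \<Otimes>\<^sub>M lborel)"
 and "!!x y. cmod (h (x, y)) <= 1"
 shows "integrable (lborel \<Otimes>\<^sub>M lborel) (%(x, y). f x * g y * h (x, y))"
proof -
 have [measurable]: "f \<in> bmeas" "g \<in> bmeas"
 using assms by auto
 have "integrable (lborel \<Otimes>\<^sub>M lborel) (%(x, y). f x * g y)"
 by (rule lborel_pair.Fubini_integrable) (use assms(1,2) in \<open>auto simp: norm_mult\<close>)
 then show ?thesis
 by (rule integrable_bound)
 (use assms(4) in \<open>auto simp: norm_mult intro!: mult_left_le AE_I2\<close>)
qed

lemma integrable_gauss_scale:
 assumes "c ~= 0"
 shows "integ (%x::'a::euclidean_space. gauss (c *. x))"
proof (rule integrableI_nonneg)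
 have "(NN (x::'a). ennreal (gauss (c *. x))) = ennreal (1 / \<bar>c\<bar> ^ DIM('a))"
 using assms by (subst nn_integral_lborel_scale[of "%x. ennreal (gauss x)"]) (auto simp: nn_integral_gauss)
 then show "(NN (x::'a). ennreal (gauss (c *. x))) < \<infinity>" by simp
qed auto

lemma integral_gauss_chr:
 assumes c: "c > 0"
 shows "(LI x. of_real (gauss (c *. x)) * chr (x \<bullet> z)) = of_real (1 / c ^ DIM('a)) * of_real (gauss ((1 / c) *. z :: 'a::euclidean_space))"
proof -
 have "(LI x. of_real (gauss (c *. x)) * chr (x \<bullet> z)) = (LI x. (%y. of_real (gauss y) * chr (y \<bullet> ((1 / c) *. z))) (0 + c *. x))"
 using c by simp
 also have "... = (1 / c ^ DIM('a)) *. inv_fourier (%xi. of_real (gauss xi)) ((1 / c) *. z)"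
 using c by (subst integral_lborel_affine) (auto simp: inv_fourier_eq inner_commute)
 finally show ?thesis by (simp add: inv_fourier_gauss scaleR_conv_of_real)
qed

text \<open>Fourier inversion with a Gaussian weight. The weight makes the double integral
  absolutely convergent, and its own transform is the rescaled Gaussian kernel of
  \<open>gconv\<close>. Plancherel and inversion both follow by letting \<open>c\<close> tend to
  0.\<close>

lemma gauss_weighted_inversion:
 fixes f :: "'a::euclidean_space => complex"
 assumes f: "integ f" and c: "c > 0"
 shows "(LI x. of_real (gauss (c *. x)) * inv_fourier f x * chr (- (x \<bullet> xi))) = gconv c f xi"
proof -
 have [measurable]: "f \<in> bmeas" using f by simp
 have ig: "integ (%x::'a. complex_of_real (gauss (c *. x)))"
 using integrable_gauss_scale[of c] c by (intro integrable_of_real) auto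
 have int: "integrable (lborel \<Otimes>\<^sub>M lborel) (%(x::'a, et). of_real (gauss (c *. x)) * f et * (%(x, et). chr (x \<bullet> et) * chr (- (x \<bullet> xi))) (x, et))"
 by (rule integrable_pair_mult[OF ig f]) (auto simp: norm_mult)
 have "(LI x. of_real (gauss (c *. x)) * inv_fourier f x * chr (- (x \<bullet> xi)))
 = (LI x. LI et. of_real (gauss (c *. x)) * f et * (chr (x \<bullet> et) * chr (- (x \<bullet> xi))))"
 unfolding inv_fourier_eq
 by (intro Bochner_Integration.integral_cong refl)
 (simp add: mult_ac flip: integral_mult_right_zero integral_mult_left_zero)
 also have "... = (LI et. LI x. of_real (gauss (c *. x)) * f et * (chr (x \<bullet> et) * chr (- (x \<bullet> xi))))"
 using lborel_pair.Fubini_integral[OF int] by simp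
 also have "... = (LI et. f et * (of_real (1 / c ^ DIM('a)) * of_real (gauss ((1 / c) *. (et - xi)))))"
 proof (intro Bochner_Integration.integral_cong refl)
 fix et :: 'a
 have "(LI x. of_real (gauss (c *. x)) * f et * (chr (x \<bullet> et) * chr (- (x \<bullet> xi))))
 = (LI x. f et * (of_real (gauss (c *. x)) * chr (x \<bullet> (et - xi))))"
 by (intro Bochner_Integration.integral_cong refl) (simp add: chr_diff chr_minus inner_diff_right mult_ac)
 then show "(LI x. of_real (gauss (c *. x)) * f et * (chr (x \<bullet> et) * chr (- (x \<bullet> xi))))
 = f et * (of_real (1 / c ^ DIM('a)) * of_real (gauss ((1 / c) *. (et - xi))))"
 by (simp add: integral_gauss_chr[OF c])
 qed
 also have "... = (1 / c ^ DIM('a)) *. (LI et. f et * of_real (gauss ((1 / c) *. (et - xi))))"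
 by (simp add: scaleR_conv_of_real mult_ac flip: integral_mult_right_zero)
 also have "... = (LI y. (%et. f et * of_real (gauss ((1 / c) *. (et - xi)))) (xi + c *. y))"
 using c by (subst integral_lborel_affine) auto
 also have "... = gconv c f xi"
 using c by (simp add: gconv_def mult.commute)
 finally show ?thesis .
qed

lemma borel_measurable_cnj[measurable]: "cnj \<in> bmeas"
 by (intro borel_measurable_continuous_onI continuous_on_cnj continuous_on_id)

lemma inverse_Suc_seq: "1 / real (Suc n) > 0" "(%n. 1 / real (Suc n)) ----> 0"
 by simp (rule LIMSEQ_Suc[OF lim_1_over_n])

lemma cnj_inv_fourier: "cnj (inv_fourier f x) = (LI et. cnj (f et) * chr (- (x \<bullet> et)))"
 by (simp add: inv_fourier_eq cnj_chr flip: Bochner_Integration.integral_cnj)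

text \<open>One of the two factors \<open>inv_fourier f x\<close> is written out as an integral and
  exchanged with the outer one; the inner integral is then
  \<open>gauss_weighted_inversion\<close>.\<close>

lemma plancherel_gauss:
 fixes f :: "'a::euclidean_space => complex"
 assumes f: "integ f" and c: "c > 0"
 shows "(LI x. of_real (gauss (c *. x) * csq (inv_fourier f x))) = (LI et. cnj (f et) * gconv c f et)"
 and "integ (%x. gauss (c *. x) * csq (inv_fourier f x))"
proof -
 have [measurable]: "f \<in> bmeas" using f by simp
 let ?G = "inv_fourier f"
 obtain B where B: "!!x. cmod (?G x) <= B" using inv_fourier_bound[OF f] by blast
 have B0: "B >= 0" using B[of 0] norm_ge_zero[of "?G 0"] by linarith
 have ig: "integ (%x::'a. complex_of_real (gauss (c *. x)))"
 using integrable_gauss_scale[of c] c by (intro integrable_of_real) auto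
 have iG: "integ (%x::'a. of_real (gauss (c *. x)) * ?G x)"
 proof (rule integrable_bound[of _ "%x. B *. complex_of_real (gauss (c *. x))"])
 show "AE x in lborel. norm (of_real (gauss (c *. x)) * ?G x) <= norm (B *. complex_of_real (gauss (c *. x)))"
 using B B0 by (auto simp: norm_mult mult.commute[of B] intro!: mult_left_mono AE_I2)
 qed (use ig in auto)
 show "integ (%x. gauss (c *. x) * csq (?G x))"
 proof (rule integrable_bound[of _ "%x. B\<^sup>2 * gauss (c *. x)"])
 show "AE x in lborel. norm (gauss (c *. x) * csq (?G x)) <= norm (B\<^sup>2 * gauss (c *. x))"
 using B B0 by (auto simp: abs_mult mult.commute[of "B\<^sup>2"] intro!: mult_left_mono AE_I2 power_mono)
 qed (use integrable_gauss_scale[of c] c in auto)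
 have int: "integrable (lborel \<Otimes>\<^sub>M lborel) (%(x::'a, et). (of_real (gauss (c *. x)) * ?G x) * cnj (f et) * (%(x, et). chr (- (x \<bullet> et))) (x, et))"
 by (rule integrable_pair_mult[OF iG]) (use f in auto)
 have "(LI x. of_real (gauss (c *. x) * csq (?G x)))
 = (LI x. LI et. (of_real (gauss (c *. x)) * ?G x) * cnj (f et) * chr (- (x \<bullet> et)))"
 proof (intro Bochner_Integration.integral_cong refl)
 fix x
 have "of_real (gauss (c *. x) * csq (?G x)) = (of_real (gauss (c *. x)) * ?G x) * cnj (?G x)"
 by (simp only: of_real_mult complex_norm_square mult.assoc)
 also have "... = (LI et. (of_real (gauss (c *. x)) * ?G x) * (cnj (f et) * chr (- (x \<bullet> et))))"
 by (simp add: cnj_inv_fourier)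
 finally show "of_real (gauss (c *. x) * csq (?G x)) = (LI et. (of_real (gauss (c *. x)) * ?G x) * cnj (f et) * chr (- (x \<bullet> et)))"
 by (simp add: mult.assoc)
 qed
 also have "... = (LI et. LI x. (of_real (gauss (c *. x)) * ?G x) * cnj (f et) * chr (- (x \<bullet> et)))"
 using lborel_pair.Fubini_integral[OF int] by simp
 also have "... = (LI et. cnj (f et) * gconv c f et)"
 proof (intro Bochner_Integration.integral_cong refl)
 fix et
 have "(LI x. (of_real (gauss (c *. x)) * ?G x) * cnj (f et) * chr (- (x \<bullet> et)))
 = (LI x. cnj (f et) * (of_real (gauss (c *. x)) * ?G x * chr (- (x \<bullet> et))))"
 by (simp add: mult_ac)
 then show "(LI x. (of_real (gauss (c *. x)) * ?G x) * cnj (f et) * chr (- (x \<bullet> et))) = cnj (f et) * gconv c f et"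
 by (simp add: gauss_weighted_inversion[OF f c])
 qed
 finally show "(LI x. of_real (gauss (c *. x) * csq (?G x))) = (LI et. cnj (f et) * gconv c f et)" .
qed

lemma square_int_cnj: "square_int f ==> square_int (%x. cnj (f x))"
 by (auto simp: square_int_def intro: measurable_compose[OF _ borel_measurable_cnj])

lemma l2sq_cnj[simp]: "l2sq (%x. cnj (f x)) = l2sq f"
 by (simp add: l2sq_def)

lemma gconv_inner_tendsto:
 assumes f: "square_int f" and c: "c ----> 0"
 shows "(%n. LI et. cnj (f et) * gconv (c n) f et) ----> of_real (l2sq f)"
proof -
 note sd = gconv_L2_diff(1)[OF f]
 have ff: "(LI et. cnj (f et) * f et) = of_real (l2sq f)"
 proof -
 have "(LI et. cnj (f et) * f et) = (LI et. complex_of_real (csq (f et)))"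
 by (intro Bochner_Integration.integral_cong refl) (simp add: complex_norm_square mult.commute del: of_real_power)
 then show ?thesis by (simp only: l2sq_def integral_complex_of_real)
 qed
 have lim: "(%n. sqrt (l2sq f) * sqrt (l2sq (%x. gconv (c n) f x - f x))) ----> 0"
 using tendsto_mult_left[OF tendsto_real_sqrt[OF gconv_tendsto_L2[OF f c]], of "sqrt (l2sq f)"] by simp
 have le: "norm ((LI et. cnj (f et) * gconv (c n) f et) - of_real (l2sq f)) <= sqrt (l2sq f) * sqrt (l2sq (%x. gconv (c n) f x - f x))" for n
 proof -
 have i1: "integ (%et. cnj (f et) * (gconv (c n) f et - f et))"
 by (rule l2_cauchy_schwarz(1)[OF square_int_cnj[OF f] sd])
 have i2: "integ (%et. cnj (f et) * f et)"
 by (rule l2_cauchy_schwarz(1)[OF square_int_cnj[OF f] f])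
 have "(LI et. cnj (f et) * gconv (c n) f et) = (LI et. cnj (f et) * (gconv (c n) f et - f et) + cnj (f et) * f et)"
 by (simp add: algebra_simps)
 also have "... = (LI et. cnj (f et) * (gconv (c n) f et - f et)) + of_real (l2sq f)"
 using i1 i2 by (simp add: ff)
 finally show ?thesis
 using l2_cauchy_schwarz(2)[OF square_int_cnj[OF f] sd[of "c n"]] by simp
 qed
 show ?thesis
 by (rule LIM_zero_cancel) (rule Lim_null_comparison[OF always_eventually[OF allI[OF le]] lim])
qed

lemma gauss_scale_tendsto_1: "c ----> 0 ==> (%n. gauss (c n *. x)) ----> 1"
proof -
 assume c: "c ----> 0"
 have "(%n. exp (- pi * (\<bar>c n\<bar> * norm x)\<^sup>2)) ----> exp (- pi * (\<bar>0\<bar> * norm x)\<^sup>2)"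
 by (intro tendsto_intros c)
 then show ?thesis by (simp add: gauss_def)
qed

section \<open>Plancherel, energies of fractional Laplacians, Fourier inversion\<close>

text \<open>The weights \<open>gauss (c n *. x)\<close> increase to 1, so monotone convergence
  delivers integrability and value of the limit at once from
  \<open>plancherel_gauss\<close>.\<close>

theorem plancherel:
 assumes f: "integ f" "square_int f"
 shows "square_int (inv_fourier f)" and "l2sq (inv_fourier f) = l2sq f"
proof -
 have [measurable]: "f \<in> bmeas" using f by simp
 let ?G = "inv_fourier f"
 define c where "c n = 1 / real (Suc n)" for n
 have c: "c n > 0" "c ----> 0" for n
 using inverse_Suc_seq by (auto simp only: c_def[abs_def])
 have cdec: "c m <= c n" if "n <= m" for m n using that by (simp add: c_def frac_le)
 let ?u = "%n x. gauss (c n *. x) * csq (?G x)"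
 have i: "integ (?u n)" for n by (rule plancherel_gauss(2)[OF f(1) c(1)])
 have "complex_of_real (LI x. ?u n x) = (LI et. cnj (f et) * gconv (c n) f et)" for n
 using plancherel_gauss(1)[OF f(1) c(1)[of n]] by (simp only: integral_complex_of_real)
 then have "(%n. complex_of_real (LI x. ?u n x)) ----> of_real (l2sq f)"
 using gconv_inner_tendsto[OF f(2) c(2)] by simp
 then have lim: "(%n. LI x. ?u n x) ----> l2sq f"
 by (simp only: tendsto_of_real_iff)
 have mono: "AE x in lborel. mono (%n. ?u n x)"
 proof (intro AE_I2 monoI mult_right_mono)
 fix x :: 'a and m n :: nat assume "m <= n"
 then have "(\<bar>c n\<bar> * norm x)\<^sup>2 <= (\<bar>c m\<bar> * norm x)\<^sup>2"
 using cdec[of m n] c(1)[of n] c(1)[of m] by (intro power_mono mult_right_mono) auto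
 then show "gauss (c m *. x) <= gauss (c n *. x)"
 by (simp add: gauss_def)
 qed simp
 have pt: "AE x in lborel. (%n. ?u n x) ----> csq (?G x)"
 proof (rule AE_I2)
 fix x
 have "(%n. ?u n x) ----> 1 * csq (?G x)"
 by (intro tendsto_mult gauss_scale_tendsto_1 tendsto_const c)
 then show "(%n. ?u n x) ----> csq (?G x)" by simp
 qed
 have m: "(%x. csq (?G x)) \<in> borel_measurable lborel" by simp
 show "square_int ?G"
 using integrable_monotone_convergence[OF i mono pt lim m] by (simp add: square_int_def)
 show "l2sq ?G = l2sq f"
 unfolding l2sq_def[of ?G] by (rule integral_monotone_convergence[OF i mono pt lim m])
qed

lemma l2sq_reflect:
 assumes "f \<in> bmeas"
 shows "l2sq (%x. f (- x)) = l2sq f"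
 unfolding l2sq_def using assms by (intro integral_lborel_reflect[of "%x. csq (f x)"]) simp

lemma integrable_lborel_reflect:
 fixes f :: "'a::euclidean_space => 'b::{banach, second_countable_topology}"
 assumes "integ f"
 shows "integ (%x. f (- x))"
proof -
 have "lborel = distr lborel borel (uminus :: 'a => 'a)"
 using lborel_affine[of "-1" "0::'a"] by (simp add: density_1)
 then have "integrable (distr lborel borel (uminus :: 'a => 'a)) f" using assms by simp
 then show ?thesis using assms by (subst (asm) integrable_distr_eq) auto
qed

lemma square_int_reflect: "square_int f ==> square_int (%x. f (- x))"
 unfolding square_int_def using integrable_lborel_reflect[of "%x. csq (f x)"]
 by (auto intro!: measurable_compose[of uminus lborel borel f borel])

lemma plancherel_fourier:
 assumes f: "integ f" "square_int f"
 shows "square_int (fourier f)" and "l2sq (fourier f) = l2sq f"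
proof -
 have [measurable]: "f \<in> bmeas" using f by simp
 show "square_int (fourier f)"
 unfolding fourier_conv_inv_fourier[abs_def] by (rule square_int_reflect[OF plancherel(1)[OF f]])
 show "l2sq (fourier f) = l2sq f"
 unfolding fourier_conv_inv_fourier[abs_def] using plancherel(2)[OF f] by (subst l2sq_reflect) auto
qed

text \<open>\<open>inv_fourier f\<close> need not be integrable. The sequence demanded by
  \<open>has_fourier_L2\<close> is obtained by multiplying it with wide Gaussians; their transforms
  are exactly \<open>gconv (c n) f\<close>.\<close>

lemma has_fourier_L2_inv_fourier:
 assumes f: "integ f" "square_int f"
 shows "has_fourier_L2 (inv_fourier f) f"
proof -
 have [measurable]: "f \<in> bmeas" using f by simp
 let ?G = "inv_fourier f"
 define c where "c n = 1 / real (Suc n)" for n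
 have c: "c n > 0" "c ----> 0" for n
 using inverse_Suc_seq by (auto simp only: c_def[abs_def])
 define h where "h n x = of_real (gauss (c n *. x)) * ?G x" for n and x :: 'a
 have [measurable]: "h n \<in> bmeas" for n unfolding h_def[abs_def] by measurable
 obtain B where B: "!!x. cmod (?G x) <= B" using inv_fourier_bound[OF f(1)] by blast
 have B0: "B >= 0" using B[of 0] norm_ge_zero[of "?G 0"] by linarith
 have hi: "integ (h n)" for n
 proof (rule integrable_bound[of _ "%x. B * gauss (c n *. x)"])
 show "AE x in lborel. norm (h n x) <= norm (B * gauss (c n *. x))"
 using B B0 by (auto simp: h_def norm_mult mult.commute[of B] intro!: mult_left_mono AE_I2)
 qed (use integrable_gauss_scale[of "c n"] c(1)[of n] in auto)
 note G = plancherel[OF f]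
 have hs: "square_int (h n)" for n
 unfolding square_int_def
 proof
 show "integ (%x. csq (h n x))"
 by (rule integrable_bound[OF square_intD(2)[OF G(1)]])
 (auto simp: h_def norm_mult power_mult_distrib power_le_one mult_right_le_one_le intro!: AE_I2 mult_left_le_one_le)
 qed simp
 have "(%n. l2sq (%x. h n x - ?G x)) ----> (LI (x::'a). 0)"
 unfolding l2sq_def
 proof (rule integral_dominated_convergence[where w="%x. csq (?G x)"])
 have eq: "csq (h n x - ?G x) = (1 - gauss (c n *. x))\<^sup>2 * csq (?G x)" for n x
 proof -
 have "h n x - ?G x = of_real (- (1 - gauss (c n *. x))) * ?G x" by (simp add: h_def algebra_simps)
 then show ?thesis by (simp only: norm_mult norm_of_real power_mult_distrib power2_abs power2_minus)
 qed
 show "AE x in lborel. (%n. csq (h n x - ?G x)) ----> 0"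
 proof (rule AE_I2)
 fix x
 have "(%n. (1 - gauss (c n *. x))\<^sup>2 * csq (?G x)) ----> (1 - 1)\<^sup>2 * csq (?G x)"
 by (intro tendsto_intros gauss_scale_tendsto_1 c)
 then show "(%n. csq (h n x - ?G x)) ----> 0" by (simp add: eq)
 qed
 show "AE x in lborel. norm (csq (h n x - ?G x)) <= csq (?G x)" for n
 unfolding eq by (auto intro!: AE_I2 mult_left_le_one_le power_le_one simp: less_imp_le)
 qed (use square_intD(2)[OF G(1)] in auto)
 then have h1: "(%n. l2sq (%x. h n x - ?G x)) ----> 0" by simp
 have "fourier (h n) = gconv (c n) f" for n
 using gauss_weighted_inversion[OF f(1) c(1)] by (auto simp: fourier_eq h_def)
 then have h2: "(%n. l2sq (%xi. fourier (h n) xi - f xi)) ----> 0"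
 using gconv_tendsto_L2[OF f(2) c(2)] by simp
 show ?thesis
 unfolding has_fourier_L2_def using G(1) f(2) hi hs h1 h2 by blast
qed

lemma has_fourier_L2_isometry:
 assumes "has_fourier_L2 f g" shows "l2sq f = l2sq g"
proof -
 from assms obtain h where h: "square_int f" "square_int g" "!!n. integ (h n)" "!!n. square_int (h n)"
 "(%n::nat. l2sq (%x. h n x - f x)) ----> 0" "(%n. l2sq (%xi. fourier (h n) xi - g xi)) ----> 0"
 unfolding has_fourier_L2_def by blast
 have "(%n. l2sq (h n)) ----> l2sq f" by (rule l2sq_tendsto[OF h(4,1,5)])
 moreover have "(%n. l2sq (fourier (h n))) ----> l2sq g"
 by (rule l2sq_tendsto[OF plancherel_fourier(1)[OF h(3,4)] h(2,6)])
 ultimately show ?thesis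
 using LIMSEQ_unique by (simp add: plancherel_fourier(2)[OF h(3,4)])
qed

text \<open>Plancherel carries the difference of the two approximating sequences to the Fourier
  side, so both transforms are limits of the same sequence.\<close>

lemma has_fourier_L2_unique:
 assumes "has_fourier_L2 f g" "has_fourier_L2 f g'"
 shows "AE x in lborel. g x = g' x"
proof -
 from assms(1) obtain h where h: "square_int f" "square_int g" "!!n. integ (h n)" "!!n. square_int (h n)"
 "(%n::nat. l2sq (%x. h n x - f x)) ----> 0" "(%n. l2sq (%xi. fourier (h n) xi - g xi)) ----> 0"
 unfolding has_fourier_L2_def by blast
 from assms(2) obtain h' where h': "square_int f" "square_int g'" "!!n. integ (h' n)" "!!n. square_int (h' n)"
 "(%n::nat. l2sq (%x. h' n x - f x)) ----> 0" "(%n. l2sq (%xi. fourier (h' n) xi - g' xi)) ----> 0"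
 unfolding has_fourier_L2_def by blast
 note F = plancherel_fourier(1)[OF h(3,4)] and F' = plancherel_fourier(1)[OF h'(3,4)]
 have lim: "(%n. 2 * (2 * l2sq (%x. h' n x - f x) + 2 * l2sq (%x. h n x - f x)) + 2 * l2sq (%xi. fourier (h' n) xi - g' xi)) ----> 2 * (2 * 0 + 2 * 0) + 2 * 0"
 by (intro tendsto_intros h h')
 have le: "l2sq (%xi. fourier (h n) xi - g' xi) <= 2 * (2 * l2sq (%x. h' n x - f x) + 2 * l2sq (%x. h n x - f x)) + 2 * l2sq (%xi. fourier (h' n) xi - g' xi)" for n
 proof -
 have "l2sq (%xi. fourier (h n) xi - g' xi) <= 2 * l2sq (%xi. fourier (h n) xi - fourier (h' n) xi) + 2 * l2sq (%xi. fourier (h' n) xi - g' xi)"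
 using l2sq_add_le[OF square_int_diff[OF F F'] square_int_diff[OF F' h'(2)], of 1 n n n] by simp
 also have "l2sq (%xi. fourier (h n) xi - fourier (h' n) xi) = l2sq (%x. h n x - h' n x)"
 using plancherel_fourier(2)[OF Bochner_Integration.integrable_diff[OF h(3) h'(3)] square_int_diff[OF h(4) h'(4)], of n n]
 by (simp add: fourier_diff[OF h(3) h'(3), abs_def])
 also have "l2sq (%x. h n x - h' n x) <= 2 * l2sq (%x. h' n x - f x) + 2 * l2sq (%x. h n x - f x)"
 using l2sq_add_le[OF square_int_diff[OF h(4,1)] square_int_diff[OF h(1) h'(4)], of 1 n n]
 by (simp add: l2sq_minus_commute[of f "h' n"])
 finally show ?thesis by simp
 qed
 have "(%n. l2sq (%xi. fourier (h n) xi - g' xi)) ----> 0"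
 by (rule tendsto_sandwich[OF always_eventually always_eventually[OF allI[OF le]] tendsto_const])
 (use lim in simp_all)
 from l2sq_limit_unique[OF F h(2) h'(2) h(6) this] show ?thesis .
qed

text \<open>\<open>frac_lap\<close> is an arbitrary choice. A representative exists because the
  multiplied transform is again rapidly decreasing; uniqueness of the transform and the isometry
  then make the energy independent of the choice.\<close>

theorem lap_energy_inv_fourier:
 assumes v: "rapid v" and p: "p > 0"
 shows "lap_energy p (inv_fourier v) = (LI xi. (2 * pi * norm xi) powr (4 * p) * csq (v xi))"
proof -
 have [measurable]: "v \<in> bmeas" using v by (simp add: rapid_def)
 let ?z = "%xi::'a. complex_of_real ((2 * pi * norm xi) powr (2 * p)) * v xi"
 have "?z = (%xi. of_real ((2 * pi) powr (2 * p)) * (of_real (norm xi powr (2 * p)) * v xi))"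
 by (simp add: powr_mult fun_eq_iff)
 then have z: "rapid ?z"
 using rapid_cmult[OF rapid_powr_mult[OF v, of "2 * p"], of "of_real ((2 * pi) powr (2 * p))"] p by simp
 have hv: "has_fourier_L2 (inv_fourier v) v"
 by (intro has_fourier_L2_inv_fourier rapid_integrable rapid_square_int v)
 have hz: "has_fourier_L2 (inv_fourier ?z) ?z"
 by (intro has_fourier_L2_inv_fourier rapid_integrable rapid_square_int z)
 have "has_frac_lap p (inv_fourier v) (inv_fourier ?z)"
 unfolding has_frac_lap_def using hv hz by blast
 then have "has_frac_lap p (inv_fourier v) (frac_lap p (inv_fourier v))"
 unfolding frac_lap_def by (rule someI[of "has_frac_lap p (inv_fourier v)"])
 then obtain v' where v': "has_fourier_L2 (inv_fourier v) v'"
 "has_fourier_L2 (frac_lap p (inv_fourier v)) (%xi. of_real ((2 * pi * norm xi) powr (2 * p)) * v' xi)"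
 unfolding has_frac_lap_def by blast
 have "lap_energy p (inv_fourier v) = l2sq (frac_lap p (inv_fourier v))"
 by (simp add: lap_energy_def l2sq_def)
 also have "... = l2sq (%xi. of_real ((2 * pi * norm xi) powr (2 * p)) * v' xi)"
 by (rule has_fourier_L2_isometry[OF v'(2)])
 also have "... = l2sq ?z"
 proof (rule l2sq_cong_AE)
 show "square_int (%xi. of_real ((2 * pi * norm xi) powr (2 * p)) * v' xi)"
 using v'(2) by (simp add: has_fourier_L2_def)
 show "AE x in lborel. complex_of_real ((2 * pi * norm x) powr (2 * p)) * v' x = ?z x"
 using has_fourier_L2_unique[OF v'(1) hv] by eventually_elim simp
 qed simp
 also have "... = (LI xi. (2 * pi * norm xi) powr (4 * p) * csq (v xi))"
 unfolding l2sq_def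
 by (intro Bochner_Integration.integral_cong refl)
 (simp add: norm_mult power_mult_distrib power2_eq_square[of "_ powr _"] flip: powr_add)
 finally show ?thesis .
qed

text \<open>The Gaussian means of the inversion integral equal \<open>gconv (c n) f x\<close>. They
  converge to the inversion integral because \<open>fourier f\<close> is integrable, and to
  \<open>f x\<close> because \<open>f\<close> is bounded and continuous.\<close>

theorem fourier_inversion:
 fixes f :: "'a::euclidean_space => complex"
 assumes f: "integ f" "continuous_on UNIV f" "!!x. cmod (f x) <= B"
 and F: "integ (fourier f)"
 shows "inv_fourier (fourier f) x = f x"
proof -
 have [measurable]: "f \<in> bmeas" using f by simp
 define c where "c n = 1 / real (Suc n)" for n
 have c: "c n > 0" "c ----> 0" for n
 using inverse_Suc_seq by (auto simp only: c_def[abs_def])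
 have eq: "(LI xi. of_real (gauss (c n *. xi)) * (fourier f xi * chr (x \<bullet> xi))) = gconv (c n) f x" for n
 proof -
 have "(LI xi. of_real (gauss (c n *. xi)) * (fourier f xi * chr (x \<bullet> xi)))
 = (LI xi. of_real (gauss (c n *. (- xi))) * (fourier f (- xi) * chr (x \<bullet> (- xi))))"
 by (rule integral_lborel_reflect[symmetric]) measurable
 also have "... = gconv (c n) f x"
 unfolding gauss_weighted_inversion[OF f(1) c(1), symmetric]
 by (simp add: fourier_conv_inv_fourier inner_commute mult.assoc)
 finally show ?thesis .
 qed
 have "(%n. LI xi. of_real (gauss (c n *. xi)) * (fourier f xi * chr (x \<bullet> xi))) ----> (LI xi. fourier f xi * chr (x \<bullet> xi))"
 proof (rule integral_dominated_convergence[where w="%xi. cmod (fourier f xi)"])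
 show "AE xi in lborel. (%n. of_real (gauss (c n *. xi)) * (fourier f xi * chr (x \<bullet> xi))) ----> fourier f xi * chr (x \<bullet> xi)"
 proof (rule AE_I2)
 fix xi
 have "(%n. of_real (gauss (c n *. xi)) * (fourier f xi * chr (x \<bullet> xi))) ----> of_real 1 * (fourier f xi * chr (x \<bullet> xi))"
 by (intro tendsto_intros gauss_scale_tendsto_1 c)
 then show "(%n. of_real (gauss (c n *. xi)) * (fourier f xi * chr (x \<bullet> xi))) ----> fourier f xi * chr (x \<bullet> xi)" by simp
 qed
 qed (use F in \<open>auto simp: norm_mult intro!: mult_left_le_one_le\<close>)
 then have 1: "(%n. gconv (c n) f x) ----> inv_fourier (fourier f) x"
 by (simp add: eq inv_fourier_eq)
 have "(%n. gconv (c n) f x) ----> (LI (y::'a). of_real (gauss y) * f x)"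
 unfolding gconv_def
 proof (rule integral_dominated_convergence[where w="%y. B * gauss y"])
 show "AE y in lborel. (%n. of_real (gauss y) * f (x + c n *. y)) ----> of_real (gauss y) * f x"
 proof (rule AE_I2)
 fix y :: 'a
 have "(%n. x + c n *. y) ----> x + 0 *. y" by (intro tendsto_intros c)
 then have "(%n. x + c n *. y) ----> x" by simp
 moreover have "isCont f x" using f(2) by (simp add: continuous_on_eq_continuous_at)
 ultimately have "(%n. f (x + c n *. y)) ----> f x" by (intro isCont_tendsto_compose[of x f])
 then show "(%n. of_real (gauss y) * f (x + c n *. y)) ----> of_real (gauss y) * f x"
 by (intro tendsto_mult tendsto_const)
 qed
 show "AE y in lborel. norm (of_real (gauss y) * f (x + c n *. y)) <= B * gauss y" for n
 using f(3) by (auto intro!: AE_I2 mult_left_mono simp: norm_mult mult.commute[of B])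
 qed auto
 then have 2: "(%n. gconv (c n) f x) ----> f x" by simp
 show ?thesis by (rule LIMSEQ_unique[OF 1 2])
qed

subsection \<open>Test functions\<close>

text \<open>Smoothness is coinductive: it is enough to exhibit a set of differentiable functions
  closed under partial derivatives, which spares all formulas for iterated derivatives.\<close>

lemma smooth_funI:
 assumes "f \<in> S" and "!!g x. g \<in> S ==> g differentiable (at x)"
 and "!!g b. g \<in> S ==> b \<in> Basis ==> partial_deriv b g \<in> S"
 shows "smooth_fun f"
proof -
 have "set bs \<subseteq> Basis ==> foldr partial_deriv bs f \<in> S" for bs
 by (induction bs) (auto intro: assms)
 then show ?thesis unfolding smooth_fun_def using assms(2) by blast
qed

lemma smooth_fun_differentiable: "smooth_fun f ==> f differentiable (at x)"
 unfolding smooth_fun_def by (elim allE[of _ "[]"]) simp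

lemma smooth_fun_partial_deriv:
 assumes "smooth_fun f" "b \<in> Basis" shows "smooth_fun (partial_deriv b f)"
 unfolding smooth_fun_def
proof (intro allI impI)
 fix bs x assume "set bs \<subseteq> (Basis :: 'a set)"
 with assms have "foldr partial_deriv (bs @ [b]) f differentiable (at x)"
 unfolding smooth_fun_def by (intro assms(1)[unfolded smooth_fun_def, rule_format]) auto
 then show "foldr partial_deriv bs (partial_deriv b f) differentiable (at x)" by simp
qed

lemma partial_deriv_eq: "(f has_derivative D) (at x) ==> partial_deriv b f x = D b"
 unfolding partial_deriv_def using frechet_derivative_at by metis

lemma has_derivative_partial:
 assumes "f differentiable (at x)"
 shows "(f has_derivative (%h. \<Sum>b\<in>Basis. of_real (h \<bullet> b) * partial_deriv b f x)) (at x)"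
proof -
 have d: "(f has_derivative frechet_derivative f (at x)) (at x)"
 using assms by (simp add: frechet_derivative_works)
 have l: "linear (frechet_derivative f (at x))"
 using d by (rule has_derivative_linear)
 have "frechet_derivative f (at x) h = (\<Sum>b\<in>Basis. of_real (h \<bullet> b) * partial_deriv b f x)" for h
 proof -
 have "frechet_derivative f (at x) h = frechet_derivative f (at x) (\<Sum>b\<in>Basis. (h \<bullet> b) *. b)"
 by (simp add: euclidean_representation)
 also have "... = (\<Sum>b\<in>Basis. (h \<bullet> b) *. frechet_derivative f (at x) b)"
 using l by (simp add: linear_sum linear_scale)
 finally show ?thesis by (simp add: partial_deriv_def scaleR_conv_of_real)
 qed
 then show ?thesis using d by presburger
qed

lemma partial_deriv_add:
 assumes "f differentiable (at x)" "g differentiable (at x)"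
 shows "partial_deriv b (%x. f x + g x) x = partial_deriv b f x + partial_deriv b g x"
proof -
 have "(f has_derivative frechet_derivative f (at x)) (at x)" "(g has_derivative frechet_derivative g (at x)) (at x)"
 using assms by (simp_all add: frechet_derivative_works)
 from has_derivative_add[OF this] show ?thesis
 by (subst partial_deriv_eq) (auto simp: partial_deriv_def)
qed

lemma partial_deriv_mult:
 assumes "f differentiable (at x)" "g differentiable (at x)"
 shows "partial_deriv b (%x. f x * g x) x = f x * partial_deriv b g x + partial_deriv b f x * g x"
proof -
 have "(f has_derivative frechet_derivative f (at x)) (at x)" "(g has_derivative frechet_derivative g (at x)) (at x)"
 using assms by (simp_all add: frechet_derivative_works)
 from has_derivative_mult[OF this] show ?thesis
 by (subst partial_deriv_eq) (auto simp: partial_deriv_def)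
qed

lemma smooth_fun_const[simp]: "smooth_fun (%_. c)"
proof (rule smooth_funI[of _ "{f. \<exists>c. f = (%_. c)}"], goal_cases)
 case (3 g b)
 then obtain c where "g = (%_. c)" by auto
 then have "partial_deriv b g = (%_. 0)" by (auto intro!: partial_deriv_eq derivative_eq_intros)
 then show ?case by auto
qed auto

lemma smooth_fun_add:
 assumes "smooth_fun f" "smooth_fun g" shows "smooth_fun (%x. f x + g x)"
proof (rule smooth_funI[of _ "{%x. f x + g x | f g. smooth_fun f \<and> smooth_fun g}"], goal_cases)
 case (2 g x) then show ?case by (auto simp: smooth_fun_differentiable)
next
 case (3 h b)
 then obtain f g where "h = (%x. f x + g x)" and fg: "smooth_fun f" "smooth_fun g" by auto
 then have "partial_deriv b h = (%x. partial_deriv b f x + partial_deriv b g x)"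
 by (auto intro: partial_deriv_add smooth_fun_differentiable)
 then show ?case using fg 3 by (auto intro: smooth_fun_partial_deriv)
qed (use assms in auto)

text \<open>The class for products: the product rule turns a product into a sum of products, so sums
  are included from the start.\<close>

inductive_set smooth_products :: "('a::euclidean_space => complex) set" where
 mult: "smooth_fun f ==> smooth_fun g ==> (%x. f x * g x) \<in> smooth_products"
| add: "f \<in> smooth_products ==> g \<in> smooth_products ==> (%x. f x + g x) \<in> smooth_products"

lemma smooth_fun_mult:
 assumes "smooth_fun f" "smooth_fun g" shows "smooth_fun (%x. f x * g x)"
proof (rule smooth_funI[of _ smooth_products])
 show d: "f differentiable (at x)" if "f \<in> smooth_products" for f :: "'a => complex" and x
 using that by induction (simp_all add: smooth_fun_differentiable)
 show "partial_deriv b f \<in> smooth_products" if "f \<in> smooth_products" "b \<in> Basis" for f :: "'a => complex" and b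
 using that(1)
 proof induction
 case (mult f g)
 then have "partial_deriv b (%x. f x * g x) = (%x. f x * partial_deriv b g x + partial_deriv b f x * g x)"
 by (auto intro: partial_deriv_mult smooth_fun_differentiable)
 then show ?case
 using mult that(2) by (auto intro!: smooth_products.intros smooth_fun_partial_deriv)
 next
 case (add f g)
 then have "partial_deriv b (%x. f x + g x) = (%x. partial_deriv b f x + partial_deriv b g x)"
 by (auto intro: partial_deriv_add d)
 then show ?case using add by (auto intro: smooth_products.intros)
 qed
qed (use assms in \<open>auto intro: smooth_products.intros\<close>)

lemma smooth_fun_inner: "smooth_fun (%x. of_real (x \<bullet> c))"
proof (rule smooth_funI[of _ "insert (%x. of_real (x \<bullet> c)) {f. \<exists>c. f = (%_. c)}"], goal_cases)
 case (2 g x)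
 have "((%x. complex_of_real (x \<bullet> c)) has_derivative (%h. of_real (h \<bullet> c))) (at x)"
 by (auto intro!: derivative_eq_intros)
 then have "(%x. complex_of_real (x \<bullet> c)) differentiable (at x)" by (rule differentiableI)
 with 2 show ?case by auto
next
 case (3 g b)
 have "partial_deriv b (%x. complex_of_real (x \<bullet> c)) = (%_. of_real (b \<bullet> c))"
 by (rule ext, rule partial_deriv_eq) (auto intro!: derivative_eq_intros)
 moreover have "partial_deriv b (%_. c) = (%_. 0)" for c
 by (auto intro!: partial_deriv_eq derivative_eq_intros)
 ultimately show ?case using 3 by auto
qed simp

lemma smooth_fun_continuous: "smooth_fun f ==> continuous_on UNIV f"
 by (meson continuous_at_imp_continuous_on differentiable_imp_continuous_within smooth_fun_differentiable)

lemma smooth_fun_measurable: "smooth_fun f ==> f \<in> bmeas"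
 by (intro borel_measurable_continuous_onI smooth_fun_continuous)

lemma partial_deriv_inv_fourier:
 assumes "rapid f"
 shows "partial_deriv b (inv_fourier f) = inv_fourier (%xi. (2 * of_real pi * \<i>) * (of_real (xi \<bullet> b) * f xi))"
 and "inv_fourier f differentiable (at x)"
proof -
 have "integ (%xi. norm xi * cmod (f xi))"
 using rapid_integrable[OF rapid_powr_mult[OF assms, of 1], THEN integrable_norm] by (simp add: norm_mult)
 note d = inv_fourier_has_derivative[OF rapid_integrable[OF assms] this]
 show "inv_fourier f differentiable (at x)" using d by (auto simp: differentiable_def)
 show "partial_deriv b (inv_fourier f) = inv_fourier (%xi. (2 * of_real pi * \<i>) * (of_real (xi \<bullet> b) * f xi))"
 by (rule ext, subst partial_deriv_eq[OF d]) (simp add: inner_commute mult.assoc)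
qed

lemma smooth_fun_inv_fourier:
 assumes "rapid f" shows "smooth_fun (inv_fourier f)"
 by (rule smooth_funI[of _ "{inv_fourier f | f. rapid f}"])
 (use assms in \<open>auto simp: partial_deriv_inv_fourier intro!: rapid_cmult rapid_inner_mult\<close>)

section \<open>A smooth bump function and the algebra of test functions\<close>

text \<open>The functions q^(-k) exp(-1/q), extended by 0 to q <= 0. All \<open>k\<close> are
  carried along because the derivative of one is a combination of those with \<open>k + 1\<close>
  and \<open>k + 2\<close>.\<close>

definition flat :: "nat => real => real" where
 "flat k q = (if q > 0 then (1 / q) ^ k * exp (- (1 / q)) else 0)"

lemma flat_nonneg[simp]: "flat k q >= 0" by (simp add: flat_def)

text \<open>Flatness at 0 to every order \<open>j\<close>, from \<open>power_le_fact_exp\<close> at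
  1 / q. The case \<open>j = 2\<close> gives the derivative at 0.\<close>

lemma flat_bound: "flat k q <= fact (k + j) * \<bar>q\<bar> ^ j"
proof (cases "q > 0")
 case True
 have "flat k q = (1 / q) ^ (k + j) * exp (- (1 / q)) * q ^ j"
 using True by (simp add: flat_def power_add power_divide)
 also have "... <= (fact (k + j) * exp (1 / q)) * exp (- (1 / q)) * q ^ j"
 using True by (intro mult_right_mono power_le_fact_exp) auto
 also have "... = fact (k + j) * q ^ j"
 by (simp add: mult.assoc flip: exp_add)
 finally show ?thesis using True by simp
qed (simp add: flat_def)

lemma flat_has_real_derivative:
 "(flat k has_real_derivative (flat (k + 2) q - real k * flat (k + 1) q)) (at q)"
proof -
 consider "q > 0" | "q < 0" | "q = 0" by linarith
 then show ?thesis
 proof cases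
 case 1
 have e: "\<forall>\<^sub>F x in nhds q. flat k x = inverse x ^ k * exp (- inverse x)"
 using eventually_nhds_in_open[of "{0<..}" q] 1 by (auto elim!: eventually_mono simp: flat_def divide_inverse)
 have "((%x. inverse x ^ k * exp (- inverse x)) has_real_derivative (flat (k + 2) q - real k * flat (k + 1) q)) (at q)"
 proof -
 have d1: "((%x. inverse x ^ k) has_real_derivative - (real k * inverse q ^ (k + 1))) (at q)"
 proof (cases k)
 case (Suc j)
 then show ?thesis
 using 1 by (intro DERIV_cong[OF DERIV_power[OF DERIV_inverse]]) (auto simp: power2_eq_square)
 qed simp
 have d2: "((%x. exp (- inverse x)) has_real_derivative inverse q ^ 2 * exp (- inverse q)) (at q)"
 using 1 by (auto intro!: derivative_eq_intros simp: power2_eq_square)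
 show ?thesis
 using 1 by (intro DERIV_cong[OF DERIV_mult[OF d1 d2]])
 (auto simp: flat_def divide_inverse power_add power2_eq_square algebra_simps)
 qed
 then show ?thesis by (subst DERIV_cong_ev[OF refl e refl])
 next
 case 2
 have e: "\<forall>\<^sub>F x in nhds q. flat k x = 0"
 using eventually_nhds_in_open[of "{..<0}" q] 2 by (auto elim!: eventually_mono simp: flat_def)
 show ?thesis using 2 by (subst DERIV_cong_ev[OF refl e refl]) (simp add: flat_def)
 next
 case 3
 have "((%h. (flat k (0 + h) - flat k 0) / h) \<longlongrightarrow> 0) (at 0)"
 proof (rule Lim_null_comparison)
 show "\<forall>\<^sub>F h in at 0. norm ((flat k (0 + h) - flat k 0) / h) <= fact (k + 2) * \<bar>h\<bar>"
 proof (rule eventually_at_filter[THEN iffD2, OF always_eventually], intro allI impI)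
 fix h :: real assume "h ~= 0"
 have "flat k h <= fact (k + 2) * \<bar>h\<bar> * \<bar>h\<bar>"
 using flat_bound[of k h 2] by (simp add: power2_eq_square mult.assoc)
 then show "norm ((flat k (0 + h) - flat k 0) / h) <= fact (k + 2) * \<bar>h\<bar>"
 using \<open>h ~= 0\<close> by (simp add: flat_def[of k 0] pos_divide_le_eq abs_mult)
 qed
 have "((%h::real. fact (k + 2) * \<bar>h\<bar>) \<longlongrightarrow> fact (k + 2) * \<bar>0\<bar>) (at 0)"
 by (intro tendsto_intros)
 then show "((%h::real. fact (k + 2) * \<bar>h\<bar>) \<longlongrightarrow> 0) (at 0)" by simp
 qed
 then show ?thesis using 3 by (simp add: DERIV_def flat_def)
 qed
qed

text \<open>The factor \<open>exp 1\<close> makes the value at the origin 1. This value reappears as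
  the mass of the mollifying kernel \<open>fourier (cutoff 1)\<close>.\<close>

definition cutoff :: "real => 'a::euclidean_space => complex" where
 "cutoff m x = of_real (exp 1 * flat 0 (1 - (x \<bullet> x) / m\<^sup>2))"

lemma flat_norm_has_derivative:
 "((%x::'a::euclidean_space. complex_of_real (flat k (1 - (x \<bullet> x) / m\<^sup>2))) has_derivative
 (%h. of_real ((flat (k + 2) (1 - (x \<bullet> x) / m\<^sup>2) - real k * flat (k + 1) (1 - (x \<bullet> x) / m\<^sup>2)) * (- 2 * (x \<bullet> h) / m\<^sup>2)))) (at x)"
proof -
 have "((%x::'a. 1 - (x \<bullet> x) / m\<^sup>2) has_derivative (%h. - 2 * (x \<bullet> h) / m\<^sup>2)) (at x)"
 unfolding divide_inverse
 by (auto intro!: derivative_eq_intros simp: inner_commute algebra_simps)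
 from has_derivative_of_real[OF has_derivative_compose[OF this flat_has_real_derivative[unfolded has_field_derivative_def]]]
 show ?thesis by (rule has_derivative_eq_rhs) simp
qed

text \<open>The same device as for products: smooth multiples of the flat functions of 1 - |x|^2 /
  m^2, and sums of these, form a class closed under partial derivatives.\<close>

inductive_set smooth_bumps :: "real => ('a::euclidean_space => complex) set" for m where
 mult: "smooth_fun f ==> (%x. of_real (flat k (1 - (x \<bullet> x) / m\<^sup>2)) * f x) \<in> smooth_bumps m"
| add: "f \<in> smooth_bumps m ==> g \<in> smooth_bumps m ==> (%x. f x + g x) \<in> smooth_bumps m"

lemma smooth_fun_flat: "smooth_fun (%x::'a::euclidean_space. of_real (flat k (1 - (x \<bullet> x) / m\<^sup>2)))"
proof (rule smooth_funI[of _ "smooth_bumps m"])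
 have dk: "(%x. complex_of_real (flat k (1 - (x \<bullet> x) / m\<^sup>2))) differentiable (at x)" for k and x :: 'a
 using flat_norm_has_derivative[of k m x] by (auto simp: differentiable_def)
 show d: "f differentiable (at x)" if "f \<in> smooth_bumps m" for f :: "'a => complex" and x
 using that by induction (simp_all add: smooth_fun_differentiable dk)
 show "partial_deriv b f \<in> smooth_bumps m" if "f \<in> smooth_bumps m" "b \<in> Basis" for f :: "'a => complex" and b
 using that(1)
 proof induction
 case (mult f k)
 have "partial_deriv b (%x. of_real (flat k (1 - (x \<bullet> x) / m\<^sup>2)) * f x) = (%x.
 (of_real (flat k (1 - (x \<bullet> x) / m\<^sup>2)) * partial_deriv b f x
 + of_real (flat (k + 2) (1 - (x \<bullet> x) / m\<^sup>2)) * (of_real (- 2 / m\<^sup>2) * of_real (x \<bullet> b) * f x))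
 + of_real (flat (k + 1) (1 - (x \<bullet> x) / m\<^sup>2)) * (of_real (2 * real k / m\<^sup>2) * of_real (x \<bullet> b) * f x))"
 using mult
 by (intro ext, subst partial_deriv_mult)
 (auto intro: dk smooth_fun_differentiable simp: partial_deriv_eq[OF flat_norm_has_derivative] algebra_simps add_divide_distrib diff_divide_distrib)
 then show ?case
 by (elim ssubst) (use mult that(2) in
 \<open>intro smooth_bumps.intros smooth_fun_partial_deriv smooth_fun_mult smooth_fun_const smooth_fun_inner\<close>)
 next
 case (add f g)
 then have "partial_deriv b (%x. f x + g x) = (%x. partial_deriv b f x + partial_deriv b g x)"
 by (auto intro: partial_deriv_add d)
 then show ?case using add by (auto intro: smooth_bumps.intros)
 qed
 show "(%x::'a. of_real (flat k (1 - (x \<bullet> x) / m\<^sup>2))) \<in> smooth_bumps m"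
 using smooth_bumps.mult[of "%_. 1" k m] by simp
qed

lemma compact_closure_subset:
 fixes A :: "'a::heine_borel set"
 shows
 "compact (closure A) ==> B \<subseteq> closure A ==> compact (closure B)"
 unfolding compact_closure by (meson bounded_closure bounded_subset)

lemma test_funD: "test_fun f ==> smooth_fun f" "test_fun f ==> compact (closure {x. f x ~= 0})"
 by (auto simp: test_fun_def)

lemma test_fun_mult:
 assumes "test_fun f" "smooth_fun g" shows "test_fun (%x. g x * f x)"
proof -
 have "{x. g x * f x ~= 0} \<subseteq> closure {x. f x ~= 0}"
 by (rule order_trans[OF _ closure_subset]) auto
 with compact_closure_subset[OF test_funD(2)[OF assms(1)] this] smooth_fun_mult[OF assms(2) test_funD(1)[OF assms(1)]]
 show ?thesis by (simp only: test_fun_def)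
qed

lemma test_fun_add:
 assumes "test_fun f" "test_fun g" shows "test_fun (%x. f x + g x)"
proof -
 have "compact (closure ({x. f x ~= 0} \<union> {x. g x ~= 0}))"
 using assms by (simp add: test_fun_def compact_Un)
 then have "compact (closure {x. f x + g x ~= 0})"
 by (rule compact_closure_subset) (rule order_trans[OF _ closure_subset], auto)
 then show ?thesis using assms by (simp add: test_fun_def smooth_fun_add)
qed

lemma test_fun_cmult: "test_fun f ==> test_fun (%x. c * f x)"
 by (intro test_fun_mult smooth_fun_const)

lemma test_fun_diff:
 assumes "test_fun f" "test_fun g" shows "test_fun (%x. f x - g x)"
 using test_fun_add[OF assms(1) test_fun_cmult[OF assms(2), of "-1"]] by simp

lemma test_fun_partial_deriv:
 assumes f: "test_fun f" and b: "b \<in> Basis" shows "test_fun (partial_deriv b f)"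
proof -
 have "{x. partial_deriv b f x ~= 0} \<subseteq> closure {x. f x ~= 0}"
 proof (rule ccontr)
 assume "\<not> {x. partial_deriv b f x ~= 0} \<subseteq> closure {x. f x ~= 0}"
 then obtain x where x: "partial_deriv b f x ~= 0" "x \<in> - closure {x. f x ~= 0}" by auto
 have z: "!!y. y \<in> - closure {x. f x ~= 0} ==> 0 = f y"
 using closure_subset[of "{x. f x ~= 0}"] by auto
 have "(f has_derivative (%h. 0)) (at x)"
 by (rule has_derivative_transform_within_open[OF _ _ x(2) z]) auto
 from partial_deriv_eq[OF this] x(1) show False by simp
 qed
 from compact_closure_subset[OF test_funD(2)[OF f] this] smooth_fun_partial_deriv[OF test_funD(1)[OF f] b]
 show ?thesis by (simp only: test_fun_def)
qed

lemma test_fun_cutoff_mult: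
 assumes f: "smooth_fun f" and m: "m > 0"
 shows "test_fun (%x. cutoff m x * f x)"
proof -
 have "smooth_fun (%x. cutoff m x * f x)"
 using smooth_fun_mult[OF smooth_fun_mult[OF smooth_fun_const[of "of_real (exp 1)"] smooth_fun_flat[of 0 m]] f]
 by (simp add: cutoff_def[abs_def])
 moreover have "{x. cutoff m x * f x ~= 0} \<subseteq> cball 0 m"
 proof safe
 fix x :: 'a assume "cutoff m x * f x ~= 0"
 then have "1 - (x \<bullet> x) / m\<^sup>2 > 0" by (auto simp: cutoff_def flat_def split: if_splits)
 then have "(norm x)\<^sup>2 <= m\<^sup>2" using m by (simp add: power2_norm_eq_inner field_simps)
 then show "x \<in> cball 0 m" using m by (simp add: power_mono_iff)
 qed
 then have "compact (closure {x. cutoff m x * f x ~= 0})"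
 by (meson bounded_cball bounded_subset compact_closure)
 ultimately show ?thesis by (simp add: test_fun_def)
qed

lemma test_fun_rapid:
 assumes f: "test_fun f" shows "rapid f"
 unfolding rapid_def
proof safe
 show "f \<in> bmeas" using f by (simp add: test_fun_def smooth_fun_measurable)
 fix k
 let ?K = "closure {x. f x ~= 0}"
 have "continuous_on ?K (%x. cmod (f x) * (1 + norm x) ^ k)"
 using f by (intro continuous_intros continuous_on_subset[OF smooth_fun_continuous]) (auto simp: test_fun_def)
 then have "bounded ((%x. cmod (f x) * (1 + norm x) ^ k) ` ?K)"
 using f by (intro compact_imp_bounded compact_continuous_image) (auto simp: test_fun_def)
 then obtain C where C: "!!x. x \<in> ?K ==> norm (cmod (f x) * (1 + norm x) ^ k) <= C"
 unfolding bounded_iff by auto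
 have "cmod (f x) * (1 + norm x) ^ k <= max C 0" for x
 proof (cases "f x = 0")
 case False
 then have "x \<in> ?K" using closure_subset[of "{x. f x ~= 0}"] by auto
 from C[OF this] show ?thesis by (simp add: le_max_iff_disj)
 qed simp
 then show "\<exists>C. \<forall>x. cmod (f x) * (1 + norm x) ^ k <= C" by blast
qed

lemma fourier_partial_deriv:
 assumes f: "test_fun f" and b: "b \<in> Basis"
 shows "fourier (partial_deriv b f) xi = 2 * of_real pi * \<i> * of_real (xi \<bullet> b) * fourier f xi"
proof -
 let ?D = "%x h. f x * (2 * of_real pi * \<i> * of_real (h \<bullet> - xi) * chr (x \<bullet> - xi))
 + (\<Sum>b\<in>Basis. of_real (h \<bullet> b) * partial_deriv b f x) * chr (x \<bullet> - xi)"
 have rf: "rapid f" and rp: "rapid (partial_deriv b f)"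
 using f b by (auto intro: test_fun_rapid test_fun_partial_deriv)
 have der: "((%x. f x * chr (x \<bullet> - xi)) has_derivative ?D x) (at x)" for x
 using f by (intro has_derivative_mult has_derivative_partial chr_has_derivative) (auto intro: smooth_fun_differentiable test_funD)
 have D: "?D x b = (- 2 * of_real pi * \<i> * of_real (xi \<bullet> b)) * (f x * chr (- (x \<bullet> xi))) + partial_deriv b f x * chr (- (x \<bullet> xi))" for x
 using b by (simp add: inner_Basis inner_commute if_distrib[of of_real] if_distrib[of "%t. t * _"] sum.delta cong: if_cong)
 have eq: "?D x b = chr (- (x \<bullet> xi)) * ((- 2 * of_real pi * \<i> * of_real (xi \<bullet> b)) * f x + partial_deriv b f x)" for x
 unfolding D by (simp add: algebra_simps)
 have rap: "rapid (%x. ?D x b)"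
 unfolding eq by (intro rapid_mult_bounded[where C=1] rapid_add rapid_cmult rf rp) auto
 have i1: "integ (%x. f x * chr (- (x \<bullet> xi)))" "integ (%x. partial_deriv b f x * chr (- (x \<bullet> xi)))"
 using integrable_mult_chr[OF rapid_integrable[OF rf], of "- xi"] integrable_mult_chr[OF rapid_integrable[OF rp], of "- xi"]
 by (simp_all add: inner_commute)
 then have "integ (%x. f x * chr (x \<bullet> - xi))" by simp
 from integral_directional_derivative_eq_0[OF this der rap b]
 have "0 = (LI x. (- 2 * of_real pi * \<i> * of_real (xi \<bullet> b)) * (f x * chr (- (x \<bullet> xi))) + partial_deriv b f x * chr (- (x \<bullet> xi)))"
 unfolding D by simp
 also have "... = (- 2 * of_real pi * \<i> * of_real (xi \<bullet> b)) * fourier f xi + fourier (partial_deriv b f) xi"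
 unfolding fourier_eq using i1 by (subst Bochner_Integration.integral_add) auto
 finally show ?thesis by (simp add: algebra_simps eq_neg_iff_add_eq_0)
qed

text \<open>If \<open>?M\<close> is the maximum of 1 and the moduli of the coordinates, then 1 + |x|
  <= (1 + N) \<open>?M\<close>. Powers of single coordinates are what partial derivatives produce
  under the Fourier transform.\<close>

lemma rapidI_coordinates:
 fixes g :: "'a::euclidean_space => complex"
 assumes [measurable]: "g \<in> bmeas"
 and "!!k b. b \<in> Basis ==> \<exists>C. \<forall>x. \<bar>x \<bullet> b\<bar> ^ k * cmod (g x) <= C" and "\<exists>C. \<forall>x. cmod (g x) <= C"
 shows "rapid g"
 unfolding rapid_def
proof safe
 fix k :: nat
 let ?N = "DIM('a)"
 from assms(2)[of _ k] obtain C where C: "!!b x. b \<in> Basis ==> \<bar>x \<bullet> b\<bar> ^ k * cmod (g x) <= C b"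
 by metis
 from assms(3) obtain C0 where C0: "!!x. cmod (g x) <= C0" by blast
 have "cmod (g x) * (1 + norm x) ^ k <= real (1 + ?N) ^ k * (C0 + (\<Sum>b\<in>Basis. C b))" for x
 proof -
 let ?M = "Max (insert 1 ((%b. \<bar>x \<bullet> b\<bar>) ` Basis))"
 have M: "1 <= ?M" "!!b. b \<in> Basis ==> \<bar>x \<bullet> b\<bar> <= ?M" by (rule Max_ge; simp)+
 have "norm x <= (\<Sum>b\<in>Basis. \<bar>x \<bullet> b\<bar>)" by (rule norm_le_l1)
 also have "... <= (\<Sum>b\<in>(Basis::'a set). ?M)" using M by (intro sum_mono) auto
 finally have "1 + norm x <= real (1 + ?N) * ?M" using M(1) by (simp add: distrib_right)
 then have "(1 + norm x) ^ k <= (real (1 + ?N) * ?M) ^ k" by (intro power_mono) auto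
 also have "... = real (1 + ?N) ^ k * ?M ^ k" by (rule power_mult_distrib)
 finally have "(1 + norm x) ^ k <= real (1 + ?N) ^ k * ?M ^ k" .
 moreover have "?M ^ k <= 1 + (\<Sum>b\<in>Basis. \<bar>x \<bullet> b\<bar> ^ k)"
 proof -
 have "?M \<in> insert 1 ((%b. \<bar>x \<bullet> b\<bar>) ` Basis)" by (rule Max_in) auto
 then consider "?M = 1" | b where "b \<in> Basis" "?M = \<bar>x \<bullet> b\<bar>" by blast
 then show ?thesis
 proof cases
 case 1 then show ?thesis by (simp add: sum_nonneg)
 next
 case 2
 then show ?thesis
 using member_le_sum[of b Basis "%b. \<bar>x \<bullet> b\<bar> ^ k"] by simp
 qed
 qed
 ultimately have "(1 + norm x) ^ k <= real (1 + ?N) ^ k * (1 + (\<Sum>b\<in>Basis. \<bar>x \<bullet> b\<bar> ^ k))"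
 by (meson mult_left_mono of_nat_0_le_iff order_trans zero_le_power)
 then have "cmod (g x) * (1 + norm x) ^ k <= cmod (g x) * (real (1 + ?N) ^ k * (1 + (\<Sum>b\<in>Basis. \<bar>x \<bullet> b\<bar> ^ k)))"
 by (rule mult_left_mono) simp
 also have "... = real (1 + ?N) ^ k * (cmod (g x) + (\<Sum>b\<in>Basis. \<bar>x \<bullet> b\<bar> ^ k * cmod (g x)))"
 by (simp add: distrib_left sum_distrib_left sum_distrib_right mult_ac)
 also have "... <= real (1 + ?N) ^ k * (C0 + (\<Sum>b\<in>Basis. C b))"
 using C0 C by (intro mult_left_mono add_mono sum_mono) auto
 finally show ?thesis .
 qed
 then show "\<exists>C. \<forall>x. cmod (g x) * (1 + norm x) ^ k <= C" by blast
qed simp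

text \<open>By induction on the power, each factor of a coordinate is traded for a partial
  derivative of the test function.\<close>

lemma fourier_rapid:
 assumes f: "test_fun f" shows "rapid (fourier f)"
proof (rule rapidI_coordinates)
 show "fourier f \<in> bmeas"
 using test_fun_rapid[OF f] by (intro fourier_measurable) (simp add: rapid_def)
 have bd: "\<exists>C. \<forall>xi. cmod (fourier f xi) <= C" if "test_fun f" for f :: "'a => complex"
 using inv_fourier_bound[OF rapid_integrable[OF test_fun_rapid[OF that]]] unfolding fourier_conv_inv_fourier by blast
 then show "\<exists>C. \<forall>xi. cmod (fourier f xi) <= C" using f by blast
 show "\<exists>C. \<forall>x. \<bar>x \<bullet> b\<bar> ^ k * cmod (fourier f x) <= C" if b: "b \<in> Basis" for k b
 using f
 proof (induction k arbitrary: f)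
 case 0 then show ?case using bd by simp
 next
 case (Suc k)
 from Suc.IH[OF test_fun_partial_deriv[OF Suc.prems b]] obtain C
 where C: "!!x. \<bar>x \<bullet> b\<bar> ^ k * cmod (fourier (partial_deriv b f) x) <= C" by blast
 have "\<bar>x \<bullet> b\<bar> ^ Suc k * cmod (fourier f x) <= C / (2 * pi)" for x
 using C[of x] by (simp add: fourier_partial_deriv[OF Suc.prems b] norm_mult pos_le_divide_eq mult_ac)
 then show ?case by blast
 qed
qed

lemma test_fun_inversion:
 assumes f: "test_fun f" shows "inv_fourier (fourier f) = f"
proof
 fix x
 obtain B where "!!x. cmod (f x) <= B" using rapid_bounded[OF test_fun_rapid[OF f]] by blast
 then show "inv_fourier (fourier f) x = f x"
 using f by (intro fourier_inversion rapid_integrable test_fun_rapid fourier_rapid smooth_fun_continuous) (auto dest: test_funD)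
qed

lemma has_derivative_norm_powr:
 fixes xi :: "'a::euclidean_space"
 assumes "xi ~= 0"
 shows "((%xi. norm xi powr p) has_derivative (%h. p * norm xi powr (p - 2) * (xi \<bullet> h))) (at xi)"
proof -
 have n: "norm xi > 0" using assms by simp
 have d: "((%r. r powr p) has_derivative (*) (p * norm xi powr (p - 1))) (at (norm xi))"
 using has_real_derivative_powr[OF n, of p] by (simp add: has_field_derivative_def)
 have "norm xi powr (p - 1) = norm xi powr (p - 2) * norm xi"
 using n powr_add[of "norm xi" "p - 2" 1] by simp
 then show ?thesis
 by (intro has_derivative_eq_rhs[OF has_derivative_compose[OF has_derivative_norm[OF assms] d]])
 (use n in \<open>simp add: fun_eq_iff sgn_div_norm inner_commute field_simps\<close>)
qed

text \<open>The factor \<open>xi \<bullet> b\<close> restores differentiability at the origin, where the profiles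
 \<open>exp (- mu |xi|\<^sup>s / s)\<close> are in general only continuous.\<close>

lemma has_derivative_inner_mult_0:
 fixes ph :: "'a::euclidean_space => complex"
 assumes "(ph \<longlongrightarrow> L) (at 0)"
 shows "((%xi. of_real (xi \<bullet> b) * ph xi) has_derivative (%h. of_real (h \<bullet> b) * L)) (at 0)"
 unfolding has_derivative_iff_norm
proof
 show "bounded_linear (%h. complex_of_real (h \<bullet> b) * L)"
 by (intro bounded_linear_mult_const bounded_linear_compose[OF bounded_linear_of_real] bounded_linear_inner_left)
 have lim: "((%xi. norm b * cmod (ph xi - L)) \<longlongrightarrow> 0) (at 0)"
 using tendsto_mult_left[OF tendsto_norm[OF LIM_zero[OF assms]], of "norm b"] by simp
 show "((%xi. cmod (of_real (xi \<bullet> b) * ph xi - of_real (0 \<bullet> b) * ph 0 - of_real ((xi - 0) \<bullet> b) * L) / norm (xi - 0)) \<longlongrightarrow> 0) (at 0)"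
 proof (rule Lim_null_comparison[OF _ lim])
 show "\<forall>\<^sub>F xi in at 0. norm (cmod (of_real (xi \<bullet> b) * ph xi - of_real (0 \<bullet> b) * ph 0 - of_real ((xi - 0) \<bullet> b) * L) / norm (xi - 0)) <= norm b * cmod (ph xi - L)"
 proof (rule eventually_at_filter[THEN iffD2, OF always_eventually], intro allI impI)
 fix xi :: 'a assume "xi ~= 0"
 have "cmod (of_real (xi \<bullet> b) * ph xi - of_real (xi \<bullet> b) * L) = \<bar>xi \<bullet> b\<bar> * cmod (ph xi - L)"
 by (simp add: norm_mult flip: right_diff_distrib)
 also have "... <= (norm xi * norm b) * cmod (ph xi - L)"
 by (intro mult_right_mono Cauchy_Schwarz_ineq2) simp
 finally show "norm (cmod (of_real (xi \<bullet> b) * ph xi - of_real (0 \<bullet> b) * ph 0 - of_real ((xi - 0) \<bullet> b) * L) / norm (xi - 0)) <= norm b * cmod (ph xi - L)"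
 using \<open>xi ~= 0\<close> by (simp add: pos_divide_le_eq mult_ac)
 qed
 qed
qed

lemma rapid_eq_off_0:
 assumes "rapid f" and [measurable]: "g \<in> bmeas" and "!!xi. xi ~= 0 ==> g xi = f xi"
 shows "rapid g"
 unfolding rapid_def
proof safe
 fix k
 obtain C where C: "!!x. cmod (f x) * (1 + norm x) ^ k <= C"
 using assms(1) unfolding rapid_def by blast
 have "cmod (g x) * (1 + norm x) ^ k <= max C (cmod (g 0))" for x
 using C[of x] assms(3)[of x] by (cases "x = 0") (auto simp: le_max_iff_disj)
 then show "\<exists>C. \<forall>x. cmod (g x) * (1 + norm x) ^ k <= C" by blast
qed simp

subsection \<open>Functions smooth off the origin\<close>

text \<open>\<open>nice z D\<close>: the common regularity of Fourier transforms of test functions and of the extremal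
 profiles; \<open>D\<close> is the derivative of \<open>z\<close> off the origin and arbitrary at the origin.\<close>

definition nice :: "('a::euclidean_space => complex) => ('a => 'a => complex) => bool" where
 "nice z D \<longleftrightarrow> continuous_on UNIV z \<and> rapid z \<and> (\<forall>xi. xi ~= 0 \<longrightarrow> (z has_derivative D xi) (at xi)) \<and>
 (\<forall>b\<in>Basis. (%xi. D xi b) \<in> bmeas \<and> rapid (%xi. of_real (norm xi) * D xi b))"

text \<open>The operator \<open>R\<close> of the overview, in coordinates rather than as
  \<open>D xi xi\<close>: this gives 0 at the origin, where \<open>D\<close> is arbitrary and
  possibly nonlinear.\<close>

definition eul :: "('a::euclidean_space => 'a => complex) => 'a => complex" where
 "eul D xi = (\<Sum>b\<in>Basis. of_real (xi \<bullet> b) * D xi b)"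

lemma niceD:
 assumes "nice z D"
 shows "continuous_on UNIV z" "rapid z" "z \<in> bmeas"
 "xi ~= 0 ==> (z has_derivative D xi) (at xi)"
 "b \<in> Basis ==> (%xi. D xi b) \<in> bmeas"
 "b \<in> Basis ==> rapid (%xi. of_real (norm xi) * D xi b)"
 using assms by (auto simp: nice_def rapid_def)

lemma nice_linear: assumes "nice z D" "xi ~= 0" shows "linear (D xi)"
 using niceD(4)[OF assms] by (rule has_derivative_linear)

lemma nice_D_eq:
 assumes "nice z D" "xi ~= 0"
 shows "D xi h = (\<Sum>b\<in>Basis. of_real (h \<bullet> b) * D xi b)"
proof -
 have "D xi h = D xi (\<Sum>b\<in>Basis. (h \<bullet> b) *. b)" by (simp add: euclidean_representation)
 also have "... = (\<Sum>b\<in>Basis. (h \<bullet> b) *. D xi b)"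
 using nice_linear[OF assms] by (simp add: linear_sum linear_scale)
 finally show ?thesis by (simp add: scaleR_conv_of_real)
qed

lemma eul_eq: "nice z D ==> xi ~= 0 ==> eul D xi = D xi xi"
 unfolding eul_def by (rule nice_D_eq[symmetric])

lemma eul_0[simp]: "eul D 0 = 0" by (simp add: eul_def)

lemma rapid_inner_D:
 assumes "nice z D" "b \<in> Basis"
 shows "rapid (%xi. of_real (xi \<bullet> c) * D xi b)"
proof (rule rapid_dominated[OF niceD(6)[OF assms], where C="norm c" and j=0])
 show "(%xi. of_real (xi \<bullet> c) * D xi b) \<in> bmeas"
 using niceD(5)[OF assms] by measurable
 fix xi
 have "\<bar>xi \<bullet> c\<bar> * cmod (D xi b) <= norm xi * norm c * cmod (D xi b)"
 by (intro mult_right_mono Cauchy_Schwarz_ineq2) simp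
 then show "cmod (of_real (xi \<bullet> c) * D xi b) <= norm c * (1 + norm xi) ^ 0 * cmod (of_real (norm xi) * D xi b)"
 by (simp add: norm_mult mult_ac)
qed

lemma rapid_eul: "nice z D ==> rapid (eul D)"
 unfolding eul_def[abs_def] by (intro rapid_sum rapid_inner_D)

lemma eul_measurable: "nice z D ==> eul D \<in> bmeas"
 using rapid_eul[of z D] by (simp add: rapid_def)

lemma nice_diff:
 assumes "nice z D" "nice y E" shows "nice (%xi. z xi - y xi) (%xi h. D xi h - E xi h)"
 unfolding nice_def
proof (intro conjI ballI allI impI)
 fix b :: 'a assume b: "b \<in> Basis"
 show "rapid (%xi. of_real (norm xi) * (D xi b - E xi b))"
 using rapid_diff[OF niceD(6)[OF assms(1) b] niceD(6)[OF assms(2) b]] by (simp add: right_diff_distrib)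
 show "(%xi. D xi b - E xi b) \<in> bmeas"
 using niceD(5)[OF assms(1) b] niceD(5)[OF assms(2) b] by simp
next
 fix xi :: 'a assume "xi ~= 0"
 then show "((%xi. z xi - y xi) has_derivative (%h. D xi h - E xi h)) (at xi)"
 by (intro has_derivative_diff niceD(4)[OF assms(1)] niceD(4)[OF assms(2)])
qed (use assms in \<open>auto simp: nice_def intro!: continuous_intros rapid_diff\<close>)

lemma nice_cmult:
 assumes "nice z D" shows "nice (%xi. c * z xi) (%xi h. c * D xi h)"
 unfolding nice_def
proof (intro conjI ballI allI impI)
 fix b :: 'a assume b: "b \<in> Basis"
 show "rapid (%xi. of_real (norm xi) * (c * D xi b))"
 using rapid_cmult[OF niceD(6)[OF assms b], of c] by (simp add: mult.left_commute)
 show "(%xi. c * D xi b) \<in> bmeas"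
 using niceD(5)[OF assms b] by simp
next
 fix xi :: 'a assume "xi ~= 0"
 then show "((%xi. c * z xi) has_derivative (%h. c * D xi h)) (at xi)"
 by (intro has_derivative_mult_right niceD(4)[OF assms(1)])
qed (use assms in \<open>auto simp: nice_def intro!: continuous_intros rapid_cmult\<close>)

lemma eul_diff: "eul (%xi h. D xi h - E xi h) xi = eul D xi - eul E xi"
 by (simp add: eul_def right_diff_distrib sum_subtractf)

lemma integrable_powr_norm2:
 assumes "rapid f" "p >= 0" shows "integ (%xi. norm xi powr p * csq (f xi))"
proof -
 have "integ (%xi. Re (of_real (norm xi powr p) * of_real (csq (f xi))))"
 by (intro integrable_Re rapid_integrable rapid_powr_mult rapid_norm2 assms)
 then show ?thesis by (simp del: of_real_power)
qed

lemma rapid_of_real_inner: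
 assumes "rapid f" "rapid g" shows "rapid (%xi. of_real (f xi \<bullet> g xi))"
proof -
 have [measurable]: "f \<in> bmeas" "g \<in> bmeas"
 using assms by (auto simp: rapid_def)
 show ?thesis
 proof (rule rapid_dominated[OF rapid_mult[OF assms], where C=1 and j=0])
 show "cmod (of_real (f x \<bullet> g x)) <= 1 * (1 + norm x) ^ 0 * cmod (f x * g x)" for x
 using Cauchy_Schwarz_ineq2[of "f x" "g x"] by (simp add: norm_mult)
 qed simp
qed

lemma integrable_powr_inner:
 assumes "rapid f" "rapid g" "p >= 0" shows "integ (%xi. norm xi powr p * (f xi \<bullet> g xi))"
proof -
 have "integ (%xi. Re (of_real (norm xi powr p) * of_real (f xi \<bullet> g xi)))"
 by (intro integrable_Re rapid_integrable rapid_powr_mult rapid_of_real_inner assms)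
 then show ?thesis by simp
qed

lemma complex_inner_of_real: "(z :: complex) \<bullet> (of_real a * w) = a * (z \<bullet> w)"
 by (simp flip: scaleR_conv_of_real)

lemma integrable_lborel_scale:
 fixes f :: "'a::euclidean_space => 'b::{banach, second_countable_topology}"
 assumes "integ f" "c ~= 0" shows "integ (%x. f (c *. x))"
proof (rule integrableI_bounded)
 have [measurable]: "f \<in> bmeas" using assms by simp
 show "(%x. f (c *. x)) \<in> borel_measurable lborel" by measurable
 show "(NN x. ennreal (norm (f (c *. x)))) < \<infinity>"
 using assms by (subst nn_integral_lborel_scale[of "%x. ennreal (norm (f x))"]) (auto simp: integrable_iff_bounded ennreal_mult_less_top)
qed

text \<open>The infinitesimal form of the behaviour of Lebesgue measure under dilations.\<close>

lemma euler_ibp: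
 fixes f e :: "'a::euclidean_space => complex"
 assumes f: "integ f" and e: "rapid e"
 and der: "!!xi. xi ~= 0 ==> ((%t. f (t *. xi)) has_vector_derivative e xi) (at 1)"
 shows "(LI xi. e xi) = - of_nat DIM('a) * (LI xi. f xi)"
proof -
 let ?m = "2 * DIM('a)"
 have [measurable]: "f \<in> bmeas" using f by simp
 \<comment> \<open>Dilations are parametrised by \<open>exp \<tau>\<close>, a one-parameter group,
   so the derivative at every \<open>\<tau>\<close> reduces to the assumed one at dilation factor
   1.\<close>
 have der': "((%\<tau>. f (exp \<tau> *. xi)) has_vector_derivative e (exp \<tau> *. xi)) (at \<tau>)" if "xi ~= 0" for xi \<tau>
 proof -
 have "((%\<sigma>. exp (\<sigma> - \<tau>)) has_vector_derivative 1) (at \<tau>)"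
 by (auto intro!: derivative_eq_intros simp: has_real_derivative_iff_has_vector_derivative[symmetric])
 from vector_diff_chain_at[OF this, of "%t. f (t *. (exp \<tau> *. xi))"] der[of "exp \<tau> *. xi"] that
 show ?thesis by (simp add: comp_def mult_exp_exp)
 qed
 obtain C where C: "C >= 0" "!!x. cmod (e x) <= C / (1 + norm x) ^ ?m" using rapid_bound[OF e] by blast
 let ?K = "%xi::'a. C * 3 ^ ?m * (1 / (1 + norm xi) ^ ?m)"
 \<comment> \<open>The factor 3 bounds \<open>exp 1\<close>, and with it every
   \<open>exp (- \<tau>)\<close> for \<tau> in the unit interval around 0.\<close>
 have bd: "cmod (e (exp \<tau> *. xi)) <= ?K xi" if "\<bar>\<tau>\<bar> < 1" for \<tau> xi
 proof -
 have "exp (- \<tau>) <= 3" using that exp_le order_trans[of "exp (- \<tau>)" "exp 1" 3] by simp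
 then have "norm xi <= 3 * (exp \<tau> * norm xi)"
 using mult_right_mono[of "exp (- \<tau>)" 3 "exp \<tau> * norm xi"] by (simp add: mult.assoc[symmetric] mult_exp_exp)
 then have "(1 + norm xi) ^ ?m <= (3 * (1 + norm (exp \<tau> *. xi))) ^ ?m" by (intro power_mono) auto
 from mult_left_mono[OF this C(1)]
 have "C / (1 + norm (exp \<tau> *. xi)) ^ ?m <= ?K xi"
 unfolding power_mult_distrib by (subst pos_divide_le_eq) (auto simp: field_simps add_pos_nonneg intro!: zero_less_power)
 with C(2)[of "exp \<tau> *. xi"] show ?thesis by linarith
 qed
 have scale: "(LI xi. f (exp \<tau> *. xi)) = exp (- (real DIM('a) * \<tau>)) *. (LI xi. f xi)" for \<tau>
 using integral_lborel_affine[of f "exp \<tau>" 0] by (simp add: exp_minus inverse_eq_divide flip: exp_of_nat_mult)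
 have "((%\<tau>. LI xi. f (exp \<tau> *. xi)) has_derivative (%h. LI xi. h *. e xi)) (at 0)"
 proof (rule has_derivative_integral[where K="?K" and d=1])
 show "integ (%xi. f (exp \<tau> *. xi))" for \<tau>
 using integrable_lborel_scale[OF f, of "exp \<tau>"] by simp
 show "integ ?K" using integrable_inverse_power_norm by (rule integrable_mult_right)
 show "integ (%xi. h *. e xi)" for h using rapid_integrable[OF e] by simp
 show "AE xi in lborel. ((%\<tau>. f (exp \<tau> *. xi)) has_derivative (%h. h *. e xi)) (at 0)"
 using AE_lborel_singleton[of 0] by eventually_elim (use der'[of _ 0] in \<open>simp add: has_vector_derivative_def\<close>)
 show "AE xi in lborel. \<forall>\<tau>\<in>ball 0 1. cmod (f (exp \<tau> *. xi) - f (exp 0 *. xi)) <= ?K xi * norm (\<tau> - 0)"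
 using AE_lborel_singleton[of 0]
 proof eventually_elim
 case (elim xi)
 show ?case
 proof
 fix \<tau> :: real assume \<tau>: "\<tau> \<in> ball 0 1"
 show "cmod (f (exp \<tau> *. xi) - f (exp 0 *. xi)) <= ?K xi * norm (\<tau> - 0)"
 proof (rule differentiable_bound[of "ball 0 1" "%\<tau>. f (exp \<tau> *. xi)" "%\<tau> h. h *. e (exp \<tau> *. xi)"])
 fix y :: real assume y: "y \<in> ball 0 1"
 show "((%\<tau>. f (exp \<tau> *. xi)) has_derivative (%h. h *. e (exp y *. xi))) (at y within ball 0 1)"
 using der'[OF elim] by (auto simp: has_vector_derivative_def intro: has_derivative_at_withinI)
 show "onorm (%h. h *. e (exp y *. xi)) <= ?K xi"
 using mult_left_mono[OF bd[of y xi]] y by (intro onorm_le) (simp add: mult.commute dist_real_def)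
 qed (use \<tau> in auto)
 qed
 qed
 show "AE xi in lborel. \<forall>h. norm (h *. e xi) <= ?K xi * norm h"
 using mult_left_mono[OF bd[of 0]] by (auto simp: mult.commute)
 qed simp
 moreover have "((%\<tau>. LI xi. f (exp \<tau> *. xi)) has_derivative (%h. (- (real DIM('a) * h)) *. (LI xi. f xi))) (at 0)"
 unfolding scale by (auto intro!: derivative_eq_intros)
 ultimately have "(%h::real. LI xi. h *. e xi) = (%h. (- (real DIM('a) * h)) *. (LI xi. f xi))"
 by (rule has_derivative_unique)
 from fun_cong[OF this, of 1] show ?thesis by (simp add: scaleR_conv_of_real)
qed

text \<open>\<open>euler_ibp\<close> applied to k(|xi|) |z|^2. The growth conditions are on
  \<open>k r\<close> and \<open>r * k' r\<close>, which admits weights whose derivative is singular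
  at the origin, such as small powers.\<close>

theorem radial_ibp_weight:
 fixes z :: "'a::euclidean_space => complex" and k k' :: "real => real"
 assumes z: "nice z D" and [measurable]: "k \<in> bmeas" "k' \<in> bmeas"
 and der: "!!r. r > 0 ==> (k has_real_derivative k' r) (at r)"
 and bd: "!!r. r >= 0 ==> \<bar>k r\<bar> <= C * (1 + r) ^ j" "!!r. r > 0 ==> \<bar>r * k' r\<bar> <= C * (1 + r) ^ j"
 shows "(LI xi. k (norm xi) * (2 * (z xi \<bullet> eul D xi))) = - (LI xi. (real DIM('a) * k (norm xi) + norm xi * k' (norm xi)) * csq (z xi))"
 and "integ (%xi. k (norm xi) * (2 * (z xi \<bullet> eul D xi)))"
 and "integ (%xi. (real DIM('a) * k (norm xi) + norm xi * k' (norm xi)) * csq (z xi))"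
proof -
 note [measurable] = niceD(3)[OF z] eul_measurable[OF z]
 have C: "0 <= C" using bd(1)[of 0] abs_ge_zero[of "k 0"] by simp
 have bd2: "\<bar>r * k' r\<bar> <= C * (1 + r) ^ j" if "r >= 0" for r
 using bd(2)[of r] that C by (cases "r = 0") auto
 have rap: "rapid (%xi. of_real (m (norm xi)) * f xi)" if "rapid f" "m \<in> bmeas" "!!r. r >= 0 ==> \<bar>m r\<bar> <= C * (1 + r) ^ j"
 for m :: "real => real" and f :: "'a => complex"
 by (rule rapid_dominated[OF that(1), where C=C and j=j])
 (use that rapidD_measurable[OF that(1)] in \<open>auto simp: norm_mult intro!: mult_right_mono\<close>)
 define p where "p xi = complex_of_real (z xi \<bullet> eul D xi)" for xi
 define q where "q xi = complex_of_real (csq (z xi))" for xi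
 have rpq: "rapid p" "rapid q"
 unfolding p_def[abs_def] q_def[abs_def] by (intro rapid_of_real_inner rapid_norm2 niceD(2)[OF z] rapid_eul[OF z])+
 have r3: "rapid (%xi. of_real (norm xi * k' (norm xi)) * q xi)"
 by (rule rap[OF rpq(2) _ bd2]) measurable
 note r = rap[OF rpq(1) assms(2) bd(1)] rap[OF rpq(2) assms(2) bd(1)] r3
 have ri: "integ h" if "integ (%xi. complex_of_real (h xi))" for h :: "'a => real"
 using integrable_Re[OF that] by simp
 show i1: "integ (%xi. k (norm xi) * (2 * (z xi \<bullet> eul D xi)))"
 using rapid_integrable[OF rapid_cmult[OF r(1), of 2]] by (intro ri) (simp add: p_def mult_ac)
 have i2: "integ (%xi. k (norm xi) * csq (z xi))" "integ (%xi. norm xi * k' (norm xi) * csq (z xi))"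
 using rapid_integrable[OF r(2)] rapid_integrable[OF r(3)] by (auto intro!: ri simp: q_def)
 then show i3: "integ (%xi. (real DIM('a) * k (norm xi) + norm xi * k' (norm xi)) * csq (z xi))"
 by (simp add: distrib_right mult.assoc)
 let ?e = "%xi. 2 * (of_real (k (norm xi)) * p xi) + of_real (norm xi * k' (norm xi)) * q xi"
 have "(LI xi. ?e xi) = - of_nat DIM('a) * (LI xi. of_real (k (norm xi)) * q xi)"
 proof (rule euler_ibp)
 show "integ (%xi. of_real (k (norm xi)) * q xi)" by (rule rapid_integrable[OF r(2)])
 show "rapid ?e" by (intro rapid_add rapid_cmult r)
 fix xi :: 'a assume xi: "xi ~= 0"
 have dz: "((%t. z (t *. xi)) has_derivative (%h. h *. eul D xi)) (at 1)"
 proof -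
 have "((%t. t *. xi) has_derivative (%h. h *. xi)) (at 1)" by (auto intro!: derivative_eq_intros)
 from has_derivative_compose[OF this, of z "D xi"] niceD(4)[OF z xi]
 show ?thesis by (simp add: eul_eq[OF z xi] linear_scale[OF nice_linear[OF z xi]])
 qed
 have dk: "((%t. k (\<bar>t\<bar> * norm xi)) has_derivative (%h. h * (norm xi * k' (norm xi)))) (at 1)"
 proof -
 have "(norm has_derivative (%h. h)) (at (1::real))"
 by (rule has_derivative_eq_rhs[OF has_derivative_norm]) auto
 then have "((%t. \<bar>t\<bar> * norm xi) has_derivative (%h. h * norm xi)) (at 1)"
 unfolding real_norm_def[abs_def] by (rule has_derivative_mult_left)
 from has_derivative_compose[OF this, of k "(*) (k' (norm xi))"] der[of "norm xi"] xi
 show ?thesis by (simp add: has_field_derivative_def mult_ac)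
 qed
 have "((%t. k (\<bar>t\<bar> * norm xi) * csq (z (t *. xi))) has_derivative
 (%h. h *. (2 * (k (norm xi) * (z xi \<bullet> eul D xi)) + norm xi * k' (norm xi) * csq (z xi)))) (at 1)"
 unfolding power2_norm_eq_inner
 by (rule has_derivative_eq_rhs[OF has_derivative_mult[OF dk has_derivative_inner[OF dz dz]]])
 (simp add: fun_eq_iff inner_commute[of "eul D xi"] algebra_simps)
 from has_derivative_of_real[OF this]
 show "((%t. of_real (k (norm (t *. xi))) * q (t *. xi)) has_vector_derivative ?e xi) (at 1)"
 by (simp add: has_vector_derivative_def p_def q_def scaleR_conv_of_real)
 qed
 also have "?e = (%xi. complex_of_real (k (norm xi) * (2 * (z xi \<bullet> eul D xi)) + norm xi * k' (norm xi) * csq (z xi)))"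
 by (simp add: fun_eq_iff p_def q_def)
 finally have "complex_of_real (LI xi. k (norm xi) * (2 * (z xi \<bullet> eul D xi)) + norm xi * k' (norm xi) * csq (z xi))
 = complex_of_real (- real DIM('a) * (LI xi. k (norm xi) * csq (z xi)))"
 unfolding q_def of_real_mult[symmetric] integral_complex_of_real by simp
 then have "(LI xi. k (norm xi) * (2 * (z xi \<bullet> eul D xi)) + norm xi * k' (norm xi) * csq (z xi))
 = - real DIM('a) * (LI xi. k (norm xi) * csq (z xi))" unfolding of_real_eq_iff .
 then show "(LI xi. k (norm xi) * (2 * (z xi \<bullet> eul D xi))) = - (LI xi. (real DIM('a) * k (norm xi) + norm xi * k' (norm xi)) * csq (z xi))"
 using i1 i2 by (simp add: distrib_right mult.assoc)
qed

lemma radial_ibp: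
 fixes z :: "'a::euclidean_space => complex"
 assumes z: "nice z D" and p: "p >= 0"
 shows "(LI xi. norm xi powr p * (2 * (z xi \<bullet> eul D xi))) = - (real DIM('a) + p) * (LI xi. norm xi powr p * csq (z xi))"
proof -
 have e: "r * (p * r powr (p - 1)) = p * r powr p" if "r >= 0" for r
 using that by (cases "r = 0") (simp_all add: powr_mult_base mult.left_commute)
 have "(LI xi. norm xi powr p * (2 * (z xi \<bullet> eul D xi))) = - (LI xi. (real DIM('a) * norm xi powr p + norm xi * (p * norm xi powr (p - 1))) * csq (z xi))"
 proof (rule radial_ibp_weight(1)[OF z, where C="1 + p" and j="nat \<lceil>p\<rceil>"])
 show "((%r. r powr p) has_real_derivative p * r powr (p - 1)) (at r)" if "r > 0" for r
 by (rule has_real_derivative_powr[OF that])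
 fix r :: real
 have b: "r powr p <= (1 + r) ^ nat \<lceil>p\<rceil>" if "r >= 0" by (rule one_plus_le_power[OF p that])
 show "\<bar>r powr p\<bar> <= (1 + p) * (1 + r) ^ nat \<lceil>p\<rceil>" if "r >= 0"
 proof -
 have "1 * (1 + r) ^ nat \<lceil>p\<rceil> <= (1 + p) * (1 + r) ^ nat \<lceil>p\<rceil>" using p that by (intro mult_right_mono) auto
 then show ?thesis using b[OF that] by simp
 qed
 show "\<bar>r * (p * r powr (p - 1))\<bar> <= (1 + p) * (1 + r) ^ nat \<lceil>p\<rceil>" if "r > 0"
 unfolding e[OF less_imp_le[OF that]]
 using b p that mult_mono[of p "1 + p" "r powr p" "(1 + r) ^ nat \<lceil>p\<rceil>"] by simp
 qed auto
 also have "... = - (LI xi. (real DIM('a) + p) * (norm xi powr p * csq (z xi)))"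
 by (rule arg_cong[where f=uminus], rule Bochner_Integration.integral_cong) (simp_all add: distrib_right powr_mult_base)
 finally show ?thesis by (simp only: integral_mult_right_zero minus_mult_left)
qed

lemma square_norm_of_real_mult: "csq (of_real a * w) = a\<^sup>2 * csq w"
 by (simp add: norm_mult power_mult_distrib)

lemma integrable_norm2: "rapid f ==> integ (%xi. csq (f xi))"
 using square_intD(2)[OF rapid_square_int] .

lemma integrable_inner: "rapid f ==> rapid g ==> integ (%xi. f xi \<bullet> g xi)"
 using integrable_Re[OF rapid_integrable[OF rapid_of_real_inner]] by fastforce

text \<open>\<open>0 powr 0\<close> is 0, so the weight in the case \<open>p = 0\<close> of
  \<open>radial_ibp\<close> is 1 only off the origin; hence the passage through almost everywhere
  equality.\<close>

lemma radial_ibp_0: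
 fixes z :: "'a::euclidean_space => complex"
 assumes z: "nice z D"
 shows "(LI xi. 2 * (z xi \<bullet> eul D xi)) = - real DIM('a) * (LI xi. csq (z xi))"
proof -
 note [measurable] = niceD(3)[OF z] eul_measurable[OF z]
 have 1: "AE xi in lborel. norm (xi::'a) powr 0 = 1"
 using AE_lborel_singleton[of "0::'a"] by eventually_elim simp
 have "(LI xi. 2 * (z xi \<bullet> eul D xi)) = (LI xi. norm xi powr 0 * (2 * (z xi \<bullet> eul D xi)))"
 proof (rule integral_cong_AE)
 show "AE xi in lborel. 2 * (z xi \<bullet> eul D xi) = norm xi powr 0 * (2 * (z xi \<bullet> eul D xi))"
 using 1 by eventually_elim (simp only: mult_1)
 qed auto
 also have "... = - real DIM('a) * (LI xi. norm xi powr 0 * csq (z xi))"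
 using radial_ibp[OF z, of 0] by simp
 also have "(LI xi. norm xi powr 0 * csq (z xi)) = (LI xi. csq (z xi))"
 proof (rule integral_cong_AE)
 show "AE xi in lborel. norm xi powr 0 * csq (z xi) = csq (z xi)"
 using 1 by eventually_elim (simp only: mult_1)
 qed auto
 finally show ?thesis .
qed

section \<open>The weighted gradient energy on the Fourier side\<close>

text \<open>Multiplication by \<open>x \<bullet> j\<close> becomes a derivative in direction
  \<open>j\<close> of \<open>(xi \<bullet> b) * z\<close>. The factor \<open>xi \<bullet> b\<close>
  makes this product differentiable at the origin too, where \<open>z\<close> itself may fail to be,
  so the origin contributes nothing.\<close>

lemma position_derivative:
 assumes z: "nice z D" and j: "j \<in> Basis" and b: "b \<in> Basis"
 defines "T \<equiv> %xi. of_real (j \<bullet> b) * z xi + of_real (xi \<bullet> b) * D xi j"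
 shows "rapid T" and "of_real (x \<bullet> j) * partial_deriv b (inv_fourier z) x = - inv_fourier T x"
proof -
 note [measurable] = niceD(3)[OF z] niceD(5)[OF z j]
 show T: "rapid T"
 unfolding T_def by (intro rapid_add rapid_cmult rapid_inner_D[OF z j] niceD(2)[OF z])
 have rb: "rapid (%xi. of_real (xi \<bullet> b) * z xi)" by (intro rapid_inner_mult niceD(2)[OF z])
 \<comment> \<open>At the origin the derivative is prescribed by the value of \<open>z\<close>
   there, as in \<open>has_derivative_inner_mult_0\<close>.\<close>
 define DF where "DF xi h = (if xi = 0 then of_real (h \<bullet> b) * (z 0 * chr (x \<bullet> 0)) else
 of_real (xi \<bullet> b) * (z xi * (2 * of_real pi * \<i> * of_real (h \<bullet> x) * chr (xi \<bullet> x)) + D xi h * chr (xi \<bullet> x))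
 + of_real (h \<bullet> b) * (z xi * chr (xi \<bullet> x)))" for xi h
 have der: "((%xi. of_real (xi \<bullet> b) * (z xi * chr (xi \<bullet> x))) has_derivative DF xi) (at xi)" for xi
 proof (cases "xi = 0")
 case True
 have "isCont (%xi. z xi * chr (xi \<bullet> x)) 0"
 using niceD(1)[OF z] has_derivative_continuous[OF chr_has_derivative[of x 0]]
 by (intro continuous_intros) (auto simp: continuous_on_eq_continuous_at)
 then have "((%xi. z xi * chr (xi \<bullet> x)) \<longlongrightarrow> z 0 * chr (x \<bullet> 0)) (at 0)"
 by (simp add: isCont_def)
 from has_derivative_inner_mult_0[OF this] show ?thesis
 using True by (simp add: DF_def[abs_def])
 next
 case False
 have d0: "((%xi. complex_of_real (xi \<bullet> b)) has_derivative (%h. of_real (h \<bullet> b))) (at xi)"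
 by (auto intro!: derivative_eq_intros)
 from has_derivative_mult[OF d0 has_derivative_mult[OF niceD(4)[OF z False] chr_has_derivative]]
 show ?thesis using False by (simp add: DF_def[abs_def])
 qed
 have eq: "DF xi j = T xi * chr (x \<bullet> xi) + (2 * of_real pi * \<i> * of_real (x \<bullet> j)) * ((of_real (xi \<bullet> b) * z xi) * chr (x \<bullet> xi))" for xi
 by (cases "xi = 0") (auto simp: DF_def T_def inner_commute algebra_simps)
 have iF: "integ (%xi. of_real (xi \<bullet> b) * (z xi * chr (xi \<bullet> x)))"
 using integrable_mult_chr[OF rapid_integrable[OF rb], of x] by (simp add: inner_commute mult.assoc)
 have "DF xi j = chr (x \<bullet> xi) * (T xi + (2 * of_real pi * \<i> * of_real (x \<bullet> j)) * (of_real (xi \<bullet> b) * z xi))" for xi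
 unfolding eq by (simp add: algebra_simps)
 then have rD: "rapid (%xi. DF xi j)"
 by (simp only:) (intro rapid_mult_bounded[where C=1] rapid_add rapid_cmult T rb, auto)
 have "0 = (LI xi. DF xi j)"
 using integral_directional_derivative_eq_0[OF iF der rD j] by simp
 also have "... = inv_fourier T x + (2 * of_real pi * \<i> * of_real (x \<bullet> j)) * inv_fourier (%xi. of_real (xi \<bullet> b) * z xi) x"
 unfolding eq inv_fourier_eq
 using integrable_mult_chr[OF rapid_integrable[OF rb], of x] integrable_mult_chr[OF rapid_integrable[OF T], of x]
 by (subst Bochner_Integration.integral_add) auto
 finally show "of_real (x \<bullet> j) * partial_deriv b (inv_fourier z) x = - inv_fourier T x"
 unfolding partial_deriv_inv_fourier(1)[OF niceD(2)[OF z]] inv_fourier_cmult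
 by (simp add: mult_ac eq_neg_iff_add_eq_0 add.commute)
qed

lemma integral_double_sum:
 fixes f :: "'i => 'j => 'm => real"
 assumes "!!j b. j \<in> A ==> b \<in> B ==> integrable M (f j b)"
 shows "(LINT x|M. (\<Sum>j\<in>A. \<Sum>b\<in>B. f j b x)) = (\<Sum>j\<in>A. \<Sum>b\<in>B. LINT x|M. f j b x)"
proof -
 have "(LINT x|M. (\<Sum>j\<in>A. \<Sum>b\<in>B. f j b x)) = (\<Sum>j\<in>A. LINT x|M. (\<Sum>b\<in>B. f j b x))"
 by (rule Bochner_Integration.integral_sum, rule Bochner_Integration.integrable_sum, rule assms)
 also have "... = (\<Sum>j\<in>A. \<Sum>b\<in>B. LINT x|M. f j b x)"
 by (intro sum.cong refl Bochner_Integration.integral_sum assms)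
 finally show ?thesis .
qed

lemma norm_square_add: "(norm (a + b))\<^sup>2 = (norm a)\<^sup>2 + 2 * (a \<bullet> b) + (norm b)\<^sup>2"
 by (simp add: power2_norm_eq_inner inner_add_left inner_add_right inner_commute[of b a])

lemma cmod_square_combination:
 "csq (of_real p * z + of_real q * w) = p\<^sup>2 * csq z + 2 * (p * q * (z \<bullet> w)) + q\<^sup>2 * csq w"
 unfolding scaleR_conv_of_real[symmetric] norm_square_add
 by (simp add: power_mult_distrib)

definition grad2 :: "('a::euclidean_space => 'a => complex) => 'a => real" where
 "grad2 D xi = (\<Sum>b\<in>Basis. csq (D xi b))"

lemma grad2_nonneg[simp]: "grad2 D xi >= 0" by (simp add: grad2_def sum_nonneg)

lemma grad2_measurable: "nice z D ==> grad2 D \<in> bmeas"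
 unfolding grad2_def[abs_def] using niceD(5)[of z D]
 by (intro borel_measurable_sum borel_measurable_power borel_measurable_norm) auto

lemma integrable_grad2:
 assumes "nice z D" shows "integ (%xi. (norm xi)\<^sup>2 * grad2 D xi)"
proof -
 have "integ (%xi. \<Sum>b\<in>Basis. csq (of_real (norm xi) * D xi b))"
 by (intro Bochner_Integration.integrable_sum integrable_norm2 niceD(6)[OF assms])
 then show ?thesis
 by (simp add: grad2_def square_norm_of_real_mult sum_distrib_left)
qed

lemma norm_square_eq_sum: "(norm x)\<^sup>2 = (\<Sum>b\<in>Basis. (x \<bullet> b)\<^sup>2)"
 unfolding power2_norm_eq_inner by (subst euclidean_inner) (simp add: power2_eq_square)

text \<open>Summing Plancherel over all pairs \<open>j\<close>, \<open>b\<close> produces N |z|^2 +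
  2 (z \<bullet> R z) besides the wanted term, and this excess integrates to 0 by
  \<open>radial_ibp_0\<close>. So the weighted gradient energy has the same form on both sides of
  the Fourier transform.\<close>

theorem grad_energy_inv_fourier:
 assumes z: "nice z D"
 shows "grad_energy (inv_fourier z) = (LI xi. (norm xi)\<^sup>2 * grad2 D xi)"
 and "integ (%x. (norm x)\<^sup>2 * (\<Sum>b\<in>Basis. csq (partial_deriv b (inv_fourier z) x)))"
proof -
 let ?T = "%j b xi. of_real (j \<bullet> b) * z xi + of_real (xi \<bullet> b) * D xi j"
 have rT: "rapid (?T j b)" if "j \<in> Basis" "b \<in> Basis" for j b
 using position_derivative(1)[OF z that] .
 note pl = plancherel[OF rapid_integrable[OF rT] rapid_square_int[OF rT]]
 have eq: "(norm x)\<^sup>2 * (\<Sum>b\<in>Basis. csq (partial_deriv b (inv_fourier z) x))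
 = (\<Sum>j\<in>Basis. \<Sum>b\<in>Basis. csq (inv_fourier (?T j b) x))" for x
 proof -
 have "(norm x)\<^sup>2 * (\<Sum>b\<in>Basis. csq (partial_deriv b (inv_fourier z) x))
 = (\<Sum>j\<in>Basis. \<Sum>b\<in>Basis. csq (of_real (x \<bullet> j) * partial_deriv b (inv_fourier z) x))"
 unfolding norm_square_eq_sum[of x] sum_product square_norm_of_real_mult ..
 also have "... = (\<Sum>j\<in>Basis. \<Sum>b\<in>Basis. csq (inv_fourier (?T j b) x))"
 by (intro sum.cong refl) (simp add: position_derivative(2)[OF z])
 finally show ?thesis .
 qed
 have int: "integ (%x. csq (inv_fourier (?T j b) x))" if "j \<in> Basis" "b \<in> Basis" for j b
 using pl(1)[OF that that] by (rule square_intD(2))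
 then show "integ (%x. (norm x)\<^sup>2 * (\<Sum>b\<in>Basis. csq (partial_deriv b (inv_fourier z) x)))"
 unfolding eq by (intro Bochner_Integration.integrable_sum) auto
 have iT: "integ (%xi. csq (?T j b xi))" if "j \<in> Basis" "b \<in> Basis" for j b
 using rT[OF that] by (rule integrable_norm2)
 have "grad_energy (inv_fourier z) = (\<Sum>j\<in>Basis. \<Sum>b\<in>Basis. l2sq (inv_fourier (?T j b)))"
 unfolding grad_energy_def eq l2sq_def by (rule integral_double_sum[OF int])
 also have "... = (\<Sum>j\<in>Basis. \<Sum>b\<in>Basis. l2sq (?T j b))"
 by (intro sum.cong refl pl(2))
 also have "... = (LI xi. (\<Sum>j\<in>Basis. \<Sum>b\<in>Basis. csq (?T j b xi)))"
 unfolding l2sq_def by (rule integral_double_sum[OF iT, symmetric])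
 also have "... = (LI xi. real DIM('a) * csq (z xi) + 2 * (z xi \<bullet> eul D xi) + (norm xi)\<^sup>2 * grad2 D xi)"
 proof (intro Bochner_Integration.integral_cong refl)
 fix xi :: 'a
 have sq: "csq (?T j b xi) = (j \<bullet> b)\<^sup>2 * csq (z xi) + 2 * ((j \<bullet> b) * (xi \<bullet> b) * (z xi \<bullet> D xi j)) + (xi \<bullet> b)\<^sup>2 * csq (D xi j)" for j b
 by (rule cmod_square_combination)
 have inner: "(\<Sum>b\<in>Basis. csq (?T j b xi)) = csq (z xi) + 2 * ((xi \<bullet> j) * (z xi \<bullet> D xi j)) + (norm xi)\<^sup>2 * csq (D xi j)" if j: "j \<in> Basis" for j
 proof -
 have "(\<Sum>b\<in>Basis. (j \<bullet> b)\<^sup>2) = 1"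
 using j norm_square_eq_sum[of j] by simp
 moreover have "(\<Sum>b\<in>Basis. (j \<bullet> b) * (xi \<bullet> b)) = xi \<bullet> j"
 by (simp only: euclidean_inner[of j xi, symmetric] inner_commute[of j xi])
 ultimately show ?thesis
 unfolding sq sum.distrib norm_square_eq_sum[of xi]
 by (simp flip: sum_distrib_left sum_distrib_right)
 qed
 have ex: "z xi \<bullet> eul D xi = (\<Sum>b\<in>Basis. (xi \<bullet> b) * (z xi \<bullet> D xi b))"
 by (simp add: eul_def inner_sum_right flip: scaleR_conv_of_real)
 show "(\<Sum>j\<in>Basis. \<Sum>b\<in>Basis. csq (?T j b xi)) = real DIM('a) * csq (z xi) + 2 * (z xi \<bullet> eul D xi) + (norm xi)\<^sup>2 * grad2 D xi"
 by (simp add: inner sum.distrib ex grad2_def sum_distrib_left)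
 qed
 also have "... = real DIM('a) * (LI xi. csq (z xi)) + (LI xi. 2 * (z xi \<bullet> eul D xi)) + (LI xi. (norm xi)\<^sup>2 * grad2 D xi)"
 proof -
 have i: "integ (%xi. csq (z xi))" "integ (%xi. z xi \<bullet> eul D xi)"
 "integ (%xi. (norm xi)\<^sup>2 * grad2 D xi)"
 by (intro integrable_norm2 integrable_inner rapid_eul[OF z] niceD(2)[OF z] integrable_grad2[OF z])+
 then show ?thesis by simp
 qed
 finally show "grad_energy (inv_fourier z) = (LI xi. (norm xi)\<^sup>2 * grad2 D xi)"
 unfolding radial_ibp_0[OF z] by simp
qed

lemma smooth_fun_integrable_moment:
 "rapid f ==> integ (%xi. norm xi * cmod (f xi))"
 using rapid_integrable[OF rapid_powr_mult[of f 1], THEN integrable_norm] by (simp add: norm_mult)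

theorem nice_fourier:
 assumes u: "test_fun u"
 shows "nice (fourier u) (%xi h. fourier (%x. (- 2 * of_real pi * \<i>) * (of_real (x \<bullet> h) * u x)) xi)"
proof -
 have tb: "test_fun (%x. (- 2 * of_real pi * \<i>) * (of_real (x \<bullet> h) * u x))" for h
 by (intro test_fun_cmult test_fun_mult u smooth_fun_inner)
 have der: "(fourier u has_derivative (%h. fourier (%x. (- 2 * of_real pi * \<i>) * (of_real (x \<bullet> h) * u x)) xi)) (at xi)" for xi
 proof -
 have "(inv_fourier u has_derivative (%h. inv_fourier (%x. 2 * of_real pi * \<i> * of_real (h \<bullet> x) * u x) (- xi))) (at (- xi))"
 using test_fun_rapid[OF u] by (intro inv_fourier_has_derivative rapid_integrable smooth_fun_integrable_moment)
 from has_derivative_compose[OF has_derivative_minus[OF has_derivative_ident] this]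
 show ?thesis
 unfolding fourier_conv_inv_fourier[abs_def]
 by (rule has_derivative_eq_rhs) (simp add: fun_eq_iff inner_commute mult.assoc)
 qed
 show ?thesis
 unfolding nice_def
 proof (intro conjI ballI allI impI der)
 show "continuous_on UNIV (fourier u)"
 using der has_derivative_continuous by (blast intro: continuous_at_imp_continuous_on)
 fix b :: 'a
 have r: "rapid (fourier (%x. (- 2 * of_real pi * \<i>) * (of_real (x \<bullet> b) * u x)))"
 by (intro fourier_rapid tb)
 then show "fourier (%x. (- 2 * of_real pi * \<i>) * (of_real (x \<bullet> b) * u x)) \<in> bmeas"
 by (simp add: rapid_def)
 show "rapid (%xi. of_real (norm xi) * fourier (%x. (- 2 * of_real pi * \<i>) * (of_real (x \<bullet> b) * u x)) xi)"
 using rapid_powr_mult[OF r, of 1] by simp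
 qed (rule fourier_rapid[OF u])
qed

section \<open>Integration in polar coordinates\<close>

lemma nn_integral_real_scale:
 fixes f :: "real => ennreal"
 assumes "f \<in> bmeas" "c > 0"
 shows "(NN t. f t) = ennreal c * (NN t. f (c * t))"
 using assms by (simp add: nn_integral_lborel_scale[of f c, simplified] mult.assoc[symmetric] ennreal_mult'[symmetric])

text \<open>The radial mass of the density \<open>ph\<close>, in the variable 1 / \<tau>. It is
  never evaluated directly: testing with a Gaussian or a constant function eliminates it.\<close>

definition polar_const :: "(real => real) => nat => ennreal" where
 "polar_const ph n = (NN \<tau>. indicator {0<..} \<tau> * ennreal ((1 / \<tau>) * ((1 / \<tau>) ^ n * ph (1 / \<tau>))))"

text \<open>Polar coordinates with the surface measure replaced by the push-forward of an arbitrary radial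
 density \<open>ph |x| dx\<close> under \<open>sgn\<close>.\<close>

theorem nn_integral_polar:
 fixes H :: "'a::euclidean_space => ennreal"
 assumes [measurable]: "H \<in> bmeas" "ph \<in> bmeas" and ph: "!!t. ph t >= 0"
 shows "(NN r. indicator {0<..} r * ennreal (r ^ (DIM('a) - 1)) * (NN x. ennreal (ph (norm x)) * H (r *. sgn x)))
 = polar_const ph DIM('a) * (NN x. H x)"
proof -
 define n where "n = DIM('a)"
 have n: "n > 0" by (simp add: n_def)
 have [measurable]: "(sgn :: 'a => 'a) \<in> bmeas"
 unfolding sgn_div_norm[abs_def] by measurable
 have "(NN r. indicator {0<..} r * ennreal (r ^ (n - 1)) * (NN x. ennreal (ph (norm x)) * H (r *. sgn x)))
 = (NN r. NN x. indicator {0<..} r * ennreal (r ^ (n - 1)) * (ennreal (ph (norm x)) * H (r *. sgn x)))"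
 by (intro nn_integral_cong nn_integral_cmult[symmetric]) measurable
 also have "... = (NN x. NN r. indicator {0<..} r * ennreal (r ^ (n - 1)) * (ennreal (ph (norm x)) * H (r *. sgn x)))"
 by (rule lborel_pair.Fubini') measurable
 \<comment> \<open>Three scalings with Tonelli in between: \<open>r = norm x * t\<close> for fixed
   \<open>x\<close>, then \<open>x = y / t\<close> for fixed \<open>t\<close>, then
   \<open>t = norm y * \<tau>\<close>, after which \<open>y\<close> has separated from the radial
   variable.\<close>
 also have "... = (NN x. NN t. indicator {0<..} t * ennreal (t ^ (n - 1)) * (ennreal (norm x ^ n * ph (norm x)) * H (t *. x)))"
 proof (rule nn_integral_cong_AE)
 show "AE x in lborel. (NN r. indicator {0<..} r * ennreal (r ^ (n - 1)) * (ennreal (ph (norm x)) * H (r *. sgn x)))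
 = (NN t. indicator {0<..} t * ennreal (t ^ (n - 1)) * (ennreal (norm x ^ n * ph (norm x)) * H (t *. x)))"
 using AE_lborel_singleton[of "0::'a"]
 proof eventually_elim
 case (elim x)
 let ?g = "%r. indicator {0<..} r * ennreal (r ^ (n - 1)) * (ennreal (ph (norm x)) * H (r *. sgn x))"
 have "(NN r. ?g r) = ennreal (norm x) * (NN t. ?g (norm x * t))"
 using elim by (intro nn_integral_real_scale) measurable
 also have "... = (NN t. ennreal (norm x) * ?g (norm x * t))"
 by (rule nn_integral_cmult[symmetric]) measurable
 also have "... = (NN t. indicator {0<..} t * ennreal (t ^ (n - 1)) * (ennreal (norm x ^ n * ph (norm x)) * H (t *. x)))"
 proof (rule nn_integral_cong)
 fix t :: real
 show "ennreal (norm x) * ?g (norm x * t) = indicator {0<..} t * ennreal (t ^ (n - 1)) * (ennreal (norm x ^ n * ph (norm x)) * H (t *. x))"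
 proof (cases "t > 0")
 case True
 have "norm x * ((norm x * t) ^ (n - 1) * ph (norm x)) = t ^ (n - 1) * (norm x ^ n * ph (norm x))"
 using n by (cases n) (auto simp: power_mult_distrib)
 then have "ennreal (norm x) * (ennreal ((norm x * t) ^ (n - 1)) * ennreal (ph (norm x))) = ennreal (t ^ (n - 1)) * ennreal (norm x ^ n * ph (norm x))"
 using True ph by (simp flip: ennreal_mult)
 moreover have "(norm x * t) *. sgn x = t *. x"
 using elim by (simp add: sgn_div_norm)
 ultimately show ?thesis
 using True elim by (simp add: zero_less_mult_iff mult.assoc[symmetric])
 next
 case False
 then show ?thesis using elim by (simp add: zero_less_mult_iff)
 qed
 qed
 finally show ?case .
 qed
 qed
 also have "... = (NN t. NN x. indicator {0<..} t * ennreal (t ^ (n - 1)) * (ennreal (norm x ^ n * ph (norm x)) * H (t *. x)))"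
 by (rule lborel_pair.Fubini') measurable
 also have "... = (NN t. NN y. H y * (indicator {0<..} t * ennreal ((1 / t) * ((norm y / t) ^ n * ph (norm y / t)))))"
 proof (rule nn_integral_cong)
 fix t :: real
 show "(NN x. indicator {0<..} t * ennreal (t ^ (n - 1)) * (ennreal (norm x ^ n * ph (norm x)) * H (t *. x)))
 = (NN y. H y * (indicator {0<..} t * ennreal ((1 / t) * ((norm y / t) ^ n * ph (norm y / t)))))"
 proof (cases "t > 0")
 case True
 let ?f = "%y. ennreal ((norm y / t) ^ n * ph (norm y / t)) * H y"
 have "(NN x. indicator {0<..} t * ennreal (t ^ (n - 1)) * (ennreal (norm x ^ n * ph (norm x)) * H (t *. x)))
 = (NN x. ennreal (t ^ (n - 1)) * ?f (t *. x))"
 using True by (intro nn_integral_cong) simp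
 also have "... = ennreal (t ^ (n - 1)) * (NN x. ?f (t *. x))"
 by (rule nn_integral_cmult) measurable
 also have "(NN x. ?f (t *. x)) = ennreal (1 / t ^ n) * (NN y. ?f y)"
 using True by (subst nn_integral_lborel_scale) (auto simp: n_def)
 also have "ennreal (t ^ (n - 1)) * (ennreal (1 / t ^ n) * (NN y. ?f y)) = ennreal (1 / t) * (NN y. ?f y)"
 using True n by (cases n) (auto simp: mult.assoc[symmetric] ennreal_mult'[symmetric])
 also have "... = (NN y. ennreal (1 / t) * ?f y)"
 by (rule nn_integral_cmult[symmetric]) measurable
 also have "... = (NN y. H y * (indicator {0<..} t * ennreal ((1 / t) * ((norm y / t) ^ n * ph (norm y / t)))))"
 proof (rule nn_integral_cong)
 fix y :: 'a
 have "ennreal ((1 / t) * ((norm y / t) ^ n * ph (norm y / t))) = ennreal (1 / t) * ennreal ((norm y / t) ^ n * ph (norm y / t))"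
 using True by (intro ennreal_mult') simp
 then show "ennreal (1 / t) * ?f y = H y * (indicator {0<..} t * ennreal ((1 / t) * ((norm y / t) ^ n * ph (norm y / t))))"
 using True by (simp only: mult_ac indicator_simps greaterThan_iff mult_1_left mult_1_right)
 qed
 finally show ?thesis .
 qed simp
 qed
 also have "... = (NN y. NN t. H y * (indicator {0<..} t * ennreal ((1 / t) * ((norm y / t) ^ n * ph (norm y / t)))))"
 by (rule lborel_pair.Fubini') measurable
 also have "... = (NN y. polar_const ph n * H y)"
 proof (rule nn_integral_cong_AE)
 show "AE y in lborel. (NN t. H y * (indicator {0<..} t * ennreal ((1 / t) * ((norm y / t) ^ n * ph (norm y / t))))) = polar_const ph n * H y"
 using AE_lborel_singleton[of "0::'a"]
 proof eventually_elim
 case (elim y)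
 let ?g = "%t. indicator {0<..} t * ennreal ((1 / t) * ((norm y / t) ^ n * ph (norm y / t)))"
 have "(NN t. ?g t) = ennreal (norm y) * (NN t. ?g (norm y * t))"
 using elim by (intro nn_integral_real_scale) measurable
 also have "... = (NN t. ennreal (norm y) * ?g (norm y * t))"
 by (rule nn_integral_cmult[symmetric]) measurable
 also have "... = polar_const ph n"
 unfolding polar_const_def
 proof (rule nn_integral_cong)
 fix t :: real
 show "ennreal (norm y) * ?g (norm y * t) = indicator {0<..} t * ennreal ((1 / t) * ((1 / t) ^ n * ph (1 / t)))"
 using elim ph[of "1 / t"] by (cases "t > 0") (auto simp: zero_less_mult_iff ennreal_mult'[symmetric])
 qed
 finally show ?case
 by (subst nn_integral_cmult) (auto simp: mult.commute)
 qed
 qed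
 also have "... = polar_const ph n * (NN y. H y)"
 by (rule nn_integral_cmult) measurable
 finally show ?thesis by (simp add: n_def)
qed

subsection \<open>The Gaussian Poincare inequality\<close>

text \<open>A segment between distinct points passes through the origin for at most one parameter,
  and the fundamental theorem of calculus tolerates finitely many exceptional points.\<close>

lemma lipschitz_off_0:
 fixes F :: "'a::euclidean_space => complex"
 assumes F: "continuous_on UNIV F" "!!x. x ~= 0 ==> (F has_derivative D x) (at x)"
 and D: "!!x h. cmod (D x h) <= L * norm h"
 shows "cmod (F x - F y) <= L * norm (x - y)"
proof (cases "x = y")
 case False
 let ?w = "x - y"
 have d: "((%t. y + t *. ?w) has_derivative (%h. h *. ?w)) (at t)" for t
 by (auto intro!: derivative_eq_intros)
 have "finite {t. y + t *. ?w = 0}"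
 proof (rule finite_subset)
 show "{t. y + t *. ?w = 0} \<subseteq> {SOME t. y + t *. ?w = 0}"
 proof
 fix t assume "t \<in> {t. y + t *. ?w = 0}"
 then have t: "y + t *. ?w = 0" by simp
 from someI[of "%t. y + t *. ?w = 0", OF t] have "t *. ?w = (SOME t. y + t *. ?w = 0) *. ?w"
 using t by (metis add_left_imp_eq)
 then show "t \<in> {SOME t. y + t *. ?w = 0}" using False by (simp only: scaleR_cancel_right) auto
 qed
 qed simp
 then have "((%t. D (y + t *. ?w) ?w) has_integral (F (y + 1 *. ?w) - F (y + 0 *. ?w))) {0..1}"
 proof (rule fundamental_theorem_of_calculus_interior_strong)
 fix t assume t: "t \<in> {0<..<1} - {t. y + t *. ?w = 0}"
 then have z: "y + t *. ?w ~= 0" by simp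
 from has_derivative_compose[OF d F(2)[OF z]]
 show "((%t. F (y + t *. ?w)) has_vector_derivative D (y + t *. ?w) ?w) (at t)"
 by (simp add: has_vector_derivative_def linear_scale[OF has_derivative_linear[OF F(2)[OF z]]])
 next
 show "continuous_on {0..1} (%t. F (y + t *. ?w))"
 by (rule continuous_on_compose2[OF F(1)]) (auto intro!: continuous_intros)
 qed simp
 moreover have "0 <= L * norm ?w" using D[of 0 ?w] norm_ge_zero order_trans by blast
 ultimately show ?thesis
 using has_integral_bound[of "L * norm ?w" "%t. D (y + t *. ?w) ?w" _ "0::real" 1] D by simp
qed simp

lemma integrable_gauss_poly: "integ (%x. gauss x * (1 + norm (x::'a::euclidean_space)) ^ k)"
proof -
 have "rapid (%x::'a. of_real (gauss x * (1 + norm x) ^ k))"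
 by (rule rapid_dominated[OF rapid_gauss, where C=1 and j=k]) (auto simp: abs_mult mult.commute simp del: of_real_mult of_real_power of_real_add)
 from integrable_Re[OF rapid_integrable[OF this]] show ?thesis by simp
qed

text \<open>If \<open>X\<close> and \<open>Y\<close> are independent standard Gaussians, so is \<open>c X + s Y\<close>.\<close>

lemma nn_integral_gauss_mix:
 fixes h :: "'a::euclidean_space => ennreal"
 assumes [measurable]: "h \<in> bmeas" and cs: "c\<^sup>2 + s\<^sup>2 = 1" "s = 0 ==> c = 1"
 shows "(NN z. ennreal (gauss z) * h (c *. fst z + s *. snd z)) = (NN x. ennreal (gauss x) * h x)"
proof -
 have g2: "gauss (x, y) = gauss x * gauss y" for x y :: 'a
 by (simp add: gauss_def norm_Pair distrib_left flip: exp_add)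
 have [measurable]: "(%z. h (c *. fst z + s *. snd z)) \<in> bmeas"
 by (rule measurable_compose[OF _ assms(1)]) (intro borel_measurable_continuous_onI continuous_intros)
 have "(NN z. ennreal (gauss z) * h (c *. fst z + s *. snd z))
 = (NN x. NN y. ennreal (gauss (x::'a)) * (ennreal (gauss y) * h (c *. x + s *. y)))"
 unfolding lborel_prod[symmetric]
 by (subst lborel.nn_integral_fst[symmetric]) (simp_all add: g2 ennreal_mult mult.assoc lborel_prod)
 also have "... = (NN x. ennreal (gauss x) * h x)"
 proof (cases "s = 0")
 case True
 then show ?thesis using cs(2)
 by (intro nn_integral_cong) (simp add: nn_integral_cmult nn_integral_multc nn_integral_gauss)
 next
 case s: False
 let ?J = "ennreal (1 / \<bar>s\<bar> ^ DIM('a))"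
 let ?g = "%p q::'a. ennreal (gauss ((p - c *. q) /\<^sub>R s))"
 \<comment> \<open>Detailed balance: the transition density from \<open>x\<close> to
   \<open>u\<close> is reversible with respect to \<open>gauss\<close>, so \<open>x\<close> can be
   integrated out.\<close>
 have sym: "gauss x * gauss ((u - c *. x) /\<^sub>R s) = gauss u * gauss ((x - c *. u) /\<^sub>R s)" for x u :: 'a
 proof -
 have c2: "c\<^sup>2 = 1 - s\<^sup>2" using cs(1) by simp
 have "(norm x)\<^sup>2 + (norm ((u - c *. x) /\<^sub>R s))\<^sup>2 = (norm u)\<^sup>2 + (norm ((x - c *. u) /\<^sub>R s))\<^sup>2"
 using s c2 unfolding power2_norm_eq_inner
 by (simp add: inner_diff_left inner_diff_right inner_commute[of u x] field_simps)
 (use cs(1) in algebra)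
 from arg_cong[OF this, of "%t. exp (- pi * t)"] show ?thesis by (simp only: gauss_def distrib_left exp_add)
 qed
 have 2: "?J * (NN x. ?g x u) = 1" for u
 using nn_integral_lborel_scale[of "%v::'a. ennreal (gauss (v /\<^sub>R s))" s] s
 by (subst nn_integral_lborel_shift[of "%v. ?g v u" "c *. u", symmetric]) (simp_all add: nn_integral_gauss)
 have 1: "(NN y. ennreal (gauss y) * h (c *. x + s *. y)) = ?J * (NN u. ?g u x * h u)" for x
 using nn_integral_lborel_scale[of "%v. ennreal (gauss (v /\<^sub>R s)) * h (v + c *. x)" s] s
 nn_integral_lborel_shift[of "%v. ?g v x * h v" "c *. x"] by (simp add: add.commute)
 have "(NN x. NN y. ennreal (gauss x) * (ennreal (gauss y) * h (c *. x + s *. y)))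
 = (NN x. NN u. ?J * (ennreal (gauss u * gauss ((x - c *. u) /\<^sub>R s)) * h u))"
 by (rule nn_integral_cong, simp add: nn_integral_cmult 1) (simp add: nn_integral_cmult[symmetric] sym[symmetric] ennreal_mult mult_ac)
 also have "... = (NN u. NN x. ?J * (ennreal (gauss u * gauss ((x - c *. u) /\<^sub>R s)) * h u))"
 by (rule lborel_pair.Fubini') measurable
 also have "... = (NN u. ennreal (gauss u) * h u * (?J * (NN x. ?g x u)))"
 by (simp add: ennreal_mult nn_integral_cmult[symmetric] mult_ac)
 also have "... = (NN u. ennreal (gauss u) * h u)" by (simp add: 2)
 finally show ?thesis .
 qed
 finally show ?thesis .
qed

theorem gauss_poincare:
 fixes F :: "'a::euclidean_space => complex"
 assumes F: "continuous_on UNIV F" "!!x. x ~= 0 ==> (F has_derivative D x) (at x)"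
 and D: "!!b. b \<in> Basis ==> (%x. D x b) \<in> bmeas" "!!x h. cmod (D x h) <= L * norm h"
 shows "(LI x. gauss x * csq (F x)) - csq (LI x. gauss x *. F x)
 <= (\<Sum>b\<in>Basis. LI x. gauss x * csq (D x b)) / (2 * pi)"
proof -
 let ?n = "2 * DIM('a \<times> 'a)"
 let ?P = "%z::'a \<times> 'a. 1 + norm z"
 have [measurable]: "F \<in> bmeas" using F(1) by (rule borel_measurable_continuous_onI)
 note lip = lipschitz_off_0[OF F D(2)]
 define A where "A = cmod (F 0) + L"
 obtain b0 :: 'a where b0: "b0 \<in> Basis" using nonempty_Basis by blast
 have L: "L >= 0" using D(2)[of 0 b0] b0 order_trans[OF norm_ge_zero] by simp
 have A: "A >= 0" "A * L >= 0" using L by (auto simp: A_def)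
 have FA: "cmod (F x) <= A * (1 + norm x)" for x
 proof -
 have "cmod (F x) <= cmod (F 0) + L * norm x" using norm_triangle_ineq[of "F 0" "F x - F 0"] lip[of x 0] by simp
 then show ?thesis
 using L mult_nonneg_nonneg[of "cmod (F 0)" "norm x"] by (simp add: A_def distrib_right distrib_left del: mult_nonneg_nonneg zero_le_mult_iff)
 qed
 have FP: "cmod (F x) <= 2 * A * ?P z" if "norm x <= 2 * norm z" for x z
 using order_trans[OF FA mult_left_mono[of "1 + norm x" "2 * ?P z" A]] that A by (simp add: algebra_simps)
 have inner: "\<bar>u \<bullet> v\<bar> <= a * b" if "cmod u <= a" "cmod v <= b" for u v :: complex and a b
 using mult_mono[OF that] Cauchy_Schwarz_ineq2[of u v] order_trans[OF norm_ge_zero that(1)] by simp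
 have g2: "gauss (x, y) = gauss x * gauss y" for x y :: 'a
 by (simp add: gauss_def norm_Pair distrib_left flip: exp_add)
 have gi: "integ (%z::'e::euclidean_space. gauss z * q z)"
 if [measurable]: "q \<in> bmeas" and "!!z. \<bar>q z\<bar> <= M * (1 + norm z)\<^sup>2" for q M
 proof (rule integrable_bound)
 show "integ (%z::'e. M * (gauss z * (1 + norm z)\<^sup>2))"
 using integrable_gauss_poly by (rule integrable_mult_right)
 show "AE z in lborel. norm (gauss z * q z) <= norm (M * (gauss z * (1 + norm z)\<^sup>2))"
 proof (rule AE_I2)
 fix z show "norm (gauss z * q z) <= norm (M * (gauss z * (1 + norm z)\<^sup>2))"
 using mult_left_mono[OF order_trans[OF that(2) abs_ge_self] gauss_nonneg[of z], of z] by (simp add: abs_mult mult_ac)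
 qed
 qed measurable
 \<comment> \<open>\<open>U th\<close> and \<open>W th\<close> are the rotated pair of coordinates,
   and \<open>W th\<close> is the derivative of \<open>U th\<close> in \<open>th\<close>.\<close>
 define U where "U th z = cos th *. fst z + sin th *. snd z" for th and z :: "'a \<times> 'a"
 define W where "W th z = cos th *. snd z - sin th *. fst z" for th and z :: "'a \<times> 'a"
 have [measurable]: "(fst :: 'a \<times> 'a => 'a) \<in> bmeas" "(snd :: 'a \<times> 'a => 'a) \<in> bmeas" "U th \<in> bmeas" "W th \<in> bmeas" for th
 unfolding U_def[abs_def] W_def[abs_def] by (intro borel_measurable_continuous_onI continuous_intros)+
 have Wn: "norm (W th z) <= 2 * norm z" for th z
 proof -
 have "norm (W th z) <= \<bar>cos th\<bar> * norm (snd z) + \<bar>sin th\<bar> * norm (fst z)"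
 unfolding W_def using norm_triangle_ineq4[of "cos th *. snd z" "sin th *. fst z"] by simp
 also have "... <= 1 * norm z + 1 * norm z"
 using norm_fst_le[of "fst z" "snd z"] norm_snd_le[of "snd z" "fst z"] by (intro add_mono mult_mono) auto
 finally show ?thesis by simp
 qed
 have Un: "norm (U th z) <= 2 * norm z" for th z
 using Wn[of "th - pi / 2" z] by (simp add: W_def U_def cos_diff sin_diff add.commute)
 have Pn: "norm (fst z) <= 2 * norm z" "norm (snd z) <= 2 * norm z" for z :: "'a \<times> 'a"
 using Un[of 0 z] Un[of "pi / 2" z] by (simp_all add: U_def)
 have Ud: "((%th. U th z) has_derivative (%h. h *. W th z)) (at th)" for th z
 unfolding U_def W_def by (auto intro!: derivative_eq_intros simp: algebra_simps)
 have Ul: "norm (U th z - U th' z) <= 2 * norm z * norm (th - th')" for th th' z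
 by (rule differentiable_bound[of UNIV _ "%th h. h *. W th z"])
 (use Ud[of z] Wn[of _ z] in \<open>auto intro!: onorm_le mult_right_mono simp: mult.commute[of "\<bar>_\<bar>"]\<close>)
 have law: "(NN z. ennreal (gauss z) * h (U th z)) = (NN x. ennreal (gauss x) * h x)"
 if [measurable]: "h \<in> bmeas" and th: "0 <= th" "th <= pi / 2" for th h
 unfolding U_def using th sin_gt_zero[of th] by (intro nn_integral_gauss_mix) (cases "th = 0"; auto)+
 have lawR: "(LI z. gauss z * h (U th z)) = (LI x. gauss x * h x)"
 if [measurable]: "h \<in> bmeas" and h: "!!x. h x >= 0" and th: "0 <= th" "th <= pi / 2" for th and h :: "'a => real"
 using law[of "%x. ennreal (h x)" th] h th by (simp add: integral_eq_nn_integral ennreal_mult)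
 \<comment> \<open>\<open>U th\<close> is again Gaussian, so the exceptional point of
   \<open>F\<close> is met with probability 0.\<close>
 have AEU: "AE z in lborel. U th z ~= 0" if th: "0 <= th" "th <= pi / 2" for th
 proof -
 have "(NN x. ennreal (gauss x) * indicator {0::'a} x) = 0"
 by (subst nn_integral_indicator_singleton) auto
 with law[of "indicator {0}" th] th have "AE z in lborel. ennreal (gauss z) * indicator {0} (U th z) = 0"
 by (subst nn_integral_0_iff_AE[symmetric]) auto
 then show ?thesis by eventually_elim (auto simp: indicator_def gauss_def split: if_splits)
 qed
 define e where "e b = (LI x. gauss x * csq (D x b))" for b
 define ps where "ps th = (LI z. gauss z * (F (fst z) \<bullet> F (U th z)))" for th
 define T where "T th b = (LI z. gauss z * ((W th z \<bullet> b) * (F (fst z) \<bullet> D (U th z) b)))" for th b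
 have Db: "cmod (D x b) <= L" if "b \<in> Basis" for x b using D(2)[of x b] that by simp
 have int': "integ (%z. gauss z * ((W th z \<bullet> b) * (F (fst z) \<bullet> D (U th z) b)))" if b: "b \<in> Basis" for th b
 proof (rule gi[of _ "4 * A * L"])
 note [measurable] = D(1)[OF b]
 show "(%z. (W th z \<bullet> b) * (F (fst z) \<bullet> D (U th z) b)) \<in> bmeas" by measurable
 show "\<bar>(W th z \<bullet> b) * (F (fst z) \<bullet> D (U th z) b)\<bar> <= 4 * A * L * (?P z)\<^sup>2" for z
 proof -
 have "\<bar>(W th z \<bullet> b) * (F (fst z) \<bullet> D (U th z) b)\<bar> <= (2 * ?P z) * (2 * A * ?P z * L)"
 unfolding abs_mult
 proof (rule mult_mono)
 show "\<bar>W th z \<bullet> b\<bar> <= 2 * ?P z"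
 using Wn[of th z] Cauchy_Schwarz_ineq2[of "W th z" b] b by simp
 show "\<bar>F (fst z) \<bullet> D (U th z) b\<bar> <= 2 * A * ?P z * L"
 using D(2)[of "U th z" b] b Pn(1)[of z] by (intro inner FP) auto
 qed auto
 then show ?thesis by (simp add: power2_eq_square algebra_simps)
 qed
 qed
 have i1: "integ (%z::'a \<times> 'a. gauss z * (D (fst z) b \<bullet> D (U th z) b))" if b: "b \<in> Basis" for th b
 proof (rule gi[of _ "L * L"])
 note [measurable] = D(1)[OF b]
 show "(%z. D (fst z) b \<bullet> D (U th z) b) \<in> bmeas" by measurable
 show "\<bar>D (fst z) b \<bullet> D (U th z) b\<bar> <= L * L * (?P z)\<^sup>2" for z
 using inner[OF Db[OF b] Db[OF b], of "fst z" "U th z"] mult_left_mono[of 1 "(?P z)\<^sup>2" "L * L"] L by (simp add: one_le_power)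
 qed
 have dps: "(ps has_real_derivative (\<Sum>b\<in>Basis. T th b)) (at th)" if th: "0 <= th" "th <= pi / 2" for th
 proof -
 let ?G = "%z. \<Sum>b\<in>Basis. gauss z * ((W th z \<bullet> b) * (F (fst z) \<bullet> D (U th z) b))"
 have iG: "integ ?G" using int' by simp
 have "(ps has_derivative (%h. LI z. h * ?G z)) (at th)"
 unfolding ps_def
 proof (rule has_derivative_integral[where K="%z. 4 * A * L * (gauss z * (?P z)\<^sup>2) + \<bar>?G z\<bar>" and d=1])
 fix th
 show "integ (%z. gauss z * (F (fst z) \<bullet> F (U th z)))"
 proof (rule gi[of _ "(2 * A) * (2 * A)"])
 show "\<bar>F (fst z) \<bullet> F (U th z)\<bar> <= (2 * A) * (2 * A) * (?P z)\<^sup>2" for z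
 using inner[OF FP[of "fst z" z] FP[of "U th z" z]] Un[of th z] Pn(1)[of z] by (simp add: power2_eq_square algebra_simps)
 qed measurable
 next
 show "AE z in lborel. ((%th. gauss z * (F (fst z) \<bullet> F (U th z))) has_derivative (%h. h * ?G z)) (at th)"
 using AEU[OF th]
 proof eventually_elim
 case (elim z)
 have lin: "linear (D (U th z))" using F(2)[OF elim] by (rule has_derivative_linear)
 have "D (U th z) (W th z) = D (U th z) (\<Sum>b\<in>Basis. (W th z \<bullet> b) *. b)" by (simp add: euclidean_representation)
 then have "gauss z * (F (fst z) \<bullet> D (U th z) (W th z)) = ?G z"
 by (simp add: linear_sum[OF lin] linear_scale[OF lin] inner_sum_right sum_distrib_left)
 then show ?case
 by (intro has_derivative_eq_rhs[OF has_derivative_mult_right[OF has_derivative_inner_right[OF has_derivative_compose[OF Ud F(2)[OF elim]]]]])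
 (simp add: linear_scale[OF lin] fun_eq_iff mult.left_commute)
 qed
 show "AE z in lborel. \<forall>th'\<in>ball th 1. norm (gauss z * (F (fst z) \<bullet> F (U th' z)) - gauss z * (F (fst z) \<bullet> F (U th z)))
 <= (4 * A * L * (gauss z * (?P z)\<^sup>2) + \<bar>?G z\<bar>) * norm (th' - th)"
 proof (intro AE_I2 ballI)
 fix z th'
 have "cmod (F (U th' z) - F (U th z)) <= L * (2 * ?P z * norm (th' - th))"
 using order_trans[OF lip mult_left_mono[OF order_trans[OF Ul mult_right_mono[of "2 * norm z" "2 * ?P z"]] L]] by simp
 from inner[OF FP[of "fst z" z] this] Pn(1)[of z]
 have "\<bar>F (fst z) \<bullet> (F (U th' z) - F (U th z))\<bar> <= 4 * A * L * (?P z)\<^sup>2 * norm (th' - th)"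
 by (simp add: power2_eq_square algebra_simps)
 from mult_left_mono[OF this gauss_nonneg[of z]]
 have "norm (gauss z * (F (fst z) \<bullet> F (U th' z)) - gauss z * (F (fst z) \<bullet> F (U th z))) <= 4 * A * L * (gauss z * (?P z)\<^sup>2) * norm (th' - th)"
 by (simp add: right_diff_distrib[symmetric] inner_diff_right[symmetric] abs_mult mult_ac)
 then show "norm (gauss z * (F (fst z) \<bullet> F (U th' z)) - gauss z * (F (fst z) \<bullet> F (U th z)))
 <= (4 * A * L * (gauss z * (?P z)\<^sup>2) + \<bar>?G z\<bar>) * norm (th' - th)"
 by (rule order_trans) (simp add: mult_right_mono)
 qed
 show "AE z in lborel. \<forall>h. norm (h * ?G z) <= (4 * A * L * (gauss z * (?P z)\<^sup>2) + \<bar>?G z\<bar>) * norm h"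
 using A by (intro AE_I2 allI) (subst mult.commute, simp only: real_norm_def abs_mult, rule mult_right_mono, auto)
 show "integ (%z. 4 * A * L * (gauss z * (?P z)\<^sup>2) + \<bar>?G z\<bar>)"
 by (intro Bochner_Integration.integrable_add integrable_mult_right integrable_gauss_poly integrable_abs iG)
 qed (use iG in auto)
 then show ?thesis
 using int' by (simp add: has_field_derivative_def T_def mult.commute[of _ "sum _ _"])
 qed
 have ibp: "T th b = - sin th / (2 * pi) * (LI z. gauss z * (D (fst z) b \<bullet> D (U th z) b))"
 if b: "b \<in> Basis" for th b
 proof -
 note [measurable] = D(1)[OF b]
 \<comment> \<open>The direction \<open>w\<close> leaves \<open>U th\<close> fixed and satisfies
   \<open>z \<bullet> w = W th z \<bullet> b\<close>. Differentiating along it brings down the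
   factor \<open>W th z \<bullet> b\<close> from the Gaussian, and the only other factor affected is
   \<open>F (fst z)\<close>.\<close>
 define w :: "'a \<times> 'a" where "w = (- sin th *. b, cos th *. b)"
 let ?p = "%z. F (fst z) \<bullet> D (U th z) b"
 let ?e = "%z. - sin th * (gauss z * (D (fst z) b \<bullet> D (U th z) b)) - 2 * pi * (gauss z * ((W th z \<bullet> b) * ?p z))"
 have U: "U th (z + t *. w) = U th z" for z t by (simp add: U_def w_def algebra_simps)
 have w: "norm w = 1" using b by (simp add: w_def norm_Pair)
 have zw: "z \<bullet> w = W th z \<bullet> b" for z by (simp add: w_def W_def inner_prod_def inner_diff_left)
 obtain C1 where C1: "C1 >= 0" "!!x y::'a \<times> 'a. norm y <= 1 ==> gauss (x + y) <= C1 * (1 / ?P x ^ ?n)"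
 by (rule rapid_shift_bound[OF rapid_gauss, of 1 ?n]) auto
 \<comment> \<open>One extra power of decay pays for the linear growth of \<open>?p\<close>.\<close>
 obtain C2 where C2: "C2 >= 0" "!!x y::'a \<times> 'a. norm y <= 1 ==> norm (x + y) * gauss (x + y) <= C2 * (1 / ?P x ^ Suc ?n)"
 by (rule rapid_shift_bound[OF rapid_powr_mult[OF rapid_gauss, of 1], of 1 "Suc ?n"]) (auto simp: norm_mult)
 have dg: "((%t. gauss (z + t *. w)) has_real_derivative - 2 * pi * ((z + t *. w) \<bullet> w) * gauss (z + t *. w)) (at t)" for z t
 unfolding has_field_derivative_def
 by (rule has_derivative_eq_rhs[OF has_derivative_compose[of "%t. z + t *. w" "%h. h *. w", OF _ gauss_has_derivative]])
 (auto intro!: derivative_eq_intros simp: fun_eq_iff)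
 have lg: "\<bar>gauss (z + t *. w) - gauss z\<bar> <= 2 * pi * C2 * (1 / ?P z ^ Suc ?n) * \<bar>t\<bar>" if t: "\<bar>t\<bar> < 1" for z t
 proof -
 have "norm (gauss (z + t *. w) - gauss (z + 0 *. w)) <= 2 * pi * C2 * (1 / ?P z ^ Suc ?n) * norm (t - 0)"
 proof (rule field_differentiable_bound[of "ball 0 1"])
 fix t :: real assume t: "t \<in> ball 0 1"
 show "((%t. gauss (z + t *. w)) has_field_derivative - 2 * pi * ((z + t *. w) \<bullet> w) * gauss (z + t *. w)) (at t within ball 0 1)"
 by (rule has_field_derivative_at_within[OF dg])
 have "\<bar>(z + t *. w) \<bullet> w\<bar> <= norm (z + t *. w)"
 using Cauchy_Schwarz_ineq2[of "z + t *. w" w] w by simp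
 from order_trans[OF mult_right_mono[OF this gauss_nonneg[of "z + t *. w"]] C2(2)[of "t *. w" z]] t w
 have "\<bar>(z + t *. w) \<bullet> w\<bar> * gauss (z + t *. w) <= C2 * (1 / ?P z ^ Suc ?n)" by simp
 from mult_left_mono[OF this, of "2 * pi"]
 show "norm (- 2 * pi * ((z + t *. w) \<bullet> w) * gauss (z + t *. w)) <= 2 * pi * C2 * (1 / ?P z ^ Suc ?n)"
 by (simp add: abs_mult mult.assoc del: power_Suc)
 qed (use t in auto)
 then show ?thesis by simp
 qed
 have "(LI z. ?e z) = 0"
 proof (rule integral_line_derivative_eq_0[where f="%z. gauss z * ?p z" and w=w and K="%z. (L * L * C1 + 4 * pi * C2 * A * L) * (1 / ?P z ^ ?n)"])
 show "integ (%z::'a \<times> 'a. (L * L * C1 + 4 * pi * C2 * A * L) * (1 / ?P z ^ ?n))"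
 by (rule integrable_mult_right[OF integrable_inverse_power_norm])
 have pb: "\<bar>?p z\<bar> <= 2 * A * L * ?P z" for z using inner[OF FP[of "fst z" z] Db[OF b]] Pn(1)[of z] by (simp only: mult_ac)
 show "integ (%z. gauss z * ?p z)"
 proof (rule gi[of _ "2 * A * L"])
 show "\<bar>?p z\<bar> <= 2 * A * L * (?P z)\<^sup>2" for z
 by (rule order_trans[OF pb mult_left_mono[OF self_le_power]]) (use A in auto)
 qed measurable
 show "integ ?e"
 by (intro Bochner_Integration.integrable_diff integrable_mult_right i1 int' b)
 show "AE z in lborel. ((%t. gauss (z + t *. w) * ?p (z + t *. w)) has_vector_derivative ?e z) (at 0)"
 using AEU[OF order_refl pi_half_ge_zero]
 proof eventually_elim
 case (elim z)
 then have z: "fst z ~= 0" by (simp add: U_def)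
 have "((%t. fst z + t *. (- sin th *. b)) has_derivative (%h. h *. (- sin th *. b))) (at 0)"
 by (auto intro!: derivative_eq_intros)
 from has_derivative_inner_left[OF has_derivative_compose[OF this, of F "D (fst z)"], of "D (U th z) b"] F(2)[OF z]
 have dp: "((%t. F (fst z + t *. (- sin th *. b)) \<bullet> D (U th z) b) has_derivative (%h. D (fst z) (h *. (- sin th *. b)) \<bullet> D (U th z) b)) (at 0)"
 by simp
 note lin = has_derivative_linear[OF F(2)[OF z]]
 have p: "?p (z + t *. w) = F (fst z + t *. (- sin th *. b)) \<bullet> D (U th z) b" for t
 unfolding U by (simp add: w_def)
 have "((%t. ?p (z + t *. w)) has_real_derivative - sin th * (D (fst z) b \<bullet> D (U th z) b)) (at 0)"
 unfolding p has_field_derivative_def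
 by (rule has_derivative_eq_rhs[OF dp]) (simp add: linear_scale[OF lin] linear_neg[OF lin] fun_eq_iff mult_ac)
 from DERIV_mult[OF dg[of z 0] this]
 show ?case
 by (simp add: has_real_derivative_iff_has_vector_derivative zw algebra_simps)
 qed
 fix z and t :: real assume t: "\<bar>t\<bar> < 1"
 let ?z = "z + t *. w"
 have "\<bar>?p ?z - ?p z\<bar> <= L * \<bar>t\<bar> * L"
 proof -
 have "cmod (F (fst ?z) - F (fst z)) <= L * (\<bar>t\<bar> * 1)"
 using b w_def mult_left_mono[of "\<bar>sin th\<bar>" 1 "\<bar>t\<bar>"] by (intro order_trans[OF lip mult_left_mono[OF _ L]]) (auto simp: abs_mult)
 from inner[OF this Db[OF b]] show ?thesis unfolding U inner_diff_left[symmetric] by simp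
 qed
 from mult_mono[OF C1(2)[of "t *. w" z] this] t w C1(1)
 have 1: "gauss ?z * \<bar>?p ?z - ?p z\<bar> <= C1 * (1 / ?P z ^ ?n) * (L * \<bar>t\<bar> * L)"
 by simp
 have 2: "\<bar>gauss ?z - gauss z\<bar> * \<bar>?p z\<bar> <= 2 * pi * C2 * (1 / ?P z ^ Suc ?n) * \<bar>t\<bar> * (2 * A * L * ?P z)"
 using C2(1) by (intro mult_mono lg pb t) auto
 have "?P z ~= 0" using norm_ge_zero[of z] by linarith
 then have 3: "2 * pi * C2 * (1 / ?P z ^ Suc ?n) * \<bar>t\<bar> * (2 * A * L * ?P z) = 4 * pi * C2 * A * L * (1 / ?P z ^ ?n) * \<bar>t\<bar>" by simp
 have "gauss ?z * ?p ?z - gauss z * ?p z = gauss ?z * (?p ?z - ?p z) + (gauss ?z - gauss z) * ?p z"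
 by (simp only: right_diff_distrib left_diff_distrib)
 then have "norm (gauss ?z * ?p ?z - gauss z * ?p z) <= gauss ?z * \<bar>?p ?z - ?p z\<bar> + \<bar>gauss ?z - gauss z\<bar> * \<bar>?p z\<bar>"
 using abs_triangle_ineq[of "gauss ?z * (?p ?z - ?p z)" "(gauss ?z - gauss z) * ?p z"] by (simp only: real_norm_def abs_mult abs_of_nonneg gauss_nonneg)
 with 1 2[unfolded 3] show "norm (gauss ?z * ?p ?z - gauss z * ?p z) <= (L * L * C1 + 4 * pi * C2 * A * L) * (1 / ?P z ^ ?n) * \<bar>t\<bar>"
 by (simp add: algebra_simps)
 qed
 then have "- sin th * (LI z. gauss z * (D (fst z) b \<bullet> D (U th z) b)) - 2 * pi * T th b = 0"
 unfolding T_def using i1[OF b, of th] int'[OF b, of th]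
 by (subst (asm) Bochner_Integration.integral_diff) (auto simp only: integral_mult_right_zero intro!: integrable_mult_right)
 then show ?thesis by (simp add: field_simps)
 qed
 \<comment> \<open>Twice the inner product of the two derivatives is at most the sum of their
   squares; \<open>fst z\<close> and \<open>U th z\<close> have the same law, so each square
   contributes \<open>e b\<close>.\<close>
 have Te: "T th b >= - sin th / (2 * pi) * e b" if b: "b \<in> Basis" and th: "0 <= th" "th <= pi / 2" for th b
 proof -
 note [measurable] = D(1)[OF b]
 have i2: "integ (%z::'a \<times> 'a. gauss z * csq (D (g z) b))" if [measurable]: "g \<in> bmeas" for g
 proof (rule gi[of _ "L\<^sup>2"])
 show "\<bar>csq (D (g z) b)\<bar> <= L\<^sup>2 * (?P z)\<^sup>2" for z
 using order_trans[OF power_mono[OF Db[OF b] norm_ge_zero] mult_left_mono[of 1 "(?P z)\<^sup>2" "L\<^sup>2", simplified]] by (simp add: one_le_power)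
 qed measurable
 have "2 * (LI z. gauss z * (D (fst z) b \<bullet> D (U th z) b))
 <= (LI z. gauss z * csq (D (U 0 z) b) + gauss z * csq (D (U th z) b))"
 unfolding integral_mult_right_zero[symmetric]
 proof (rule integral_mono)
 fix z :: "'a \<times> 'a"
 have "2 * (D (fst z) b \<bullet> D (U th z) b) <= csq (D (U 0 z) b) + csq (D (U th z) b)"
 using zero_le_power2[of "cmod (D (fst z) b - D (U th z) b)"]
 unfolding power2_norm_eq_inner by (simp add: inner_diff_left inner_diff_right inner_commute U_def)
 from mult_left_mono[OF this gauss_nonneg[of z]]
 show "2 * (gauss z * (D (fst z) b \<bullet> D (U th z) b)) <= gauss z * csq (D (U 0 z) b) + gauss z * csq (D (U th z) b)"
 by (simp add: distrib_left mult.left_commute)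
 qed (use i1[OF b] i2 in auto)
 also have "... = e b + e b"
 using lawR[of "%x. csq (D x b)" 0] lawR[of "%x. csq (D x b)" th] th by (simp add: i2 e_def)
 finally have "sin th / (2 * pi) * (LI z. gauss z * (D (fst z) b \<bullet> D (U th z) b)) <= sin th / (2 * pi) * e b"
 using th by (intro mult_left_mono) (auto intro!: divide_nonneg_pos sin_ge_zero)
 then show ?thesis unfolding ibp[OF b] by simp
 qed
 let ?K = "(\<Sum>b\<in>Basis. e b) / (2 * pi)"
 have "ps 0 - ?K * cos 0 <= ps (pi / 2) - ?K * cos (pi / 2)"
 proof (rule DERIV_nonneg_imp_nondecreasing[of 0 "pi / 2" "%th. ps th - ?K * cos th"])
 fix th assume th: "0 <= th" "th <= pi / 2"
 have "(\<Sum>b\<in>Basis. - sin th / (2 * pi) * e b) <= (\<Sum>b\<in>Basis. T th b)" by (intro sum_mono Te th)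
 then have "0 <= (\<Sum>b\<in>Basis. T th b) + ?K * sin th" by (simp only: sum_distrib_left[symmetric]) (simp add: mult.commute)
 then show "\<exists>y. ((%th. ps th - ?K * cos th) has_real_derivative y) (at th) \<and> 0 <= y"
 by (intro exI[of _ "(\<Sum>b\<in>Basis. T th b) + ?K * sin th"]) (auto intro!: derivative_eq_intros dps th)
 qed simp
 moreover have "ps 0 = (LI x. gauss x * csq (F x))"
 using lawR[of "%x. csq (F x)" 0] by (simp add: ps_def U_def power2_norm_eq_inner)
 moreover have "ps (pi / 2) = csq (LI x. gauss x *. F x)"
 proof -
 have iF: "integ (%x. gauss x *. F x)"
 proof (rule integrable_bound[OF integrable_mult_right[OF integrable_gauss_poly[of 1]]])
 show "AE x in lborel. norm (gauss x *. F x) <= norm (A * (gauss x * (1 + norm x) ^ 1))"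
 using A by (intro AE_I2) (simp add: abs_mult mult.left_commute FA)
 qed measurable
 let ?I = "LI x. gauss x *. F x"
 have "integ (%z. gauss z * (F (fst z) \<bullet> F (snd z)))"
 proof (rule gi[of _ "(2 * A) * (2 * A)"])
 show "\<bar>F (fst z) \<bullet> F (snd z)\<bar> <= (2 * A) * (2 * A) * (?P z)\<^sup>2" for z
 using inner[OF FP[of "fst z" z] FP[of "snd z" z]] Pn(1)[of z] Pn(2)[of z] by (simp add: power2_eq_square algebra_simps)
 qed measurable
 from lborel_pair.integral_fst'[OF this[folded lborel_prod]] have "ps (pi / 2) = (LI x. LI y. gauss (x, y) * (F x \<bullet> F y))"
 by (simp add: lborel_prod ps_def U_def)
 also have "... = (LI x. (gauss x *. F x) \<bullet> ?I)"
 using iF by (simp add: g2 mult.assoc integral_inner_right[symmetric] del: integral_inner_right)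
 also have "... = ?I \<bullet> ?I" using iF by (intro integral_inner_left) auto
 finally show ?thesis by (simp only: power2_norm_eq_inner)
 qed
 ultimately show ?thesis by (simp add: e_def)
qed

section \<open>Norm and direction of a Gaussian vector\<close>

lemma sgn_measurable[measurable]: "(sgn :: 'a::euclidean_space => 'a) \<in> bmeas"
 unfolding sgn_div_norm[abs_def] by measurable

lemma gauss_neq_0[simp]: "gauss x ~= 0"
 by (simp add: gauss_def)

lemma sgn_sgn_eq: "sgn (sgn x) = sgn (x::'a::real_normed_vector)"
 by (cases "x = 0") (simp_all add: sgn_div_norm[of "sgn x"] norm_sgn)

lemma sgn_scale_sgn: "r > 0 ==> sgn (r *. sgn x) = sgn (x::'a::real_normed_vector)"
 by (cases "x = 0") (simp_all add: sgn_scaleR sgn_sgn_eq)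

lemma norm_scale_sgn: "r > 0 ==> x ~= 0 ==> norm (r *. sgn (x::'a::real_normed_vector)) = r"
 by (simp add: norm_sgn)

lemma AE_neq_0: "AE x in lborel. x ~= (0::'a::euclidean_space)"
 by (rule AE_lborel_singleton)

definition radial_mass :: "nat => ennreal" where
 "radial_mass n = (NN r. indicator {0<..} r * ennreal (r ^ (n - 1)) * ennreal (gauss r))"

lemma radial_mass_pos: "radial_mass n ~= 0"
proof
 assume "radial_mass n = 0"
 then have "AE r::real in lborel. indicator {0<..} r * ennreal (r ^ (n - 1)) * ennreal (gauss r) = 0"
 unfolding radial_mass_def by (subst (asm) nn_integral_0_iff_AE) auto
 then have "AE r::real in lborel. \<not> r \<in> {0<..<1}"
 by eventually_elim (auto simp: indicator_def)
 then have "emeasure lborel {0<..<1::real} = 0"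
 by (subst (asm) AE_iff_measurable[where N="{0<..<1::real}"]) auto
 then show False by simp
qed

lemma radial_mass_finite: "radial_mass n < \<infinity>"
proof -
 have "integ (%r::real. Re (of_real (norm r powr real (n - 1)) * of_real (gauss r)))"
 by (intro integrable_Re rapid_integrable rapid_powr_mult rapid_gauss) simp
 then have "integ (%r::real. \<bar>r\<bar> powr real (n - 1) * gauss r)" by simp
 then have fin: "(NN r. ennreal (\<bar>r\<bar> powr real (n - 1) * gauss r)) < \<infinity>"
 by (subst nn_integral_eq_integral) auto
 have "radial_mass n <= (NN r. ennreal (\<bar>r\<bar> powr real (n - 1) * gauss r))"
 unfolding radial_mass_def
 proof (rule nn_integral_mono)
 fix r :: real
 show "indicator {0<..} r * ennreal (r ^ (n - 1)) * ennreal (gauss r) <= ennreal (\<bar>r\<bar> powr real (n - 1) * gauss r)"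
 by (cases "r > 0") (auto simp: powr_realpow ennreal_mult)
 qed
 with fin show ?thesis by (rule le_less_trans[rotated])
qed

text \<open>The polar formula for \<open>gauss\<close> times a function of the direction relates it
  to the density \<open>ph\<close> through a single constant, and the constant function 1 identifies
  that constant. Thus every radial density induces the same mean over directions.\<close>

lemma radial_independence_gauss:
 fixes \<Psi> :: "'a::euclidean_space => ennreal"
 assumes [measurable]: "\<Psi> \<in> bmeas" "ph \<in> bmeas" and ph: "!!t. ph t >= 0"
 shows "(NN x. ennreal (ph (norm x)) * \<Psi> (sgn x))
 = (NN (x::'a). ennreal (ph (norm x))) * (NN x. ennreal (gauss x) * \<Psi> (sgn x))"
proof -
 let ?n = "DIM('a)"
 have main: "radial_mass ?n * (NN x. ennreal (ph (norm x)) * \<Psi> (sgn x)) = polar_const ph ?n * (NN x. ennreal (gauss x) * \<Psi> (sgn x))"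
 if [measurable]: "\<Psi> \<in> bmeas" for \<Psi> :: "'a => ennreal"
 proof -
 have "polar_const ph ?n * (NN x. ennreal (gauss x) * \<Psi> (sgn x))
 = (NN r. indicator {0<..} r * ennreal (r ^ (?n - 1)) * (NN x. ennreal (ph (norm x)) * (ennreal (gauss (r *. sgn x)) * \<Psi> (sgn (r *. sgn x)))))"
 by (rule nn_integral_polar[symmetric]) (use ph in auto)
 also have "... = (NN r. indicator {0<..} r * ennreal (r ^ (?n - 1)) * ennreal (gauss r) * (NN x. ennreal (ph (norm x)) * \<Psi> (sgn x)))"
 proof (rule nn_integral_cong)
 fix r :: real
 show "indicator {0<..} r * ennreal (r ^ (?n - 1)) * (NN x. ennreal (ph (norm x)) * (ennreal (gauss (r *. sgn x)) * \<Psi> (sgn (r *. sgn x))))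
 = indicator {0<..} r * ennreal (r ^ (?n - 1)) * ennreal (gauss r) * (NN x. ennreal (ph (norm x)) * \<Psi> (sgn x))"
 proof (cases "r > 0")
 case True
 have "(NN x. ennreal (ph (norm x)) * (ennreal (gauss (r *. sgn x)) * \<Psi> (sgn (r *. sgn x))))
 = (NN x. ennreal (gauss r) * (ennreal (ph (norm x)) * \<Psi> (sgn x)))"
 proof (rule nn_integral_cong_AE)
 show "AE x in lborel. ennreal (ph (norm x)) * (ennreal (gauss (r *. sgn x)) * \<Psi> (sgn (r *. sgn x))) = ennreal (gauss r) * (ennreal (ph (norm x)) * \<Psi> (sgn x))"
 using AE_neq_0
 proof eventually_elim
 case (elim x)
 have "gauss (r *. sgn x) = gauss r" unfolding gauss_def norm_scale_sgn[OF True elim] by simp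
 then show ?case by (simp add: sgn_scale_sgn[OF True] mult_ac)
 qed
 qed
 also have "... = ennreal (gauss r) * (NN x. ennreal (ph (norm x)) * \<Psi> (sgn x))"
 by (rule nn_integral_cmult) measurable
 finally show ?thesis by (simp add: mult.assoc)
 qed simp
 qed
 also have "... = radial_mass ?n * (NN x. ennreal (ph (norm x)) * \<Psi> (sgn x))"
 unfolding radial_mass_def by (rule nn_integral_multc) measurable
 finally show ?thesis by simp
 qed
 have "radial_mass ?n * (NN (x::'a). ennreal (ph (norm x))) = polar_const ph ?n"
 using main[of "%_. 1"] by (simp add: nn_integral_gauss)
 then have "radial_mass ?n * (NN x. ennreal (ph (norm x)) * \<Psi> (sgn x))
 = radial_mass ?n * ((NN (x::'a). ennreal (ph (norm x))) * (NN x. ennreal (gauss x) * \<Psi> (sgn x)))"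
 using main[of \<Psi>] by (simp add: mult.assoc[symmetric])
 then show ?thesis
 using radial_mass_pos[of ?n] radial_mass_finite[of ?n, THEN less_imp_neq] by (auto simp: ennreal_mult_cancel_left)
qed

definition e1 :: "'a::euclidean_space itself => real" where
 "e1 _ = (LI (x::'a). norm x * gauss x)"

lemma integrable_norm_gauss: "integ (%x::'a::euclidean_space. norm x * gauss x)"
 using integrable_Re[OF rapid_integrable[OF rapid_powr_mult[OF rapid_gauss, of 1]]] by simp

lemma e1_pos: "e1 TYPE('a::euclidean_space) > 0"
proof -
 have "e1 TYPE('a) >= 0" unfolding e1_def by (intro integral_nonneg_AE) auto
 moreover have "e1 TYPE('a) ~= 0"
 proof
 assume "e1 TYPE('a) = 0"
 then have "AE x::'a in lborel. norm x * gauss x = 0"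
 unfolding e1_def using integrable_norm_gauss by (subst (asm) integral_nonneg_eq_0_iff_AE) auto
 then have "AE x::'a in lborel. False"
 using AE_neq_0
 proof eventually_elim
 case (elim x)
 then show ?case using gauss_pos[of x] by simp
 qed
 then show False by (simp add: eventually_False ae_filter_eq_bot_iff)
 qed
 ultimately show ?thesis by simp
qed

subsection \<open>Spherical means\<close>

text \<open>The density \<open>sph\<close> of the spherical mean carries the factor \<open>|x|\<close> so that the 1-homogeneous
 extension of a function of spherical mean zero has Gaussian mean zero.\<close>

definition sph :: "'a::euclidean_space => real" where
 "sph x = norm x * gauss x / e1 TYPE('a)"

definition smean :: "('a::euclidean_space => complex) => real => complex" where
 "smean v r = (LI x. of_real (sph x) * v (r *. sgn x))"

lemma sph_measurable[measurable]: "sph \<in> bmeas"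
 unfolding sph_def[abs_def] by measurable

lemma sph_nonneg[simp]: "sph x >= 0"
 using e1_pos[where 'a='a] by (simp add: sph_def)

lemma integrable_sph[simp]: "integ (sph :: 'a::euclidean_space => real)"
 unfolding sph_def[abs_def] by (rule integrable_divide[OF integrable_norm_gauss])

lemma integral_sph[simp]: "(LI x. sph (x::'a::euclidean_space)) = 1"
proof -
 have "(LI x. sph (x::'a)) = e1 TYPE('a) / e1 TYPE('a)"
 unfolding sph_def by (simp add: e1_def)
 then show ?thesis using e1_pos[where 'a='a] by simp
qed

lemma nn_integral_sph: "(NN (x::'a::euclidean_space). ennreal (sph x)) = 1"
 by (simp add: nn_integral_eq_integral)

lemma sph_eq: "sph x = (%t. \<bar>t\<bar> * gauss t / e1 TYPE('a)) (norm (x::'a::euclidean_space))"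
 by (simp add: sph_def gauss_def)

lemma nn_integral_sph_eq_gauss:
 fixes \<Psi> :: "'a::euclidean_space => ennreal"
 assumes [measurable]: "\<Psi> \<in> bmeas"
 shows "(NN x. ennreal (sph x) * \<Psi> (sgn x)) = (NN x. ennreal (gauss x) * \<Psi> (sgn x))"
proof -
 let ?ph = "%t::real. \<bar>t\<bar> * gauss t / e1 TYPE('a)"
 have "(NN x. ennreal (?ph (norm x)) * \<Psi> (sgn x)) = (NN (x::'a). ennreal (?ph (norm x))) * (NN x. ennreal (gauss x) * \<Psi> (sgn x))"
 using e1_pos[where 'a='a] by (intro radial_independence_gauss) auto
 then show ?thesis
 unfolding sph_eq[symmetric] by (simp add: nn_integral_sph)
qed

lemma radial_independence:
 fixes \<Psi> :: "'a::euclidean_space => ennreal"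
 assumes [measurable]: "\<Psi> \<in> bmeas" "ph \<in> bmeas" and ph: "!!t. ph t >= 0"
 shows "(NN x. ennreal (ph (norm x)) * \<Psi> (sgn x))
 = (NN (x::'a). ennreal (ph (norm x))) * (NN x. ennreal (sph x) * \<Psi> (sgn x))"
 unfolding nn_integral_sph_eq_gauss[OF assms(1)] by (rule radial_independence_gauss[OF assms])

text \<open>Integration by parts along dilations, since R applied to \<open>gauss\<close> gives - 2
  pi |x|^2 times \<open>gauss\<close>.\<close>

lemma nn_integral_gauss_square: "(NN x. ennreal (gauss x) * ennreal ((norm (x::'a::euclidean_space))\<^sup>2)) = ennreal (real DIM('a) / (2 * pi))"
proof -
 let ?e = "%x::'a. complex_of_real (- (2 * pi) * (norm x powr 2 * gauss x))"
 have rap: "rapid (%x::'a. complex_of_real (norm x powr 2 * gauss x))"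
 using rapid_powr_mult[OF rapid_gauss, of 2] by simp
 have "(LI x. ?e x) = - of_nat DIM('a) * (LI (x::'a). of_real (gauss x))"
 proof (rule euler_ibp)
 show "integ (%x::'a. complex_of_real (gauss x))" by (rule rapid_integrable[OF rapid_gauss])
 show "rapid ?e" using rapid_cmult[OF rap, of "- (2 * pi)"] by simp
 fix x :: 'a
 have "((%t. gauss (t *. x)) has_derivative (%h. h *. (- (2 * pi) * ((norm x)\<^sup>2 * gauss x)))) (at 1)"
 by (rule has_derivative_eq_rhs[OF has_derivative_compose[of "%t. t *. x" "%h. h *. x", OF _ gauss_has_derivative]])
 (auto intro!: derivative_eq_intros simp: fun_eq_iff power2_norm_eq_inner)
 from has_derivative_of_real[OF this]
 show "((%t. complex_of_real (gauss (t *. x))) has_vector_derivative ?e x) (at 1)"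
 by (simp add: has_vector_derivative_def scaleR_conv_of_real)
 qed
 then have "complex_of_real (LI x. - (2 * pi) * (norm (x::'a) powr 2 * gauss x)) = of_real (- real DIM('a))"
 unfolding integral_complex_of_real by simp
 then have "2 * pi * (LI (x::'a). norm x powr 2 * gauss x) = real DIM('a)"
 unfolding of_real_eq_iff by simp
 then have "(LI (x::'a). norm x powr 2 * gauss x) = real DIM('a) / (2 * pi)"
 by (simp add: eq_divide_eq mult.commute)
 moreover have "integ (%x::'a. norm x powr 2 * gauss x)"
 using integrable_Re[OF rapid_integrable[OF rap]] by simp
 ultimately show ?thesis
 by (simp add: nn_integral_eq_integral mult.commute flip: ennreal_mult)
qed

text \<open>|xi|^2 times the squared tangential gradient, that is, the squared gradient on the unit
  sphere of the restriction to the sphere through \<open>xi\<close>. Defined by subtraction so that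
  its integral combines with the Euler term; \<open>ang_eq\<close> shows the sum of squares.\<close>

definition ang :: "('a::euclidean_space => 'a => complex) => 'a => real" where
 "ang D xi = (norm xi)\<^sup>2 * grad2 D xi - csq (eul D xi)"

lemma ang_measurable: "nice z D ==> ang D \<in> bmeas"
 unfolding ang_def[abs_def] using grad2_measurable[of z D] eul_measurable[of z D] by measurable

text \<open>The gradient is split into its radial and tangential components. The vanishing sum says
  that the tangential one is orthogonal to \<open>sgn x\<close>, which removes the cross term in
  \<open>sphere_poincare\<close>.\<close>

lemma ang_eq:
 fixes D :: "'a::euclidean_space => 'a => complex"
 assumes r: "r > 0" and x: "x ~= 0"
 defines "xi \<equiv> r *. sgn x"
 shows "ang D xi = (\<Sum>b\<in>Basis. csq (of_real r * D xi b - of_real (sgn x \<bullet> b) * eul D xi))"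
 and "(\<Sum>b\<in>Basis. of_real (sgn x \<bullet> b) * (of_real r * D xi b - of_real (sgn x \<bullet> b) * eul D xi)) = 0"
proof -
 have n: "norm xi = r" unfolding xi_def using r x by (rule norm_scale_sgn)
 have ns: "norm (sgn x) = 1" using x by (simp add: norm_sgn)
 have eu: "eul D xi = (\<Sum>b\<in>Basis. of_real (sgn x \<bullet> b) * (of_real r * D xi b))"
 unfolding eul_def by (intro sum.cong refl) (simp add: xi_def)
 have s1: "(\<Sum>b\<in>Basis. (sgn x \<bullet> b)\<^sup>2) = 1" using norm_square_eq_sum[of "sgn x"] ns by simp
 then have s1c: "(\<Sum>b\<in>Basis. complex_of_real (sgn x \<bullet> b) * of_real (sgn x \<bullet> b)) = 1"
 by (simp add: power2_eq_square flip: of_real_mult of_real_sum)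
 have "(\<Sum>b\<in>Basis. of_real (sgn x \<bullet> b) * (of_real r * D xi b - of_real (sgn x \<bullet> b) * eul D xi))
 = eul D xi - (\<Sum>b\<in>Basis. complex_of_real (sgn x \<bullet> b) * of_real (sgn x \<bullet> b)) * eul D xi"
 unfolding right_diff_distrib sum_subtractf eu[symmetric] by (simp add: sum_distrib_right mult.assoc)
 then show "(\<Sum>b\<in>Basis. of_real (sgn x \<bullet> b) * (of_real r * D xi b - of_real (sgn x \<bullet> b) * eul D xi)) = 0"
 using s1c by simp
 have sq: "csq (of_real r * D xi b - of_real (sgn x \<bullet> b) * eul D xi)
 = r\<^sup>2 * csq (D xi b) - 2 * (((of_real (sgn x \<bullet> b) * (of_real r * D xi b))) \<bullet> eul D xi) + (sgn x \<bullet> b)\<^sup>2 * csq (eul D xi)" for b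
 using cmod_square_combination[of r "D xi b" "- (sgn x \<bullet> b)" "eul D xi"]
 by (simp add: complex_inner_of_real inner_commute[of _ "eul D xi"])
 show "ang D xi = (\<Sum>b\<in>Basis. csq (of_real r * D xi b - of_real (sgn x \<bullet> b) * eul D xi))"
 unfolding sq sum.distrib sum_subtractf sum_distrib_left[symmetric] sum_distrib_right[symmetric] inner_sum_left[symmetric] eu[symmetric] s1 ang_def n grad2_def
 by (simp add: power2_norm_eq_inner)
qed

lemma sgn_has_derivative:
 fixes x :: "'a::euclidean_space"
 assumes "x ~= 0"
 shows "((%x. r *. sgn x) has_derivative (%h. (r / norm x) *. (h - (sgn x \<bullet> h) *. sgn x))) (at x)"
proof -
 have n: "norm x ~= 0" using assms by simp
 have "((%x::'a. inverse (norm x) *. x) has_derivative (%h. inverse (norm x) *. h + (- (inverse (norm x) * (h \<bullet> sgn x) * inverse (norm x))) *. x)) (at x)"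
 by (rule has_derivative_eq_rhs[OF has_derivative_scaleR[OF Deriv.has_derivative_inverse[OF n has_derivative_norm[OF assms]] has_derivative_ident]]) simp
 from has_derivative_scaleR_right[OF this, of r] show ?thesis
 unfolding sgn_div_norm[abs_def]
 by (rule has_derivative_eq_rhs) (simp add: fun_eq_iff sgn_div_norm divide_inverse inner_commute scaleR_diff_right mult_ac)
qed

lemma complex_inner_of_real': "(of_real a * w) \<bullet> (z :: complex) = a * (w \<bullet> z)"
 by (simp add: inner_complex_def algebra_simps)

text \<open>The Gaussian inequality is applied to the 1-homogeneous function \<open>F\<close>, the
  norm times the centred restriction. On the left |x|^2 is independent of the direction and
  contributes N / (2 pi); on the right the squared gradient of \<open>F\<close> is the squared
  restriction plus the squared tangential gradient. So N X <= X + Y, and subtracting the radial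
  contribution leaves N - 1. The constant is not worsened because linear functions, the first-order
  harmonics, are extremal in both inequalities.\<close>

theorem sphere_poincare:
 fixes v :: "'a::euclidean_space => complex"
 assumes v: "nice v D" and r: "r > 0" and N: "DIM('a) >= 2"
 shows "ennreal (real DIM('a) - 1) * (NN x. ennreal (sph x) * ennreal (csq (v (r *. sgn x) - smean v r)))
 <= (NN x. ennreal (sph x) * ennreal (ang D (r *. sgn x)))"
proof -
 note [measurable] = niceD(3)[OF v] niceD(5)[OF v] eul_measurable[OF v] ang_measurable[OF v]
 define c where "c = smean v r"
 define V where "V x = v (r *. sgn x) - c" for x
 have [measurable]: "V \<in> bmeas" unfolding V_def[abs_def] by measurable
 obtain B0 where B0: "B0 >= 0" "!!xi. cmod (v xi) <= B0" using rapid_bounded[OF niceD(2)[OF v]] by blast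
 define B where "B = B0 + cmod c"
 have B: "B >= 0" "!!x. cmod (V x) <= B"
 using B0 norm_triangle_ineq4[of "v _" c] unfolding V_def B_def
 by (auto intro: add_nonneg_nonneg order_trans[OF norm_triangle_ineq4] add_mono)
 define F where "F x = of_real (norm x) * V x" for x
 define DF where "DF x h = (if x = 0 then 0 else of_real (sgn x \<bullet> h) * V x + (of_real r * D (r *. sgn x) h - of_real (sgn x \<bullet> h) * eul D (r *. sgn x)))" for x h
 have nz: "r *. sgn x ~= 0" if "x ~= 0" for x :: 'a using that r by (simp add: sgn_zero_iff)
 have der: "(F has_derivative DF x) (at x)" if x: "x ~= 0" for x
 proof -
 let ?xi = "r *. sgn x"
 have n: "norm x ~= 0" using x by simp
 note lin = nice_linear[OF v nz[OF x]]
 have dv: "((%x. v (r *. sgn x)) has_derivative (%h. D ?xi ((r / norm x) *. (h - (sgn x \<bullet> h) *. sgn x)))) (at x)"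
 by (rule has_derivative_compose[OF sgn_has_derivative[OF x] niceD(4)[OF v nz[OF x]]])
 have eu: "eul D ?xi = of_real r * D ?xi (sgn x)"
 using eul_eq[OF v nz[OF x]] linear_scale[OF lin, of r "sgn x"] by (simp add: scaleR_conv_of_real)
 have dv': "D ?xi ((r / norm x) *. (h - (sgn x \<bullet> h) *. sgn x)) = of_real (1 / norm x) * (of_real r * D ?xi h - of_real (sgn x \<bullet> h) * eul D ?xi)" for h
 unfolding eu using n by (simp add: linear_scale[OF lin] linear_diff[OF lin] scaleR_conv_of_real algebra_simps)
 have "(V has_derivative (%h. of_real (1 / norm x) * (of_real r * D ?xi h - of_real (sgn x \<bullet> h) * eul D ?xi))) (at x)"
 unfolding V_def[abs_def] using has_derivative_diff[OF dv has_derivative_const[of c]] by (simp add: dv')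
 from has_derivative_mult[OF has_derivative_of_real[OF has_derivative_norm[OF x]] this]
 show ?thesis
 unfolding F_def[abs_def]
 by (rule has_derivative_eq_rhs) (use n x in \<open>simp add: fun_eq_iff DF_def inner_commute\<close>)
 qed
 have contF: "continuous_on UNIV F"
 unfolding continuous_on_eq_continuous_at[OF open_UNIV]
 proof
 fix x :: 'a
 show "isCont F x"
 proof (cases "x = 0")
 case True
 have "(F \<longlongrightarrow> 0) (at 0)"
 proof (rule Lim_null_comparison)
 show "\<forall>\<^sub>F x in at 0. norm (F x) <= B * norm x"
 using B by (auto simp: F_def norm_mult mult.commute[of B] intro!: always_eventually mult_left_mono)
 have "((%x::'a. B * norm x) \<longlongrightarrow> B * norm (0::'a)) (at 0)" by (intro tendsto_intros)
 then show "((%x::'a. B * norm x) \<longlongrightarrow> 0) (at 0)" by simp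
 qed
 then show ?thesis using True by (simp add: isCont_def F_def)
 qed (use der has_derivative_continuous in blast)
 qed
 have mDF: "(%x. DF x b) \<in> bmeas" if "b \<in> Basis" for b
 unfolding DF_def using that by measurable
 obtain Ce where Ce: "Ce >= 0" "!!xi. cmod (eul D xi) <= Ce" using rapid_bounded[OF rapid_eul[OF v]] by blast
 have "\<forall>b\<in>Basis. \<exists>c. \<forall>xi. cmod (of_real (norm xi) * D xi b) <= c" using rapid_bounded[OF niceD(6)[OF v]] by metis
 then obtain K where K: "!!b xi. b \<in> Basis ==> cmod (of_real (norm xi) * D xi b) <= K b" by metis
 have DFL: "cmod (DF x h) <= (B + (sum K Basis + Ce)) * norm h" for x h
 proof (cases "x = 0")
 case True
 have "0 <= sum K Basis" using order_trans[OF norm_ge_zero K] by (intro sum_nonneg)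
 then show ?thesis using True B(1) Ce(1) by (simp add: DF_def)
 next
 case False
 have sh: "\<bar>sgn x \<bullet> h\<bar> <= norm h" using Cauchy_Schwarz_ineq2[of "sgn x" h] False by (simp add: norm_sgn)
 have "cmod (of_real r * D (r *. sgn x) h) <= (\<Sum>b\<in>Basis. cmod (of_real (h \<bullet> b) * (of_real r * D (r *. sgn x) b)))"
 using norm_sum[of "%b. of_real (h \<bullet> b) * (of_real r * D (r *. sgn x) b)" Basis]
 by (subst nice_D_eq[OF v nz[OF False], of h]) (simp add: sum_distrib_left mult.left_commute)
 also have "... <= (\<Sum>b\<in>Basis. norm h * K b)"
 proof (rule sum_mono)
 fix b :: 'a assume b: "b \<in> Basis"
 show "cmod (of_real (h \<bullet> b) * (of_real r * D (r *. sgn x) b)) <= norm h * K b"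
 using K[OF b, of "r *. sgn x"] r False Basis_le_norm[OF b] unfolding norm_mult[of "of_real (h \<bullet> b)"]
 by (intro mult_mono) (auto simp: norm_sgn)
 qed
 finally have "cmod (of_real r * D (r *. sgn x) h) <= norm h * sum K Basis" by (simp add: sum_distrib_left)
 then have "cmod (DF x h) <= norm h * B + (norm h * sum K Basis + norm h * Ce)"
 using False sh B Ce unfolding DF_def
 by (auto simp: norm_mult intro!: norm_triangle_le norm_triangle_le_diff add_mono mult_mono)
 then show ?thesis by (simp add: algebra_simps)
 qed
 have g2: "integ (%x::'a. B\<^sup>2 * (gauss x * (norm x)\<^sup>2))"
 proof -
 have "(NN x. ennreal (gauss x * (norm (x::'a))\<^sup>2)) < \<infinity>"
 using nn_integral_gauss_square[where 'a='a] by (simp add: ennreal_mult)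
 then have "integ (%x::'a. gauss x * (norm x)\<^sup>2)"
 by (intro integrableI_nonneg) auto
 then show ?thesis by simp
 qed
 have iF: "integ (%x. gauss x * csq (F x))"
 proof (rule integrable_bound[OF g2])
 have [measurable]: "F \<in> bmeas" using contF by (rule borel_measurable_continuous_onI)
 show "(%x. gauss x * csq (F x)) \<in> borel_measurable lborel" by simp
 show "AE x in lborel. norm (gauss x * csq (F x)) <= norm (B\<^sup>2 * (gauss x * (norm x)\<^sup>2))"
 proof (rule AE_I2)
 fix x :: 'a
 have "gauss x * ((norm x)\<^sup>2 * csq (V x)) <= gauss x * ((norm x)\<^sup>2 * B\<^sup>2)"
 using B(2)[of x] by (intro mult_left_mono power_mono) auto
 then show "norm (gauss x * csq (F x)) <= norm (B\<^sup>2 * (gauss x * (norm x)\<^sup>2))"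
 by (simp add: F_def norm_mult power_mult_distrib abs_mult mult_ac)
 qed
 qed
 have iV: "integ (%x. of_real (sph x) * V x)" "integ (%x. of_real (sph x) * v (r *. sgn x))"
 proof -
 have bd: "integ (%x. of_real (sph x) * f x)" if "f \<in> bmeas" "!!x. cmod (f x) <= K" for f :: "'a => complex" and K
 proof (rule integrable_bound)
 have "K >= 0" using that(2)[of 0] norm_ge_zero order_trans by blast
 then show "AE x in lborel. norm (of_real (sph x) * f x) <= norm (K * sph x)"
 using that(2) by (auto simp: norm_mult abs_mult mult.commute[of K] intro!: AE_I2 mult_left_mono)
 qed (use that(1) in auto)
 show "integ (%x. of_real (sph x) * V x)" by (rule bd[OF _ B(2)]) measurable
 show "integ (%x. of_real (sph x) * v (r *. sgn x))" by (rule bd[OF _ B0(2)]) measurable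
 qed
 have mean: "(LI x. of_real (gauss x) * F x) = 0"
 proof -
 have "(LI x. of_real (sph x) * V x) = (LI x. of_real (sph x) * v (r *. sgn x) - of_real (sph x) * c)"
 by (simp add: V_def right_diff_distrib)
 also have "... = smean v r - c"
 using iV(2) by (simp add: smean_def)
 finally have 0: "(LI x. of_real (sph x) * V x) = 0" by (simp add: c_def)
 have "(LI x. of_real (gauss x) * F x) = (LI x. of_real (e1 TYPE('a)) * (of_real (sph x) * V x))"
 using e1_pos[where 'a='a] by (intro Bochner_Integration.integral_cong refl) (simp add: F_def sph_def)
 also have "... = 0" by (simp add: 0)
 finally show ?thesis .
 qed
 define X where "X = (NN x. ennreal (sph x) * ennreal (csq (V x)))"
 define Y where "Y = (NN x. ennreal (sph x) * ennreal (ang D (r *. sgn x)))"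
 \<comment> \<open>\<open>V\<close> depends on the direction alone; the idempotent
   \<open>sgn\<close> makes this visible to \<open>radial_independence\<close>.\<close>
 have Vs: "V x = v (r *. sgn (sgn x)) - c" for x by (simp add: V_def sgn_sgn_eq)
 have "ennreal (real DIM('a) / (2 * pi)) * X = (NN x. ennreal (\<bar>norm x\<bar>\<^sup>2 * gauss (norm x)) * ennreal (csq (v (r *. sgn (sgn x)) - c)))"
 proof -
 have "(NN x. ennreal (\<bar>norm x\<bar>\<^sup>2 * gauss (norm x)) * ennreal (csq (v (r *. sgn (sgn x)) - c)))
 = (NN (x::'a). ennreal (\<bar>norm x\<bar>\<^sup>2 * gauss (norm x))) * (NN x. ennreal (sph x) * ennreal (csq (v (r *. sgn (sgn x)) - c)))"
 by (rule radial_independence[of "%y. ennreal (csq (v (r *. sgn y) - c))" "%t. \<bar>t\<bar>\<^sup>2 * gauss t"]) auto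
 also have "(NN (x::'a). ennreal (\<bar>norm x\<bar>\<^sup>2 * gauss (norm x))) = ennreal (real DIM('a) / (2 * pi))"
 unfolding nn_integral_gauss_square[symmetric]
 by (intro nn_integral_cong) (simp add: gauss_def ennreal_mult mult.commute)
 finally show ?thesis by (simp add: X_def Vs)
 qed
 also have "... = (NN x. ennreal (gauss x * csq (F x)))"
 proof (rule nn_integral_cong)
 fix x :: 'a
 have "\<bar>norm x\<bar>\<^sup>2 * gauss (norm x) * csq (v (r *. sgn (sgn x)) - c) = gauss x * csq (F x)"
 by (simp add: F_def norm_mult power_mult_distrib gauss_def flip: Vs)
 then show "ennreal (\<bar>norm x\<bar>\<^sup>2 * gauss (norm x)) * ennreal (csq (v (r *. sgn (sgn x)) - c)) = ennreal (gauss x * csq (F x))"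
 by (simp flip: ennreal_mult)
 qed
 also have "... = ennreal (LI x. gauss x * csq (F x))"
 using iF by (intro nn_integral_eq_integral) auto
 also have "... <= (\<Sum>b\<in>Basis. NN x. ennreal (gauss x) * ennreal (csq (DF x b) / (2 * pi)))"
 proof -
 have "(LI x. gauss x * csq (F x)) <= (\<Sum>b\<in>Basis. LI x. gauss x * (csq (DF x b) / (2 * pi)))"
 using gauss_poincare[OF contF der mDF DFL] by (simp add: mean scaleR_conv_of_real sum_divide_distrib)
 also have "... = (\<Sum>b\<in>Basis. enn2real (NN x. ennreal (gauss x) * ennreal (csq (DF x b) / (2 * pi))))"
 using mDF by (intro sum.cong refl) (subst integral_eq_nn_integral, auto simp flip: ennreal_mult)
 finally have "ennreal (LI x. gauss x * csq (F x)) <= (\<Sum>b\<in>Basis. ennreal (enn2real (NN x. ennreal (gauss x) * ennreal (csq (DF x b) / (2 * pi)))))"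
 by (simp add: ennreal_leI)
 also have "... <= (\<Sum>b\<in>Basis. NN x. ennreal (gauss x) * ennreal (csq (DF x b) / (2 * pi)))"
 by (intro sum_mono) (simp add: ennreal_enn2real_if)
 finally show ?thesis .
 qed
 also have "... = (NN x. (\<Sum>b\<in>Basis. ennreal (gauss x) * ennreal (csq (DF x b) / (2 * pi))))"
 using mDF by (intro nn_integral_sum[symmetric]) auto
 also have "... = (NN x. ennreal (1 / (2 * pi)) * (ennreal (gauss x) * (ennreal (csq (V x)) + ennreal (ang D (r *. sgn x)))))"
 proof (rule nn_integral_cong_AE)
 show "AE x in lborel. (\<Sum>b\<in>Basis. ennreal (gauss x) * ennreal (csq (DF x b) / (2 * pi))) = ennreal (1 / (2 * pi)) * (ennreal (gauss x) * (ennreal (csq (V x)) + ennreal (ang D (r *. sgn x))))"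
 using AE_neq_0
 proof eventually_elim
 case (elim x)
 let ?T = "%b. of_real r * D (r *. sgn x) b - of_real (sgn x \<bullet> b) * eul D (r *. sgn x)"
 have "(\<Sum>b\<in>Basis. csq (DF x b)) = (\<Sum>b\<in>Basis. (sgn x \<bullet> b)\<^sup>2 * csq (V x) + 2 * (V x \<bullet> (of_real (sgn x \<bullet> b) * ?T b)) + csq (?T b))"
 unfolding DF_def norm_square_add using elim
 by (intro sum.cong refl) (simp add: norm_square_add norm_mult power_mult_distrib complex_inner_of_real complex_inner_of_real' del: inner_mult_left)
 
 also have "... = (\<Sum>b\<in>Basis. (sgn x \<bullet> b)\<^sup>2) * csq (V x) + 2 * (V x \<bullet> (\<Sum>b\<in>Basis. of_real (sgn x \<bullet> b) * ?T b)) + (\<Sum>b\<in>Basis. csq (?T b))"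
 by (simp only: sum.distrib inner_sum_right sum_distrib_left sum_distrib_right)
 also have "... = csq (V x) + ang D (r *. sgn x)"
 unfolding ang_eq(2)[OF r elim] ang_eq(1)[OF r elim] using norm_square_eq_sum[of "sgn x"] elim by (simp add: norm_sgn)
 finally have s: "(\<Sum>b\<in>Basis. csq (DF x b)) = csq (V x) + ang D (r *. sgn x)" .
 have a0: "ang D (r *. sgn x) >= 0" unfolding ang_eq(1)[OF r elim] by (simp add: sum_nonneg)
 have "(\<Sum>b\<in>Basis. ennreal (gauss x) * ennreal (csq (DF x b) / (2 * pi))) = ennreal (\<Sum>b\<in>Basis. gauss x * (csq (DF x b) / (2 * pi)))"
 by (simp flip: ennreal_mult)
 also have "(\<Sum>b\<in>Basis. gauss x * (csq (DF x b) / (2 * pi))) = (1 / (2 * pi)) * (gauss x * (csq (V x) + ang D (r *. sgn x)))"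
 unfolding s[symmetric] by (simp add: sum_distrib_left sum_divide_distrib)
 finally show ?case using a0 by (simp flip: ennreal_mult ennreal_plus)
 qed
 qed
 also have "... = ennreal (1 / (2 * pi)) * (X + Y)"
 proof -
 have "(NN x. ennreal (gauss x) * (ennreal (csq (V x)) + ennreal (ang D (r *. sgn x))))
 = (NN x. ennreal (gauss x) * (%y. ennreal (csq (v (r *. sgn y) - c)) + ennreal (ang D (r *. sgn y))) (sgn x))"
 by (simp add: V_def sgn_sgn_eq)
 also have "... = (NN x. ennreal (sph x) * (%y. ennreal (csq (v (r *. sgn y) - c)) + ennreal (ang D (r *. sgn y))) (sgn x))"
 by (rule nn_integral_sph_eq_gauss[symmetric]) measurable
 also have "... = (NN x. ennreal (sph x) * ennreal (csq (V x)) + ennreal (sph x) * ennreal (ang D (r *. sgn x)))"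
 by (simp add: V_def sgn_sgn_eq distrib_left)
 also have "... = X + Y"
 unfolding X_def Y_def by (rule nn_integral_add) measurable
 finally show ?thesis by (subst nn_integral_cmult) auto
 qed
 finally have le: "ennreal (real DIM('a) / (2 * pi)) * X <= ennreal (1 / (2 * pi)) * (X + Y)" .
 \<comment> \<open>In the extended reals \<open>X\<close> can be subtracted from both sides only
   when it is finite.\<close>
 have X: "X < \<infinity>"
 proof -
 have "X <= (NN x. ennreal (B\<^sup>2) * ennreal (sph (x::'a)))"
 unfolding X_def using B(2) by (intro nn_integral_mono) (auto simp: mult.commute[of "ennreal (B\<^sup>2)"] intro!: mult_left_mono ennreal_leI power_mono)
 also have "... = ennreal (B\<^sup>2)" by (simp add: nn_integral_cmult nn_integral_sph)
 finally show ?thesis by (rule le_less_trans) simp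
 qed
 have "ennreal (real DIM('a) - 1) * X <= Y"
 proof (cases Y)
 case top then show ?thesis by simp
 next
 case (real y)
 obtain x where x: "X = ennreal x" "x >= 0" using X by (cases X) auto
 have "ennreal (real DIM('a) / (2 * pi) * x) <= ennreal (1 / (2 * pi) * (x + y))"
 using le unfolding x(1) real(2) using x(2) real(1) by (subst (1 2) ennreal_mult) (simp_all add: ennreal_plus)
 then have "real DIM('a) / (2 * pi) * x <= 1 / (2 * pi) * (x + y)"
 using x(2) real(1) by (simp add: ennreal_le_iff)
 then have "(real DIM('a) - 1) * x <= y" by (simp add: field_simps)
 then have "ennreal ((real DIM('a) - 1) * x) <= ennreal y" by (rule ennreal_leI)
 then show ?thesis using x real N by (simp add: ennreal_mult)
 qed
 then show ?thesis unfolding X_def Y_def V_def c_def .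
qed

text \<open>Testing the polar formula with \<open>gauss\<close> shows that its constant is
  \<open>radial_mass\<close>, which is positive and finite and can later be cancelled.\<close>

lemma nn_integral_polar_sph:
 fixes H :: "'a::euclidean_space => ennreal"
 assumes [measurable]: "H \<in> bmeas"
 shows "(NN r. indicator {0<..} r * ennreal (r ^ (DIM('a) - 1)) * (NN x. ennreal (sph x) * H (r *. sgn x)))
 = radial_mass DIM('a) * (NN x. H x)"
proof -
 let ?ph = "%t. \<bar>t\<bar> * gauss t / e1 TYPE('a)" and ?n = "DIM('a)"
 have P: "(NN r. indicator {0<..} r * ennreal (r ^ (?n - 1)) * (NN x. ennreal (sph x) * H (r *. sgn x)))
 = polar_const ?ph ?n * (NN x. H x)" if [measurable]: "H \<in> bmeas" for H :: "'a => ennreal"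
 unfolding sph_eq using e1_pos[where 'a='a] by (intro nn_integral_polar) auto
 have inner: "(NN x. ennreal (sph x) * ennreal (gauss (r *. sgn (x::'a)))) = ennreal (gauss r)" if "r > 0" for r :: real
 proof -
 have "(NN x. ennreal (sph x) * ennreal (gauss (r *. sgn (x::'a)))) = (NN x. ennreal (sph (x::'a)) * ennreal (gauss r))"
 proof (rule nn_integral_cong_AE)
 show "AE x in lborel. ennreal (sph x) * ennreal (gauss (r *. sgn (x::'a))) = ennreal (sph x) * ennreal (gauss r)"
 using AE_neq_0
 proof eventually_elim
 case (elim x)
 then show ?case unfolding gauss_def by (simp add: norm_scale_sgn[OF that] del: norm_scaleR)
 qed
 qed
 then show ?thesis by (simp add: nn_integral_multc nn_integral_sph)
 qed
 have "polar_const ?ph ?n = polar_const ?ph ?n * (NN x. ennreal (gauss (x::'a)))"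
 by (simp add: nn_integral_gauss)
 also have "... = radial_mass ?n"
 unfolding radial_mass_def
 by (subst P[symmetric]) (auto intro!: nn_integral_cong simp: indicator_def inner mult.assoc)
 finally show ?thesis using P[OF assms] by simp
qed

lemma integrable_sph_mult:
 fixes f :: "'a::euclidean_space => complex"
 assumes "f \<in> bmeas" "!!x. cmod (f x) <= K"
 shows "integ (%x. of_real (sph x) * f x)"
proof (rule integrable_bound)
 have "K >= 0" using assms(2)[of 0] norm_ge_zero order_trans by blast
 then show "AE x in lborel. norm (of_real (sph x) * f x) <= norm (K * sph x)"
 using assms(2) by (auto simp: norm_mult abs_mult mult.commute[of K] intro!: AE_I2 mult_left_mono)
 show "integ (%x::'a. K * sph x)" by simp
qed (use assms(1) in auto)

lemma integrable_smean:
 assumes "rapid f" shows "integ (%x. of_real (sph x) * f (r *. sgn x))"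
proof -
 obtain C where "!!x. cmod (f x) <= C" using rapid_bounded[OF assms] by blast
 then show ?thesis using rapidD_measurable[OF assms] by (intro integrable_sph_mult) auto
qed

lemma norm_smean_le:
 fixes f :: "'a::euclidean_space => complex"
 assumes "r > 0" and f: "f \<in> bmeas" "!!x. norm x = r ==> cmod (f x) <= K"
 shows "cmod (smean f r) <= K"
proof -
 have ae: "AE x in lborel. cmod (of_real (sph x) * f (r *. sgn x)) <= K * sph (x::'a)"
 using AE_neq_0
 proof eventually_elim
 case (elim x)
 then show ?case using f(2)[OF norm_scale_sgn[OF \<open>r > 0\<close>]]
 by (simp add: norm_mult mult.commute[of K] mult_left_mono)
 qed
 then have ae': "AE x in lborel. 0 <= K * sph (x::'a)"
 by eventually_elim (rule order_trans[OF norm_ge_zero])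
 have "cmod (smean f r) <= (LI x. K * sph (x::'a))"
 unfolding smean_def
 by (rule order_trans[OF integral_norm_bound integral_mono_AE'[OF _ ae ae']]) simp
 then show ?thesis by simp
qed

lemma smean_measurable:
 fixes f :: "'a::euclidean_space => complex"
 assumes [measurable]: "f \<in> bmeas" shows "smean f \<in> bmeas"
 unfolding smean_def[abs_def] by measurable

lemma rapid_smean:
 fixes f :: "'a::euclidean_space => complex"
 assumes f: "rapid f" shows "rapid (%xi::'a. smean f (norm xi))"
proof -
 note [measurable] = smean_measurable[OF rapidD_measurable[OF f]]
 have "\<exists>C. \<forall>xi::'a. cmod (if xi = 0 then 0 else smean f (norm xi)) * (1 + norm xi) ^ k <= C" for k
 proof -
 obtain C where C: "C >= 0" "!!x. cmod (f x) <= C / (1 + norm x) ^ k" using rapid_bound[OF f] by blast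
 have "cmod (if xi = 0 then 0 else smean f (norm xi)) * (1 + norm xi) ^ k <= C" for xi :: 'a
 proof (cases "xi = 0")
 case False
 have "cmod (smean f (norm xi)) <= C / (1 + norm xi) ^ k"
 using C(2) False by (intro norm_smean_le rapidD_measurable[OF f]) (auto, metis C(2))
 moreover have "(1 + norm xi) ^ k > 0" by (intro zero_less_power add_pos_nonneg) auto
 ultimately show ?thesis using False by (simp add: pos_le_divide_eq)
 qed (use C in simp)
 then show ?thesis by blast
 qed
 then have "rapid (%xi::'a. if xi = 0 then 0 else smean f (norm xi))"
 unfolding rapid_def by (intro conjI allI) auto
 then show ?thesis by (rule rapid_eq_off_0) auto
qed

lemma smean_diff:
 "rapid f ==> rapid g ==> smean (%x. f x - g x) r = smean f r - smean g r"
 using integrable_smean[of f r] integrable_smean[of g r] by (simp add: smean_def right_diff_distrib)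

lemma smean_radial_mult:
 fixes f :: "'a::euclidean_space => complex"
 assumes [measurable]: "f \<in> bmeas" "k \<in> bmeas" and r: "r > 0"
 shows "smean (%x. k (norm x) * f x) r = k r * smean f r"
proof -
 have "smean (%x. k (norm x) * f x) r = (LI x. k r * (of_real (sph x) * f (r *. sgn x)))"
 unfolding smean_def
 proof (rule integral_cong_AE)
 show "AE x in lborel. of_real (sph x) * (k (norm (r *. sgn x)) * f (r *. sgn x)) = k r * (of_real (sph (x::'a)) * f (r *. sgn x))"
 using AE_neq_0
 proof eventually_elim
 case (elim x)
 show ?case unfolding norm_scale_sgn[OF r elim] by (rule mult.left_commute)
 qed
 qed measurable
 then show ?thesis by (simp add: smean_def)
qed

lemma smean_const: "smean (%x::'a::euclidean_space. c) r = c"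
proof -
 have "(LI x. complex_of_real (sph (x::'a)) * c) = (LI x. complex_of_real (sph (x::'a))) * c"
 by (intro integral_mult_left_zero)
 then show ?thesis by (simp add: smean_def)
qed

lemma smean_radial:
 assumes "k \<in> bmeas" "r > 0"
 shows "smean (%x::'a::euclidean_space. k (norm x)) r = k r"
 using smean_radial_mult[of "%_::'a. 1" k r] assms by (simp add: smean_const)

lemma smean_minus_smean:
 fixes f :: "'a::euclidean_space => complex"
 assumes f: "rapid f" and r: "r > 0"
 shows "smean (%x. f x - smean f (norm x)) r = 0"
 using smean_diff[OF f rapid_smean[OF f]] smean_radial[OF smean_measurable[OF rapidD_measurable[OF f]] r, where 'a='a]
 by simp

lemma continuous_smean:
 assumes f: "rapid f" and cont: "continuous_on UNIV f"
 shows "continuous_on UNIV (smean f)"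
 unfolding continuous_on_sequentially
proof (intro allI ballI impI, elim conjE)
 fix X :: "nat => real" and r assume X: "X ----> r"
 obtain C where C: "!!x. cmod (f x) <= C" using rapid_bounded[OF f] by blast
 have [measurable]: "f \<in> bmeas" by (rule rapidD_measurable[OF f])
 show "(smean f \<circ> X) ----> smean f r"
 unfolding comp_def smean_def
 proof (rule integral_dominated_convergence[where w="%x. C * sph x"])
 show "AE x in lborel. (%i. complex_of_real (sph x) * f (X i *. sgn x)) ----> complex_of_real (sph (x::'a)) * f (r *. sgn x)"
 proof (rule AE_I2)
 fix x :: 'a
 have "(%i. X i *. sgn x) ----> r *. sgn x" using X by (intro tendsto_intros)
 moreover have "isCont f (r *. sgn x)" using cont by (simp add: continuous_on_eq_continuous_at)
 ultimately have "(%i. f (X i *. sgn x)) ----> f (r *. sgn x)" using isCont_tendsto_compose by blast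
 then show "(%i. complex_of_real (sph x) * f (X i *. sgn x)) ----> complex_of_real (sph x) * f (r *. sgn x)"
 by (intro tendsto_intros)
 qed
 show "AE x in lborel. norm (complex_of_real (sph x) * f (X i *. sgn x)) <= C * sph (x::'a)" for i
 using C by (auto simp: norm_mult mult.commute[of C] intro!: mult_left_mono)
 show "integ (%x::'a. C * sph x)" by simp
 qed measurable
qed

text \<open>Along a ray the derivative of \<open>v\<close> is the Euler derivative divided by the
  radius, and averaging over directions commutes with it.\<close>

lemma smean_has_vector_derivative:
 assumes v: "nice v D" and r: "r > 0"
 shows "(smean v has_vector_derivative smean (eul D) r / of_real r) (at r)"
proof -
 note [measurable] = niceD(3)[OF v] eul_measurable[OF v]
 obtain C where C: "C >= 0" "!!x. cmod (eul D x) <= C" using rapid_bounded[OF rapid_eul[OF v]] by blast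
 have e: "((%t. v (t *. sgn x)) has_vector_derivative eul D (t *. sgn x) / of_real t) (at t)" if x: "x ~= 0" and t: "t > 0" for x and t :: real
 proof -
 have nz: "t *. sgn x ~= 0" using x t by (simp add: sgn_zero_iff)
 have "((%t. t *. sgn x) has_derivative (%h. h *. sgn x)) (at t)" by (auto intro!: derivative_eq_intros)
 then have d: "((%t. v (t *. sgn x)) has_derivative (%h. D (t *. sgn x) (h *. sgn x))) (at t)"
 by (rule has_derivative_compose[where f="%t. t *. sgn x"]) (rule niceD(4)[OF v nz])
 have "D (t *. sgn x) (h *. sgn x) = h *. (eul D (t *. sgn x) / of_real t)" for h
 using t by (simp add: eul_eq[OF v nz] linear_scale[OF nice_linear[OF v nz]] scaleR_conv_of_real)
 with d show ?thesis by (simp add: has_vector_derivative_def)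
 qed
 \<comment> \<open>The neighbourhood of radius \<open>r / 2\<close> keeps \<open>t\<close> above
   \<open>r / 2\<close>, so that the Euler derivative divided by \<open>t\<close> is at most
   \<open>2 * C / r\<close> in modulus.\<close>
 have "((%t. LI x. of_real (sph x) * v (t *. sgn x)) has_derivative
 (%h. LI x. of_real (sph x) * (h *. (eul D (r *. sgn x) / of_real r)))) (at r)"
 proof (rule has_derivative_integral[where d="r/2" and K="%x. sph x * (2 * C / r)"])
 show "integ (%x. of_real (sph x) * v (t *. sgn x))" for t by (rule integrable_smean[OF niceD(2)[OF v]])
 show "integ (%x. of_real (sph x) * (h *. (eul D (r *. sgn x) / of_real r)))" for h
 using integrable_mult_right[OF integrable_smean[OF rapid_eul[OF v], of r], of "of_real h / of_real r"]
 by (simp add: scaleR_conv_of_real mult_ac)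
 show "AE x in lborel. ((%t. of_real (sph x) * v (t *. sgn x)) has_derivative (%h. of_real (sph x) * (h *. (eul D (r *. sgn x) / of_real r)))) (at r)"
 using AE_neq_0 by eventually_elim (intro has_derivative_mult_right e[unfolded has_vector_derivative_def] r)
 show "integ (%x::'a. sph x * (2 * C / r))" by simp
 show "AE x in lborel. \<forall>t\<in>ball r (r / 2). cmod (of_real (sph x) * v (t *. sgn x) - of_real (sph x) * v (r *. sgn x)) <= sph x * (2 * C / r) * norm (t - r)"
 using AE_neq_0
 proof eventually_elim
 case (elim x)
 show ?case
 proof
 fix t assume t: "t \<in> ball r (r / 2)"
 have "cmod (v (t *. sgn x) - v (r *. sgn x)) <= (2 * C / r) * norm (t - r)"
 proof (rule differentiable_bound[of "ball r (r/2)" "%t. v (t *. sgn x)" "%t h. h *. (eul D (t *. sgn x) / of_real t)"])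
 fix y assume y: "y \<in> ball r (r / 2)"
 then have "\<bar>r - y\<bar> < r / 2" by (simp add: dist_real_def)
 then have y2: "y > r / 2" by linarith
 then have y0: "y > 0" using r by linarith
 show "((%t. v (t *. sgn x)) has_derivative (%h. h *. (eul D (y *. sgn x) / of_real y))) (at y within ball r (r / 2))"
 using e[OF elim y0] by (auto simp: has_vector_derivative_def intro: has_derivative_at_withinI)
 have "cmod (eul D (y *. sgn x)) / y <= C / (r / 2)"
 using C y2 r by (intro frac_le) auto
 then have "cmod (eul D (y *. sgn x) / of_real y) <= C / (r / 2)"
 using y0 by (simp add: norm_divide)
 from mult_left_mono[OF this, of "\<bar>h\<bar>" for h :: real]
 have "cmod (h *. (eul D (y *. sgn x) / of_real y)) <= 2 * C / r * norm h" for h :: real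
 by (simp add: mult_ac)
 then show "onorm (%h. h *. (eul D (y *. sgn x) / of_real y)) <= 2 * C / r"
 by (rule onorm_le)
 qed (use r t in auto)
 then have "sph x * cmod (v (t *. sgn x) - v (r *. sgn x)) <= sph x * ((2 * C / r) * norm (t - r))"
 by (intro mult_left_mono) auto
 then show "cmod (of_real (sph x) * v (t *. sgn x) - of_real (sph x) * v (r *. sgn x)) <= sph x * (2 * C / r) * norm (t - r)"
 by (simp add: right_diff_distrib[symmetric] norm_mult mult.assoc)
 qed
 qed
 show "AE x in lborel. \<forall>h. cmod (of_real (sph x) * (h *. (eul D (r *. sgn x) / of_real r))) <= sph x * (2 * C / r) * norm h"
 proof (intro AE_I2 allI)
 fix x :: 'a and h :: real
 have "cmod (eul D (r *. sgn x)) / r <= 2 * C / r"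
 using C(1) C(2)[of "r *. sgn x"] r by (intro divide_right_mono) auto
 then have "sph x * (\<bar>h\<bar> * (cmod (eul D (r *. sgn x)) / r)) <= sph x * (\<bar>h\<bar> * (2 * C / r))"
 by (intro mult_left_mono) auto
 then show "cmod (of_real (sph x) * (h *. (eul D (r *. sgn x) / of_real r))) <= sph x * (2 * C / r) * norm h"
 using r by (simp add: norm_mult norm_divide mult_ac)
 qed
 qed (use r in auto)
 moreover have "(LI x. of_real (sph x) * (h *. (eul D (r *. sgn x) / of_real r))) = h *. (smean (eul D) r / of_real r)" for h
 proof -
 have "(LI x. of_real (sph x) * (h *. (eul D (r *. sgn x) / of_real r))) = (LI x. (of_real h / of_real r) * (of_real (sph x) * eul D (r *. sgn x)))"
 by (intro Bochner_Integration.integral_cong refl) (simp add: scaleR_conv_of_real)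
 then show ?thesis by (simp add: smean_def scaleR_conv_of_real)
 qed
 ultimately show ?thesis by (simp add: has_vector_derivative_def smean_def[abs_def])
qed

text \<open>The derivative of a radial function whose derivative in the radius is \<open>q\<close>;
  division by zero makes it vanish at the origin.\<close>

definition radD :: "(real => complex) => 'a::euclidean_space => 'a => complex" where
 "radD q xi h = of_real ((xi \<bullet> h) / norm xi) * q (norm xi)"

lemma nice_radial:
 fixes q q' :: "real => complex"
 assumes cont: "continuous_on {0..} q" and rap: "rapid (%xi::'a::euclidean_space. q (norm xi))"
 and der: "!!r. r > 0 ==> (q has_vector_derivative q' r) (at r)"
 and [measurable]: "q' \<in> bmeas" and rap': "rapid (%xi::'a. of_real (norm xi) * q' (norm xi))"
 shows "nice (%xi::'a. q (norm xi)) (radD q')"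
 unfolding nice_def
proof (intro conjI ballI allI impI)
 show "continuous_on UNIV (%xi::'a. q (norm xi))"
 by (rule continuous_on_compose2[OF cont, where f=norm]) (rule continuous_on_norm_id, auto)
 fix b :: 'a assume b: "b \<in> Basis"
 show m: "(%xi. radD q' xi b) \<in> bmeas" unfolding radD_def by measurable
 show "rapid (%xi. of_real (norm xi) * radD q' xi b)"
 proof (rule rapid_dominated[OF rap', where C=1 and j=0])
 show "(%xi. of_real (norm xi) * radD q' xi b) \<in> bmeas" using m by measurable
 fix xi :: 'a
 have "\<bar>xi \<bullet> b\<bar> <= norm xi" using Basis_le_norm[OF b, of xi] by simp
 from mult_right_mono[OF this, of "cmod (q' (norm xi))"]
 show "cmod (of_real (norm xi) * radD q' xi b) <= 1 * (1 + norm xi) ^ 0 * cmod (of_real (norm xi) * q' (norm xi))"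
 by (simp add: radD_def norm_mult norm_divide)
 qed
next
 fix xi :: 'a assume xi: "xi ~= 0"
 have "((%xi. q (norm xi)) has_derivative (%h. (xi \<bullet> h / norm xi) *. q' (norm xi))) (at xi)"
 proof (rule has_derivative_compose[where g=q])
 show "(norm has_derivative (%h. xi \<bullet> h / norm xi)) (at xi)"
 by (rule has_derivative_eq_rhs[OF has_derivative_norm[OF xi]])
 (simp add: fun_eq_iff sgn_div_norm divide_inverse inner_commute mult.commute)
 show "(q has_derivative (%h. h *. q' (norm xi))) (at (norm xi))"
 using der[of "norm xi"] xi by (simp add: has_vector_derivative_def)
 qed
 then show "((%xi. q (norm xi)) has_derivative radD q' xi) (at xi)"
 by (rule has_derivative_eq_rhs) (simp add: fun_eq_iff radD_def scaleR_conv_of_real)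
qed (rule rap)

lemma eul_radD: "eul (radD q) xi = of_real (norm xi) * q (norm xi)"
proof (cases "xi = 0")
 case False
 have "eul (radD q) xi = of_real (\<Sum>b\<in>Basis. (xi \<bullet> b)\<^sup>2) * (q (norm xi) / of_real (norm xi))"
 by (simp add: eul_def radD_def sum_distrib_right sum_divide_distrib power2_eq_square mult.assoc)
 then show ?thesis using False unfolding norm_square_eq_sum[symmetric] by (simp add: power2_eq_square)
qed simp

lemma grad2_radD: "(norm xi)\<^sup>2 * grad2 (radD q) xi = (norm xi)\<^sup>2 * csq (q (norm xi))"
proof (cases "xi = 0")
 case False
 have "grad2 (radD q) xi = (\<Sum>b\<in>Basis. (xi \<bullet> b)\<^sup>2) * (csq (q (norm xi)) / (norm xi)\<^sup>2)"
 by (simp add: grad2_def radD_def sum_distrib_right sum_divide_distrib norm_mult norm_divide power_mult_distrib power_divide)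
 then show ?thesis using False unfolding norm_square_eq_sum[symmetric] by simp
qed simp

lemma nice_smean:
 fixes v :: "'a::euclidean_space => complex"
 assumes v: "nice v D" shows "nice (%xi::'a. smean v (norm xi)) (radD (%r. smean (eul D) r / of_real r))"
proof (rule nice_radial)
 note [measurable] = smean_measurable[OF eul_measurable[OF v]]
 show "continuous_on {0..} (smean v)"
 using continuous_smean[OF niceD(2,1)[OF v]] by (rule continuous_on_subset) simp
 show "rapid (%xi::'a. smean v (norm xi))" by (rule rapid_smean[OF niceD(2)[OF v]])
 show "(%r. smean (eul D) r / of_real r) \<in> bmeas" by measurable
 show "rapid (%xi::'a. of_real (norm xi) * (smean (eul D) (norm xi) / of_real (norm xi)))"
 by (rule rapid_eq_off_0[OF rapid_smean[OF rapid_eul[OF v]]]) auto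
qed (rule smean_has_vector_derivative[OF v])

text \<open>Pythagoras on one sphere: the cross term with a constant vanishes because
  \<open>X\<close> has mean zero there. \<open>nn_integral_square_add_radial\<close> integrates this
  over the radii with a radial weight.\<close>

lemma nn_integral_sph_square_add:
 fixes X :: "'a::euclidean_space => complex"
 assumes X: "rapid X" "smean X r = 0"
 shows "(NN x. ennreal (sph x) * ennreal (csq (X (r *. sgn x) + c)))
 = (NN x. ennreal (sph x) * ennreal (csq (X (r *. sgn x)))) + ennreal (csq c)"
proof -
 let ?X = "%x. X (r *. sgn x)"
 note [measurable] = rapidD_measurable[OF X(1)]
 obtain C where C: "!!x. cmod (X x) <= C" using rapid_bounded[OF X(1)] by blast
 have i1: "integ (%x. sph x * csq (?X x))"
 proof (rule integrable_bound)
 show "integ (%x::'a. sph x * C\<^sup>2)" by simp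
 have "sph x * csq (?X x) <= sph x * C\<^sup>2" for x
 using C[of "r *. sgn x"] by (intro mult_left_mono power_mono) auto
 then show "AE x in lborel. norm (sph x * csq (?X x)) <= norm (sph x * C\<^sup>2)" by (simp add: abs_mult)
 qed measurable
 have iX: "integ (%x. of_real (sph x) * ?X x)" by (rule integrable_smean[OF X(1)])
 have i2: "integ (%x. (of_real (sph x) * ?X x) \<bullet> c)"
 using iX by (rule integrable_inner_left)
 have z: "(LI x. (of_real (sph x) * ?X x) \<bullet> c) = 0"
 using X(2) iX by (simp add: smean_def)
 have eq: "sph x * csq (?X x + c) = sph x * csq (?X x) + 2 * ((of_real (sph x) * ?X x) \<bullet> c) + sph x * csq c" for x
 unfolding norm_square_add by (simp add: complex_inner_of_real' algebra_simps)
 have i0: "integ (%x. sph x * csq (?X x + c))"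
 unfolding eq using i1 i2 by simp
 have s: "(LI x. sph x * csq (?X x + c)) = (LI x. sph x * csq (?X x)) + csq c"
 unfolding eq using i1 i2 by (simp add: z)
 have nn: "(NN x. ennreal (sph x) * ennreal (csq (f x))) = ennreal (LI x. sph x * csq (f x))"
 if "integ (%x. sph x * csq (f x))" for f :: "'a => complex"
 using nn_integral_eq_integral[OF that] by (simp add: ennreal_mult)
 show ?thesis unfolding nn[OF i0] nn[OF i1] s by (rule ennreal_plus) (auto intro!: integral_nonneg_AE)
qed

lemma radial_mass_cancel: "radial_mass n * a = radial_mass n * b ==> a = b"
 using radial_mass_pos[of n] radial_mass_finite[of n, THEN less_imp_neq] by (auto simp: ennreal_mult_cancel_left)

lemma radial_mass_cancel_le: "radial_mass n * a <= radial_mass n * b ==> a <= b"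
 using radial_mass_pos[of n] radial_mass_finite[of n] by (subst (asm) ennreal_mult_le_mult_iff) auto

lemma nn_integral_square_add_radial:
 fixes X :: "'a::euclidean_space => complex" and ph :: "real => real"
 assumes X: "rapid X" "!!r. r > 0 ==> smean X r = 0"
 and [measurable]: "y \<in> bmeas" "ph \<in> bmeas" and ph: "!!t. ph t >= 0"
 shows "(NN xi. ennreal (ph (norm xi)) * ennreal (csq (X xi + y (norm xi))))
 = (NN xi. ennreal (ph (norm xi)) * ennreal (csq (X xi)))
 + (NN (xi::'a). ennreal (ph (norm xi)) * ennreal (csq (y (norm xi))))"
proof (rule radial_mass_cancel[of "DIM('a)"])
 let ?n = "DIM('a)"
 note [measurable] = rapidD_measurable[OF X(1)]
 let ?w = "%r. indicator {0<..} r * ennreal (r ^ (?n - 1))"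
 let ?A = "%r. NN x. ennreal (sph x) * ennreal (csq (X (r *. sgn x)))"
 have polar: "radial_mass ?n * (NN xi. ennreal (ph (norm xi)) * H xi (norm xi))
 = (NN r. ?w r * (ennreal (ph r) * (NN x. ennreal (sph x) * H (r *. sgn x) r)))"
 if [measurable]: "(%(xi, r). H xi r) \<in> borel_measurable (borel \<Otimes>\<^sub>M borel)" for H :: "'a => real => ennreal"
 proof -
 have "radial_mass ?n * (NN xi. ennreal (ph (norm xi)) * H xi (norm xi))
 = (NN r. ?w r * (NN x. ennreal (sph x) * (ennreal (ph (norm (r *. sgn x))) * H (r *. sgn x) (norm (r *. sgn x)))))"
 by (rule nn_integral_polar_sph[symmetric]) measurable
 also have "... = (NN r. ?w r * (ennreal (ph r) * (NN x. ennreal (sph x) * H (r *. sgn x) r)))"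
 proof (rule nn_integral_cong)
 fix r :: real
 have "(NN x. ennreal (sph x) * (ennreal (ph (norm (r *. sgn x))) * H (r *. sgn x) (norm (r *. sgn x))))
 = ennreal (ph r) * (NN x. ennreal (sph x) * H (r *. sgn x) r)" if r: "r > 0"
 proof -
 have "(NN x. ennreal (sph x) * (ennreal (ph (norm (r *. sgn x))) * H (r *. sgn x) (norm (r *. sgn x))))
 = (NN x. ennreal (ph r) * (ennreal (sph x) * H (r *. sgn x) r))"
 proof (rule nn_integral_cong_AE)
 show "AE x in lborel. ennreal (sph x) * (ennreal (ph (norm (r *. sgn x))) * H (r *. sgn x) (norm (r *. sgn x))) = ennreal (ph r) * (ennreal (sph x) * H (r *. sgn x) r)"
 using AE_neq_0
 proof eventually_elim
 case (elim x)
 show ?case unfolding norm_scale_sgn[OF r elim] by (rule mult.left_commute)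
 qed
 qed
 then show ?thesis by (simp add: nn_integral_cmult)
 qed
 then show "?w r * (NN x. ennreal (sph x) * (ennreal (ph (norm (r *. sgn x))) * H (r *. sgn x) (norm (r *. sgn x))))
 = ?w r * (ennreal (ph r) * (NN x. ennreal (sph x) * H (r *. sgn x) r))"
 by (cases "r > 0") auto
 qed
 finally show ?thesis .
 qed
 have "radial_mass ?n * (NN xi. ennreal (ph (norm xi)) * ennreal (csq (X xi + y (norm xi))))
 = (NN r. ?w r * (ennreal (ph r) * (NN x. ennreal (sph x) * ennreal (csq (X (r *. sgn x) + y r)))))"
 by (rule polar[where H="%xi r. ennreal (csq (X xi + y r))"]) measurable
 also have "... = (NN r. ?w r * (ennreal (ph r) * ?A r) + ?w r * (ennreal (ph r) * (NN x. ennreal (sph (x::'a)) * ennreal (csq (y r)))))"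
 proof (rule nn_integral_cong)
 fix r :: real
 show "?w r * (ennreal (ph r) * (NN x. ennreal (sph x) * ennreal (csq (X (r *. sgn x) + y r))))
 = ?w r * (ennreal (ph r) * ?A r) + ?w r * (ennreal (ph r) * (NN x. ennreal (sph (x::'a)) * ennreal (csq (y r))))"
 proof (cases "r > 0")
 case True
 show ?thesis unfolding nn_integral_sph_square_add[OF X(1) X(2)[OF True], of "y r"]
 by (simp add: nn_integral_multc nn_integral_sph distrib_left)
 qed simp
 qed
 also have "... = (NN r. ?w r * (ennreal (ph r) * ?A r))
 + (NN r. ?w r * (ennreal (ph r) * (NN x. ennreal (sph (x::'a)) * ennreal (csq (y r)))))"
 by (rule nn_integral_add) measurable
 also have "(NN r. ?w r * (ennreal (ph r) * ?A r)) = radial_mass ?n * (NN xi. ennreal (ph (norm xi)) * ennreal (csq (X xi)))"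
 by (rule polar[where H="%xi r. ennreal (csq (X xi))", symmetric]) measurable
 also have "(NN r. ?w r * (ennreal (ph r) * (NN x. ennreal (sph (x::'a)) * ennreal (csq (y r)))))
 = radial_mass ?n * (NN (xi::'a). ennreal (ph (norm xi)) * ennreal (csq (y (norm xi))))"
 by (rule polar[where H="%xi r. ennreal (csq (y r))", symmetric]) measurable
 finally show "radial_mass ?n * (NN xi. ennreal (ph (norm xi)) * ennreal (csq (X xi + y (norm xi))))
 = radial_mass ?n * ((NN xi. ennreal (ph (norm xi)) * ennreal (csq (X xi)))
 + (NN (xi::'a). ennreal (ph (norm xi)) * ennreal (csq (y (norm xi)))))"
 by (simp only: distrib_left)
qed

lemma integral_square_add_radial:
 fixes X :: "'a::euclidean_space => complex" and ph :: "real => real"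
 assumes X: "rapid X" "!!r. r > 0 ==> smean X r = 0"
 and [measurable]: "y \<in> bmeas" "ph \<in> bmeas" and ph: "!!t. ph t >= 0"
 and i: "integ (%xi. ph (norm xi) * csq (X xi))" "integ (%xi::'a. ph (norm xi) * csq (y (norm xi)))"
 "integ (%xi::'a. ph (norm xi) * csq (X xi + y (norm xi)))"
 shows "(LI xi. ph (norm xi) * csq (X xi + y (norm xi)))
 = (LI xi. ph (norm xi) * csq (X xi)) + (LI xi. ph (norm (xi::'a)) * csq (y (norm xi)))"
proof -
 have nn: "(NN x. ennreal (ph (norm x)) * ennreal (csq (f x))) = ennreal (LI x. ph (norm x) * csq (f x))"
 if "integ (%x. ph (norm x) * csq (f x))" for f :: "'a => complex"
 using nn_integral_eq_integral[OF that] ph by (simp add: ennreal_mult)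
 have "ennreal (LI xi. ph (norm xi) * csq (X xi + y (norm xi)))
 = ennreal ((LI xi. ph (norm xi) * csq (X xi)) + (LI xi. ph (norm (xi::'a)) * csq (y (norm xi))))"
 using nn_integral_square_add_radial[OF X assms(3,4) ph] unfolding nn[OF i(1)] nn[OF i(2)] nn[OF i(3)]
 by (subst ennreal_plus) (auto intro!: integral_nonneg_AE simp: ph)
 then show ?thesis
 by (subst (asm) ennreal_inj) (auto intro!: integral_nonneg_AE add_nonneg_nonneg simp: ph)
qed

lemma ang_nonneg:
 fixes xi :: "'a::euclidean_space"
 assumes "xi ~= 0" shows "ang D xi >= 0"
proof -
 have "norm xi *. sgn xi = xi" by (simp add: sgn_div_norm assms)
 then show ?thesis using ang_eq(1)[of "norm xi" xi D] assms by (simp add: sum_nonneg)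
qed

lemma integrable_ang:
 assumes "nice v D" shows "integ (ang D)"
 unfolding ang_def[abs_def] by (intro Bochner_Integration.integrable_diff integrable_grad2[OF assms] integrable_norm2 rapid_eul[OF assms])

text \<open>\<open>sphere_poincare\<close> on each sphere, integrated over the radii.
  \<open>ang\<close> already contains the factor |xi|^2, so both sides carry the same power of the
  radius.\<close>

lemma angular_energy_ge:
 fixes v :: "'a::euclidean_space => complex"
 assumes v: "nice v D" and N: "DIM('a) >= 2"
 shows "(real DIM('a) - 1) * (LI xi. csq (v xi - smean v (norm xi))) <= (LI xi. ang D xi)"
proof -
 let ?n = "DIM('a)"
 note [measurable] = niceD(3)[OF v] smean_measurable[OF niceD(3)[OF v]] ang_measurable[OF v]
 have r: "rapid (%xi. v xi - smean v (norm xi))" by (intro rapid_diff niceD(2)[OF v] rapid_smean)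
 have "radial_mass ?n * (ennreal (real ?n - 1) * (NN xi. ennreal (csq (v xi - smean v (norm xi)))))
 = radial_mass ?n * (NN xi. ennreal (real ?n - 1) * ennreal (csq (v xi - smean v (norm xi))))"
 by (subst nn_integral_cmult) auto
 also have "... = (NN r. indicator {0<..} r * ennreal (r ^ (?n - 1)) * (NN x. ennreal (sph x) * (ennreal (real ?n - 1) * ennreal (csq (v (r *. sgn x) - smean v (norm (r *. sgn x)))))))"
 by (rule nn_integral_polar_sph[symmetric]) measurable
 also have "... <= (NN r. indicator {0<..} r * ennreal (r ^ (?n - 1)) * (NN x. ennreal (sph x) * ennreal (ang D (r *. sgn x))))"
 proof (rule nn_integral_mono)
 fix r :: real
 have "(NN x. ennreal (sph x) * (ennreal (real ?n - 1) * ennreal (csq (v (r *. sgn x) - smean v (norm (r *. sgn x))))))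
 <= (NN x. ennreal (sph x) * ennreal (ang D (r *. sgn x)))" if r: "r > 0"
 proof -
 have "(NN x. ennreal (sph x) * (ennreal (real ?n - 1) * ennreal (csq (v (r *. sgn x) - smean v (norm (r *. sgn x))))))
 = (NN x. ennreal (real ?n - 1) * (ennreal (sph x) * ennreal (csq (v (r *. sgn x) - smean v r))))"
 proof (rule nn_integral_cong_AE)
 show "AE x in lborel. ennreal (sph x) * (ennreal (real ?n - 1) * ennreal (csq (v (r *. sgn x) - smean v (norm (r *. sgn x)))))
 = ennreal (real ?n - 1) * (ennreal (sph x) * ennreal (csq (v (r *. sgn x) - smean v r)))"
 using AE_neq_0
 proof eventually_elim
 case (elim x)
 show ?case unfolding norm_scale_sgn[OF r elim] by (rule mult.left_commute)
 qed
 qed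
 also have "... = ennreal (real ?n - 1) * (NN x. ennreal (sph x) * ennreal (csq (v (r *. sgn x) - smean v r)))"
 by (rule nn_integral_cmult) measurable
 also have "... <= (NN x. ennreal (sph x) * ennreal (ang D (r *. sgn x)))"
 by (rule sphere_poincare[OF v r N])
 finally show ?thesis .
 qed
 then show "indicator {0<..} r * ennreal (r ^ (?n - 1)) * (NN x. ennreal (sph x) * (ennreal (real ?n - 1) * ennreal (csq (v (r *. sgn x) - smean v (norm (r *. sgn x))))))
 <= indicator {0<..} r * ennreal (r ^ (?n - 1)) * (NN x. ennreal (sph x) * ennreal (ang D (r *. sgn x)))"
 by (cases "r > 0") (auto intro!: mult_left_mono)
 qed
 also have "... = radial_mass ?n * (NN xi. ennreal (ang D xi))"
 by (rule nn_integral_polar_sph) measurable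
 finally have "ennreal (real ?n - 1) * (NN xi. ennreal (csq (v xi - smean v (norm xi)))) <= (NN xi. ennreal (ang D xi))"
 by (rule radial_mass_cancel_le)
 also have "(NN xi. ennreal (csq (v xi - smean v (norm xi)))) = ennreal (LI xi. csq (v xi - smean v (norm xi)))"
 by (rule nn_integral_eq_integral[OF integrable_norm2[OF r]]) simp
 also have "(NN xi. ennreal (ang D xi)) = ennreal (LI xi. ang D xi)"
 proof (rule nn_integral_eq_integral[OF integrable_ang[OF v]])
 show "AE xi in lborel. 0 <= ang D xi" using AE_neq_0 by eventually_elim (rule ang_nonneg)
 qed
 finally have "ennreal ((real ?n - 1) * (LI xi. csq (v xi - smean v (norm xi)))) <= ennreal (LI xi. ang D xi)"
 using N by (subst ennreal_mult) (auto intro!: integral_nonneg_AE)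
 moreover have "(LI xi. ang D xi) >= 0"
 by (rule integral_nonneg_AE, use AE_neq_0 in eventually_elim) (rule ang_nonneg)
 ultimately show ?thesis by (simp add: ennreal_le_iff)
qed

lemma exp_powr_times_power_bounded:
 assumes s: "s > 0" and mu: "mu > 0"
 shows "\<exists>C. \<forall>t\<ge>0. exp (- mu * t powr s / s) * (1 + t) ^ k <= (C::real)"
proof -
 \<comment> \<open>\<open>n\<close> is chosen with \<open>k <= s * n\<close>, so that t^k <= (t^s)^n
   for t >= 1 and one term of the exponential series controls it.\<close>
 define n where "n = nat \<lceil>real k / s\<rceil>"
 define K where "K = (s / mu) ^ n * fact n"
 have K: "K >= 0" using s mu by (simp add: K_def)
 have n: "real k <= s * real n"
 proof -
 have "real k / s <= real n" unfolding n_def by linarith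
 then show ?thesis using s by (simp add: pos_divide_le_eq mult.commute)
 qed
 have "exp (- mu * t powr s / s) * (1 + t) ^ k <= 2 ^ k * (1 + K)" if t: "t >= 0" for t
 proof -
 let ?x = "mu * t powr s / s"
 have "(1 + t) ^ k <= 2 ^ k * (1 + K) * exp ?x"
 proof (cases "t >= 1")
 case True
 have "t ^ k = t powr real k" using True by (simp add: powr_realpow)
 also have "... <= t powr (s * real n)" using True n by (intro powr_mono) auto
 also have "... = (t powr s) ^ n" using True by (simp add: powr_powr flip: powr_realpow)
 also have "... = (s / mu) ^ n * ?x ^ n" using s mu by (simp add: power_divide power_mult_distrib)
 also have "... <= (s / mu) ^ n * (fact n * exp ?x)"
 using s mu t by (intro mult_left_mono power_le_fact_exp) auto
 finally have "t ^ k <= K * exp ?x" by (simp add: K_def mult.assoc)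
 have "(1 + t) ^ k <= (2 * t) ^ k" using True by (intro power_mono) auto
 also have "... <= 2 ^ k * (K * exp ?x)" unfolding power_mult_distrib
 using \<open>t ^ k <= K * exp ?x\<close> by (intro mult_left_mono) auto
 also have "... <= 2 ^ k * ((1 + K) * exp ?x)" by (intro mult_left_mono mult_right_mono) auto
 finally show ?thesis by (simp add: mult.assoc)
 next
 case False
 have "(1 + t) ^ k <= 2 ^ k" using False t by (intro power_mono) auto
 also have "... <= 2 ^ k * ((1 + K) * exp ?x)"
 proof -
 have "1 * 1 <= (1 + K) * exp ?x" using K s mu t by (intro mult_mono) auto
 then show ?thesis by simp
 qed
 finally show ?thesis by (simp add: mult.assoc)
 qed
 then have "exp (- ?x) * (1 + t) ^ k <= exp (- ?x) * (2 ^ k * (1 + K) * exp ?x)" by (intro mult_left_mono) auto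
 also have "... = 2 ^ k * (1 + K)" by (simp add: exp_minus)
 finally show ?thesis by simp
 qed
 then show ?thesis by blast
qed

subsection \<open>Profiles and spectral gaps\<close>

definition gl :: "real => real => real => real" where
 "gl s mu t = exp (- mu * t powr s / s)"

definition prof :: "real => real => 'a::euclidean_space => complex" where
 "prof s mu xi = of_real (gl s mu (norm xi))"

lemma gl_pos[simp]: "gl s mu t > 0" and gl_neq_0[simp]: "gl s mu t ~= 0" by (auto simp: gl_def)

lemma gl_measurable[measurable]: "gl s mu \<in> bmeas"
 unfolding gl_def[abs_def] by measurable

lemma gl_has_derivative:
 assumes "s > 0" "t > 0"
 shows "(gl s mu has_real_derivative - mu * t powr (s - 1) * gl s mu t) (at t)"
 unfolding gl_def[abs_def] using assms by (auto intro!: derivative_eq_intros)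

lemma rapid_prof: "s > 0 ==> mu > 0 ==> rapid (prof s mu)"
 unfolding rapid_def
proof (intro conjI allI)
 show "prof s mu \<in> bmeas" unfolding prof_def[abs_def] by measurable
 fix k assume "s > 0" "mu > 0"
 then obtain C where "!!t. t >= 0 ==> exp (- mu * t powr s / s) * (1 + t) ^ k <= C"
 using exp_powr_times_power_bounded by blast
 then show "\<exists>C. \<forall>x. cmod (prof s mu x) * (1 + norm x) ^ k <= C"
 by (intro exI[of _ C]) (auto simp: prof_def gl_def)
qed

lemma continuous_on_gl: "s > 0 ==> continuous_on {0..} (gl s mu)"
 unfolding gl_def[abs_def] by (intro continuous_intros continuous_on_powr') auto

definition glD :: "real => real => real => complex" where
 "glD s mu t = of_real (- mu * t powr (s - 1) * gl s mu t)"

lemma nice_prof: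
 assumes s: "s > 0" and mu: "mu > 0"
 shows "nice (prof s mu :: 'a::euclidean_space => complex) (radD (glD s mu))"
 unfolding prof_def[abs_def]
proof (rule nice_radial)
 show "continuous_on {0..} (%t. complex_of_real (gl s mu t))"
 using continuous_on_gl[OF s] by (intro continuous_intros)
 show "rapid (%xi::'a. complex_of_real (gl s mu (norm xi)))" using rapid_prof[OF s mu] by (simp add: prof_def[abs_def])
 show "((%t. complex_of_real (gl s mu t)) has_vector_derivative glD s mu r) (at r)" if "r > 0" for r
 unfolding glD_def using gl_has_derivative[OF s that] by (intro has_vector_derivative_of_real)
 show "glD s mu \<in> bmeas" unfolding glD_def[abs_def] by measurable
 show "rapid (%xi::'a. complex_of_real (norm xi) * glD s mu (norm xi))"
 proof (rule rapid_eq_off_0)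
 show "rapid (%xi::'a. of_real (- mu) * (complex_of_real (norm xi powr s) * prof s mu xi))"
 using s by (intro rapid_cmult rapid_powr_mult rapid_prof mu) auto
 show "(%xi::'a. complex_of_real (norm xi) * glD s mu (norm xi)) \<in> bmeas"
 unfolding glD_def by measurable
 fix xi :: 'a assume "xi ~= 0"
 then have "norm xi * norm xi powr (s - 1) = norm xi powr s" by (simp add: powr_mult_base)
 then have "norm xi * (norm xi powr (s - 1) * gl s mu (norm xi)) = norm xi powr s * gl s mu (norm xi)"
 by (simp flip: mult.assoc)
 from arg_cong[OF this, of complex_of_real]
 show "complex_of_real (norm xi) * glD s mu (norm xi) = of_real (- mu) * (complex_of_real (norm xi powr s) * prof s mu xi)"
 by (simp add: glD_def prof_def mult_ac)
 qed
qed

definition mom :: "real => ('a::euclidean_space => complex) => real" where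
 "mom p v = (LI xi. norm xi powr p * csq (v xi))"

lemma mom_nonneg[simp]: "mom p v >= 0"
 unfolding mom_def by (intro integral_nonneg_AE) auto

lemma powr_mult_self: "((t::real) powr p)\<^sup>2 = t powr (2 * p)"
 by (simp add: power2_eq_square powr_add[symmetric])

text \<open>The hypotheses make \<open>z\<close> vanish on the sphere where \<open>h = 0\<close>. There the multiplier \<open>\<kappa> = s r\<^sup>s / h\<close> solves
 the Riccati equation \<open>\<kappa>\<^sup>2 + r \<kappa>' = s \<kappa>\<close>, and the claim is \<open>\<integral>|R z - \<kappa> z|\<^sup>2 >= 0\<close> integrated by parts;
 the singularity is removed by replacing \<open>1 / h\<close> with \<open>h / (h\<^sup>2 + e\<^sup>2)\<close>.\<close>

lemma gap_of_zero_on_sphere: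
 fixes z :: "'a::euclidean_space => complex"
 assumes z: "nice z D" and s: "s > 0" and mu: "mu > 0"
 defines "h \<equiv> %r. r powr s - (real DIM('a) + s) / (2 * mu)"
 assumes z0: "!!x. h (norm x) = 0 ==> z x = 0"
 and int: "integ (%x. norm x powr (2 * s) * (cmod (z x) / h (norm x))\<^sup>2)"
 shows "2 * s * mu * mom s z <= (LI x. csq (eul D x + of_real (mu * norm x powr s) * z x))"
proof -
 note [measurable] = niceD(3)[OF z] eul_measurable[OF z]
 have [measurable]: "h \<in> bmeas" unfolding h_def by measurable
 let ?R = "%x. eul D x + of_real (mu * norm x powr s) * z x"
 let ?Z = "%x. csq (z x)"
 let ?S = "%x. s * norm x powr s"
 \<comment> \<open>With the regularised multiplier k = s r^s h / (h^2 + e^2) the Riccati equation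
   holds up to the error (s r^s)^2 e^2 / (h^2 + e^2)^2, whose contribution is \<open>?B\<close>;
   \<open>?A\<close> is the regularised gain. Both have majorants uniform in \<open>e\<close>, and
   the one for \<open>?B\<close> is integrable by \<open>int\<close>.\<close>
 let ?A = "%e x. 2 * mu * (?S x * ?Z x) * ((h (norm x))\<^sup>2 / ((h (norm x))\<^sup>2 + e\<^sup>2))"
 let ?B = "%e x. (?S x)\<^sup>2 * ?Z x * (e\<^sup>2 / ((h (norm x))\<^sup>2 + e\<^sup>2)\<^sup>2)"
 have rR: "integ (%x. csq (?R x))"
 by (rule integrable_norm2) (use rapid_add[OF rapid_eul[OF z] rapid_cmult[OF rapid_powr_mult[OF niceD(2)[OF z], of s], of mu]] s in \<open>simp add: mult.assoc\<close>)
 have iS: "integ (%x. 2 * mu * (?S x * ?Z x))"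
 using integrable_mult_right[OF integrable_powr_norm2[OF niceD(2)[OF z], of s], of "2 * mu * s"] s by (simp add: mult_ac)
 have iB: "integ (%x. s\<^sup>2 * (norm x powr (2 * s) * (cmod (z x) / h (norm x))\<^sup>2))"
 using int by simp
 have Ale: "norm (?A e x) <= 2 * mu * (?S x * ?Z x)" for e x
 proof -
 have "(h (norm x))\<^sup>2 / ((h (norm x))\<^sup>2 + e\<^sup>2) <= 1" by (subst divide_le_eq_1) (smt (verit) zero_le_power2)
 from mult_left_le[OF this, of "2 * mu * (?S x * ?Z x)"] s mu show ?thesis by (simp add: abs_mult)
 qed
 have Ble: "norm (?B e x) <= s\<^sup>2 * (norm x powr (2 * s) * (cmod (z x) / h (norm x))\<^sup>2)" for e x
 proof (cases "h (norm x) = 0")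
 case False
 then have "(h (norm x))\<^sup>2 * e\<^sup>2 <= ((h (norm x))\<^sup>2 + e\<^sup>2)\<^sup>2" "(h (norm x))\<^sup>2 + e\<^sup>2 > 0"
 using mult_mono[of "(h (norm x))\<^sup>2" "(h (norm x))\<^sup>2 + e\<^sup>2" "e\<^sup>2" "(h (norm x))\<^sup>2 + e\<^sup>2"]
 by (auto simp: power2_eq_square[of "_ + _"] add_pos_nonneg)
 then have "e\<^sup>2 / ((h (norm x))\<^sup>2 + e\<^sup>2)\<^sup>2 <= 1 / (h (norm x))\<^sup>2"
 using False by (simp add: divide_simps mult.commute)
 from mult_left_mono[OF this, of "(?S x)\<^sup>2 * ?Z x"] show ?thesis
 by (simp add: power_mult_distrib power_divide powr_mult_self mult_ac)
 qed (simp add: z0)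
 have iA: "integ (?A e)" for e
 by (rule integrable_bound[OF iS]) (use Ale in \<open>auto intro: order_trans[OF _ abs_ge_self]\<close>)
 have iB': "integ (?B e)" for e
 by (rule integrable_bound[OF iB]) (use Ble in \<open>auto intro: order_trans[OF _ abs_ge_self]\<close>)
 have main: "(LI x. ?A e x) - (LI x. ?B e x) <= (LI x. csq (?R x))" if e: "e > 0" for e
 proof -
 define q where "q r = (h r)\<^sup>2 + e\<^sup>2" for r
 have q: "q r >= e\<^sup>2" "q r > 0" "q r >= (h r)\<^sup>2" "\<bar>h r\<bar> <= q r / e" for r
 proof -
 show "q r >= e\<^sup>2" "q r > 0" "q r >= (h r)\<^sup>2" using e by (auto simp: q_def add_nonneg_pos)
 have "2 * (\<bar>h r\<bar> * e) <= q r" using sum_squares_bound[of "\<bar>h r\<bar>" e] by (simp add: q_def)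
 moreover have "0 <= \<bar>h r\<bar> * e" using e by simp
 ultimately have "\<bar>h r\<bar> * e <= q r" by linarith
 then show "\<bar>h r\<bar> <= q r / e" using e by (simp add: pos_le_divide_eq)
 qed
 define k where "k r = s * r powr s * (h r / q r)" for r
 define k' where "k' r = s * (s * r powr (s - 1)) * (h r / q r) + s * r powr s * (s * r powr (s - 1) * (e\<^sup>2 - (h r)\<^sup>2) / (q r)\<^sup>2)" for r
 have [measurable]: "k \<in> bmeas" "k' \<in> bmeas"
 unfolding k_def[abs_def] k'_def[abs_def] q_def by measurable
 have rk': "r * k' r = s * k r + (s * r powr s)\<^sup>2 * (e\<^sup>2 - (h r)\<^sup>2) / (q r)\<^sup>2" if "r > 0" for r
 proof -
 have r: "r * r powr (s - 1) = r powr s" using that by (simp add: powr_mult_base)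
 have "r * k' r = s * (s * (r * r powr (s - 1)) * (h r / q r)) + s * r powr s * (s * (r * r powr (s - 1)) * (e\<^sup>2 - (h r)\<^sup>2) / (q r)\<^sup>2)"
 by (simp add: k'_def algebra_simps)
 also have "... = s * k r + (s * r powr s)\<^sup>2 * (e\<^sup>2 - (h r)\<^sup>2) / (q r)\<^sup>2"
 unfolding r by (simp add: k_def power2_eq_square mult.assoc)
 finally show ?thesis .
 qed
 have hq: "\<bar>h r / q r\<bar> <= 1 / e" "\<bar>(e\<^sup>2 - (h r)\<^sup>2) / (q r)\<^sup>2\<bar> <= 1 / e\<^sup>2" for r
 proof -
 show "\<bar>h r / q r\<bar> <= 1 / e" using q(2,4)[of r] e by (simp add: pos_divide_le_eq)
 have "\<bar>e\<^sup>2 - (h r)\<^sup>2\<bar> * e\<^sup>2 <= q r * q r" using q(1,2)[of r] by (intro mult_mono) (auto simp: q_def abs_le_iff)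
 then show "\<bar>(e\<^sup>2 - (h r)\<^sup>2) / (q r)\<^sup>2\<bar> <= 1 / e\<^sup>2" using q(2)[of r] e by (simp add: divide_simps power2_eq_square)
 qed
 define C where "C = s * (1 / e) + s * (s * (1 / e)) + s\<^sup>2 * (1 / e\<^sup>2)"
 define j where "j = nat \<lceil>s\<rceil>"
 have P: "r powr s <= (1 + r) ^ (2 * j)" "(r powr s)\<^sup>2 <= (1 + r) ^ (2 * j)" if "r >= 0" for r
 proof -
 have p: "r powr s <= (1 + r) ^ j" unfolding j_def using s that by (intro one_plus_le_power) auto
 then show "r powr s <= (1 + r) ^ (2 * j)" using power_increasing[of j "2 * j" "1 + r"] that by simp
 show "(r powr s)\<^sup>2 <= (1 + r) ^ (2 * j)" using power_mono[OF p, of 2] by (simp add: power_mult[symmetric] mult.commute)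
 qed
 have kb: "\<bar>k r\<bar> <= s * (1 / e) * (1 + r) ^ (2 * j)" if "r >= 0" for r
 proof -
 have "\<bar>k r\<bar> <= s * (1 + r) ^ (2 * j) * (1 / e)"
 unfolding k_def abs_mult using hq(1)[of r] P(1)[OF that] s that by (intro mult_mono) auto
 then show ?thesis by (simp add: mult_ac)
 qed
 have dk: "(k has_real_derivative k' r) (at r)" if r: "r > 0" for r
 proof -
 have p: "((%r. r powr s) has_real_derivative s * r powr (s - 1)) (at r)" by (rule has_real_derivative_powr[OF r])
 then have dh: "(h has_real_derivative s * r powr (s - 1)) (at r)"
 unfolding h_def using DERIV_diff[OF p DERIV_const] by simp
 have "((%r. h r / q r) has_real_derivative (s * r powr (s - 1) * (e\<^sup>2 - (h r)\<^sup>2) / (q r)\<^sup>2)) (at r)"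
 using q(2)[of r] unfolding q_def
 by (intro DERIV_cong[OF DERIV_divide[OF dh DERIV_add[OF DERIV_power[OF dh, of 2] DERIV_const]]])
 (auto simp: power2_eq_square algebra_simps)
 from DERIV_mult[OF DERIV_cmult[OF p, of s] this] show ?thesis
 unfolding k_def[abs_def] by (rule DERIV_cong) (simp add: k'_def)
 qed
 let ?ibp = "%x::'a. (real DIM('a) * k (norm x) + norm x * k' (norm x)) * ?Z x"
 have bC: "\<bar>k r\<bar> <= C * (1 + r) ^ (2 * j)" "r > 0 ==> \<bar>r * k' r\<bar> <= C * (1 + r) ^ (2 * j)" if r: "r >= 0" for r
 proof -
 let ?P = "(1 + r) ^ (2 * j)"
 have P0: "0 <= s * (1 / e) * ?P" "0 <= s * (s * (1 / e)) * ?P" "0 <= s\<^sup>2 * (1 / e\<^sup>2) * ?P" using s e r by auto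
 show "\<bar>k r\<bar> <= C * ?P" using kb[OF r] P0 unfolding C_def distrib_right by linarith
 assume r0: "r > 0"
 have "(s * r powr s)\<^sup>2 * \<bar>(e\<^sup>2 - (h r)\<^sup>2) / (q r)\<^sup>2\<bar> <= (s\<^sup>2 * ?P) * (1 / e\<^sup>2)"
 unfolding power_mult_distrib using hq(2)[of r] P(2)[OF r] r by (intro mult_mono) auto
 then have "\<bar>(s * r powr s)\<^sup>2 * (e\<^sup>2 - (h r)\<^sup>2) / (q r)\<^sup>2\<bar> <= s\<^sup>2 * (1 / e\<^sup>2) * ?P" by (simp add: abs_mult mult_ac)
 moreover have "\<bar>s * k r\<bar> <= s * (s * (1 / e)) * ?P" using mult_left_mono[OF kb[OF r], of s] s by (simp add: abs_mult mult_ac)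
 ultimately show "\<bar>r * k' r\<bar> <= C * ?P"
 unfolding rk'[OF r0] C_def distrib_right add.assoc
 by (intro order_trans[OF abs_triangle_ineq] add_increasing[OF P0(1)] add_mono)
 qed
 note ibp = radial_ibp_weight[OF z, of k k' C "2 * j", OF _ _ dk bC(1) bC(2)[OF less_imp_le], simplified]
 have gen: "(M - c) * w = (X - u + (m * l + v)) * w" if "c + t = u" "M = X + (m + s) * l" "v = s * l + t" for c t u M X m l v w :: real
 using that(2,3) that(1)[symmetric] by (simp add: algebra_simps)
 have "?A e x - ?B e x <= csq (?R x) - k (norm x) * (2 * (z x \<bullet> eul D x)) - ?ibp x" if x: "x ~= 0" for x
 proof -
 let ?r = "norm x"
 have "0 <= csq (?R x + of_real (- k ?r) * z x)" by simp
 also have "... = csq (?R x) - 2 * k ?r * (z x \<bullet> eul D x) - (2 * mu * ?r powr s * k ?r - (k ?r)\<^sup>2) * ?Z x"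
 unfolding norm_square_add complex_inner_of_real complex_inner_of_real' square_norm_of_real_mult inner_add_left
 by (simp add: power2_norm_eq_inner inner_commute algebra_simps)
 finally have 1: "2 * k ?r * (z x \<bullet> eul D x) + (2 * mu * ?r powr s * k ?r - (k ?r)\<^sup>2) * ?Z x <= csq (?R x)" by simp
 have "(k ?r)\<^sup>2 + (s * ?r powr s)\<^sup>2 * (e\<^sup>2 - (h ?r)\<^sup>2) / (q ?r)\<^sup>2 = (s * ?r powr s)\<^sup>2 * (e\<^sup>2 / (q ?r)\<^sup>2)"
 unfolding k_def power_mult_distrib power_divide by (simp add: diff_divide_distrib right_diff_distrib add_divide_distrib)
 \<comment> \<open>Here the position of the zero of \<open>h\<close> matters: (N + s) k cancels
   against N k from the dimension and s k from \<open>r * k' r\<close> in the integration by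
   parts.\<close>
 moreover have "2 * mu * ?r powr s * k ?r = 2 * mu * (?S x * ((h ?r)\<^sup>2 / q ?r)) + (real DIM('a) + s) * k ?r"
 proof -
 have h: "2 * mu * ?r powr s = 2 * mu * h ?r + (real DIM('a) + s)" using mu by (simp add: h_def field_simps)
 show ?thesis unfolding h distrib_right by (simp add: k_def power2_eq_square mult_ac)
 qed
 ultimately have "(2 * mu * ?r powr s * k ?r - (k ?r)\<^sup>2) * ?Z x
 = (2 * mu * (?S x * ((h ?r)\<^sup>2 / q ?r)) - (s * ?r powr s)\<^sup>2 * (e\<^sup>2 / (q ?r)\<^sup>2) + (real DIM('a) * k ?r + ?r * k' ?r)) * ?Z x"
 by (rule gen[OF _ _ rk']) (use x in simp)
 then show ?thesis using 1 by (simp add: q_def algebra_simps)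
 qed
 then have "AE x in lborel. ?A e x - ?B e x <= csq (?R x) - k (norm x) * (2 * (z x \<bullet> eul D x)) - ?ibp x"
 using AE_neq_0 by (auto elim: eventually_mono)
 then have "(LI x. ?A e x - ?B e x) <= (LI x. csq (?R x) - k (norm x) * (2 * (z x \<bullet> eul D x)) - ?ibp x)"
 by (intro integral_mono_AE Bochner_Integration.integrable_diff iA iB' rR ibp)
 then show ?thesis
 using ibp iA iB' rR by simp
 qed
 define e where "e n = 1 / real (Suc n)" for n
 have e: "e n > 0" "e ----> 0" for n unfolding e_def using inverse_Suc_seq by auto
 have tA: "(%n. ?A (e n) x) ----> 2 * mu * (?S x * ?Z x)" and tB: "(%n. ?B (e n) x) ----> 0" for x
 proof -
 have "(%n. ?A (e n) x) ----> ?A 0 x" "(%n. ?B (e n) x) ----> ?B 0 x" if "h (norm x) ~= 0"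
 using that by (intro tendsto_intros e(2); simp)+
 then show "(%n. ?A (e n) x) ----> 2 * mu * (?S x * ?Z x)" "(%n. ?B (e n) x) ----> 0"
 using z0[of x] by (cases "h (norm x) = 0"; simp)+
 qed
 have "(%n. LI x. ?A (e n) x) ----> (LI x. 2 * mu * (?S x * ?Z x))"
 by (rule integral_dominated_convergence[OF _ _ iS]) (use tA Ale in auto)
 moreover have "(%n. LI x. ?B (e n) x) ----> (LI (x::'a). 0)"
 by (rule integral_dominated_convergence[OF _ _ iB]) (use tB Ble in auto)
 ultimately have lim: "(%n. (LI x. ?A (e n) x) - (LI x. ?B (e n) x)) ----> (LI x. 2 * mu * (?S x * ?Z x)) - (LI (x::'a). 0)"
 by (rule tendsto_diff)
 have eq: "(LI x. 2 * mu * (?S x * ?Z x)) - (LI (x::'a). 0) = 2 * s * mu * mom s z"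
 by (simp add: mom_def mult_ac)
 show ?thesis unfolding eq[symmetric] by (rule LIMSEQ_le_const2[OF lim]) (use main[OF e(1)] in blast)
qed

text \<open>Subtracting a multiple of the profile leaves the right-hand side unchanged, since R + mu
  |xi|^s annihilates the profile. The multiple is fixed by making the difference vanish at the
  radius where the multiplier is singular; then \<open>gap_of_zero_on_sphere\<close>
  applies.\<close>

theorem radial_stability:
 fixes c c' :: "real => complex"
 assumes s: "s > 0" and mu: "mu > 0"
 and n: "nice (%xi::'a::euclidean_space. c (norm xi)) (radD c')"
 and der: "!!t. t > 0 ==> (c has_vector_derivative c' t) (at t)"
 shows "\<exists>al. 2 * s * mu * mom s (%xi::'a. c (norm xi) - al * prof s mu xi)
 <= (LI xi. csq (eul (radD c') (xi::'a) + of_real (mu * norm xi powr s) * c (norm xi)))"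
proof -
 \<comment> \<open>|xi|^s - b times the profile is the first excited radial state, so
   \<open>R\<close> is the radius of its node.\<close>
 define b where "b = (real DIM('a) + s) / (2 * mu)"
 define R where "R = b powr (1 / s)"
 have b: "b > 0" using s mu by (simp add: b_def add_pos_pos)
 then have R: "R > 0" "R powr s = b" using s by (auto simp: R_def powr_powr)
 define al where "al = c R / of_real (gl s mu R)"
 define q where "q t = c t - al * of_real (gl s mu t)" for t
 define z where "z xi = q (norm xi)" for xi :: 'a
 let ?h = "%r. r powr s - b"
 let ?D = "%xi h. radD c' xi h - al * radD (glD s mu) xi h"
 have ze: "z = (%xi. c (norm xi) - al * prof s mu xi)" by (simp add: z_def q_def prof_def fun_eq_iff)
 have nz: "nice z ?D" unfolding ze by (intro nice_diff nice_cmult n nice_prof s mu)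
 have qR: "q R = 0" by (simp add: q_def al_def)
 have h_eq: "r = R" if "?h r = 0" "r >= 0" for r
 using that s R(1) powr_less_mono2[of s r R] powr_less_mono2[of s R r] R(2) by (cases r R rule: linorder_cases) auto
 have "2 * s * mu * mom s z <= (LI x. csq (eul ?D x + of_real (mu * norm x powr s) * z x))"
 proof (rule gap_of_zero_on_sphere[OF nz s mu])
 show "z x = 0" if "norm x powr s - (real DIM('a) + s) / (2 * mu) = 0" for x
 using h_eq[of "norm x"] that qR by (simp add: z_def b_def)
 have dq: "(q has_vector_derivative c' R - al * glD s mu R) (at R)"
 unfolding q_def[abs_def] glD_def
 by (intro has_vector_derivative_diff der R has_vector_derivative_mult_right has_vector_derivative_of_real gl_has_derivative s)
 have dh: "(?h has_real_derivative s * R powr (s - 1)) (at R)"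
 using DERIV_diff[OF has_real_derivative_powr[OF R(1)] DERIV_const] by simp
 \<comment> \<open>At the node \<open>q\<close> vanishes and is differentiable, while
   \<open>?h\<close> has a simple zero, so their quotient stays bounded nearby.\<close>
 obtain M d where M: "d > 0" "!!r. \<bar>r - R\<bar> < d ==> cmod (q r) <= M * \<bar>?h r\<bar>"
 proof -
 let ?q = "c' R - al * glD s mu R"
 define k where "k = s * R powr (s - 1)"
 have k: "k > 0" using s R(1) by (simp add: k_def)
 obtain d1 where d1: "d1 > 0" "!!r. \<bar>r - R\<bar> < d1 ==> cmod (q r - q R - (r - R) *. ?q) <= 1 * \<bar>r - R\<bar>"
 using dq unfolding has_vector_derivative_def has_derivative_at_alt real_norm_def by (meson zero_less_one)
 obtain d2 where d2: "d2 > 0" "!!r. \<bar>r - R\<bar> < d2 ==> \<bar>?h r - ?h R - k * (r - R)\<bar> <= k / 2 * \<bar>r - R\<bar>"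
 using dh[folded k_def] k unfolding has_field_derivative_def has_derivative_at_alt real_norm_def by (meson half_gt_zero)
 show ?thesis
 proof (rule that[of "min d1 d2" "(cmod ?q + 1) * (2 / k)"])
 fix r assume r: "\<bar>r - R\<bar> < min d1 d2"
 have "k * \<bar>r - R\<bar> <= \<bar>?h r\<bar> + k / 2 * \<bar>r - R\<bar>"
 using d2(2)[of r] r R(2) abs_triangle_ineq2[of "k * (r - R)" "?h r"] k abs_minus_commute[of "k * (r - R)" "?h r"] by (simp add: abs_mult)
 then have "\<bar>r - R\<bar> <= 2 / k * \<bar>?h r\<bar>" using k by (simp add: field_simps)
 then have "(cmod ?q + 1) * \<bar>r - R\<bar> <= (cmod ?q + 1) * (2 / k * \<bar>?h r\<bar>)" by (intro mult_left_mono) auto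
 moreover have "cmod (q r) <= (cmod ?q + 1) * \<bar>r - R\<bar>"
 using d1(2)[of r] r norm_triangle_sub[of "q r" "(r - R) *. ?q"] by (simp add: qR distrib_right mult.commute[of "cmod _"])
 ultimately show "cmod (q r) <= (cmod ?q + 1) * (2 / k) * \<bar>?h r\<bar>" by (simp only: mult.assoc)
 qed (use d1 d2 in simp)
 qed
 \<comment> \<open>Away from the node \<open>?h\<close> is bounded below in modulus by monotonicity
   of the power; the \<open>max\<close> covers the case that \<open>d\<close> exceeds
   \<open>R\<close>.\<close>
 obtain et where et: "et > 0" "!!r. r >= 0 ==> \<bar>r - R\<bar> >= d ==> et <= \<bar>?h r\<bar>"
 proof -
 define m where "m = max 0 (R - d)"
 have m: "0 <= m" "m < R" "R - d <= m" using R M(1) by (auto simp: m_def)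
 show ?thesis
 proof (rule that[of "min (?h (R + d)) (- ?h m)"])
 show "0 < min (?h (R + d)) (- ?h m)"
 using powr_less_mono2[of s R "R + d"] powr_less_mono2[of s m R] s R M(1) m by simp
 fix r assume r: "r >= 0" "\<bar>r - R\<bar> >= d"
 show "min (?h (R + d)) (- ?h m) <= \<bar>?h r\<bar>"
 proof (cases "r >= R + d")
 case True then show ?thesis using powr_mono2[of s "R + d" r] s R M(1) by simp
 next
 case False
 then have "r <= m" using m r by linarith
 then have "r powr s <= m powr s" using s r by (intro powr_mono2) auto
 then show ?thesis by linarith
 qed
 qed
 qed
 note [measurable] = niceD(3)[OF nz]
 have "integ (%x. norm x powr (2 * s) * (cmod (z x) / ?h (norm x))\<^sup>2)"
 proof (rule integrable_bound)
 let ?W = "%x. (1 / et\<^sup>2) * (norm x powr (2 * s) * csq (z x)) + M\<^sup>2 * (R + d) powr (2 * s) * indicator (ball 0 (R + d)) x"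
 show "integ ?W"
 using s by (intro Bochner_Integration.integrable_add integrable_mult_right integrable_powr_norm2 niceD(2)[OF nz] integrable_real_indicator emeasure_lborel_ball_finite) auto
 show "AE x in lborel. norm (norm x powr (2 * s) * (cmod (z x) / ?h (norm x))\<^sup>2) <= norm (?W x)"
 proof (rule AE_I2)
 fix x :: 'a
 have W: "0 <= (1 / et\<^sup>2) * (norm x powr (2 * s) * csq (z x))" "0 <= M\<^sup>2 * (R + d) powr (2 * s) * indicator (ball 0 (R + d)) x" by auto
 have "norm x powr (2 * s) * (cmod (z x) / ?h (norm x))\<^sup>2 <= ?W x"
 proof (cases "\<bar>norm x - R\<bar> < d")
 case True
 have "(cmod (z x) / ?h (norm x))\<^sup>2 <= M\<^sup>2"
 proof (cases "?h (norm x) = 0")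
 case False
 then have "\<bar>cmod (z x) / ?h (norm x)\<bar> <= M" using M(2)[OF True] by (simp add: z_def pos_divide_le_eq)
 from power_mono[OF this abs_ge_zero, of 2] show ?thesis by (simp only: power2_abs)
 qed simp
 moreover have "norm x powr (2 * s) <= (R + d) powr (2 * s)" using True s by (intro powr_mono2) auto
 ultimately have "norm x powr (2 * s) * (cmod (z x) / ?h (norm x))\<^sup>2 <= (R + d) powr (2 * s) * M\<^sup>2" by (intro mult_mono) auto
 moreover have "indicator (ball 0 (R + d)) x = (1::real)" using True by (simp add: indicator_def)
 ultimately show ?thesis by (intro add_increasing[OF W(1)]) (simp add: mult.commute)
 next
 case False
 then have "cmod (z x) / \<bar>?h (norm x)\<bar> <= cmod (z x) / et" using et(2)[of "norm x"] et(1) by (intro divide_left_mono) auto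
 then have "\<bar>cmod (z x) / ?h (norm x)\<bar> <= cmod (z x) / et" by simp
 from power_mono[OF this abs_ge_zero, of 2] have "(cmod (z x) / ?h (norm x))\<^sup>2 <= 1 / et\<^sup>2 * csq (z x)"
 unfolding power2_abs by (simp add: power_divide[of _ et])
 from mult_left_mono[OF this, of "norm x powr (2 * s)"] show ?thesis by (intro add_increasing2[OF W(2)]) (simp add: mult_ac)
 qed
 then show "norm (norm x powr (2 * s) * (cmod (z x) / ?h (norm x))\<^sup>2) <= norm (?W x)"
 using W by simp
 qed
 qed measurable
 then show "integ (%x. norm x powr (2 * s) * (cmod (z x) / (norm x powr s - (real DIM('a) + s) / (2 * mu)))\<^sup>2)"
 by (simp add: b_def)
 qed
 moreover have "eul ?D x + of_real (mu * norm x powr s) * z x = eul (radD c') x + of_real (mu * norm x powr s) * c (norm x)" for x :: 'a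
 proof -
 have "eul (%xi h. al * radD (glD s mu) xi h) x = al * eul (radD (glD s mu)) x"
 by (simp add: eul_def sum_distrib_left mult.left_commute)
 moreover have "norm x * norm x powr (s - 1) = norm x powr s" using s by (cases "x = 0") (simp_all add: powr_mult_base)
 then have "complex_of_real (norm x) * glD s mu (norm x) = - of_real (mu * norm x powr s) * of_real (gl s mu (norm x))"
 by (simp add: glD_def flip: of_real_mult of_real_minus)
 ultimately show ?thesis by (simp add: eul_diff eul_radD z_def q_def algebra_simps)
 qed
 ultimately show ?thesis unfolding ze by (intro exI[of _ al]) simp
qed

definition gradB :: "('a::euclidean_space => 'a => complex) => real" where
 "gradB D = (LI xi. (norm xi)\<^sup>2 * grad2 D xi)"

lemma gradB_nonneg[simp]: "gradB D >= 0"
 unfolding gradB_def by (intro integral_nonneg_AE) auto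

lemma smean_add:
 "rapid f ==> rapid g ==> smean (%x. f x + g x) r = smean f r + smean g r"
 using integrable_smean[of f r] integrable_smean[of g r] by (simp add: smean_def distrib_left)

lemma rapid_eul_plus:
 assumes "nice v D" "s >= 0"
 shows "rapid (%xi. eul D xi + of_real (mu * norm xi powr s) * v xi)"
proof -
 have "rapid (%xi. eul D xi + of_real mu * (of_real (norm xi powr s) * v xi))"
 by (intro rapid_add rapid_eul[OF assms(1)] rapid_cmult rapid_powr_mult niceD(2)[OF assms(1)] assms(2))
 then show ?thesis by (simp add: mult.assoc)
qed

text \<open>The mixed term of the square is where integration by parts along dilations with weight
  |xi|^s produces the constant N + s. Every real \<open>mu\<close> is allowed, which the
  discriminant argument of \<open>spectral_uncertainty\<close> exploits.\<close>

theorem deficit_identity: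
 fixes v :: "'a::euclidean_space => complex"
 assumes v: "nice v D" and s: "s > 0"
 shows "(LI xi. csq (eul D xi + of_real (mu * norm xi powr s) * v xi)) + (LI xi. ang D xi)
 = gradB D + mu\<^sup>2 * mom (2 * s) v - mu * (real DIM('a) + s) * mom s v"
proof -
 have i1: "integ (%xi. csq (eul D xi + of_real (mu * norm xi powr s) * v xi))"
 using s by (intro integrable_norm2 rapid_eul_plus v) auto
 note i2 = integrable_ang[OF v]
 have i3: "integ (%xi. norm xi powr s * (2 * (v xi \<bullet> eul D xi)))"
 using integrable_powr_inner[OF niceD(2)[OF v] rapid_eul[OF v], of s] s integrable_mult_right[of "2::real" lborel "%xi. norm xi powr s * (v xi \<bullet> eul D xi)"]
 by (simp add: mult.left_commute)
 have i4: "integ (%xi. norm xi powr (2 * s) * csq (v xi))"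
 using s by (intro integrable_powr_norm2 niceD(2)[OF v]) auto
 have eq: "csq (eul D xi + of_real (mu * norm xi powr s) * v xi) + ang D xi
 = (norm xi)\<^sup>2 * grad2 D xi + mu\<^sup>2 * (norm xi powr (2 * s) * csq (v xi)) + mu * (norm xi powr s * (2 * (v xi \<bullet> eul D xi)))" for xi
 unfolding norm_square_add complex_inner_of_real square_norm_of_real_mult power_mult_distrib powr_mult_self ang_def
 by (simp add: inner_commute[of "eul D xi"])
 have "(LI xi. csq (eul D xi + of_real (mu * norm xi powr s) * v xi)) + (LI xi. ang D xi)
 = (LI xi. csq (eul D xi + of_real (mu * norm xi powr s) * v xi) + ang D xi)"
 using i1 i2 by simp
 also have "... = gradB D + mu\<^sup>2 * mom (2 * s) v + mu * (LI xi. norm xi powr s * (2 * (v xi \<bullet> eul D xi)))"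
 unfolding eq mom_def gradB_def using i3 i4 integrable_grad2[OF v] by simp
 also have "(LI xi. norm xi powr s * (2 * (v xi \<bullet> eul D xi))) = - (real DIM('a) + s) * mom s v"
 using radial_ibp[OF v, of s] s by (simp add: mom_def)
 finally show ?thesis by (simp add: algebra_simps)
qed

lemma integral_ang_nonneg: "(LI xi. ang D xi) >= 0"
 by (rule integral_nonneg_AE, use AE_neq_0 in eventually_elim) (rule ang_nonneg)

text \<open>The quadratic polynomial B + mu^2 A - mu M is nonnegative for every real
  \<open>mu\<close>, so its discriminant is not positive.\<close>

theorem spectral_uncertainty:
 fixes v :: "'a::euclidean_space => complex"
 assumes v: "nice v D" and s: "s > 0"
 shows "(real DIM('a) + s) / 2 * mom s v <= sqrt (mom (2 * s) v) * sqrt (gradB D)"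
proof -
 define A B M where "A = mom (2 * s) v" and "B = gradB D" and "M = (real DIM('a) + s) * mom s v"
 have nn: "A >= 0" "B >= 0" "M >= 0" using s by (auto simp: A_def B_def M_def)
 have q: "B + mu\<^sup>2 * A - mu * M >= 0" for mu
 proof -
 have "0 <= (LI xi. csq (eul D xi + of_real (mu * norm xi powr s) * v xi))"
 by (intro integral_nonneg_AE) auto
 then show ?thesis
 using deficit_identity[OF v s, of mu] integral_ang_nonneg[of D]
 unfolding A_def B_def M_def mult.assoc[symmetric] by linarith
 qed
 have "M\<^sup>2 <= 4 * A * B"
 proof (cases "A = 0")
 case True
 \<comment> \<open>Without quadratic term the polynomial is affine in \<open>mu\<close>, and a
   nonnegative affine function has slope 0.\<close>
 have "M = 0"
 proof (rule ccontr)
 assume "M ~= 0"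
 then show False using q[of "(B + 1) / M"] True by simp
 qed
 then show ?thesis using True by simp
 next
 case False
 then have A: "A > 0" using nn by simp
 have "B + (M / (2 * A))\<^sup>2 * A - M / (2 * A) * M = B - M\<^sup>2 / (4 * A)"
 using A by (simp add: field_simps power2_eq_square)
 then have "M\<^sup>2 / (4 * A) <= B" using q[of "M / (2 * A)"] by simp
 then show ?thesis using A by (simp add: pos_divide_le_eq mult_ac)
 qed
 then have "(M / 2)\<^sup>2 <= A * B" by (simp add: power_divide)
 then have "M / 2 <= sqrt (A * B)" by (rule real_le_rsqrt)
 then show ?thesis by (simp add: A_def B_def M_def real_sqrt_mult)
qed

text \<open>\<open>X\<close> and \<open>y\<close> are the nonradial and radial parts of R v + mu
  |xi|^s v, and spherical mean zero makes both the square integral and the weighted mass split. The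
  nonradial part is paid for by the angular energy, the radial part by
  \<open>radial_stability\<close>; as profiles are radial, subtracting a multiple affects the radial
  part only.\<close>

theorem spectral_stability:
 fixes v :: "'a::euclidean_space => complex"
 assumes v: "nice v D" and s: "s > 0" and mu: "mu > 0" and N: "DIM('a) >= 2"
 and a: "a > 0" "a\<^sup>2 + a * real DIM('a) = real DIM('a) - 1"
 shows "\<exists>al. min (2 * s) (2 * a) * mu * mom s (%xi. v xi - al * prof s mu xi)
 <= gradB D + mu\<^sup>2 * mom (2 * s) v - mu * (real DIM('a) + s) * mom s v"
proof -
 let ?n = "DIM('a)"
 define c where "c = smean v"
 define c' where "c' r = smean (eul D) r / of_real r" for r
 note [measurable] = niceD(3)[OF v] eul_measurable[OF v] ang_measurable[OF v]
 have [measurable]: "c \<in> bmeas" unfolding c_def by (rule smean_measurable) measurable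
 have [measurable]: "c' \<in> bmeas" unfolding c'_def[abs_def] using smean_measurable[OF eul_measurable[OF v]] by measurable
 have n0: "nice (%xi::'a. c (norm xi)) (radD c')" using nice_smean[OF v] by (simp add: c_def c'_def[abs_def])
 define vp where "vp xi = v xi - c (norm xi)" for xi :: 'a
 define Dp where "Dp xi h = D xi h - radD c' xi h" for xi h :: 'a
 have np: "nice vp Dp" unfolding vp_def[abs_def] Dp_def[abs_def] by (rule nice_diff[OF v n0])
 note [measurable] = niceD(3)[OF np] eul_measurable[OF np]
 define X where "X xi = eul Dp xi + of_real (mu * norm xi powr s) * vp xi" for xi
 define y where "y r = of_real r * c' r + of_real (mu * r powr s) * c r" for r
 have [measurable]: "y \<in> bmeas" unfolding y_def[abs_def] by measurable
 have rX: "rapid X" unfolding X_def[abs_def] using s by (intro rapid_eul_plus[OF np]) auto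
 have ry: "rapid (%xi::'a. y (norm xi))"
 using rapid_eul_plus[OF n0, of s mu] s by (simp add: eul_radD y_def)
 have Xy: "eul D xi + of_real (mu * norm xi powr s) * v xi = X xi + y (norm xi)" for xi
 unfolding X_def y_def Dp_def eul_diff eul_radD vp_def by (simp add: algebra_simps)
 have svp: "smean vp r = 0" if "r > 0" for r
 unfolding vp_def c_def by (rule smean_minus_smean[OF niceD(2)[OF v] that])
 have sX: "smean X r = 0" if r: "r > 0" for r
 proof -
 have "smean (eul Dp) r = smean (%xi. eul D xi - of_real (norm xi) * c' (norm xi)) r"
 by (intro arg_cong[where f="%f. smean f r"]) (simp add: fun_eq_iff Dp_def[abs_def] eul_diff eul_radD)
 also have "... = smean (eul D) r - smean (%xi::'a. of_real (norm xi) * c' (norm xi)) r"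
 using rapid_eul[OF n0] by (intro smean_diff rapid_eul[OF v]) (simp add: eul_radD[abs_def])
 also have "smean (%xi::'a. of_real (norm xi) * c' (norm xi)) r = of_real r * c' r"
 by (rule smean_radial[where k="%r. of_real r * c' r"]) (use r in measurable)
 finally have 1: "smean (eul Dp) r = 0" using r by (simp add: c'_def)
 have "smean X r = smean (eul Dp) r + smean (%xi. of_real (mu * norm xi powr s) * vp xi) r"
 unfolding X_def using rapid_diff[OF rX rapid_eul[OF np]] by (intro smean_add rapid_eul[OF np]) (simp add: X_def)
 also have "smean (%xi. of_real (mu * norm xi powr s) * vp xi) r = of_real (mu * r powr s) * smean vp r"
 by (rule smean_radial_mult[where k="%r. of_real (mu * r powr s)"]) (use r in measurable)
 finally show ?thesis using 1 svp[OF r] by simp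
 qed
 have split: "(LI xi. csq (eul D xi + of_real (mu * norm xi powr s) * v xi))
 = (LI xi. csq (X xi)) + (LI xi. csq (y (norm (xi::'a))))"
 using integral_square_add_radial[OF rX sX, where y=y and ph="%_. 1"] integrable_norm2[OF rX] integrable_norm2[OF ry] integrable_norm2[OF rapid_add[OF rX ry]]
 unfolding Xy by simp
 have rvp: "rapid vp" by (rule niceD(2)[OF np])
 have ang_ge: "(real ?n - 1) * (LI xi. csq (vp xi)) <= (LI xi. ang D xi)"
 using angular_energy_ge[OF v N] by (simp add: vp_def c_def)
 \<comment> \<open>The square of \<open>X - a * vp\<close>, integrated by parts, turns plain mass
   into |xi|^s-weighted mass at the price a^2 + a N. By the choice of \<open>a\<close> this price
   equals the Poincare constant N - 1, so adding \<open>ang_ge\<close> cancels the plain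
   mass.\<close>
 have X_ge: "2 * a * mu * mom s vp - (real ?n - 1) * (LI xi. csq (vp xi)) <= (LI xi. csq (X xi))"
 proof -
 have iP: "integ (%xi. norm xi powr s * csq (vp xi))" using s by (intro integrable_powr_norm2 rvp) auto
 have iI: "integ (%xi. 2 * (vp xi \<bullet> eul Dp xi))"
 using integrable_inner[OF rvp rapid_eul[OF np]] by simp
 have le: "a * (2 * (vp xi \<bullet> eul Dp xi)) + 2 * a * mu * (norm xi powr s * csq (vp xi)) - a\<^sup>2 * csq (vp xi) <= csq (X xi)" for xi
 proof -
 have "0 <= csq (X xi + of_real (- a) * vp xi)" by simp
 also have "... = csq (X xi) - 2 * a * (X xi \<bullet> vp xi) + a\<^sup>2 * csq (vp xi)"
 unfolding norm_square_add complex_inner_of_real square_norm_of_real_mult by simp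
 also have "X xi \<bullet> vp xi = vp xi \<bullet> eul Dp xi + mu * (norm xi powr s * csq (vp xi))"
 unfolding X_def inner_add_left complex_inner_of_real' by (simp add: power2_norm_eq_inner inner_commute mult.assoc)
 finally show ?thesis by (simp add: algebra_simps)
 qed
 have "(LI xi. a * (2 * (vp xi \<bullet> eul Dp xi)) + 2 * a * mu * (norm xi powr s * csq (vp xi)) - a\<^sup>2 * csq (vp xi)) <= (LI xi. csq (X xi))"
 using iP iI integrable_norm2[OF rvp] integrable_norm2[OF rX] le by (intro integral_mono) auto
 also have "(LI xi. a * (2 * (vp xi \<bullet> eul Dp xi)) + 2 * a * mu * (norm xi powr s * csq (vp xi)) - a\<^sup>2 * csq (vp xi))
 = a * (LI xi. 2 * (vp xi \<bullet> eul Dp xi)) + 2 * a * mu * mom s vp - a\<^sup>2 * (LI xi. csq (vp xi))"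
 unfolding mom_def using iP iI integrable_norm2[OF rvp] by simp
 also have "... = 2 * a * mu * mom s vp - (a\<^sup>2 + a * real ?n) * (LI xi. csq (vp xi))"
 unfolding radial_ibp_0[OF np] by (simp add: algebra_simps)
 finally show ?thesis unfolding a(2) .
 qed
 have "(c has_vector_derivative c' t) (at t)" if "t > 0" for t
 using smean_has_vector_derivative[OF v that] by (simp add: c_def c'_def)
 from radial_stability[OF s mu n0 this] obtain al
 where al: "2 * s * mu * mom s (%xi::'a. c (norm xi) - al * prof s mu xi) <= (LI xi. csq (y (norm (xi::'a))))"
 by (auto simp: eul_radD y_def)
 define z where "z xi = c (norm xi) - al * prof s mu xi" for xi :: 'a
 have rz: "rapid z" unfolding z_def[abs_def] by (intro rapid_diff rapid_cmult rapid_prof s mu niceD(2)[OF n0])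
 have mom_split: "mom s (%xi. v xi - al * prof s mu xi) = mom s vp + mom s z"
 proof -
 have e: "v xi - al * prof s mu xi = vp xi + (%t. c t - al * of_real (gl s mu t)) (norm xi)" for xi
 by (simp add: vp_def prof_def)
 have ze: "z xi = (%t. c t - al * of_real (gl s mu t)) (norm xi)" for xi by (simp add: z_def prof_def)
 show ?thesis
 unfolding mom_def e ze
 proof (rule integral_square_add_radial[OF rvp svp, where ph="%t. t powr s"])
 show "integ (%xi. norm xi powr s * csq (vp xi))" using s by (intro integrable_powr_norm2 rvp) auto
 show "integ (%xi::'a. norm xi powr s * csq (c (norm xi) - al * complex_of_real (gl s mu (norm xi))))"
 using integrable_powr_norm2[OF rz, of s] s by (simp add: ze)
 show "integ (%xi. norm xi powr s * csq (vp xi + (c (norm xi) - al * complex_of_real (gl s mu (norm xi)))))"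
 using integrable_powr_norm2[OF rapid_add[OF rvp rz], of s] s by (simp add: ze)
 qed auto
 qed
 have "min (2 * s) (2 * a) * mu * (mom s vp + mom s z) <= 2 * a * mu * mom s vp + 2 * s * mu * mom s z"
 unfolding distrib_left using mu by (intro add_mono mult_right_mono) auto
 also have "... <= (LI xi. csq (X xi)) + (LI xi. csq (y (norm (xi::'a)))) + (LI xi. ang D xi)"
 using ang_ge X_ge al[folded z_def[abs_def]] by linarith
 also have "... = gradB D + mu\<^sup>2 * mom (2 * s) v - mu * (real DIM('a) + s) * mom s v"
 using deficit_identity[OF v s, of mu] unfolding split .
 finally show ?thesis unfolding mom_split[symmetric] by blast
qed

section \<open>Energies, deficit and distance in terms of the Fourier transform\<close>

lemma mom_eq_l2sq: "mom p v = l2sq (%xi. of_real (norm xi powr (p / 2)) * v xi)"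
 by (simp add: mom_def l2sq_def norm_mult power_mult_distrib powr_mult_self)

lemma square_int_weight: "rapid v ==> p >= 0 ==> square_int (%xi. of_real (norm xi powr (p / 2)) * v xi)"
 by (intro rapid_square_int rapid_powr_mult) auto

lemma mom_triangle:
 assumes "rapid v" "rapid w" "p >= 0"
 shows "\<bar>sqrt (mom p v) - sqrt (mom p w)\<bar> <= sqrt (mom p (%xi. v xi - w xi))"
 using l2_triangle_diff[OF square_int_weight[OF assms(1,3)] square_int_weight[OF assms(2,3)]]
 by (simp add: mom_eq_l2sq right_diff_distrib)

lemma mom_cmult: "mom p (%xi. c * v xi) = csq c * mom p v"
 by (simp add: mom_def norm_mult power_mult_distrib mult.left_commute flip: integral_mult_right_zero)

lemma mom_minus_commute: "mom p (%xi. v xi - w xi) = mom p (%xi. w xi - v xi)"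
 by (simp add: mom_def norm_minus_commute)

lemma mom_cong_AE:
 assumes "AE xi in lborel. v xi = w xi" "v \<in> bmeas" "w \<in> bmeas"
 shows "mom p v = mom p w"
 unfolding mom_def using assms by (intro integral_cong_AE) (auto elim: AE_mp)

lemma mom_eq_0_AE:
 assumes "rapid v" "p >= 0" "mom p v = 0" shows "AE xi in lborel. v xi = 0"
 using l2sq_zero_AE[OF square_int_weight[OF assms(1,2)]] assms(3) AE_neq_0
 unfolding mom_eq_l2sq by auto

lemma lap_energy_mom:
 assumes "rapid v" "p > 0"
 shows "lap_energy p (inv_fourier v) = (2 * pi) powr (4 * p) * mom (4 * p) v"
proof -
 have "(2 * pi * norm xi) powr (4 * p) * csq (v xi) = (2 * pi) powr (4 * p) * (norm xi powr (4 * p) * csq (v xi))" for xi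
 by (simp add: powr_mult)
 then show ?thesis unfolding lap_energy_inv_fourier[OF assms] mom_def by (simp only: integral_mult_right_zero)
qed

lemma grad_energy_gradB: "nice z D ==> grad_energy (inv_fourier z) = gradB D"
 unfolding gradB_def by (rule grad_energy_inv_fourier(1))

lemma inv_fourier_diff': "rapid v ==> rapid w ==> inv_fourier (%xi. v xi - w xi) = (%x. inv_fourier v x - inv_fourier w x)"
 by (intro ext inv_fourier_diff rapid_integrable)

definition deficit :: "real => ('a::euclidean_space => complex) => ('a => 'a => complex) => real" where
 "deficit s z D = sqrt (mom (2 * s) z) * sqrt (gradB D) - (real DIM('a) + s) / 2 * mom s z"

lemma G_eq: "G s mu = inv_fourier (prof s mu)"
 by (simp add: G_def prof_def[abs_def] gl_def)

text \<open>The powers of 2 pi combine to one common factor (2 pi)^s in both terms of the deficit,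
  so they drop out of all comparisons.\<close>

lemma energies_inv_fourier:
 fixes z :: "'a::euclidean_space => complex"
 assumes z: "nice z D" and s: "s > 0"
 shows "lap_energy (s / 4) (inv_fourier z) = (2 * pi) powr s * mom s z"
 and "lap_energy (s / 2) (inv_fourier z) = (2 * pi) powr (2 * s) * mom (2 * s) z"
 and "sqrt (lap_energy (s / 2) (inv_fourier z)) * sqrt (grad_energy (inv_fourier z)) - (real DIM('a) + s) / 2 * lap_energy (s / 4) (inv_fourier z)
 = (2 * pi) powr s * deficit s z D"
proof -
 note r = niceD(2)[OF z]
 show 1: "lap_energy (s / 4) (inv_fourier z) = (2 * pi) powr s * mom s z"
 and 2: "lap_energy (s / 2) (inv_fourier z) = (2 * pi) powr (2 * s) * mom (2 * s) z"
 using lap_energy_mom[OF r, of "s / 4"] lap_energy_mom[OF r, of "s / 2"] s by (simp_all add: mult.commute[of _ 2])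
 have "sqrt ((2 * pi) powr (2 * s)) = (2 * pi) powr s"
 by (simp add: powr_mult_self[symmetric])
 then show "sqrt (lap_energy (s / 2) (inv_fourier z)) * sqrt (grad_energy (inv_fourier z)) - (real DIM('a) + s) / 2 * lap_energy (s / 4) (inv_fourier z)
 = (2 * pi) powr s * deficit s z D"
 unfolding 1 2 grad_energy_gradB[OF z] deficit_def by (simp add: real_sqrt_mult right_diff_distrib)
qed

lemma profile_distance:
 assumes z: "rapid z" and s: "s > 0" and mu: "mu > 0"
 shows "lap_energy (s / 4) (%x. inv_fourier z x - al * G s mu x) = (2 * pi) powr s * mom s (%xi. z xi - al * prof s mu xi)"
proof -
 have r: "rapid (%xi. al * prof s mu xi)" by (intro rapid_cmult rapid_prof s mu)
 have "(%x. inv_fourier z x - al * G s mu x) = inv_fourier (%xi. z xi - al * prof s mu xi)"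
 unfolding inv_fourier_diff'[OF z r] G_eq inv_fourier_cmult ..
 then show ?thesis using lap_energy_mom[OF rapid_diff[OF z r], of "s / 4"] s by simp
qed

lemma dist_to_profiles_le:
 assumes z: "rapid z" and s: "s > 0" and mu: "mu > 0"
 shows "dist_to_profiles s (inv_fourier z) <= (2 * pi) powr s * mom s (%xi. z xi - al * prof s mu xi)"
proof -
 have "dist_to_profiles s (inv_fourier z) <= (case (al, mu) of (al, mu) => lap_energy (s / 4) (%x. inv_fourier z x - al * G s mu x))"
 unfolding dist_to_profiles_def
 proof (rule cINF_lower)
 show "bdd_below ((%(al, mu). lap_energy (s / 4) (%x. inv_fourier z x - al * G s mu x)) ` (UNIV \<times> {0<..}))"
 using profile_distance[OF z s] by (intro bdd_belowI[of _ 0]) auto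
 qed (use mu in auto)
 then show ?thesis by (simp add: profile_distance[OF z s mu])
qed

lemma dist_to_profiles_ge:
 assumes z: "rapid z" and s: "s > 0" and d: "!!al mu. mu > 0 ==> d <= mom s (%xi. z xi - al * prof s mu xi)"
 shows "(2 * pi) powr s * d <= dist_to_profiles s (inv_fourier z)"
 unfolding dist_to_profiles_def
 by (rule cINF_greatest) (use profile_distance[OF z s] d in auto)

lemma deficit_nonneg: "nice z D ==> s > 0 ==> deficit s z D >= 0"
 using spectral_uncertainty[of z D s] by (simp add: deficit_def)

text \<open>\<open>a\<close> is the positive root of the quadratic equation; that it lies below 1
  comes from N^2 + 4 N - 4 < (N + 2)^2.\<close>

lemma spectral_gap_root:
 assumes N: "N >= (2::real)"
 defines "a \<equiv> (sqrt (N\<^sup>2 + 4 * N - 4) - N) / 2"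
 shows "a > 0" "a < 1" "a\<^sup>2 + a * N = N - 1"
proof -
 have "N\<^sup>2 < N\<^sup>2 + 4 * N - 4" using N by simp
 then show "a > 0" unfolding a_def using N real_less_rsqrt[of N] by simp
 have "sqrt (N\<^sup>2 + 4 * N - 4) < N + 2"
 using N by (intro real_less_lsqrt) (auto simp: power2_eq_square algebra_simps)
 then show "a < 1" by (simp add: a_def)
 have "(sqrt (N\<^sup>2 + 4 * N - 4))\<^sup>2 = N\<^sup>2 + 4 * N - 4"
 using N zero_le_power2[of N] by (intro real_sqrt_pow2) linarith
 then show "a\<^sup>2 + a * N = N - 1" unfolding a_def by (simp add: power2_eq_square field_simps)
qed

theorem stability_inv_fourier:
 fixes z :: "'a::euclidean_space => complex"
 assumes z: "nice z D" and s: "s > 0" and N: "DIM('a) >= 2"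
 defines "n \<equiv> real DIM('a)"
 shows "min (2 * s) (sqrt (n\<^sup>2 + 4 * n - 4) - n) / 2 * dist_to_profiles s (inv_fourier z) <= (2 * pi) powr s * deficit s z D"
proof -
 let ?\<Lambda> = "min (2 * s) (sqrt (n\<^sup>2 + 4 * n - 4) - n)"
 define a where "a = (sqrt (n\<^sup>2 + 4 * n - 4) - n) / 2"
 have a: "a > 0" "a < 1" "a\<^sup>2 + a * n = n - 1"
 unfolding a_def using spectral_gap_root[of n] N by (auto simp: n_def)
 have "2 * a = sqrt (n\<^sup>2 + 4 * n - 4) - n" by (simp add: a_def)
 then have L: "?\<Lambda> = min (2 * s) (2 * a)" "?\<Lambda> > 0" using a(1) s by auto
 have "\<exists>al mu. mu > 0 \<and> ?\<Lambda> / 2 * mom s (%xi. z xi - al * prof s mu xi) <= deficit s z D"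
 proof (cases "mom (2 * s) z > 0 \<and> gradB D > 0")
 case True
 define A B where "A = sqrt (mom (2 * s) z)" and "B = sqrt (gradB D)"
 have AB: "A > 0" "B > 0" "mom (2 * s) z = A\<^sup>2" "gradB D = B\<^sup>2" using True by (auto simp: A_def B_def)
 \<comment> \<open>The balancing choice: both energies then contribute \<open>B\<^sup>2\<close>, and
   the quadratic expression becomes 2 mu times the deficit, which is why half the spectral gap
   appears.\<close>
 define mu where "mu = B / A"
 have mu: "mu > 0" using AB by (simp add: mu_def)
 obtain al where "?\<Lambda> * mu * mom s (%xi. z xi - al * prof s mu xi) <= B\<^sup>2 + mu\<^sup>2 * A\<^sup>2 - mu * (n + s) * mom s z"
 using spectral_stability[OF z s mu N a(1) a(3)[unfolded n_def]] unfolding L(1)[symmetric] AB(3,4) n_def[symmetric] by blast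
 also have "B\<^sup>2 + mu\<^sup>2 * A\<^sup>2 - mu * (n + s) * mom s z = 2 * mu * deficit s z D"
 unfolding deficit_def A_def[symmetric] B_def[symmetric] n_def[symmetric] using AB(1,2)
 by (simp add: mu_def field_simps power2_eq_square)
 finally have le: "?\<Lambda> * mu * mom s (%xi. z xi - al * prof s mu xi) <= 2 * mu * deficit s z D" .
 have "mu * (L / 2 * m) <= mu * d" if "L * mu * m <= 2 * mu * d" for L m d :: real
 using that by (simp add: algebra_simps)
 from this[OF le] have "mu * (?\<Lambda> / 2 * mom s (%xi. z xi - al * prof s mu xi)) <= mu * deficit s z D" .
 then show ?thesis using mu by (metis mult_le_cancel_left_pos)
 next
 case False
 \<comment> \<open>If one energy vanishes, the uncertainty inequality forces the weighted mass to
   vanish, and the trivial multiple 0 suffices.\<close>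
 then have "mom (2 * s) z = 0 \<or> gradB D = 0"
 using mom_nonneg[of "2 * s" z] gradB_nonneg[of D] by linarith
 then have "(n + s) / 2 * mom s z <= 0" using spectral_uncertainty[OF z s] by (auto simp: n_def)
 then have "mom s z = 0"
 using s N mom_nonneg[of s z] by (simp add: n_def mult_le_0_iff)
 then show ?thesis using deficit_nonneg[OF z s] by (intro exI[of _ 0] exI[of _ 1]) simp
 qed
 then obtain al mu where mu: "mu > 0" "?\<Lambda> / 2 * mom s (%xi. z xi - al * prof s mu xi) <= deficit s z D" by blast
 have "?\<Lambda> / 2 * dist_to_profiles s (inv_fourier z) <= ?\<Lambda> / 2 * ((2 * pi) powr s * mom s (%xi. z xi - al * prof s mu xi))"
 using L(2) by (intro mult_left_mono dist_to_profiles_le niceD(2)[OF z] s mu(1)) auto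
 also have "... <= (2 * pi) powr s * deficit s z D"
 using mult_left_mono[OF mu(2), of "(2 * pi) powr s"] by (simp only: mult_ac powr_ge_zero)
 finally show ?thesis .
qed

subsection \<open>Approximation by test functions\<close>

text \<open>\<open>mollify k z m\<close> is the Fourier transform of the truncation of \<open>inv_fourier z\<close> by
 \<open>x \<mapsto> inv_fourier k (x / m)\<close>.\<close>

definition mollify :: "('a::euclidean_space => complex) => ('a => complex) => real => 'a => complex" where
 "mollify k z m xi = (LI et. k et * z (xi - (1 / m) *. et))"

lemma mollify_measurable:
 assumes [measurable]: "k \<in> bmeas" "z \<in> bmeas"
 shows "mollify k z m \<in> bmeas"
 unfolding mollify_def[abs_def] by measurable

text \<open>Peetre's inequality gives the uniform decay.\<close>

lemma mollify_bound:
 fixes k z :: "'a::euclidean_space => complex"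
 assumes k: "rapid k" and z: "rapid z"
 shows "\<exists>C\<ge>0. \<forall>m\<ge>1. \<forall>xi. cmod (mollify k z m xi) <= C / (1 + norm xi) ^ j"
proof -
 note [measurable] = rapidD_measurable[OF k] rapidD_measurable[OF z]
 obtain C where C: "C >= 0" "!!x. cmod (z x) <= C / (1 + norm x) ^ j" using rapid_bound[OF z, of j] by blast
 have "rapid (%et. of_real ((1 + norm et) ^ j) * k et)"
 by (rule rapid_dominated[OF k, where C=1 and j=j]) (auto simp: norm_mult simp del: of_real_power of_real_add)
 from integrable_norm[OF rapid_integrable[OF this]]
 have i: "integ (%et. (1 + norm et) ^ j * cmod (k et))" by (simp add: norm_mult del: of_real_power of_real_add)
 define K where "K = (LI et. (1 + norm et) ^ j * cmod (k et))"
 have K: "K >= 0" unfolding K_def by (intro integral_nonneg_AE) auto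
 have "cmod (mollify k z m xi) <= C * K / (1 + norm xi) ^ j" if m: "m >= 1" for m xi
 proof -
 have pos: "(1 + norm xi) ^ j > 0" for xi :: 'a by (intro zero_less_power add_pos_nonneg) auto
 have "cmod (mollify k z m xi) <= (LI et. C / (1 + norm xi) ^ j * ((1 + norm et) ^ j * cmod (k et)))"
 unfolding mollify_def
 proof (rule order_trans[OF integral_norm_bound integral_mono_AE'])
 show "AE et in lborel. cmod (k et * z (xi - (1 / m) *. et)) <= C / (1 + norm xi) ^ j * ((1 + norm et) ^ j * cmod (k et))"
 proof (rule AE_I2)
 fix et :: 'a
 let ?y = "xi - (1 / m) *. et"
 have "norm xi <= norm ?y + norm ((1 / m) *. et)" using norm_triangle_ineq[of ?y "(1 / m) *. et"] by simp
 also have "norm ((1 / m) *. et) <= 1 * norm et" using m by (simp only: norm_scaleR) (intro mult_right_mono, auto)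
 moreover have "(1 + norm ?y) * (1 + norm et) = 1 + norm ?y + norm et + norm ?y * norm et" "0 <= norm ?y * norm et"
 by (simp_all add: algebra_simps)
 ultimately have "1 + norm xi <= (1 + norm ?y) * (1 + norm et)" by linarith
 then have "(1 + norm xi) ^ j <= ((1 + norm ?y) * (1 + norm et)) ^ j" by (intro power_mono) auto
 then have P: "(1 + norm xi) ^ j <= (1 + norm ?y) ^ j * (1 + norm et) ^ j" by (simp only: power_mult_distrib)
 have "1 / b <= c / a" if "a <= b * c" "a > 0" "b > 0" for a b c :: real
 using that by (simp add: divide_simps mult.commute)
 from this[OF P pos pos] have "1 / (1 + norm ?y) ^ j <= (1 + norm et) ^ j / (1 + norm xi) ^ j" .
 from mult_left_mono[OF this C(1)] have "cmod (z ?y) <= C * ((1 + norm et) ^ j / (1 + norm xi) ^ j)"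
 using C(2)[of ?y] by simp
 from mult_left_mono[OF this, of "cmod (k et)"]
 show "cmod (k et * z ?y) <= C / (1 + norm xi) ^ j * ((1 + norm et) ^ j * cmod (k et))"
 by (simp add: norm_mult mult_ac)
 qed
 qed (use i C(1) in auto)
 also have "... = C * K / (1 + norm xi) ^ j" by (simp add: K_def)
 finally show ?thesis .
 qed
 then show ?thesis using K C(1) by (intro exI[of _ "C * K"]) auto
qed

lemma rapid_mollify: "rapid k ==> rapid z ==> m >= 1 ==> rapid (mollify k z m)"
 unfolding rapid_def[of "mollify k z m"]
proof (intro conjI allI)
 fix j assume "rapid k" "rapid z" "m >= 1"
 then obtain C where C: "!!xi. cmod (mollify k z m xi) <= C / (1 + norm xi) ^ j" using mollify_bound by meson
 have "(1 + norm xi) ^ j > 0" for xi :: 'a by (intro zero_less_power add_pos_nonneg) auto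
 then show "\<exists>C. \<forall>x. cmod (mollify k z m x) * (1 + norm x) ^ j <= C"
 using C by (intro exI[of _ C]) (simp add: pos_le_divide_eq)
qed (intro mollify_measurable rapidD_measurable)

lemma mollify_tendsto:
 fixes k z :: "'a::euclidean_space => complex"
 assumes k: "rapid k" "(LI et. k et) = 1" and z: "rapid z" "continuous_on UNIV z"
 and c: "(%n. 1 / c n) ----> 0"
 shows "(%n. mollify k z (c n) xi) ----> z xi"
proof -
 note [measurable] = rapidD_measurable[OF k(1)] rapidD_measurable[OF z(1)]
 obtain C where C: "!!x. cmod (z x) <= C" using rapid_bounded[OF z(1)] by blast
 have "(%n. mollify k z (c n) xi) ----> (LI et. k et * z xi)"
 unfolding mollify_def
 proof (rule integral_dominated_convergence[where w="%et. cmod (k et) * C"])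
 show "AE et in lborel. (%n. k et * z (xi - (1 / c n) *. et)) ----> k et * z xi"
 proof (rule AE_I2)
 fix et :: 'a
 have "(%n. xi - (1 / c n) *. et) ----> xi - 0 *. et" by (intro tendsto_intros c)
 moreover have "isCont z (xi - 0 *. et)" using z(2) by (simp add: continuous_on_eq_continuous_at)
 ultimately have "(%n. z (xi - (1 / c n) *. et)) ----> z (xi - 0 *. et)" using isCont_tendsto_compose by blast
 then show "(%n. k et * z (xi - (1 / c n) *. et)) ----> k et * z xi" by (intro tendsto_mult_left) simp
 qed
 show "AE et in lborel. norm (k et * z (xi - (1 / c n) *. et)) <= cmod (k et) * C" for n
 using C by (auto simp: norm_mult intro!: mult_left_mono)
 show "integ (%et. cmod (k et) * C)" using integrable_norm[OF rapid_integrable[OF k(1)]] by simp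
 qed measurable
 then show ?thesis using k(2) rapid_integrable[OF k(1)] by simp
qed

lemma inv_fourier_mollify:
 fixes k z :: "'a::euclidean_space => complex"
 assumes k: "rapid k" and z: "rapid z"
 shows "inv_fourier (mollify k z m) x = inv_fourier k ((1 / m) *. x) * inv_fourier z x"
proof -
 note [measurable] = rapidD_measurable[OF k] rapidD_measurable[OF z]
 let ?F = "%(xi, et). k et * z (xi - (1 / m) *. et) * chr (x \<bullet> xi)"
 have shift: "(LI xi. k et * z (xi - (1 / m) *. et) * chr (x \<bullet> xi)) = (k et * chr ((1 / m) *. x \<bullet> et)) * inv_fourier z x" for et
 proof -
 have "(LI xi. k et * z (xi - (1 / m) *. et) * chr (x \<bullet> xi)) = (LI xi. k et * z xi * chr (x \<bullet> (xi + (1 / m) *. et)))"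
 using integral_lborel_shift[of "%xi. k et * z (xi - (1 / m) *. et) * chr (x \<bullet> xi)" "(1 / m) *. et"] by simp
 also have "... = (LI xi. (k et * chr ((1 / m) *. x \<bullet> et)) * (z xi * chr (x \<bullet> xi)))"
 by (intro Bochner_Integration.integral_cong refl) (simp add: inner_add_right chr_add mult_ac)
 finally show ?thesis by (simp add: inv_fourier_eq)
 qed
 have int: "integrable (lborel \<Otimes>\<^sub>M lborel) ?F"
 proof -
 have "integrable (lborel \<Otimes>\<^sub>M lborel) (%(et, xi). k et * z (xi - (1 / m) *. et) * chr (x \<bullet> xi))"
 proof (rule lborel_pair.Fubini_integrable)
 have "(LI xi. cmod (k et * z (xi - (1 / m) *. et) * chr (x \<bullet> xi))) = cmod (k et) * (LI xi. cmod (z xi))" for et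
 using integral_lborel_shift[of "%xi. cmod (z (xi - (1 / m) *. et))" "(1 / m) *. et"] by (simp add: norm_mult)
 then show "integ (%et. LI xi. norm (case (et, xi) of (et, xi) => k et * z (xi - (1 / m) *. et) * chr (x \<bullet> xi)))"
 using integrable_norm[OF rapid_integrable[OF k]] by simp
 have "integ (%xi. k et * (z (xi - (1 / m) *. et) * chr (x \<bullet> xi)))" for et
 using integrable_lborel_shift[of z "- (1 / m) *. et"] rapid_integrable[OF z]
 by (intro integrable_mult_right integrable_mult_chr) auto
 then show "AE et in lborel. integ (%xi. case (et, xi) of (et, xi) => k et * z (xi - (1 / m) *. et) * chr (x \<bullet> xi))"
 by (simp add: mult.assoc)
 qed measurable
 then show ?thesis by (subst lborel_pair.integrable_product_swap_iff[symmetric]) (simp add: split_beta')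
 qed
 have "inv_fourier (mollify k z m) x = (LI xi. LI et. k et * z (xi - (1 / m) *. et) * chr (x \<bullet> xi))"
 by (simp add: inv_fourier_eq mollify_def)
 also have "... = (LI et. LI xi. k et * z (xi - (1 / m) *. et) * chr (x \<bullet> xi))"
 using lborel_pair.Fubini_integral[OF int] by simp
 also have "... = inv_fourier k ((1 / m) *. x) * inv_fourier z x"
 by (simp only: shift integral_mult_left_zero) (simp add: inv_fourier_eq)
 finally show ?thesis .
qed

lemma mom_mollify_tendsto:
 fixes k z :: "'a::euclidean_space => complex"
 assumes k: "rapid k" "(LI et. k et) = 1" and z: "rapid z" "continuous_on UNIV z" and p: "p >= 0"
 shows "(%n. mom p (%xi. mollify k z (real (Suc n)) xi - z xi)) ----> 0"
proof -
 \<comment> \<open>Enough decay to absorb the weight of order \<open>p\<close> and leave an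
   integrable power; by \<open>mollify_bound\<close> the constant \<open>C\<close> is the same for
   all \<open>n\<close>.\<close>
 let ?j = "nat \<lceil>p\<rceil> + 2 * DIM('a)" and ?y = "%n. mollify k z (real (Suc n))"
 have [measurable]: "!!n. ?y n \<in> bmeas" "z \<in> bmeas"
 using k z by (auto intro!: rapidD_measurable rapid_mollify)
 obtain C where C: "C >= 0" "!!n xi. cmod (?y n xi) <= C / (1 + norm xi) ^ ?j"
 using mollify_bound[OF k(1) z(1), of ?j] by force
 obtain E where E: "E >= 0" "!!xi. cmod (z xi) <= E / (1 + norm xi) ^ ?j" using rapid_bound[OF z(1)] by blast
 have "(%n. mom p (%xi. ?y n xi - z xi)) ----> (LI xi. norm (xi::'a) powr p * csq 0)"
 unfolding mom_def
 proof (rule integral_dominated_convergence[where w="%xi. (C + E)\<^sup>2 * (1 / (1 + norm xi) ^ (2 * DIM('a)))"])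
 have "(%n. ?y n xi) ----> z xi" for xi
 by (rule mollify_tendsto[OF k z, where c="%n. real (Suc n)"]) (rule inverse_Suc_seq(2))
 then have "(%n. ?y n xi - z xi) ----> 0" for xi by (simp add: LIM_zero_iff)
 then show "AE xi in lborel. (%n. norm (xi::'a) powr p * csq (?y n xi - z xi)) ----> norm xi powr p * csq 0"
 by (intro AE_I2 tendsto_intros) (metis)
 show "AE xi in lborel. norm (norm xi powr p * csq (?y n xi - z xi)) <= (C + E)\<^sup>2 * (1 / (1 + norm xi) ^ (2 * DIM('a)))" for n
 proof (rule AE_I2)
 fix xi :: 'a
 let ?q = "1 + norm xi"
 have q: "?q >= 1" by simp
 have pos: "?q ^ i > 0" for i by (intro zero_less_power) (simp add: add_pos_nonneg)
 have "cmod (?y n xi - z xi) <= (C + E) / ?q ^ ?j"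
 using norm_triangle_ineq4[of "?y n xi" "z xi"] C(2)[of n xi] E(2)[of xi] by (simp add: add_divide_distrib)
 then have "csq (?y n xi - z xi) <= ((C + E) / ?q ^ ?j)\<^sup>2" by (intro power_mono) auto
 moreover have "norm xi powr p <= ?q ^ nat \<lceil>p\<rceil>" by (rule one_plus_le_power[OF p]) simp
 ultimately have "norm xi powr p * csq (?y n xi - z xi) <= ?q ^ nat \<lceil>p\<rceil> * ((C + E) / ?q ^ ?j)\<^sup>2"
 by (intro mult_mono) auto
 also have "... = (C + E)\<^sup>2 * (?q ^ nat \<lceil>p\<rceil> / ?q ^ (2 * ?j))"
 by (simp add: power_divide power_mult[symmetric] mult.commute)
 also have "?q ^ nat \<lceil>p\<rceil> / ?q ^ (2 * ?j) <= 1 / ?q ^ (2 * DIM('a))"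
 proof -
 have "?q ^ (nat \<lceil>p\<rceil> + 2 * DIM('a)) <= ?q ^ (2 * ?j)" using q by (intro power_increasing) auto
 then show ?thesis using pos[of "2 * ?j"] pos[of "2 * DIM('a)"] by (simp add: pos_divide_le_eq pos_le_divide_eq power_add)
 qed
 finally show "norm (norm xi powr p * csq (?y n xi - z xi)) <= (C + E)\<^sup>2 * (1 / ?q ^ (2 * DIM('a)))"
 by (simp add: abs_mult mult_left_mono)
 qed
 show "integ (%xi::'a. (C + E)\<^sup>2 * (1 / (1 + norm xi) ^ (2 * DIM('a))))"
 using integrable_inverse_power_norm by (intro integrable_mult_right)
 qed measurable
 then show ?thesis by simp
qed

definition cut :: "('a::euclidean_space => complex) => nat => 'a => complex" where
 "cut u n x = cutoff (real (Suc n)) x * u x"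

lemma cutoff_scale: "m ~= 0 ==> cutoff m x = cutoff 1 ((1 / m) *. x)"
 by (simp add: cutoff_def power2_eq_square)

lemma cutoff_0: "cutoff 1 0 = 1"
 by (simp add: cutoff_def flat_def exp_minus flip: of_real_mult)

lemma test_fun_cutoff: "m > 0 ==> test_fun (cutoff m)"
 using test_fun_cutoff_mult[of "%_. 1" m] by simp

lemma test_fun_cut: "rapid z ==> test_fun (cut (inv_fourier z) n)"
 unfolding cut_def[abs_def] by (intro test_fun_cutoff_mult smooth_fun_inv_fourier) auto

text \<open>Both sides are rapidly decreasing with the same inverse transform, so Plancherel makes
  their difference null. Equality almost everywhere is all that the moments see.\<close>

lemma fourier_cut_AE:
 assumes z: "rapid z"
 shows "AE xi in lborel. fourier (cut (inv_fourier z) n) xi = mollify (fourier (cutoff 1)) z (real (Suc n)) xi"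
proof -
 let ?k = "fourier (cutoff 1) :: 'a => complex"
 let ?v = "fourier (cut (inv_fourier z) n)" and ?w = "mollify ?k z (real (Suc n))"
 have k: "rapid ?k" by (intro fourier_rapid test_fun_cutoff) simp
 have r: "rapid ?v" "rapid ?w" using test_fun_cut[OF z] k z by (auto intro!: fourier_rapid rapid_mollify)
 have "inv_fourier ?w x = cut (inv_fourier z) n x" for x
 by (simp add: inv_fourier_mollify[OF k z] test_fun_inversion test_fun_cutoff cut_def cutoff_scale[symmetric] del: of_nat_Suc)
 then have "inv_fourier (%xi. ?v xi - ?w xi) x = 0" for x
 by (simp add: inv_fourier_diff'[OF r] test_fun_inversion[OF test_fun_cut[OF z]] del: of_nat_Suc)
 then have "l2sq (%xi. ?v xi - ?w xi) = 0"
 using plancherel(2)[OF rapid_integrable[OF rapid_diff[OF r]] rapid_square_int[OF rapid_diff[OF r]]] by (simp add: l2sq_def)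
 then have "AE xi in lborel. ?v xi - ?w xi = 0" by (intro l2sq_zero_AE rapid_square_int rapid_diff r)
 then show ?thesis by eventually_elim simp
qed

text \<open>The kernel \<open>fourier (cutoff 1)\<close> has mass \<open>cutoff 1 0 = 1\<close>, so
  the mollified transforms converge to \<open>z\<close>.\<close>

lemma mom_cut_tendsto:
 assumes z: "rapid z" "continuous_on UNIV z" and p: "p >= 0"
 shows "(%n. mom p (%xi. fourier (cut (inv_fourier z) n) xi - z xi)) ----> 0"
proof -
 let ?k = "fourier (cutoff 1) :: 'a => complex"
 have k: "rapid ?k" by (intro fourier_rapid test_fun_cutoff) simp
 have "inv_fourier ?k 0 = cutoff 1 (0::'a)" by (simp add: test_fun_inversion test_fun_cutoff)
 then have k1: "(LI et. ?k et) = 1" by (simp add: inv_fourier_eq cutoff_0)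
 have "mom p (%xi. fourier (cut (inv_fourier z) n) xi - z xi) = mom p (%xi. mollify ?k z (real (Suc n)) xi - z xi)" for n
 proof (rule mom_cong_AE)
 show "AE xi in lborel. fourier (cut (inv_fourier z) n) xi - z xi = mollify ?k z (real (Suc n)) xi - z xi"
 using fourier_cut_AE[OF z(1)] by eventually_elim simp
 qed (use k z test_fun_cut[OF z(1)] in \<open>auto intro!: rapidD_measurable rapid_diff fourier_rapid rapid_mollify\<close>)
 then show ?thesis using mom_mollify_tendsto[OF k k1 z p] by simp
qed

text \<open>Carried out on the physical side. The product rule leaves two terms: the cutoff minus 1
  times a derivative of \<open>inv_fourier z\<close>, which has finite weighted energy, and a
  derivative of the rescaled cutoff times \<open>inv_fourier z\<close>, which is square integrable.
  Dominated convergence disposes of both.\<close>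

lemma grad_energy_cut_tendsto:
 assumes z: "nice z D"
 shows "(%n. grad_energy (%x. cut (inv_fourier z) n x - inv_fourier z x)) ----> 0"
proof -
 let ?Z = "inv_fourier z" and ?\<chi> = "cutoff 1 :: 'a => complex"
 let ?c = "%n. 1 / real (Suc n)"
 have sZ: "smooth_fun ?Z" by (rule smooth_fun_inv_fourier[OF niceD(2)[OF z]])
 have t\<chi>: "test_fun ?\<chi>" by (rule test_fun_cutoff) simp
 note s\<chi> = test_funD(1)[OF t\<chi>]
 have [measurable]: "?Z \<in> bmeas" "?\<chi> \<in> bmeas"
 by (auto intro: smooth_fun_measurable sZ s\<chi>)
 have mp: "partial_deriv b ?Z \<in> bmeas" "partial_deriv b ?\<chi> \<in> bmeas" if "b \<in> Basis" for b
 using that by (auto intro: smooth_fun_measurable smooth_fun_partial_deriv sZ s\<chi>)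
 let ?E = "%b n x. (?\<chi> (?c n *. x) - 1) * partial_deriv b ?Z x + of_real (?c n) * partial_deriv b ?\<chi> (?c n *. x) * ?Z x"
 have pd: "partial_deriv b (%x. cut ?Z n x - ?Z x) x = ?E b n x" for b n x
 proof (rule partial_deriv_eq[THEN trans])
 have d: "(?\<chi> has_derivative frechet_derivative ?\<chi> (at (?c n *. x))) (at (?c n *. x))"
 "(?Z has_derivative frechet_derivative ?Z (at x)) (at x)"
 using smooth_fun_differentiable[OF s\<chi>] smooth_fun_differentiable[OF sZ] by (simp_all add: frechet_derivative_works[symmetric])
 have "((%x. ?\<chi> (?c n *. x)) has_derivative (%h. frechet_derivative ?\<chi> (at (?c n *. x)) (?c n *. h))) (at x)"
 by (rule has_derivative_compose[where f="%x. ?c n *. x"]) (rule has_derivative_scaleR_right[OF has_derivative_ident], rule d)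
 from has_derivative_diff[OF has_derivative_mult[OF this d(2)] d(2)]
 show "((%x. cut ?Z n x - ?Z x) has_derivative (%h. (?\<chi> (?c n *. x) * frechet_derivative ?Z (at x) h + frechet_derivative ?\<chi> (at (?c n *. x)) (?c n *. h) * ?Z x) - frechet_derivative ?Z (at x) h)) (at x)"
 unfolding cut_def cutoff_scale[of "real (Suc n)", OF of_nat_neq_0] .
 have "frechet_derivative ?\<chi> (at (?c n *. x)) (?c n *. b) = ?c n *. frechet_derivative ?\<chi> (at (?c n *. x)) b"
 by (rule linear_scale[OF has_derivative_linear[OF d(1)]])
 then show "(?\<chi> (?c n *. x) * frechet_derivative ?Z (at x) b + frechet_derivative ?\<chi> (at (?c n *. x)) (?c n *. b) * ?Z x) - frechet_derivative ?Z (at x) b = ?E b n x"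
 by (simp add: partial_deriv_def scaleR_conv_of_real left_diff_distrib)
 qed
 obtain C0 where C0: "C0 >= 0" "!!x. cmod (?\<chi> x) <= C0" using rapid_bounded[OF test_fun_rapid[OF t\<chi>]] by blast
 have "\<exists>C. \<forall>b\<in>Basis. \<forall>x. norm x * cmod (partial_deriv b ?\<chi> x) <= C"
 proof -
 have "\<forall>b\<in>Basis. \<exists>C. \<forall>x. norm x * cmod (partial_deriv b ?\<chi> x) <= C"
 proof
 fix b :: 'a assume "b \<in> Basis"
 then have "rapid (partial_deriv b ?\<chi>)" by (intro test_fun_rapid test_fun_partial_deriv t\<chi>)
 then have "rapid (%x. of_real (norm x powr 1) * partial_deriv b ?\<chi> x)" by (rule rapid_powr_mult) simp
 then obtain C where "!!x. cmod (of_real (norm x powr 1) * partial_deriv b ?\<chi> x) <= C"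
 using rapid_bounded by blast
 then show "\<exists>C. \<forall>x. norm x * cmod (partial_deriv b ?\<chi> x) <= C" by (auto simp: norm_mult)
 qed
 then obtain C where C: "!!b x. b \<in> Basis ==> norm x * cmod (partial_deriv b ?\<chi> x) <= C b" by metis
 have "norm x * cmod (partial_deriv b ?\<chi> x) <= (\<Sum>b\<in>Basis. C b)" if b: "b \<in> Basis" for b x
 proof -
 have "0 <= C b'" if "b' \<in> Basis" for b' using C[OF that, of 0] by simp
 then have "C b <= (\<Sum>b\<in>Basis. C b)" using b by (intro member_le_sum) auto
 with C[OF b, of x] show ?thesis by linarith
 qed
 then show ?thesis by blast
 qed
 then obtain C1 where C1: "!!b x. b \<in> Basis ==> norm x * cmod (partial_deriv b ?\<chi> x) <= C1" by blast
 have lim: "(%n. norm x * cmod (?E b n x)) ----> 0" if b: "b \<in> Basis" for b x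
 proof -
 have c0: "(%n. ?c n *. x) ----> 0 *. x" by (intro tendsto_intros inverse_Suc_seq(2))
 have c: "isCont ?\<chi> (0 *. x)" "isCont (partial_deriv b ?\<chi>) (0 *. x)"
 using smooth_fun_continuous[OF s\<chi>] smooth_fun_continuous[OF smooth_fun_partial_deriv[OF s\<chi> b]]
 by (simp_all add: continuous_on_eq_continuous_at)
 have "(%n. norm x * cmod (?E b n x)) ----> norm x * cmod ((?\<chi> (0 *. x) - 1) * partial_deriv b ?Z x + of_real 0 * partial_deriv b ?\<chi> (0 *. x) * ?Z x)"
 by (intro tendsto_intros isCont_tendsto_compose[OF c(1) c0] isCont_tendsto_compose[OF c(2) c0] inverse_Suc_seq(2))
 then show ?thesis by (simp add: cutoff_0)
 qed
 have sqZ: "integ (%x. csq (?Z x))"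
 using plancherel(1)[OF rapid_integrable rapid_square_int, OF niceD(2)[OF z] niceD(2)[OF z]] by (rule square_intD)
 \<comment> \<open>\<open>norm x * ?c n\<close> is the norm of the rescaled point, so the weight
   times the derivative of the rescaled cutoff is bounded by \<open>C1\<close> at every
   scale.\<close>
 have bd: "(norm x * cmod (?E b n x))\<^sup>2 <= 2 * (C0 + 1)\<^sup>2 * ((norm x)\<^sup>2 * csq (partial_deriv b ?Z x)) + 2 * C1\<^sup>2 * csq (?Z x)"
 if b: "b \<in> Basis" for b n x
 proof -
 let ?A = "(?\<chi> (?c n *. x) - 1) * partial_deriv b ?Z x" and ?B = "of_real (?c n) * partial_deriv b ?\<chi> (?c n *. x) * ?Z x"
 have "cmod (?\<chi> (?c n *. x) - 1) <= C0 + 1" using norm_triangle_ineq4[of "?\<chi> (?c n *. x)" 1] C0(2)[of "?c n *. x"] by simp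
 then have A: "(norm x)\<^sup>2 * csq ?A <= (C0 + 1)\<^sup>2 * ((norm x)\<^sup>2 * csq (partial_deriv b ?Z x))"
 by (auto simp: norm_mult power_mult_distrib mult.left_commute intro!: mult_left_mono mult_right_mono power_mono)
 have "norm x * cmod ?B = (norm (?c n *. x) * cmod (partial_deriv b ?\<chi> (?c n *. x))) * cmod (?Z x)"
 by (simp add: norm_mult del: of_real_divide of_nat_Suc)
 also have "... <= C1 * cmod (?Z x)" by (intro mult_right_mono C1 b) auto
 finally have "(norm x * cmod ?B)\<^sup>2 <= (C1 * cmod (?Z x))\<^sup>2" by (intro power_mono) auto
 then have B: "(norm x)\<^sup>2 * csq ?B <= C1\<^sup>2 * csq (?Z x)" by (simp only: power_mult_distrib)
 have "(norm x)\<^sup>2 * csq (?A + ?B) <= (norm x)\<^sup>2 * (2 * csq ?A + 2 * csq ?B)"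
 by (intro mult_left_mono cmod_add_square_le) simp
 then show ?thesis using A B by (simp add: power_mult_distrib distrib_left)
 qed
 have "(%n. LI x. (\<Sum>b\<in>Basis. (norm (x::'a) * cmod (?E b n x))\<^sup>2)) ----> (LI (x::'a). (\<Sum>b\<in>(Basis::'a set). 0\<^sup>2))"
 proof (rule integral_dominated_convergence[where w="%x. 2 * (C0 + 1)\<^sup>2 * ((norm x)\<^sup>2 * (\<Sum>b\<in>Basis. csq (partial_deriv b ?Z x))) + real DIM('a) * (2 * C1\<^sup>2 * csq (?Z x))"])
 show "AE x in lborel. (%n. \<Sum>b\<in>Basis. (norm (x::'a) * cmod (?E b n x))\<^sup>2) ----> (\<Sum>b\<in>(Basis::'a set). 0\<^sup>2)"
 by (intro AE_I2 tendsto_sum tendsto_power lim)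
 show "AE x in lborel. norm (\<Sum>b\<in>Basis. (norm (x::'a) * cmod (?E b n x))\<^sup>2) <= 2 * (C0 + 1)\<^sup>2 * ((norm x)\<^sup>2 * (\<Sum>b\<in>Basis. csq (partial_deriv b ?Z x))) + real DIM('a) * (2 * C1\<^sup>2 * csq (?Z x))" for n
 proof (rule AE_I2)
 fix x :: 'a
 have "(\<Sum>b\<in>Basis. (norm x * cmod (?E b n x))\<^sup>2) <= (\<Sum>b\<in>Basis. 2 * (C0 + 1)\<^sup>2 * ((norm x)\<^sup>2 * csq (partial_deriv b ?Z x)) + 2 * C1\<^sup>2 * csq (?Z x))"
 by (intro sum_mono bd)
 also have "... = 2 * (C0 + 1)\<^sup>2 * ((norm x)\<^sup>2 * (\<Sum>b\<in>Basis. csq (partial_deriv b ?Z x))) + real DIM('a) * (2 * C1\<^sup>2 * csq (?Z x))"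
 by (simp add: sum.distrib sum_distrib_left)
 finally show "norm (\<Sum>b\<in>Basis. (norm x * cmod (?E b n x))\<^sup>2) <= 2 * (C0 + 1)\<^sup>2 * ((norm x)\<^sup>2 * (\<Sum>b\<in>Basis. csq (partial_deriv b ?Z x))) + real DIM('a) * (2 * C1\<^sup>2 * csq (?Z x))"
 by (simp add: sum_nonneg)
 qed
 show "integ (%x. 2 * (C0 + 1)\<^sup>2 * ((norm x)\<^sup>2 * (\<Sum>b\<in>Basis. csq (partial_deriv b ?Z x))) + real DIM('a) * (2 * C1\<^sup>2 * csq (?Z x)))"
 using grad_energy_inv_fourier(2)[OF z] sqZ by (intro Bochner_Integration.integrable_add integrable_mult_right)
 show "(%x. \<Sum>b\<in>Basis. (norm (x::'a) * cmod (?E b n x))\<^sup>2) \<in> borel_measurable lborel" for n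
 proof (intro borel_measurable_sum)
 fix b :: 'a assume b: "b \<in> Basis"
 have "(%x. partial_deriv b ?\<chi> (?c n *. x)) \<in> bmeas"
 by (rule measurable_compose[OF _ mp(2)[OF b]]) simp
 note [measurable] = this mp(1)[OF b]
 show "(%x. (norm x * cmod (?E b n x))\<^sup>2) \<in> borel_measurable lborel" by measurable
 qed
 qed simp
 then show ?thesis unfolding grad_energy_def pd by (simp add: sum_distrib_left power_mult_distrib)
qed

lemma l2sq_eq_mom_0:
 assumes [measurable]: "f \<in> bmeas" shows "l2sq f = mom 0 f"
 unfolding l2sq_def mom_def
proof (rule integral_cong_AE)
 show "AE x in lborel. csq (f x) = norm x powr 0 * csq (f x)"
 using AE_neq_0 by eventually_elim simp
qed auto

lemma l2sq_inv_fourier: "rapid z ==> l2sq (inv_fourier z) = l2sq z"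
 by (intro plancherel(2) rapid_integrable rapid_square_int)

lemma square_int_inv_fourier: "rapid z ==> square_int (inv_fourier z)"
 by (intro plancherel(1) rapid_integrable rapid_square_int)

lemma gradB_eq_l2sq:
 assumes "nice z D" shows "gradB D = (\<Sum>b\<in>Basis. l2sq (%xi. of_real (norm xi) * D xi b))"
proof -
 have "gradB D = (LI xi. (\<Sum>b\<in>Basis. csq (of_real (norm xi) * D xi b)))"
 unfolding gradB_def by (simp add: grad2_def square_norm_of_real_mult sum_distrib_left)
 also have "... = (\<Sum>b\<in>Basis. l2sq (%xi. of_real (norm xi) * D xi b))"
 unfolding l2sq_def by (intro Bochner_Integration.integral_sum integrable_norm2 niceD(6)[OF assms])
 finally show ?thesis .
qed

lemma gradB_add_le:
 fixes D E :: "'a::euclidean_space => 'a => complex"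
 assumes "nice z D" "nice y E" "et > 0"
 shows "gradB D <= (1 + et) * gradB (%xi h. D xi h - E xi h) + (1 + 1 / et) * gradB E"
proof -
 note n = nice_diff[OF assms(1,2)]
 have "l2sq (%xi. of_real (norm xi) * D xi b) <= (1 + et) * l2sq (%xi. of_real (norm xi) * (D xi b - E xi b)) + (1 + 1 / et) * l2sq (%xi. of_real (norm xi) * E xi b)"
 if b: "b \<in> Basis" for b :: 'a
 using l2sq_add_le[OF rapid_square_int[OF niceD(6)[OF n b]] rapid_square_int[OF niceD(6)[OF assms(2) b]] assms(3)]
 by (simp add: right_diff_distrib)
 then show ?thesis
 unfolding gradB_eq_l2sq[OF assms(1)] gradB_eq_l2sq[OF assms(2)] gradB_eq_l2sq[OF n] sum_distrib_left sum.distrib[symmetric]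
 by (intro sum_mono)
qed

lemma gradB_minus_commute: "gradB (%xi h. D xi h - E xi h) = gradB (%xi h. E xi h - D xi h)"
 by (simp add: gradB_def grad2_def norm_minus_commute)

lemma gradB_triangle:
 assumes "nice z D" "nice y E"
 shows "\<bar>sqrt (gradB D) - sqrt (gradB E)\<bar> <= sqrt (gradB (%xi h. D xi h - E xi h))"
proof -
 have "sqrt (gradB D) <= sqrt (gradB (%xi h. D xi h - E xi h)) + sqrt (gradB E)" if "nice z D" "nice y E"
 for z y :: "'a => complex" and D E
 using gradB_add_le[OF that] by (intro quadratic_triangle) auto
 from this[OF assms] this[OF assms(2,1)] show ?thesis by (simp add: gradB_minus_commute[of E])
qed

definition fD :: "('a::euclidean_space => complex) => 'a => 'a => complex" where
 "fD u xi h = fourier (%x. (- 2 * of_real pi * \<i>) * (of_real (x \<bullet> h) * u x)) xi"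

lemma nice_test: "test_fun u ==> nice (fourier u) (fD u)"
 using nice_fourier by (simp add: fD_def[abs_def])

subsection \<open>The completion\<close>

text \<open>The squared energy norm of \<open>inv_fourier z\<close>, computed on the Fourier side.\<close>

definition E2 :: "real => ('a::euclidean_space => complex) => ('a => 'a => complex) => real" where
 "E2 s z D = (2 * pi) powr (2 * s) * mom (2 * s) z + gradB D"

lemma energy_norm_E2: "nice z D ==> s > 0 ==> energy_norm s (inv_fourier z) = sqrt (E2 s z D)"
 by (simp add: energy_norm_def E2_def energies_inv_fourier(2) grad_energy_gradB)

lemma E2_nonneg[simp]: "E2 s z D >= 0" by (simp add: E2_def)

lemma E2_minus_commute: "E2 s (%xi. z xi - y xi) (%xi h. D xi h - E xi h) = E2 s (%xi. y xi - z xi) (%xi h. E xi h - D xi h)"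
 by (simp add: E2_def mom_minus_commute[of _ z] gradB_minus_commute[of D])

lemma E2_add_le:
 assumes "nice z D" "nice y E" "s > 0"
 shows "E2 s z D <= 2 * E2 s (%xi. z xi - y xi) (%xi h. D xi h - E xi h) + 2 * E2 s y E"
proof -
 note r = niceD(2)[OF assms(1)] niceD(2)[OF assms(2)]
 have "mom (2 * s) z <= 2 * mom (2 * s) (%xi. z xi - y xi) + 2 * mom (2 * s) y"
 using l2sq_add_le[OF square_int_weight[OF rapid_diff[OF r]] square_int_weight[OF r(2)], of "2 * s" "2 * s" 1] assms(3)
 by (simp add: mom_eq_l2sq right_diff_distrib)
 from mult_left_mono[OF this, of "(2 * pi) powr (2 * s)"] gradB_add_le[OF assms(1,2), of 1]
 show ?thesis unfolding E2_def by (simp add: algebra_simps)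
qed

lemma energy_norm_diff_E2:
 assumes "test_fun u" "test_fun w" "s > 0"
 shows "energy_norm s (%x. u x - w x) = sqrt (E2 s (%xi. fourier u xi - fourier w xi) (%xi h. fD u xi h - fD w xi h))"
 using energy_norm_E2[OF nice_diff[OF nice_test[OF assms(1)] nice_test[OF assms(2)]] assms(3)]
 inv_fourier_diff'[OF niceD(2) niceD(2), OF nice_test[OF assms(1)] nice_test[OF assms(2)]]
 by (simp add: test_fun_inversion assms)

lemma integral_inner_le:
 assumes f: "square_int f" and g: "square_int g"
 shows "integ (%x. f x \<bullet> g x)" "\<bar>LI x. f x \<bullet> g x\<bar> <= sqrt (l2sq f) * sqrt (l2sq g)"
proof -
 have eq: "f x \<bullet> g x = Re (f x * cnj (g x))" for x by (simp add: inner_complex_def)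
 note c = l2_cauchy_schwarz[OF f square_int_cnj[OF g]]
 show "integ (%x. f x \<bullet> g x)" unfolding eq by (rule integrable_Re[OF c(1)])
 have "(LI x. f x \<bullet> g x) = Re (LI x. f x * cnj (g x))" unfolding eq by (rule integral_Re[OF c(1)])
 then show "\<bar>LI x. f x \<bullet> g x\<bar> <= sqrt (l2sq f) * sqrt (l2sq g)"
 using c(2) abs_Re_le_cmod[of "LI x. f x * cnj (g x)"] by simp
qed

lemma norm_square_le_diff: "(norm a)\<^sup>2 <= (norm (a - b))\<^sup>2 + 2 * (a \<bullet> b)"
 using norm_square_add[of a "- b"] by simp

lemma test_fun_ibp:
 fixes f g :: "'a::euclidean_space => complex"
 assumes f: "test_fun f" and g: "test_fun g" and b: "b \<in> Basis"
 shows "(LI x. partial_deriv b f x \<bullet> g x) = - (LI x. f x \<bullet> partial_deriv b g x)"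
proof -
 let ?D = "%x h. complex_of_real (f x \<bullet> frechet_derivative g (at x) h + frechet_derivative f (at x) h \<bullet> g x)"
 have d: "(f has_derivative frechet_derivative f (at x)) (at x)" "(g has_derivative frechet_derivative g (at x)) (at x)" for x
 using f g by (simp_all add: test_funD smooth_fun_differentiable frechet_derivative_works[symmetric])
 note r = test_fun_rapid[OF f] test_fun_rapid[OF g] test_fun_rapid[OF test_fun_partial_deriv[OF f b]] test_fun_rapid[OF test_fun_partial_deriv[OF g b]]
 have Db: "?D x b = of_real (f x \<bullet> partial_deriv b g x) + of_real (partial_deriv b f x \<bullet> g x)" for x
 by (simp add: partial_deriv_def)
 have "(LI x. ?D x b) = 0"
 proof (rule integral_directional_derivative_eq_0[where F="%x. of_real (f x \<bullet> g x)"])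
 show "integ (%x. complex_of_real (f x \<bullet> g x))" by (intro rapid_integrable rapid_of_real_inner r)
 show "((%x. complex_of_real (f x \<bullet> g x)) has_derivative ?D x) (at x)" for x
 by (intro has_derivative_of_real has_derivative_inner d)
 show "rapid (%x. ?D x b)" unfolding Db by (intro rapid_add rapid_of_real_inner r)
 qed (rule b)
 then have "complex_of_real (LI x. f x \<bullet> partial_deriv b g x + partial_deriv b f x \<bullet> g x) = 0"
 by (simp only: partial_deriv_def integral_complex_of_real)
 then have "(LI x. f x \<bullet> partial_deriv b g x + partial_deriv b f x \<bullet> g x) = 0" by (simp only: of_real_eq_0_iff)
 then show ?thesis using integrable_inner[OF r(1,4)] integrable_inner[OF r(3,2)] by simp
qed

text \<open>Closability of the energy form: pairing with a fixed test function is continuous in \<open>L\<^sup>2\<close>.\<close>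

lemma energy_le_diff:
 assumes d: "test_fun d" and s: "s > 0"
 shows "\<exists>H\<ge>0. \<forall>f. test_fun f \<longrightarrow> (energy_norm s f)\<^sup>2 <= (energy_norm s (%x. f x - d x))\<^sup>2 + 2 * H * sqrt (l2sq f)"
proof -
 let ?w = "%xi. of_real (norm xi powr (2 * s)) * fourier d xi"
 let ?K = "(2 * pi) powr (2 * s)"
 \<comment> \<open>|x|^2 is written as a sum of products of linear functions, so that
   \<open>?g b\<close> is visibly a test function and the derivative can be moved off
   \<open>f\<close>.\<close>
 let ?g = "%b x. (\<Sum>c\<in>Basis. of_real (x \<bullet> c) * of_real (x \<bullet> c)) * partial_deriv b d x"
 have tg: "test_fun (?g b)" if "b \<in> Basis" for b
 proof (intro test_fun_mult test_fun_partial_deriv d that)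
 have "smooth_fun (%x::'a. \<Sum>c\<in>C. complex_of_real (x \<bullet> c) * of_real (x \<bullet> c))" if "finite C" for C
 using that by (induction C) (auto intro!: smooth_fun_add smooth_fun_mult smooth_fun_inner)
 then show "smooth_fun (%x::'a. \<Sum>c\<in>Basis. complex_of_real (x \<bullet> c) * of_real (x \<bullet> c))" by simp
 qed
 have g: "?g b x = of_real ((norm x)\<^sup>2) * partial_deriv b d x" for b x
 unfolding norm_square_eq_sum by (simp add: power2_eq_square)
 \<comment> \<open>The pairing of \<open>f\<close> with \<open>d\<close> in the energy form, its
   fractional part on the Fourier side and its gradient part on the physical side, is at most
   \<open>H\<close> times the L^2 norm of \<open>f\<close>.\<close>
 define H where "H = ?K * sqrt (l2sq ?w) + (\<Sum>b\<in>Basis. sqrt (l2sq (partial_deriv b (?g b))))"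
 have rd: "rapid (fourier d)" by (rule fourier_rapid[OF d])
 have rw: "rapid ?w" using s by (intro rapid_powr_mult rd) auto
 have "(energy_norm s f)\<^sup>2 <= (energy_norm s (%x. f x - d x))\<^sup>2 + 2 * H * sqrt (l2sq f)" if f: "test_fun f" for f
 proof -
 have rf: "rapid (fourier f)" by (rule fourier_rapid[OF f])
 have lf: "l2sq (fourier f) = l2sq f" using l2sq_inv_fourier[OF rf] by (simp add: test_fun_inversion[OF f])
 have fd: "test_fun (%x. f x - d x)" by (rule test_fun_diff[OF f d])
 have ifd: "inv_fourier (%xi. fourier f xi - fourier d xi) = (%x. f x - d x)"
 by (simp add: inv_fourier_diff'[OF rf rd] test_fun_inversion f d)
 note nfd = nice_diff[OF nice_test[OF f] nice_test[OF d]]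
 have lap: "mom (2 * s) (fourier f) <= mom (2 * s) (%xi. fourier f xi - fourier d xi) + 2 * (sqrt (l2sq f) * sqrt (l2sq ?w))"
 proof -
 note i = integral_inner_le[OF rapid_square_int[OF rf] rapid_square_int[OF rw]]
 have ip: "integ (%xi. norm xi powr (2 * s) * csq (h xi))" if "rapid h" for h :: "'a => complex"
 using s that by (intro integrable_powr_norm2) auto
 have "mom (2 * s) (fourier f) <= (LI xi. norm xi powr (2 * s) * csq (fourier f xi - fourier d xi) + 2 * (fourier f xi \<bullet> ?w xi))"
 unfolding mom_def
 proof (rule integral_mono)
 fix xi :: 'a
 show "norm xi powr (2 * s) * csq (fourier f xi) <= norm xi powr (2 * s) * csq (fourier f xi - fourier d xi) + 2 * (fourier f xi \<bullet> ?w xi)"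
 using mult_left_mono[OF norm_square_le_diff[of "fourier f xi" "fourier d xi"], of "norm xi powr (2 * s)"]
 unfolding complex_inner_of_real by (simp add: distrib_left mult.left_commute)
 qed (intro Bochner_Integration.integrable_add integrable_mult_right i ip rf rd rapid_diff)+
 also have "... = mom (2 * s) (%xi. fourier f xi - fourier d xi) + 2 * (LI xi. fourier f xi \<bullet> ?w xi)"
 unfolding mom_def using ip[OF rapid_diff[OF rf rd]] i(1) by simp
 finally show ?thesis using i(2) unfolding lf by linarith
 qed
 have grad: "grad_energy f <= grad_energy (%x. f x - d x) + 2 * (sqrt (l2sq f) * (\<Sum>b\<in>Basis. sqrt (l2sq (partial_deriv b (?g b)))))"
 proof -
 have pd: "partial_deriv b (%x. f x - d x) x = partial_deriv b f x - partial_deriv b d x" for b x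
 proof -
 have "(f has_derivative frechet_derivative f (at x)) (at x)" "(d has_derivative frechet_derivative d (at x)) (at x)"
 using f d by (simp_all add: test_funD smooth_fun_differentiable frechet_derivative_works[symmetric])
 from partial_deriv_eq[OF has_derivative_diff[OF this], of b] show ?thesis by (simp add: partial_deriv_def)
 qed
 have igr: "integ (%x. (norm x)\<^sup>2 * (\<Sum>b\<in>Basis. csq (partial_deriv b h x)))" if "test_fun h" for h :: "'a => complex"
 using grad_energy_inv_fourier(2)[OF nice_test[OF that]] by (simp add: test_fun_inversion that)
 have ii: "integ (%x. partial_deriv b f x \<bullet> ?g b x)" if "b \<in> Basis" for b
 using that by (intro integrable_inner test_fun_rapid test_fun_partial_deriv f tg)
 have "grad_energy f <= (LI x. (norm x)\<^sup>2 * (\<Sum>b\<in>Basis. csq (partial_deriv b (%x. f x - d x) x)) + 2 * (\<Sum>b\<in>Basis. partial_deriv b f x \<bullet> ?g b x))"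
 unfolding grad_energy_def
 proof (rule integral_mono)
 fix x :: 'a
 have "(norm x)\<^sup>2 * (\<Sum>b\<in>Basis. csq (partial_deriv b f x)) <= (norm x)\<^sup>2 * (\<Sum>b\<in>Basis. csq (partial_deriv b f x - partial_deriv b d x) + 2 * (partial_deriv b f x \<bullet> partial_deriv b d x))"
 by (intro mult_left_mono sum_mono norm_square_le_diff) auto
 then show "(norm x)\<^sup>2 * (\<Sum>b\<in>Basis. csq (partial_deriv b f x)) <= (norm x)\<^sup>2 * (\<Sum>b\<in>Basis. csq (partial_deriv b (%x. f x - d x) x)) + 2 * (\<Sum>b\<in>Basis. partial_deriv b f x \<bullet> ?g b x)"
 unfolding pd g complex_inner_of_real by (simp add: sum.distrib distrib_left sum_distrib_left mult.left_commute)
 qed (intro Bochner_Integration.integrable_add integrable_mult_right Bochner_Integration.integrable_sum ii igr f fd)+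
 also have "... = grad_energy (%x. f x - d x) + 2 * (\<Sum>b\<in>Basis. LI x. partial_deriv b f x \<bullet> ?g b x)"
 unfolding grad_energy_def using igr[OF fd] ii
 by (subst Bochner_Integration.integral_add) (auto intro!: Bochner_Integration.integrable_sum Bochner_Integration.integral_sum)
 also have "(\<Sum>b\<in>Basis. LI x. partial_deriv b f x \<bullet> ?g b x) <= (\<Sum>b\<in>Basis. sqrt (l2sq f) * sqrt (l2sq (partial_deriv b (?g b))))"
 proof (rule sum_mono)
 fix b :: 'a assume b: "b \<in> Basis"
 show "(LI x. partial_deriv b f x \<bullet> ?g b x) <= sqrt (l2sq f) * sqrt (l2sq (partial_deriv b (?g b)))"
 unfolding test_fun_ibp[OF f tg[OF b] b]
 using integral_inner_le(2)[OF rapid_square_int[OF test_fun_rapid[OF f]] rapid_square_int[OF test_fun_rapid[OF test_fun_partial_deriv[OF tg[OF b] b]]]]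
 by linarith
 qed
 finally show ?thesis by (simp add: sum_distrib_left)
 qed
 have e: "(energy_norm s h)\<^sup>2 = ?K * mom (2 * s) (fourier h) + grad_energy h" if "test_fun h" for h :: "'a => complex"
 using energy_norm_E2[OF nice_test[OF that] s] grad_energy_gradB[OF nice_test[OF that]] by (simp add: test_fun_inversion that E2_def)
 have e': "(energy_norm s (%x. f x - d x))\<^sup>2 = ?K * mom (2 * s) (%xi. fourier f xi - fourier d xi) + grad_energy (%x. f x - d x)"
 using energy_norm_E2[OF nfd s] grad_energy_gradB[OF nfd] by (simp add: ifd E2_def)
 have "?K * mom (2 * s) (fourier f) <= ?K * (mom (2 * s) (%xi. fourier f xi - fourier d xi) + 2 * (sqrt (l2sq f) * sqrt (l2sq ?w)))"
 by (intro mult_left_mono lap) simp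
 with grad show ?thesis unfolding e[OF f] e' H_def by (simp add: algebra_simps)
 qed
 moreover have "H >= 0" unfolding H_def by (intro add_nonneg_nonneg sum_nonneg mult_nonneg_nonneg) (auto simp: l2sq_nonneg)
 ultimately show ?thesis by blast
qed

lemma energy_norm_nonneg: "test_fun u ==> s > 0 ==> energy_norm s u >= 0"
 using energy_norm_E2[OF nice_test, of u s] by (simp add: test_fun_inversion)

lemma energy_norm_square_le:
 assumes "test_fun u" "test_fun w" "s > 0"
 shows "(energy_norm s u)\<^sup>2 <= 2 * (energy_norm s (%x. u x - w x))\<^sup>2 + 2 * (energy_norm s w)\<^sup>2"
 using E2_add_le[OF nice_test[OF assms(1)] nice_test[OF assms(2)] assms(3)]
 energy_norm_E2[OF nice_test[OF assms(1)] assms(3)] energy_norm_E2[OF nice_test[OF assms(2)] assms(3)]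
 by (simp add: energy_norm_diff_E2 assms test_fun_inversion)

text \<open>\<open>energy_le_diff\<close> is used with the fixed function \<open>d M\<close>: the
  first summand is small for all later \<open>n\<close> by the Cauchy property, and for that
  \<open>M\<close> the second one tends to 0. So a sequence vanishing in L^2 cannot keep energy in
  the limit.\<close>

lemma energy_norm_tendsto_0:
 assumes d: "!!n. test_fun (d n)" and s: "s > 0"
 and cauchy: "!!e. e > 0 ==> \<exists>M. \<forall>m\<ge>M. \<forall>n\<ge>M. energy_norm s (%x. d m x - d n x) < e"
 and l2: "(%n::nat. l2sq (d n)) ----> 0"
 shows "(%n. energy_norm s (d n)) ----> 0"
proof -
 have "(%n. (energy_norm s (d n))\<^sup>2) ----> 0"
 proof (rule LIMSEQ_I)
 fix e :: real assume e: "e > 0"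
 obtain M where M: "!!n. n >= M ==> energy_norm s (%x. d n x - d M x) < sqrt (e / 2)"
 using cauchy[of "sqrt (e / 2)"] e by auto
 obtain H where H: "!!f. test_fun f ==> (energy_norm s f)\<^sup>2 <= (energy_norm s (%x. f x - d M x))\<^sup>2 + 2 * H * sqrt (l2sq f)"
 using energy_le_diff[OF d s] by blast
 have "(%n. 2 * H * sqrt (l2sq (d n))) ----> 2 * H * sqrt 0" by (intro tendsto_intros l2)
 then have "\<forall>\<^sub>F n in sequentially. 2 * H * sqrt (l2sq (d n)) < e / 2" using e by (intro order_tendstoD(2)) auto
 then obtain M' where M': "!!n. n >= M' ==> 2 * H * sqrt (l2sq (d n)) < e / 2" by (auto simp: eventually_sequentially)
 show "\<exists>n0. \<forall>n\<ge>n0. norm ((energy_norm s (d n))\<^sup>2 - 0) < e"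
 proof (intro exI[of _ "max M M'"] allI impI)
 fix n assume n: "n >= max M M'"
 have "(energy_norm s (%x. d n x - d M x))\<^sup>2 < (sqrt (e / 2))\<^sup>2"
 using n by (intro power_strict_mono M energy_norm_nonneg test_fun_diff d s) auto
 then show "norm ((energy_norm s (d n))\<^sup>2 - 0) < e" using H[OF d, of n] M'[of n] n e by simp
 qed
 qed
 from tendsto_real_sqrt[OF this] show ?thesis by (simp add: energy_norm_nonneg[OF d s])
qed

lemma approximatesD:
 assumes "approximates s ph u"
 shows "test_fun (ph n)" "square_int u" "(%n. l2sq (%x. ph n x - u x)) ----> 0"
 "e > 0 ==> \<exists>M. \<forall>m\<ge>M. \<forall>n\<ge>M. energy_norm s (%x. ph m x - ph n x) < e"
 using assms unfolding approximates_def by simp_all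

text \<open>The difference of two approximating sequences is Cauchy in energy and null in L^2. This
  is what makes \<open>extend\<close> independent of the sequence.\<close>

lemma approximates_unique_energy:
 assumes ph: "approximates s ph u" and ps: "approximates s ps u" and s: "s > 0"
 shows "(%n. energy_norm s (%x. ph n x - ps n x)) ----> 0"
proof (rule energy_norm_tendsto_0)
 have t: "!!n. test_fun (ph n)" "!!n. test_fun (ps n)" and u: "square_int u"
 and l: "(%n. l2sq (%x. ph n x - u x)) ----> 0" "(%n. l2sq (%x. ps n x - u x)) ----> 0"
 by (rule approximatesD[OF ph] approximatesD[OF ps])+
 show "test_fun (%x. ph n x - ps n x)" for n by (intro test_fun_diff t)
 have sq: "square_int (ph n)" "square_int (ps n)" for n by (intro rapid_square_int test_fun_rapid t)+
 have le: "l2sq (%x. ph n x - ps n x) <= 2 * l2sq (%x. ph n x - u x) + 2 * l2sq (%x. ps n x - u x)" for n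
 using l2sq_add_le[OF square_int_diff[OF sq(1) u] square_int_diff[OF u sq(2)], of 1 n n] by (simp add: l2sq_minus_commute[of u])
 have "(%n. 2 * l2sq (%x. ph n x - u x) + 2 * l2sq (%x. ps n x - u x)) ----> 2 * 0 + 2 * 0" by (intro tendsto_intros l)
 then have lim: "(%n. 2 * l2sq (%x. ph n x - u x) + 2 * l2sq (%x. ps n x - u x)) ----> 0" by simp
 show "(%n. l2sq (%x. ph n x - ps n x)) ----> 0"
 by (rule Lim_null_comparison[OF always_eventually[OF allI] lim]) (simp add: l2sq_nonneg le)
 fix e :: real assume e: "e > 0"
 obtain M where M: "\<forall>m\<ge>M. \<forall>n\<ge>M. energy_norm s (%x. ph m x - ph n x) < e / 2"
 using approximatesD(4)[OF ph half_gt_zero[OF e]] by blast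
 obtain M' where M': "\<forall>m\<ge>M'. \<forall>n\<ge>M'. energy_norm s (%x. ps m x - ps n x) < e / 2"
 using approximatesD(4)[OF ps half_gt_zero[OF e]] by blast
 have "energy_norm s (%x. (ph m x - ps m x) - (ph n x - ps n x)) < e" if mn: "m >= max M M'" "n >= max M M'" for m n
 proof (rule power_less_imp_less_base)
 have "(energy_norm s (%x. ph m x - ph n x))\<^sup>2 < (e / 2)\<^sup>2" "(energy_norm s (%x. ps n x - ps m x))\<^sup>2 < (e / 2)\<^sup>2"
 using mn by (intro power_strict_mono M[rule_format] M'[rule_format] energy_norm_nonneg test_fun_diff t s; simp)+
 moreover have "(%x. (ph m x - ps m x) - (ph n x - ps n x) - (ps n x - ps m x)) = (%x. ph m x - ph n x)" by (simp add: fun_eq_iff)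
 ultimately show "(energy_norm s (%x. (ph m x - ps m x) - (ph n x - ps n x)))\<^sup>2 < e\<^sup>2"
 using energy_norm_square_le[OF test_fun_diff[OF test_fun_diff[OF t] test_fun_diff[OF t]] test_fun_diff[OF t(2) t(2)] s, of m m n n n m]
 by (simp add: power_divide)
 qed (use e in auto)
 then show "\<exists>M. \<forall>m\<ge>M. \<forall>n\<ge>M. energy_norm s (%x. (ph m x - ps m x) - (ph n x - ps n x)) < e" by blast
qed (rule s)

section \<open>Continuous extension of the three energies\<close>

text \<open>Stated for the square root because each energy is the square of a seminorm, and a
  dominated seminorm is Lipschitz; the functional is recovered by squaring.\<close>

definition energy_continuous :: "real => (('a::euclidean_space => complex) => real) => bool" where
 "energy_continuous s Q \<longleftrightarrow> (\<forall>u. test_fun u \<longrightarrow> Q u >= 0) \<and>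
 (\<exists>c\<ge>0. \<forall>u w. test_fun u \<longrightarrow> test_fun w \<longrightarrow> \<bar>sqrt (Q u) - sqrt (Q w)\<bar> <= c * energy_norm s (%x. u x - w x))"

lemma tendsto_extend:
 assumes Q: "energy_continuous s Q" and ph: "approximates s ph u" and s: "s > 0"
 shows "(%n. Q (ph n)) ----> extend s Q u"
proof -
 have t: "!!n. test_fun (ph n)" by (rule approximatesD(1)[OF ph])
 obtain c where c: "c >= 0" "!!u w. test_fun u ==> test_fun w ==> \<bar>sqrt (Q u) - sqrt (Q w)\<bar> <= c * energy_norm s (%x. u x - w x)"
 using Q unfolding energy_continuous_def by blast
 have Q0: "test_fun u ==> Q u >= 0" for u using Q unfolding energy_continuous_def by blast
 have "Cauchy (%n. sqrt (Q (ph n)))"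
 proof (rule metric_CauchyI)
 fix e :: real assume e: "e > 0"
 then have e': "e / (c + 1) > 0" using c(1) by simp
 then obtain M where M: "\<forall>m\<ge>M. \<forall>n\<ge>M. energy_norm s (%x. ph m x - ph n x) < e / (c + 1)"
 using approximatesD(4)[OF ph] by blast
 have "dist (sqrt (Q (ph m))) (sqrt (Q (ph n))) < e" if "m >= M" "n >= M" for m n
 proof -
 have "dist (sqrt (Q (ph m))) (sqrt (Q (ph n))) <= c * energy_norm s (%x. ph m x - ph n x)"
 using c(2)[OF t t] by (simp add: dist_real_def)
 also have "... <= c * (e / (c + 1))" using M[rule_format, OF that] c(1) by (intro mult_left_mono) auto
 also have "... < e" using e c(1) by (simp add: divide_simps)
 finally show ?thesis .
 qed
 then show "\<exists>M. \<forall>m\<ge>M. \<forall>n\<ge>M. dist (sqrt (Q (ph m))) (sqrt (Q (ph n))) < e" by blast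
 qed
 then obtain L where L: "(%n. sqrt (Q (ph n))) ----> L" using Cauchy_convergent[unfolded convergent_def] by blast
 have all: "(%n. Q (ps n)) ----> L\<^sup>2" if ps: "approximates s ps u" for ps
 proof -
 have t': "!!n. test_fun (ps n)" by (rule approximatesD(1)[OF ps])
 have lim: "(%n. c * energy_norm s (%x. ps n x - ph n x)) ----> 0"
 using tendsto_mult_left[OF approximates_unique_energy[OF ps ph s], of c] by simp
 have "(%n. sqrt (Q (ps n)) - sqrt (Q (ph n))) ----> 0"
 by (rule Lim_null_comparison[OF always_eventually[OF allI] lim]) (simp add: c(2)[OF t' t])
 from tendsto_power[OF tendsto_add[OF this L], of 2] show ?thesis by (simp add: Q0[OF t'])
 qed
 \<comment> \<open>The given sequence \<open>ph\<close> is one of those quantified over in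
   \<open>extend\<close> and thereby forces uniqueness of the number described.\<close>
 have "extend s Q u = L\<^sup>2"
 unfolding extend_def
 proof (rule the_equality)
 show "\<forall>ph. approximates s ph u \<longrightarrow> (%n. Q (ph n)) ----> L\<^sup>2" using all by blast
 show "l = L\<^sup>2" if "\<forall>ph. approximates s ph u \<longrightarrow> (%n. Q (ph n)) ----> l" for l
 using that ph all[OF ph] LIMSEQ_unique by blast
 qed
 then show ?thesis using all[OF ph] by simp
qed

text \<open>The first two energies are summands of the squared energy norm. The third is bounded by
  the product of their square roots through the uncertainty inequality itself, which is the origin
  of the factor 2 / (N + s).\<close>

lemma energy_continuous_energies:
 assumes s: "s > 0"
 shows "energy_continuous s (lap_energy (s / 2) :: ('a::euclidean_space => complex) => real)"
 and "energy_continuous s (grad_energy :: ('a => complex) => real)"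
 and "energy_continuous s (lap_energy (s / 4) :: ('a => complex) => real)"
proof -
 let ?K = "(2 * pi) powr s"
 have K: "(2 * pi) powr (2 * s) = ?K\<^sup>2" by (simp add: powr_mult_self)
 have e: "lap_energy (s / 2) u = ?K\<^sup>2 * mom (2 * s) (fourier u)" "grad_energy u = gradB (fD u)" "lap_energy (s / 4) u = ?K * mom s (fourier u)"
 if "test_fun u" for u :: "'a => complex"
 using energies_inv_fourier(1,2)[OF nice_test[OF that] s] grad_energy_gradB[OF nice_test[OF that]] by (simp_all add: test_fun_inversion that K)
 have main: "\<bar>sqrt (lap_energy (s / 2) u) - sqrt (lap_energy (s / 2) w)\<bar> <= 1 * energy_norm s (%x. u x - w x)"
 "\<bar>sqrt (grad_energy u) - sqrt (grad_energy w)\<bar> <= 1 * energy_norm s (%x. u x - w x)"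
 "\<bar>sqrt (lap_energy (s / 4) u) - sqrt (lap_energy (s / 4) w)\<bar> <= sqrt (2 / (real DIM('a) + s)) * energy_norm s (%x. u x - w x)"
 if t: "test_fun u" "test_fun w" for u w :: "'a => complex"
 proof -
 let ?v = "%xi. fourier u xi - fourier w xi" and ?D = "%xi h. fD u xi h - fD w xi h"
 note n = nice_test[OF t(1)] nice_test[OF t(2)]
 note r = niceD(2)[OF n(1)] niceD(2)[OF n(2)]
 let ?A = "?K * sqrt (mom (2 * s) ?v)" and ?B = "sqrt (gradB ?D)"
 have en: "energy_norm s (%x. u x - w x) = sqrt (?A\<^sup>2 + ?B\<^sup>2)"
 unfolding energy_norm_diff_E2[OF t s] E2_def K by (simp add: power_mult_distrib)
 have A: "?A <= sqrt (?A\<^sup>2 + ?B\<^sup>2)" and B: "?B <= sqrt (?A\<^sup>2 + ?B\<^sup>2)" by (rule real_le_rsqrt, simp)+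
 show "\<bar>sqrt (lap_energy (s / 2) u) - sqrt (lap_energy (s / 2) w)\<bar> <= 1 * energy_norm s (%x. u x - w x)"
 proof -
 have "?K * \<bar>sqrt (mom (2 * s) (fourier u)) - sqrt (mom (2 * s) (fourier w))\<bar> <= ?A"
 using s by (intro mult_left_mono mom_triangle r) auto
 also note A
 finally show ?thesis
 unfolding en e[OF t(1)] e[OF t(2)] real_sqrt_mult by (simp add: abs_mult right_diff_distrib[symmetric])
 qed
 show "\<bar>sqrt (grad_energy u) - sqrt (grad_energy w)\<bar> <= 1 * energy_norm s (%x. u x - w x)"
 using order_trans[OF gradB_triangle[OF n] B] unfolding en e[OF t(1)] e[OF t(2)] by (simp only: mult_1)
 have "(real DIM('a) + s) / 2 * mom s ?v <= sqrt (mom (2 * s) ?v) * ?B"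
 by (rule spectral_uncertainty[OF nice_diff[OF n] s])
 from mult_left_mono[OF this, of ?K] have "(real DIM('a) + s) / 2 * (?K * mom s ?v) <= ?A * ?B" by (simp add: mult_ac)
 also have "... <= ?A\<^sup>2 + ?B\<^sup>2"
 using sum_squares_bound[of ?A ?B] zero_le_power2[of ?A] zero_le_power2[of ?B] by linarith
 finally have "?K * mom s ?v <= 2 / (real DIM('a) + s) * (?A\<^sup>2 + ?B\<^sup>2)"
 using s by (simp add: field_simps)
 then have "sqrt (?K * mom s ?v) <= sqrt (2 / (real DIM('a) + s)) * sqrt (?A\<^sup>2 + ?B\<^sup>2)"
 unfolding real_sqrt_mult[symmetric] by (rule real_sqrt_le_mono)
 moreover have "\<bar>sqrt (lap_energy (s / 4) u) - sqrt (lap_energy (s / 4) w)\<bar> <= sqrt (?K * mom s ?v)"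
 using mult_left_mono[OF mom_triangle[OF r, of s], of "sqrt ?K"] s
 unfolding e[OF t(1)] e[OF t(2)] real_sqrt_mult by (simp add: abs_mult right_diff_distrib[symmetric])
 ultimately show "\<bar>sqrt (lap_energy (s / 4) u) - sqrt (lap_energy (s / 4) w)\<bar> <= sqrt (2 / (real DIM('a) + s)) * energy_norm s (%x. u x - w x)"
 unfolding en by linarith
 qed
 show "energy_continuous s (lap_energy (s / 2) :: ('a => complex) => real)"
 unfolding energy_continuous_def using main(1) e(1) by (intro conjI exI[of _ 1]) auto
 show "energy_continuous s (grad_energy :: ('a => complex) => real)"
 unfolding energy_continuous_def using main(2) e(2) by (intro conjI exI[of _ 1]) auto
 show "energy_continuous s (lap_energy (s / 4) :: ('a => complex) => real)"
 unfolding energy_continuous_def using main(3) e(3) s by (intro conjI exI[of _ "sqrt (2 / (real DIM('a) + s))"]) auto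
qed

lemma cut_energies_tendsto:
 assumes z: "nice z D"
 defines "ph \<equiv> cut (inv_fourier z)"
 shows "p >= 0 ==> (%n. mom p (fourier (ph n))) ----> mom p z"
 and "(%n. gradB (%xi h. fD (ph n) xi h - D xi h)) ----> 0"
 and "(%n. gradB (fD (ph n))) ----> gradB D"
proof -
 note r = niceD(2)[OF z]
 have t: "test_fun (ph n)" for n unfolding ph_def by (rule test_fun_cut[OF r])
 have sq: "(%n. Q n) ----> q" if "!!n. \<bar>sqrt (Q n) - sqrt q\<bar> <= sqrt (R n)" "R ----> 0" "!!n. Q n >= 0" "q >= 0" for Q R :: "nat => real" and q
 proof -
 have lim: "(%n. sqrt (R n)) ----> 0" using tendsto_real_sqrt[OF that(2)] by simp
 have "(%n. sqrt (Q n) - sqrt q) ----> 0"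
 by (rule Lim_null_comparison[OF always_eventually[OF allI] lim]) (simp add: that(1))
 then have "(%n. sqrt (Q n)) ----> sqrt q" by (simp add: LIM_zero_iff)
 from tendsto_power[OF this, of 2] show ?thesis using that(3,4) by simp
 qed
 show "(%n. mom p (fourier (ph n))) ----> mom p z" if "p >= 0"
 by (rule sq[OF mom_triangle[OF fourier_rapid[OF t] r that] mom_cut_tendsto[OF r niceD(1)[OF z] that, folded ph_def]]) auto
 have "grad_energy (%x. ph n x - inv_fourier z x) = gradB (%xi h. fD (ph n) xi h - D xi h)" for n
 using grad_energy_gradB[OF nice_diff[OF nice_test[OF t] z], of n] by (simp add: inv_fourier_diff'[OF fourier_rapid[OF t] r] test_fun_inversion t)
 then show g: "(%n. gradB (%xi h. fD (ph n) xi h - D xi h)) ----> 0"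
 using grad_energy_cut_tendsto[OF z] by (simp add: ph_def)
 show "(%n. gradB (fD (ph n))) ----> gradB D"
 by (rule sq[OF gradB_triangle[OF nice_test[OF t] z] g]) auto
qed

text \<open>This places the inverse transform of every \<open>nice\<close> function, in particular
  every profile, in the completion. The Cauchy property follows by comparing two truncations with
  their common limit on the Fourier side.\<close>

lemma cut_approximates:
 assumes z: "nice z D" and s: "s > 0"
 shows "approximates s (cut (inv_fourier z)) (inv_fourier z)"
 unfolding approximates_def
proof (intro conjI allI impI)
 note r = niceD(2)[OF z]
 let ?ph = "cut (inv_fourier z)"
 show t: "test_fun (?ph n)" for n by (rule test_fun_cut[OF r])
 show "square_int (inv_fourier z)" by (rule square_int_inv_fourier[OF r])
 have rd: "rapid (%xi. fourier (?ph n) xi - z xi)" for n by (intro rapid_diff fourier_rapid t r)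
 have "l2sq (%x. ?ph n x - inv_fourier z x) = mom 0 (%xi. fourier (?ph n) xi - z xi)" for n
 using l2sq_inv_fourier[OF rd, of n] l2sq_eq_mom_0[OF rapidD_measurable[OF rd], of n]
 by (simp add: inv_fourier_diff'[OF fourier_rapid[OF t] r] test_fun_inversion t)
 then show "(%n. l2sq (%x. ?ph n x - inv_fourier z x)) ----> 0"
 using mom_cut_tendsto[OF r niceD(1)[OF z], of 0] by simp
 fix e :: real assume e: "e > 0"
 let ?E = "%n. E2 s (%xi. fourier (?ph n) xi - z xi) (%xi h. fD (?ph n) xi h - D xi h)"
 have "?E ----> (2 * pi) powr (2 * s) * 0 + 0"
 unfolding E2_def using s by (intro tendsto_intros mom_cut_tendsto r niceD(1)[OF z] cut_energies_tendsto(2)[OF z]) auto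
 then have "\<forall>\<^sub>F n in sequentially. ?E n < e\<^sup>2 / 4" using e by (intro order_tendstoD(2)) auto
 then obtain M where M: "!!n. n >= M ==> ?E n < e\<^sup>2 / 4" by (auto simp: eventually_sequentially)
 have "energy_norm s (%x. ?ph m x - ?ph n x) < e" if mn: "m >= M" "n >= M" for m n
 proof -
 have "E2 s (%xi. fourier (?ph m) xi - fourier (?ph n) xi) (%xi h. fD (?ph m) xi h - fD (?ph n) xi h) <= 2 * ?E m + 2 * ?E n"
 using E2_add_le[OF nice_diff[OF nice_test[OF t] nice_test[OF t]] nice_diff[OF z nice_test[OF t]] s, of m n n]
 by (simp add: E2_minus_commute[of s z])
 also have "... < e\<^sup>2" using M[OF mn(1)] M[OF mn(2)] by simp
 finally have "sqrt (E2 s (%xi. fourier (?ph m) xi - fourier (?ph n) xi) (%xi h. fD (?ph m) xi h - fD (?ph n) xi h)) < sqrt (e\<^sup>2)"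
 by (rule real_sqrt_less_mono)
 then show ?thesis unfolding energy_norm_diff_E2[OF t t s] using e by simp
 qed
 then show "\<exists>M. \<forall>m\<ge>M. \<forall>n\<ge>M. energy_norm s (%x. ?ph m x - ?ph n x) < e" by blast
qed

section \<open>Moments of the profiles and the equality case\<close>

lemma gradB_prof: "gradB (radD (glD s mu) :: 'a::euclidean_space => 'a => complex) = mu\<^sup>2 * mom (2 * s) (prof s mu :: 'a => complex)"
proof -
 have "(norm xi)\<^sup>2 * grad2 (radD (glD s mu)) xi = mu\<^sup>2 * (norm xi powr (2 * s) * csq (prof s mu xi))" for xi :: 'a
 proof (cases "xi = 0")
 case False
 then have "norm xi * norm xi powr (s - 1) = norm xi powr s" by (simp add: powr_mult_base)
 from arg_cong[OF this, of "%x. x\<^sup>2"]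
 have "(norm xi)\<^sup>2 * (norm xi powr (s - 1))\<^sup>2 = norm xi powr (2 * s)"
 by (simp only: power_mult_distrib powr_mult_self[of "norm xi" s])
 then show ?thesis unfolding grad2_radD glD_def prof_def norm_of_real power2_abs power_mult_distrib by (simp add: mult_ac)
 qed simp
 then show ?thesis unfolding gradB_def mom_def by (simp only: integral_mult_right_zero)
qed

lemma eul_prof:
 "eul (radD (glD s mu)) xi = of_real (- mu * norm xi powr s) * prof s mu xi"
proof (cases "xi = 0")
 case False
 then have "norm xi * norm xi powr (s - 1) = norm xi powr s" by (simp add: powr_mult_base)
 then have "complex_of_real (norm xi) * of_real (norm xi powr (s - 1)) = of_real (norm xi powr s)" by (simp flip: of_real_mult)
 then show ?thesis by (simp add: eul_radD glD_def prof_def mult.left_commute mult.assoc[symmetric])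
qed simp

text \<open>Integration by parts along dilations, with R g = - mu |xi|^s g for the profile g. It
  stands in for the Gamma function, since below only ratios of moments occur.\<close>

lemma mom_prof_recurrence:
 fixes s :: real
 assumes s: "s > 0" and mu: "mu > 0" and p: "p >= 0"
 shows "(real DIM('a) + p) * mom p (prof s mu :: 'a::euclidean_space => complex) = 2 * mu * mom (p + s) (prof s mu :: 'a => complex)"
proof -
 have e: "norm xi powr p * (2 * (prof s mu xi \<bullet> eul (radD (glD s mu)) xi)) = - (2 * mu) * (norm xi powr (p + s) * csq (prof s mu xi))" for xi :: 'a
 unfolding eul_prof complex_inner_of_real powr_add by (simp add: power2_norm_eq_inner mult_ac)
 show ?thesis
 using radial_ibp[OF nice_prof[OF s mu, where 'a='a] p] unfolding e integral_mult_right_zero mom_def[symmetric] by linarith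
qed

lemma not_AE_False: "\<not> (AE x in (lborel :: 'a::euclidean_space measure). False)"
 by (simp add: eventually_False ae_filter_eq_bot_iff)

lemma mom_prof_pos:
 assumes "s > 0" "mu > 0" "p >= 0"
 shows "mom p (prof s mu :: 'a::euclidean_space => complex) > 0"
proof -
 have "mom p (prof s mu :: 'a => complex) ~= 0"
 using mom_eq_0_AE[OF rapid_prof[OF assms(1,2)] assms(3), where 'a='a] not_AE_False by (auto simp: prof_def)
 then show ?thesis using mom_nonneg[of p "prof s mu :: 'a => complex"] by linarith
qed

lemma gradB_cmult: "gradB (%xi h. c * D xi h) = csq c * gradB D"
 by (simp add: gradB_def grad2_def norm_mult power_mult_distrib sum_distrib_left[symmetric] mult.left_commute flip: integral_mult_right_zero)

text \<open>The moment recurrence at \<open>p = s\<close>, together with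
  \<open>gradB_prof\<close>.\<close>

lemma deficit_prof:
 assumes "s > 0" "mu > 0"
 shows "deficit s (%xi. al * prof s mu xi) (%xi h. al * radD (glD s mu) xi (h::'a::euclidean_space)) = 0"
proof -
 have "sqrt (mom (2 * s) (prof s mu :: 'a => complex)) * sqrt (mom (2 * s) (prof s mu :: 'a => complex)) = mom (2 * s) (prof s mu :: 'a => complex)" by simp
 then show ?thesis
 using mom_prof_recurrence[OF assms, of s, where 'a='a] assms mult_2[of s]
 by (simp add: deficit_def mom_cmult gradB_cmult gradB_prof real_sqrt_mult power2_eq_square algebra_simps)
qed

text \<open>Along the truncations the energies converge to the direct values, and by
  \<open>tendsto_extend\<close> also to the extended ones.\<close>

lemma extend_inv_fourier:
 assumes z: "nice z D" and s: "s > 0"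
 shows "extend s (lap_energy (s / 2)) (inv_fourier z) = lap_energy (s / 2) (inv_fourier z)"
 and "extend s grad_energy (inv_fourier z) = grad_energy (inv_fourier z)"
 and "extend s (lap_energy (s / 4)) (inv_fourier z) = lap_energy (s / 4) (inv_fourier z)"
proof -
 let ?ph = "cut (inv_fourier z)"
 have t: "test_fun (?ph n)" for n by (rule test_fun_cut[OF niceD(2)[OF z]])
 have e: "lap_energy (s / 2) (?ph n) = (2 * pi) powr (2 * s) * mom (2 * s) (fourier (?ph n))" "grad_energy (?ph n) = gradB (fD (?ph n))"
 "lap_energy (s / 4) (?ph n) = (2 * pi) powr s * mom s (fourier (?ph n))" for n
 using energies_inv_fourier(1,2)[OF nice_test[OF t] s] grad_energy_gradB[OF nice_test[OF t]] by (simp_all add: test_fun_inversion t)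
 note lim = tendsto_extend[OF energy_continuous_energies(1)[OF s] cut_approximates[OF z s] s]
 tendsto_extend[OF energy_continuous_energies(2)[OF s] cut_approximates[OF z s] s]
 tendsto_extend[OF energy_continuous_energies(3)[OF s] cut_approximates[OF z s] s]
 note c = cut_energies_tendsto[OF z]
 show "extend s (lap_energy (s / 2)) (inv_fourier z) = lap_energy (s / 2) (inv_fourier z)"
 unfolding energies_inv_fourier(2)[OF z s] using s
 by (intro LIMSEQ_unique[OF lim(1)[unfolded e]] tendsto_mult_left c(1)) auto
 show "extend s grad_energy (inv_fourier z) = grad_energy (inv_fourier z)"
 unfolding grad_energy_gradB[OF z] by (rule LIMSEQ_unique[OF lim(2)[unfolded e] c(3)])
 show "extend s (lap_energy (s / 4)) (inv_fourier z) = lap_energy (s / 4) (inv_fourier z)"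
 unfolding energies_inv_fourier(1)[OF z s] using s
 by (intro LIMSEQ_unique[OF lim(3)[unfolded e]] tendsto_mult_left c(1)) auto
qed

lemma equality_case_profile:
 assumes s: "s > 0" and mu: "mu > 0" and al: "al ~= 0"
 shows "equality_case s ((real DIM('a) + s) / 2) (%x. al * G s mu (x::'a::euclidean_space))"
proof -
 let ?z = "%xi::'a. al * prof s mu xi"
 note z = nice_cmult[OF nice_prof[OF s mu, where 'a='a], of al]
 note r = niceD(2)[OF z]
 have u: "(%x. al * G s mu x) = inv_fourier ?z" by (simp add: fun_eq_iff G_eq inv_fourier_cmult)
 have "\<not> (AE x in lborel. inv_fourier ?z x = 0)"
 proof
 assume "AE x in lborel. inv_fourier ?z x = 0"
 then have "l2sq (inv_fourier ?z) = l2sq (%_::'a. 0)" by (intro l2sq_cong_AE square_int_inv_fourier r) auto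
 then have "mom 0 ?z = 0" using l2sq_inv_fourier[OF r] l2sq_eq_mom_0[OF rapidD_measurable[OF r]] by (simp add: l2sq_def)
 then show False using mom_prof_pos[OF s mu, of 0, where 'a='a] al by (simp add: mom_cmult)
 qed
 moreover have "inv_fourier ?z \<in> completion s" using cut_approximates[OF z s] by (auto simp: completion_def)
 moreover have "sqrt (lap_energy (s / 2) (inv_fourier ?z)) * sqrt (grad_energy (inv_fourier ?z)) = (real DIM('a) + s) / 2 * lap_energy (s / 4) (inv_fourier ?z)"
 using energies_inv_fourier(3)[OF z s] deficit_prof[OF s mu, of al, where 'a='a] by simp
 ultimately show ?thesis unfolding u equality_case_def extend_inv_fourier[OF z s] by blast
qed

text \<open>Weighted convergence along a subsequence identifies the \<open>L\<^sup>2\<close> limit, by Fatou's lemma.\<close>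

lemma approximates_limit:
 assumes ph: "approximates s ph u" and s: "s > 0" and f: "rapid f" and r: "strict_mono r"
 and lim: "(%n. mom s (%xi. fourier (ph (r n)) xi - f xi)) ----> 0"
 shows "AE x in lborel. u x = inv_fourier f x"
proof -
 note t = approximatesD(1)[OF ph]
 let ?v = "%n. fourier (ph n)"
 have rv: "rapid (?v n)" for n by (rule fourier_rapid[OF t])
 note [measurable] = rapidD_measurable[OF rv] rapidD_measurable[OF f]
 have l2v: "l2sq (%xi. ?v m xi - ?v n xi) = l2sq (%x. ph m x - ph n x)" for m n
 using l2sq_inv_fourier[OF rapid_diff[OF rv rv], of m n] by (simp add: inv_fourier_diff'[OF rv rv] test_fun_inversion t)
 have sq: "square_int (ph n)" for n by (rule rapid_square_int[OF test_fun_rapid[OF t]])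
 have "(LI xi. norm (norm xi powr s * csq (?v (r n) xi - f xi))) = mom s (%xi. ?v (r n) xi - f xi)" for n
 by (simp add: mom_def abs_mult)
 moreover have "integ (%xi. norm xi powr s * csq (?v (r n) xi - f xi))" for n
 using s by (intro integrable_powr_norm2 rapid_diff rv f) auto
 \<comment> \<open>Weighted convergence gives pointwise convergence along a further subsequence, and
   off the origin the weight can be divided out.\<close>
 ultimately obtain k where k: "strict_mono k" "AE xi in lborel. (%n. norm xi powr s * csq (?v (r (k n)) xi - f xi)) ----> 0"
 using tendsto_L1_AE_subseq[of lborel "%n xi. norm xi powr s * csq (?v (r n) xi - f xi)"] lim by auto
 have ae: "AE xi in lborel. (%n. ?v (r (k n)) xi) ----> f xi"
 using k(2) AE_neq_0
 proof eventually_elim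
 case (elim xi)
 have "(%n. 1 / norm xi powr s * (norm xi powr s * csq (?v (r (k n)) xi - f xi))) ----> 1 / norm xi powr s * 0"
 by (intro tendsto_mult_left elim)
 then have "(%n. csq (?v (r (k n)) xi - f xi)) ----> 0" using elim(2) by simp
 from tendsto_real_sqrt[OF this] have "(%n. ?v (r (k n)) xi - f xi) ----> 0"
 by (simp add: tendsto_norm_zero_iff)
 then show ?case by (simp add: LIM_zero_iff)
 qed
 have rk: "r (k n) >= n" for n
 using seq_suble[OF k(1), of n] seq_suble[OF r, of "k n"] by linarith
 have "(%n. l2sq (%xi. ?v n xi - f xi)) ----> 0"
 proof (rule LIMSEQ_I)
 fix e :: real assume e: "e > 0"
 have "\<forall>\<^sub>F n in sequentially. l2sq (%x. ph n x - u x) < e / 8"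
 using approximatesD(3)[OF ph] e by (intro order_tendstoD(2)) auto
 then obtain M where M: "!!n. n >= M ==> l2sq (%x. ph n x - u x) < e / 8" by (auto simp: eventually_sequentially)
 have cauchy: "l2sq (%xi. ?v m xi - ?v n xi) <= e / 2" if "m >= M" "n >= M" for m n
 using l2sq_add_le[OF square_int_diff[OF sq approximatesD(2)[OF ph]] square_int_diff[OF approximatesD(2)[OF ph] sq], of 1 m n]
 M[OF that(1)] M[OF that(2)] by (simp add: l2v l2sq_minus_commute[of u])
 have nn: "(NN xi. ennreal (csq (h xi))) = ennreal (l2sq h)" if "rapid h" for h :: "'a => complex"
 unfolding l2sq_def by (rule nn_integral_eq_integral[OF integrable_norm2[OF that]]) simp
 have "l2sq (%xi. ?v n xi - f xi) < e" if n: "n >= M" for n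
 proof -
 \<comment> \<open>By Plancherel the transforms are Cauchy in L^2; Fatou along the subsequence
   carries this estimate over to the limit \<open>f\<close>.\<close>
 have "(NN xi. ennreal (csq (?v n xi - f xi))) = (NN xi. liminf (%j. ennreal (csq (?v n xi - ?v (r (k j)) xi))))"
 proof (rule nn_integral_cong_AE, use ae in eventually_elim)
 fix xi assume l: "(%n. ?v (r (k n)) xi) ----> f xi"
 have "(%j. ennreal (csq (?v n xi - ?v (r (k j)) xi))) ----> ennreal (csq (?v n xi - f xi))"
 by (intro tendsto_ennrealI tendsto_intros l)
 then show "ennreal (csq (?v n xi - f xi)) = liminf (%j. ennreal (csq (?v n xi - ?v (r (k j)) xi)))"
 by (intro lim_imp_Liminf[symmetric]) auto
 qed
 also have "... <= liminf (%j. NN xi. ennreal (csq (?v n xi - ?v (r (k j)) xi)))"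
 by (rule nn_integral_liminf) measurable
 also have "... <= liminf (%j. ennreal (e / 2))"
 proof (rule Liminf_mono, rule eventually_sequentiallyI[of M])
 fix j assume "j >= M"
 then have "r (k j) >= M" using rk[of j] by linarith
 then show "(NN xi. ennreal (csq (?v n xi - ?v (r (k j)) xi))) <= ennreal (e / 2)"
 unfolding nn[OF rapid_diff[OF rv rv]] by (intro ennreal_leI cauchy n)
 qed
 also have "... = ennreal (e / 2)" by (simp add: Liminf_const)
 finally have "l2sq (%xi. ?v n xi - f xi) <= e / 2"
 unfolding nn[OF rapid_diff[OF rv f]] using e by (simp add: ennreal_le_iff)
 then show ?thesis using e by linarith
 qed
 then show "\<exists>n0. \<forall>n\<ge>n0. norm (l2sq (%xi. ?v n xi - f xi) - 0) < e" by (auto simp: l2sq_nonneg)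
 qed
 moreover have "l2sq (%x. ph n x - inv_fourier f x) = l2sq (%xi. ?v n xi - f xi)" for n
 using l2sq_inv_fourier[OF rapid_diff[OF rv f], of n] by (simp add: inv_fourier_diff'[OF rv f] test_fun_inversion t)
 ultimately show ?thesis
 using l2sq_limit_unique[OF sq approximatesD(2)[OF ph] square_int_inv_fourier[OF f] approximatesD(3)[OF ph]] by simp
qed

text \<open>\<open>spectral_stability\<close> is applied along an approximating sequence with the
  single \<open>mu\<close> that balances the limiting energies. Its right-hand sides tend to 0, so
  the transforms approach multiples \<open>al n\<close> of one fixed profile; the coefficients are
  bounded, and a limit point yields the profile. Regularity of \<open>u\<close> itself never has to
  be discussed.\<close>

theorem equality_case_imp_profile:
 fixes u :: "'a::euclidean_space => complex"
 assumes eq: "equality_case s ((real DIM('a) + s) / 2) u" and s: "s > 0" and N: "DIM('a) >= 2"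
 shows "\<exists>al mu. al ~= 0 \<and> mu > 0 \<and> (AE x in lborel. u x = al * G s mu x)"
proof -
 let ?N = "real DIM('a)"
 define K where "K = (2 * pi) powr s"
 have K: "K > 0" "(2 * pi) powr (2 * s) = K\<^sup>2" by (simp_all add: K_def powr_mult_self)
 obtain ph where ph: "approximates s ph u" using eq by (auto simp: equality_case_def completion_def)
 have u0: "\<not> (AE x in lborel. u x = 0)" using eq by (simp add: equality_case_def)
 note t = approximatesD(1)[OF ph]
 let ?v = "%n. fourier (ph n)"
 have n: "nice (?v n) (fD (ph n))" for n by (rule nice_test[OF t])
 note rv = niceD(2)[OF n]
 define A B M where "A = extend s (lap_energy (s / 2)) u / K\<^sup>2" and "B = extend s grad_energy u" and "M = extend s (lap_energy (s / 4)) u / K"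
 have e: "lap_energy (s / 2) (ph n) / K\<^sup>2 = mom (2 * s) (?v n)" "grad_energy (ph n) = gradB (fD (ph n))" "lap_energy (s / 4) (ph n) / K = mom s (?v n)" for n
 using energies_inv_fourier(1,2)[OF n s] grad_energy_gradB[OF n] K by (simp_all add: test_fun_inversion t K_def[symmetric])
 have lA: "(%n. mom (2 * s) (?v n)) ----> A" and lB: "(%n. gradB (fD (ph n))) ----> B" and lM: "(%n. mom s (?v n)) ----> M"
 unfolding A_def B_def M_def e[symmetric] using K
 by (intro tendsto_divide tendsto_const tendsto_extend[OF _ ph s] energy_continuous_energies s; simp)+
 have nn: "A >= 0" "B >= 0" "M >= 0"
 using lA lB lM by (auto intro!: LIMSEQ_le_const)
 have AB: "sqrt A * sqrt B = (?N + s) / 2 * M"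
 using eq K(1) by (simp add: equality_case_def A_def B_def M_def real_sqrt_divide field_simps power2_eq_square)
 \<comment> \<open>If \<open>M\<close> vanished, the transforms would tend to 0 in the weighted
   norm, and \<open>u\<close> would be null by \<open>approximates_limit\<close>.\<close>
 have M: "M > 0"
 proof (rule ccontr)
 assume "\<not> M > 0"
 then have "M = 0" using nn by simp
 then have "AE x in lborel. u x = inv_fourier (%_. 0) x"
 using lM by (intro approximates_limit[OF ph s, where r=id]) (auto simp: strict_mono_def)
 then show False using u0 by (simp add: inv_fourier_eq)
 qed
 have "sqrt A * sqrt B > 0" unfolding AB using M s by (intro mult_pos_pos) (auto intro: add_nonneg_pos)
 then have AB0: "sqrt A > 0" "sqrt B > 0" using nn by (auto simp: zero_less_mult_iff)
 define mu where "mu = sqrt B / sqrt A"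
 have mu: "mu > 0" using AB0 by (simp add: mu_def)
 define a where "a = (sqrt (?N\<^sup>2 + 4 * ?N - 4) - ?N) / 2"
 have a: "a > 0" "a\<^sup>2 + a * ?N = ?N - 1" unfolding a_def using spectral_gap_root[of ?N] N by auto
 define L where "L = min (2 * s) (2 * a) * mu"
 have L: "L > 0" using a(1) s mu by (simp add: L_def)
 define de where "de n = gradB (fD (ph n)) + mu\<^sup>2 * mom (2 * s) (?v n) - mu * (?N + s) * mom s (?v n)" for n
 have "\<forall>n. \<exists>al. L * mom s (%xi. ?v n xi - al * prof s mu xi) <= de n"
 using spectral_stability[OF n s mu N a] unfolding L_def de_def by blast
 then obtain al where al: "!!n. L * mom s (%xi. ?v n xi - al n * prof s mu xi) <= de n" by metis
 have "de ----> B + mu\<^sup>2 * A - mu * (?N + s) * M" unfolding de_def by (intro tendsto_intros lA lB lM)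
 \<comment> \<open>At the balancing \<open>mu\<close> the quadratic expression is 2 mu times the
   limiting deficit, which is 0 by the assumed equality.\<close>
 also have "B + mu\<^sup>2 * A - mu * (?N + s) * M = 0"
 proof -
 have "mu * ((?N + s) * M) = mu * (2 * (sqrt A * sqrt B))" unfolding AB by simp
 also have "... = 2 * B" using AB0 nn by (simp add: mu_def)
 finally have 1: "mu * (?N + s) * M = 2 * B" by simp
 have "mu\<^sup>2 * A = B" using AB0 nn by (simp add: mu_def power_divide)
 with 1 show ?thesis by simp
 qed
 finally have de0: "de ----> 0" .
 let ?g = "prof s mu :: 'a => complex"
 have rg: "rapid (%xi::'a. c * prof s mu xi)" for c by (intro rapid_cmult rapid_prof s mu)
 let ?w = "%n. sqrt (mom s (%xi. ?v n xi - al n * prof s mu xi))"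
 have w0: "?w ----> 0"
 proof -
 have "(%n. sqrt (de n / L)) ----> sqrt (0 / L)" using L by (intro tendsto_intros de0) auto
 then have lim: "(%n. sqrt (de n / L)) ----> 0" by simp
 show ?thesis
 by (rule Lim_null_comparison[OF always_eventually[OF allI] lim])
 (use al L in \<open>simp add: pos_le_divide_eq mult.commute\<close>)
 qed
 define q where "q = sqrt (mom s ?g)"
 have q: "q > 0" using mom_prof_pos[OF s mu, of s, where 'a='a] s by (simp add: q_def)
 have sc: "sqrt (mom s (%xi::'a. c * prof s mu xi)) = cmod c * q" for c
 by (simp add: mom_cmult real_sqrt_mult q_def)
 \<comment> \<open>The weighted norms of the multiples differ from the convergent norms of
   \<open>?v n\<close> by at most the null sequence \<open>?w\<close>.\<close>
 have "bounded (range al)"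
 proof -
 have "(%n. (?w n + sqrt (mom s (?v n))) / q) ----> (0 + sqrt M) / q"
 using q by (intro tendsto_intros w0 lM) auto
 then have "convergent (%n. (?w n + sqrt (mom s (?v n))) / q)" by (rule convergentI)
 then have "Bseq (%n. (?w n + sqrt (mom s (?v n))) / q)" by (rule convergent_imp_Bseq)
 then obtain C where C: "!!n. norm ((?w n + sqrt (mom s (?v n))) / q) <= C" unfolding Bseq_def by blast
 have "cmod (al n) <= C" for n
 proof -
 have "cmod (al n) * q <= ?w n + sqrt (mom s (?v n))"
 using mom_triangle[OF rv rg, of s n "al n"] s unfolding sc by (simp add: abs_le_iff)
 then have "cmod (al n) <= (?w n + sqrt (mom s (?v n))) / q" using q by (simp add: pos_le_divide_eq)
 then show ?thesis using order_trans[OF abs_ge_self C[of n, unfolded real_norm_def]] by linarith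
 qed
 then show ?thesis by (auto simp: bounded_iff)
 qed
 then obtain al0 r where r: "strict_mono r" "(%n. al (r n)) ----> al0"
 using bounded_imp_convergent_subsequence[of al] by (auto simp: comp_def)
 have "(%n. mom s (%xi. ?v (r n) xi - al0 * prof s mu xi)) ----> 0"
 proof -
 have "(%n. ?w (r n) + cmod (al0 - al (r n)) * q) ----> 0 + cmod (al0 - al0) * q"
 using LIMSEQ_subseq_LIMSEQ[OF w0 r(1)] by (intro tendsto_intros r(2)) (simp add: comp_def)
 then have lim: "(%n. ?w (r n) + cmod (al0 - al (r n)) * q) ----> 0" by simp
 have le: "sqrt (mom s (%xi. ?v (r n) xi - al0 * prof s mu xi)) <= ?w (r n) + cmod (al0 - al (r n)) * q" for n
 proof -
 have "(%xi::'a. ?v (r n) xi - al (r n) * prof s mu xi - (al0 - al (r n)) * prof s mu xi) = (%xi. ?v (r n) xi - al0 * prof s mu xi)"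
 by (simp add: fun_eq_iff algebra_simps)
 then show ?thesis
 using l2_triangle[OF square_int_weight[OF rapid_diff[OF rv rg]] square_int_weight[OF rg], of s s "r n" "al (r n)" "al (r n) - al0"] s sc[of "al (r n) - al0"]
 by (simp add: mom_eq_l2sq distrib_left[symmetric] norm_minus_commute algebra_simps)
 qed
 have "(%n. sqrt (mom s (%xi. ?v (r n) xi - al0 * prof s mu xi))) ----> 0"
 by (rule Lim_null_comparison[OF always_eventually[OF allI] lim]) (simp add: le)
 from tendsto_power[OF this, of 2] show ?thesis by simp
 qed
 from approximates_limit[OF ph s rg r(1) this]
 have ae: "AE x in lborel. u x = al0 * G s mu x" by (simp add: G_eq inv_fourier_cmult)
 have "al0 ~= 0" using ae u0 by auto
 with mu ae show ?thesis by blast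
qed

lemma deficit_cut_tendsto:
 fixes z :: "'a::euclidean_space => complex"
 assumes z: "nice z D" and s: "s > 0"
 shows "(%n. deficit s (fourier (cut (inv_fourier z) n)) (fD (cut (inv_fourier z) n))) ----> deficit s z D"
 unfolding deficit_def using s by (intro tendsto_intros cut_energies_tendsto[OF z]) auto

text \<open>The profile with \<open>mu = 1\<close> has deficit 0 and positive weighted mass, and
  both quantities are limits along its truncations, which are test functions.\<close>

lemma sharp_constant:
 assumes s: "s > 0" and C: "C > (real DIM('a) + s) / 2"
 shows "\<exists>u :: 'a::euclidean_space => complex. test_fun u \<and> sqrt (lap_energy (s / 2) u) * sqrt (grad_energy u) < C * lap_energy (s / 4) u"
proof -
 let ?g = "prof s 1 :: 'a => complex"
 have g: "nice ?g (radD (glD s 1))" by (rule nice_prof[OF s]) simp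
 let ?ph = "cut (inv_fourier ?g)" and ?c = "C - (real DIM('a) + s) / 2"
 have t: "test_fun (?ph n)" for n by (rule test_fun_cut[OF niceD(2)[OF g]])
 have "deficit s ?g (radD (glD s 1)) = 0" using deficit_prof[OF s, of 1 1, where 'a='a] by simp
 then have "(%n. ?c * mom s (fourier (?ph n)) - deficit s (fourier (?ph n)) (fD (?ph n))) ----> ?c * mom s ?g - 0"
 using deficit_cut_tendsto[OF g s] s by (intro tendsto_intros cut_energies_tendsto[OF g]) auto
 moreover have "?c * mom s ?g - 0 > 0" using C mom_prof_pos[OF s, of 1 s, where 'a='a] s by simp
 ultimately have "\<forall>\<^sub>F n in sequentially. ?c * mom s (fourier (?ph n)) - deficit s (fourier (?ph n)) (fD (?ph n)) > 0"
 by (rule order_tendstoD(1))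
 then obtain n where "deficit s (fourier (?ph n)) (fD (?ph n)) < ?c * mom s (fourier (?ph n))"
 by (auto simp: eventually_sequentially)
 then have "(2 * pi) powr s * deficit s (fourier (?ph n)) (fD (?ph n)) < (2 * pi) powr s * (?c * mom s (fourier (?ph n)))"
 by (intro mult_strict_left_mono) auto
 then show ?thesis
 using energies_inv_fourier(1,3)[OF nice_test[OF t] s, of n] t[of n]
 by (intro exI[of _ "?ph n"]) (simp add: test_fun_inversion algebra_simps)
qed

text \<open>Passes from a candidate on the Fourier side to a test function. The deficit converges
  under truncation; the distance is an infimum over all profiles, so its lower bound has to survive
  uniformly in \<open>al\<close> and \<open>mu\<close>, and the triangle inequality achieves this
  with the error \<open>e n\<close>, which does not depend on them.\<close>

lemma sharp_stability_candidate:
 fixes z :: "'a::euclidean_space => complex"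
 assumes z: "nice z D" and s: "s > 0" and d: "d > 0" and L: "L >= 0" "C > L"
 and dist: "!!al mu. mu > 0 ==> d <= mom s (%xi. z xi - al * prof s mu xi)" and def: "deficit s z D <= L * d"
 shows "\<exists>u :: 'a => complex. test_fun u \<and>
 sqrt (lap_energy (s / 2) u) * sqrt (grad_energy u) - (real DIM('a) + s) / 2 * lap_energy (s / 4) u < C * dist_to_profiles s u"
proof -
 let ?ph = "cut (inv_fourier z)"
 note r = niceD(2)[OF z]
 have t: "test_fun (?ph n)" for n by (rule test_fun_cut[OF r])
 have rv: "rapid (fourier (?ph n))" for n by (rule fourier_rapid[OF t])
 define e where "e n = sqrt (mom s (%xi. fourier (?ph n) xi - z xi))" for n
 have e0: "e ----> 0"
 using tendsto_real_sqrt[OF mom_cut_tendsto[OF r niceD(1)[OF z], of s]] s by (simp add: e_def[abs_def])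
 \<comment> \<open>The maximum with 0 keeps the squared lower bound valid when \<open>e n\<close>
   exceeds \<open>sqrt d\<close>.\<close>
 define l where "l n = (max 0 (sqrt d - e n))\<^sup>2" for n
 have "l ----> (max 0 (sqrt d - 0))\<^sup>2" unfolding l_def[abs_def] by (intro tendsto_intros e0)
 then have l: "l ----> d" using d by simp
 have "(%n. C * l n - deficit s (fourier (?ph n)) (fD (?ph n))) ----> C * d - deficit s z D"
 by (intro tendsto_intros l deficit_cut_tendsto[OF z s])
 moreover have "C * d - deficit s z D > 0" using def mult_strict_right_mono[OF L(2) d] by linarith
 ultimately have "\<forall>\<^sub>F n in sequentially. C * l n - deficit s (fourier (?ph n)) (fD (?ph n)) > 0" by (rule order_tendstoD(1))
 then obtain n where n: "deficit s (fourier (?ph n)) (fD (?ph n)) < C * l n" by (auto simp: eventually_sequentially)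
 have "l n <= mom s (%xi. fourier (?ph n) xi - al * prof s mu xi)" if mu: "mu > 0" for al mu
 proof -
 let ?q = "sqrt (mom s (%xi. fourier (?ph n) xi - al * prof s mu xi))"
 have rg: "rapid (%xi. al * prof s mu xi)" by (intro rapid_cmult rapid_prof s mu)
 have "sqrt d <= sqrt (mom s (%xi. z xi - al * prof s mu xi))" using dist[OF mu] by simp
 moreover have "(%xi. (z xi - al * prof s mu xi) - (fourier (?ph n) xi - al * prof s mu xi)) = (%xi. z xi - fourier (?ph n) xi)"
 by (simp add: fun_eq_iff)
 then have "\<bar>sqrt (mom s (%xi. z xi - al * prof s mu xi)) - ?q\<bar> <= e n"
 using mom_triangle[OF rapid_diff[OF r rg] rapid_diff[OF rv rg], of s n] s by (simp add: e_def mom_minus_commute[of s z])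
 ultimately have "sqrt d - e n <= ?q" by linarith
 then have "max 0 (sqrt d - e n) <= ?q" by simp
 then have "l n <= ?q\<^sup>2" unfolding l_def by (intro power_mono) auto
 then show ?thesis by simp
 qed
 from dist_to_profiles_ge[OF rv s this]
 have "(2 * pi) powr s * l n <= dist_to_profiles s (?ph n)" by (simp add: test_fun_inversion t)
 then have "C * ((2 * pi) powr s * l n) <= C * dist_to_profiles s (?ph n)" using L by (intro mult_left_mono) auto
 moreover have "(2 * pi) powr s * deficit s (fourier (?ph n)) (fD (?ph n)) < (2 * pi) powr s * (C * l n)"
 using n by (intro mult_strict_left_mono) auto
 ultimately have "(2 * pi) powr s * deficit s (fourier (?ph n)) (fD (?ph n)) < C * dist_to_profiles s (?ph n)"
 unfolding mult.left_commute[of C] by linarith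
 then show ?thesis
 using energies_inv_fourier(3)[OF nice_test[OF t] s, of n] t[of n]
 by (intro exI[of _ "?ph n"]) (simp add: test_fun_inversion)
qed

text \<open>The arithmetic-geometric inequality replaces the product by a sum, so an upper bound for
  the deficit can be read off from \<open>deficit_identity\<close> at \<open>mu = 1\<close>.\<close>

lemma deficit_le: "deficit s z (D :: 'a::euclidean_space => 'a => complex) <= (gradB D + mom (2 * s) z - (real DIM('a) + s) * mom s z) / 2"
proof -
 have "2 * (sqrt (mom (2 * s) z) * sqrt (gradB D)) <= mom (2 * s) z + gradB D"
 using sum_squares_bound[of "sqrt (mom (2 * s) z)" "sqrt (gradB D)"] by simp
 then show ?thesis by (simp add: deficit_def field_simps)
qed

subsection \<open>Sharpness of the stability constant\<close>

text \<open>The candidate for \<open>\<Lambda> = 2 a\<close>: a first-order spherical harmonic times \<open>|xi|\<^bsup>a\<^esup> exp (- |xi|\<^bsup>s\<^esup> / s)\<close>, on which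
 both inequalities used for the nonradial part are equalities.\<close>

definition dip :: "real => real => 'a::euclidean_space => real" where
 "dip s a xi = norm xi powr (a - 1) * gl s 1 (norm xi)"

text \<open>Off the origin the gradient of \<open>dip s a\<close> at \<open>xi\<close> is
  \<open>dipk s a xi\<close> times \<open>xi\<close>.\<close>

definition dipk :: "real => real => 'a::euclidean_space => real" where
 "dipk s a xi = ((a - 1) * norm xi powr (a - 3) - norm xi powr (a + s - 3)) * gl s 1 (norm xi)"

definition dipD :: "real => real => 'a::euclidean_space => 'a => 'a => complex" where
 "dipD s a b xi h = of_real (dip s a xi * (h \<bullet> b) + dipk s a xi * ((xi \<bullet> h) * (xi \<bullet> b)))"

lemma dip_has_derivative:
 fixes xi :: "'a::euclidean_space"
 assumes s: "s > 0" and xi: "xi ~= 0"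
 shows "(dip s a has_derivative (%h. dipk s a xi * (xi \<bullet> h))) (at xi)"
proof -
 let ?r = "norm xi"
 have r: "?r > 0" using xi by simp
 have g: "((%xi. gl s 1 (norm xi)) has_derivative (%h. (xi \<bullet> h / ?r) * (- 1 * ?r powr (s - 1) * gl s 1 ?r))) (at xi)"
 proof (rule has_derivative_compose[where g="gl s 1" and f'="%h. xi \<bullet> h / ?r" and g'="%t. t * (- 1 * ?r powr (s - 1) * gl s 1 ?r)"])
 show "(norm has_derivative (%h. xi \<bullet> h / ?r)) (at xi)"
 by (rule has_derivative_eq_rhs[OF has_derivative_norm[OF xi]])
 (simp add: fun_eq_iff sgn_div_norm divide_inverse inner_commute mult.commute)
 show "(gl s 1 has_derivative (%t. t * (- 1 * ?r powr (s - 1) * gl s 1 ?r))) (at ?r)"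
 by (rule has_derivative_eq_rhs[OF gl_has_derivative[OF s r, of 1, unfolded has_field_derivative_def]]) (simp add: fun_eq_iff)
 qed
 have p1: "?r powr (a + s - 3) = ?r powr (a - 1) * ?r powr (s - 1) / ?r"
 using r powr_diff[of ?r "a - 1 + (s - 1)" 1] by (simp add: powr_add[symmetric] algebra_simps)
 show ?thesis
 unfolding dip_def[abs_def]
 by (rule has_derivative_eq_rhs[OF has_derivative_mult[OF has_derivative_norm_powr[OF xi] g]])
 (use r in \<open>simp add: fun_eq_iff dipk_def p1 field_simps\<close>)
qed

lemma norm_mult_dip: "norm xi * dip s a xi = norm xi powr a * gl s 1 (norm xi)"
 by (cases "xi = 0") (auto simp: dip_def powr_mult_base simp flip: mult.assoc)

lemma norm_square_mult_dipk: "(norm xi)\<^sup>2 * dipk s a xi = (a - 1 - norm xi powr s) * dip s a xi"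
proof (cases "xi = 0")
 case False
 then have q: "(norm xi)\<^sup>2 = norm xi powr 2" by (simp add: powr_numeral)
 have "(norm xi)\<^sup>2 * norm xi powr (a - 3) = norm xi powr (a - 1)" "(norm xi)\<^sup>2 * norm xi powr (a + s - 3) = norm xi powr s * norm xi powr (a - 1)"
 unfolding q powr_add[symmetric] by (simp_all add: algebra_simps)
 then have "(norm xi)\<^sup>2 * ((a - 1) * norm xi powr (a - 3) - norm xi powr (a + s - 3)) = (a - 1 - norm xi powr s) * norm xi powr (a - 1)"
 by (simp add: algebra_simps)
 then show ?thesis by (simp add: dipk_def dip_def flip: mult.assoc)
qed (simp add: dip_def)

text \<open>The factor |xi|^(a - 1) is singular at the origin, but the coordinate
  \<open>xi \<bullet> b\<close> makes the product of order |xi|^a, hence continuous. The gradient is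
  of order |xi|^(a - 1) near the origin, and the factor |xi| in \<open>nice\<close> compensates for
  that.\<close>

lemma nice_dip:
 fixes b :: "'a::euclidean_space"
 assumes s: "s > 0" and a: "a > 0" "a < 1" and b: "b \<in> Basis"
 shows "nice (%xi. of_real (dip s a xi * (xi \<bullet> b))) (dipD s a b)"
 unfolding nice_def
proof (intro conjI ballI allI impI)
 have m[measurable]: "dip s a \<in> bmeas" "dipk s a \<in> bmeas"
 unfolding dip_def[abs_def] dipk_def[abs_def] by measurable
 have bd: "\<bar>dip s a xi * (xi \<bullet> c)\<bar> <= norm xi powr a * gl s 1 (norm xi)" if "c \<in> Basis" for c xi :: 'a
 proof -
 have "dip s a xi >= 0" by (simp add: dip_def less_imp_le)
 then have "\<bar>dip s a xi * (xi \<bullet> c)\<bar> <= dip s a xi * norm xi"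
 using Basis_le_norm[OF that, of xi] by (simp add: abs_mult mult_left_mono)
 then show ?thesis by (simp add: norm_mult_dip[symmetric] mult.commute)
 qed
 show "rapid (%xi::'a. of_real (dip s a xi * (xi \<bullet> b)))"
 by (rule rapid_dominated[OF rapid_powr_mult[OF rapid_prof[OF s zero_less_one], of a], where C=1 and j=0])
 (use bd[OF b] a in \<open>simp_all add: prof_def norm_mult less_imp_le del: of_real_mult\<close>)
 show "continuous_on UNIV (%xi::'a. complex_of_real (dip s a xi * (xi \<bullet> b)))"
 proof (intro continuous_on_of_real continuous_at_imp_continuous_on ballI)
 fix xi :: 'a
 show "isCont (%xi. dip s a xi * (xi \<bullet> b)) xi"
 proof (cases "xi = 0")
 case True
 have "isCont (%xi::'a. norm xi powr a * gl s 1 (norm xi)) 0"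
 proof -
 have "continuous_on UNIV (%xi::'a. norm xi powr a * gl s 1 (norm xi))"
 using a s by (intro continuous_intros continuous_on_powr' continuous_on_compose2[OF continuous_on_gl[of s 1]]) auto
 then show ?thesis by (simp add: continuous_on_eq_continuous_at)
 qed
 then have "((%xi::'a. norm xi powr a * gl s 1 (norm xi)) \<longlongrightarrow> 0) (at 0)" by (simp add: isCont_def)
 then have "((%xi. dip s a xi * (xi \<bullet> b)) \<longlongrightarrow> 0) (at 0)"
 by (rule Lim_null_comparison[OF always_eventually[OF allI], rotated]) (simp add: bd[OF b])
 then show ?thesis using True by (simp add: isCont_def)
 next
 case False
 then show ?thesis
 by (intro continuous_intros) (rule has_derivative_continuous[OF dip_has_derivative[OF s False]])
 qed
 qed
 show "((%xi. complex_of_real (dip s a xi * (xi \<bullet> b))) has_derivative dipD s a b xi) (at xi)" if "xi ~= 0" for xi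
 proof -
 have "((%xi. xi \<bullet> b) has_derivative (%h. h \<bullet> b)) (at xi)" by (auto intro!: derivative_eq_intros)
 from has_derivative_of_real[OF has_derivative_mult[OF dip_has_derivative[OF s that] this]]
 show ?thesis by (rule has_derivative_eq_rhs) (simp add: fun_eq_iff dipD_def mult_ac)
 qed
 fix c :: 'a assume c: "c \<in> Basis"
 show mD: "(%xi. dipD s a b xi c) \<in> bmeas" unfolding dipD_def by measurable
 show "rapid (%xi. of_real (norm xi) * dipD s a b xi c)"
 proof (rule rapid_dominated[where C=1 and j=0])
 show "rapid (%xi::'a. 2 * (of_real (norm xi powr a) * prof s 1 xi) + of_real (norm xi powr s) * (of_real (norm xi powr a) * prof s 1 xi))"
 using a s by (intro rapid_add rapid_cmult rapid_powr_mult rapid_prof) auto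
 show "(%xi. of_real (norm xi) * dipD s a b xi c) \<in> bmeas" using mD by measurable
 fix xi :: 'a
 let ?r = "norm xi" and ?f = "norm xi powr a * gl s 1 (norm xi)"
 have f0: "dip s a xi >= 0" "?f >= 0" by (simp_all add: dip_def less_imp_le)
 have "\<bar>xi \<bullet> c\<bar> * \<bar>xi \<bullet> b\<bar> <= ?r * ?r" using Basis_le_norm[OF c, of xi] Basis_le_norm[OF b, of xi] by (intro mult_mono) auto
 then have "\<bar>dipk s a xi * ((xi \<bullet> c) * (xi \<bullet> b))\<bar> <= \<bar>dipk s a xi\<bar> * (?r * ?r)" by (simp add: abs_mult mult_left_mono)
 also have "... = \<bar>?r\<^sup>2 * dipk s a xi\<bar>" by (simp add: abs_mult power2_eq_square mult_ac)
 also have "... <= (1 + ?r powr s) * dip s a xi"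
 proof -
 have "\<bar>a - 1 - ?r powr s\<bar> <= 1 + ?r powr s" using a powr_ge_zero[of ?r s] by linarith
 from mult_right_mono[OF this f0(1)] show ?thesis unfolding norm_square_mult_dipk abs_mult using f0(1) by simp
 qed
 finally have k: "\<bar>dipk s a xi * ((xi \<bullet> c) * (xi \<bullet> b))\<bar> <= (1 + ?r powr s) * dip s a xi" .
 have "\<bar>c \<bullet> b\<bar> <= 1" using b c by (simp add: inner_Basis)
 then have "\<bar>dip s a xi * (c \<bullet> b)\<bar> <= dip s a xi * 1" using f0 unfolding abs_mult by (intro mult_mono) auto
 with k have "\<bar>dip s a xi * (c \<bullet> b) + dipk s a xi * ((xi \<bullet> c) * (xi \<bullet> b))\<bar> <= (2 + ?r powr s) * dip s a xi"
 by (simp add: algebra_simps)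
 from mult_left_mono[OF this norm_ge_zero[of xi]]
 have "cmod (of_real ?r * dipD s a b xi c) <= (2 + ?r powr s) * ?f"
 unfolding norm_mult_dip[symmetric] by (simp add: dipD_def norm_mult mult.left_commute del: of_real_add of_real_mult)
 also have "... = cmod (of_real ((2 + ?r powr s) * ?f))" unfolding norm_of_real
 using f0 by (intro abs_of_nonneg[symmetric] mult_nonneg_nonneg add_nonneg_nonneg) (auto simp: less_imp_le)
 finally show "cmod (of_real ?r * dipD s a b xi c)
 <= 1 * (1 + norm xi) ^ 0 * cmod (2 * (of_real (?r powr a) * prof s 1 xi) + of_real (?r powr s) * (of_real (?r powr a) * prof s 1 xi))"
 by (simp add: prof_def algebra_simps)
 qed
qed

text \<open>The power factor is homogeneous of degree \<open>a\<close>, and the profile contributes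
  - |xi|^s. Consequently R v + |xi|^s v = a v, which is equality in the completed square for the
  nonradial part.\<close>

lemma eul_dipD:
 assumes s: "s > 0" and a: "a > 0" "a < 1" and b: "b \<in> Basis"
 shows "eul (dipD s a b) xi = of_real ((a - norm xi powr s) * (dip s a xi * (xi \<bullet> b)))"
proof (cases "xi = 0")
 case False
 have "dip s a xi * (xi \<bullet> b) + dipk s a xi * ((xi \<bullet> xi) * (xi \<bullet> b)) = (dip s a xi + (norm xi)\<^sup>2 * dipk s a xi) * (xi \<bullet> b)"
 by (simp add: power2_norm_eq_inner algebra_simps)
 also have "... = (a - norm xi powr s) * (dip s a xi * (xi \<bullet> b))"
 unfolding norm_square_mult_dipk by (simp add: algebra_simps)
 finally show ?thesis unfolding eul_eq[OF nice_dip[OF s a b] False] dipD_def by simp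
qed simp

lemma ang_dipD:
 fixes xi :: "'a::euclidean_space"
 assumes s: "s > 0" and a: "a > 0" "a < 1" and b: "b \<in> Basis"
 shows "ang (dipD s a b) xi = (norm xi powr a * gl s 1 (norm xi))\<^sup>2 - (dip s a xi * (xi \<bullet> b))\<^sup>2"
proof -
 let ?f = "dip s a xi" and ?k = "dipk s a xi" and ?x = "xi \<bullet> b" and ?r = "norm xi"
 have s1: "(\<Sum>c\<in>Basis. (c \<bullet> b)\<^sup>2) = 1" using norm_square_eq_sum[of b] b by (simp add: inner_commute)
 have s2: "(\<Sum>c\<in>Basis. (c \<bullet> b) * (xi \<bullet> c)) = ?x" using euclidean_inner[of xi b] by (simp add: inner_commute mult.commute)
 have "grad2 (dipD s a b) xi = (\<Sum>c\<in>Basis. ?f\<^sup>2 * (c \<bullet> b)\<^sup>2 + 2 * ?f * ?k * ?x * ((c \<bullet> b) * (xi \<bullet> c)) + ?k\<^sup>2 * ?x\<^sup>2 * (xi \<bullet> c)\<^sup>2)"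
 unfolding grad2_def dipD_def norm_of_real power2_abs by (intro sum.cong refl) (simp add: power2_eq_square algebra_simps)
 also have "... = ?f\<^sup>2 + 2 * ?f * ?k * ?x\<^sup>2 + ?k\<^sup>2 * ?x\<^sup>2 * ?r\<^sup>2"
 unfolding sum.distrib sum_distrib_left[symmetric] s1 s2 norm_square_eq_sum[symmetric] by (simp add: power2_eq_square)
 finally have g: "?r\<^sup>2 * grad2 (dipD s a b) xi = (?r * ?f)\<^sup>2 + 2 * (?r\<^sup>2 * ?k) * ?f * ?x\<^sup>2 + (?r\<^sup>2 * ?k)\<^sup>2 * ?x\<^sup>2"
 by (simp add: power2_eq_square algebra_simps)
 show ?thesis
 unfolding ang_def g eul_dipD[OF assms] norm_square_mult_dipk norm_of_real power2_abs norm_mult_dip by (simp add: power2_eq_square algebra_simps)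
qed

text \<open>The candidate is odd and the profiles are even, so the nearest multiple is 0 and the
  squared distance is the full weighted mass; the deficit is estimated through
  \<open>deficit_identity\<close> at \<open>mu = 1\<close>.\<close>

theorem dipole_candidate:
 assumes s: "s > 0" and N: "DIM('a) >= 2" and a: "a > 0" "a < 1" "a\<^sup>2 + a * real DIM('a) = real DIM('a) - 1"
 shows "\<exists>(z :: 'a::euclidean_space => complex) D d. nice z D \<and> d > 0 \<and>
 (\<forall>al mu. mu > 0 \<longrightarrow> d <= mom s (%xi. z xi - al * prof s mu xi)) \<and> deficit s z D <= a * d"
proof -
 let ?N = "real DIM('a)"
 let ?z = "%b (xi::'a). complex_of_real (dip s a xi * (xi \<bullet> b))"
 note z = nice_dip[OF s a(1,2), where 'a='a]
 define I where "I b = (LI xi. csq (?z b xi))" for b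
 define S where "S = mom (2 * a) (prof s 1 :: 'a => complex)"
 have S: "S > 0" unfolding S_def using s a by (intro mom_prof_pos) auto
 have Se: "(norm xi powr a * gl s 1 (norm xi))\<^sup>2 = norm xi powr (2 * a) * csq (prof s 1 xi)" for xi :: 'a
 by (simp add: prof_def power_mult_distrib powr_mult_self)
 have iS: "integ (%xi::'a. norm xi powr (2 * a) * csq (prof s 1 xi))"
 using a s by (intro integrable_powr_norm2 rapid_prof) auto
 have iI: "integ (%xi. csq (?z b xi))" if "b \<in> Basis" for b
 by (rule integrable_norm2[OF niceD(2)[OF z[OF that]]])
 have sumI: "(\<Sum>b\<in>Basis. I b) = S"
 proof -
 have sq: "(\<Sum>b\<in>Basis. csq (?z b xi)) = norm xi powr (2 * a) * csq (prof s 1 xi)" for xi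
 proof -
 have "(\<Sum>b\<in>Basis. csq (?z b xi)) = (\<Sum>b\<in>Basis. (dip s a xi)\<^sup>2 * (xi \<bullet> b)\<^sup>2)"
 by (simp add: power_mult_distrib norm_mult)
 also have "... = (norm xi * dip s a xi)\<^sup>2"
 unfolding sum_distrib_left[symmetric] norm_square_eq_sum[symmetric] by (simp add: power_mult_distrib)
 finally show ?thesis unfolding norm_mult_dip Se .
 qed
 have "(\<Sum>b\<in>Basis. I b) = (LI xi. (\<Sum>b\<in>Basis. csq (?z b xi)))"
 unfolding I_def using iI by (intro Bochner_Integration.integral_sum[symmetric])
 then show ?thesis unfolding sq by (simp add: S_def mom_def)
 qed
 \<comment> \<open>By symmetry all \<open>I b\<close> equal \<open>S / ?N\<close>; picking a
   direction with at least the average value avoids rotating the integral.\<close>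
 have "\<exists>b\<in>Basis. S <= ?N * I b"
 proof (rule ccontr)
 assume "\<not> ?thesis"
 then have "(\<Sum>b\<in>(Basis::'a set). ?N * I b) < (\<Sum>b\<in>(Basis::'a set). S)" by (intro sum_strict_mono) auto
 then show False using sumI by (simp flip: sum_distrib_left)
 qed
 then obtain b :: 'a where b: "b \<in> Basis" "S <= ?N * I b" by blast
 define v where "v = ?z b"
 define D where "D = dipD s a b"
 have n: "nice v D" unfolding v_def D_def by (rule z[OF b(1)])
 note rv = niceD(2)[OF n]
 have I: "I b > 0" using S b(2) N by (metis less_le_trans mult_pos_pos not_less_iff_gr_or_eq zero_less_mult_pos of_nat_0_less_iff DIM_positive)
 have iv: "integ (%xi. csq (v xi))" by (rule integrable_norm2[OF rv])
 have im: "integ (%xi. norm xi powr s * csq (v xi))" using s by (intro integrable_powr_norm2 rv) auto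
 have eul: "eul D xi = of_real (a - norm xi powr s) * v xi" for xi
 unfolding D_def eul_dipD[OF s a(1,2) b(1)] v_def by simp
 have mom: "mom s v = (2 * a + ?N) / 2 * I b"
 proof -
 have "v xi \<bullet> v xi = csq (v xi)" for xi by (simp add: power2_norm_eq_inner)
 then have e: "2 * (v xi \<bullet> eul D xi) = 2 * a * csq (v xi) - 2 * (norm xi powr s * csq (v xi))" for xi
 unfolding eul complex_inner_of_real by (simp add: algebra_simps)
 have "2 * a * I b - 2 * mom s v = - ?N * I b"
 using radial_ibp_0[OF n] iv im unfolding e by (simp add: I_def mom_def v_def)
 then show ?thesis by (simp add: algebra_simps)
 qed
 have d: "mom s v > 0" unfolding mom using I a by (intro mult_pos_pos) (auto intro: add_pos_nonneg)
 have dist: "mom s v <= mom s (%xi. v xi - al * prof s mu xi)" if mu: "mu > 0" for al mu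
 proof -
 let ?g = "%xi::'a. al * prof s mu xi"
 have rg: "rapid ?g" by (intro rapid_cmult rapid_prof s mu)
 have ig: "integ (%xi::'a. norm xi powr s * csq (?g xi))" using s by (intro integrable_powr_norm2 rg) auto
 have ic: "integ (%xi. norm xi powr s * (v xi \<bullet> ?g xi))" using s by (intro integrable_powr_inner rv rg) auto
 have "norm (- xi) powr s * (v (- xi) \<bullet> ?g (- xi)) = - (norm xi powr s * (v xi \<bullet> ?g xi))" for xi
 by (simp add: v_def dip_def prof_def)
 then have "(LI xi. norm xi powr s * (v xi \<bullet> ?g xi)) = (LI xi. - (norm xi powr s * (v xi \<bullet> ?g xi)))"
 using integral_lborel_reflect[of "%xi. norm xi powr s * (v xi \<bullet> ?g xi)"] borel_measurable_integrable[OF ic] by simp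
 then have odd: "(LI xi. norm xi powr s * (v xi \<bullet> ?g xi)) = 0" by simp
 have f: "csq (v xi - ?g xi) = csq (v xi) - 2 * (v xi \<bullet> ?g xi) + csq (?g xi)" for xi
 using norm_square_add[of "v xi" "- ?g xi"] by simp
 have "norm xi powr s * csq (v xi - ?g xi) = norm xi powr s * csq (v xi) - 2 * (norm xi powr s * (v xi \<bullet> ?g xi)) + norm xi powr s * csq (?g xi)" for xi
 unfolding f by (simp add: algebra_simps)
 then have "mom s (%xi. v xi - ?g xi) = mom s v + mom s ?g"
 unfolding mom_def using im ig ic odd by simp
 then show ?thesis by simp
 qed
 have "gradB D + mom (2 * s) v - (?N + s) * mom s v = (a\<^sup>2 - 1) * I b + S"
 proof -
 have "eul D xi + of_real (1 * norm xi powr s) * v xi = of_real a * v xi" for xi unfolding eul by (simp add: algebra_simps)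
 then have "(LI xi. csq (eul D xi + of_real (1 * norm xi powr s) * v xi)) = a\<^sup>2 * I b"
 by (simp add: square_norm_of_real_mult I_def v_def del: of_real_mult)
 moreover have "(LI xi. ang D xi) = S - I b"
 proof -
 have "csq (v xi) = (dip s a xi * (xi \<bullet> b))\<^sup>2" for xi by (simp add: v_def del: of_real_mult)
 then have "ang D xi = norm xi powr (2 * a) * csq (prof s 1 xi) - csq (v xi)" for xi
 unfolding D_def ang_dipD[OF s a(1,2) b(1)] Se by simp
 then show ?thesis using iS iv by (simp add: S_def mom_def I_def v_def)
 qed
 ultimately show ?thesis using deficit_identity[OF n s, of 1] by (simp add: algebra_simps)
 qed
 also have "... <= (a\<^sup>2 + ?N - 1) * I b" using b(2) by (simp add: algebra_simps)
 \<comment> \<open>The equation for \<open>a\<close> enters here, and the factor 2 a + N matches the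
   one in \<open>mom\<close>.\<close>
 also have "a\<^sup>2 + ?N - 1 = a * (2 * a + ?N)" using a(3) by (simp add: power2_eq_square algebra_simps)
 finally have "gradB D + mom (2 * s) v - (?N + s) * mom s v <= 2 * (a * mom s v)" unfolding mom by simp
 from order_trans[OF deficit_le divide_right_mono[OF this]] have "deficit s v D <= a * mom s v" by simp
 with n d dist show ?thesis by blast
qed

text \<open>Dilation by mu^(-1/s) carries the profile with parameter \<open>mu\<close> to the one
  with parameter 1; the exponent collects the Jacobian and the weight.\<close>

lemma mom_prof_scaling:
 assumes s: "s > 0" and mu: "mu > 0"
 shows "mom s (prof s mu :: 'a::euclidean_space => complex) = mu powr (- ((real DIM('a) + s) / s)) * mom s (prof s 1 :: 'a => complex)"
proof -
 define \<kappa> where "\<kappa> = mu powr (- 1 / s)"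
 have \<kappa>: "\<kappa> > 0" using mu by (simp add: \<kappa>_def)
 have \<kappa>s: "\<kappa> powr s = 1 / mu" unfolding \<kappa>_def powr_powr using s mu by (simp add: powr_minus_divide)
 have g: "gl s mu (\<kappa> * r) = gl s 1 r" if "r >= 0" for r
 using mu \<kappa> that by (simp add: gl_def powr_mult \<kappa>s)
 have "norm (0 + \<kappa> *. xi) powr s * csq (prof s mu (0 + \<kappa> *. xi)) = \<kappa> powr s * (norm xi powr s * csq (prof s 1 xi))" for xi :: 'a
 using \<kappa> by (simp add: prof_def g powr_mult)
 then have "\<kappa> powr s * mom s (prof s 1 :: 'a => complex) = 1 / \<kappa> ^ DIM('a) * mom s (prof s mu :: 'a => complex)"
 using integral_lborel_affine[of "%xi::'a. norm xi powr s * csq (prof s mu xi)" \<kappa> 0] \<kappa> rapidD_measurable[OF rapid_prof[OF s mu], where 'a='a]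
 by (simp add: mom_def)
 then have "mom s (prof s mu :: 'a => complex) = (\<kappa> powr real DIM('a) * \<kappa> powr s) * mom s (prof s 1 :: 'a => complex)"
 using \<kappa> by (simp add: powr_realpow field_simps)
 also have "\<kappa> powr real DIM('a) * \<kappa> powr s = mu powr (- ((real DIM('a) + s) / s))"
 unfolding powr_add[symmetric] by (simp add: \<kappa>_def powr_powr)
 finally show ?thesis .
qed

text \<open>The candidate for \<open>\<Lambda> = 2 s\<close>: the first radial excitation \<open>|xi|\<^bsup>s\<^esup> - c\<close>, added to the profile with an
 imaginary factor.  A real perturbation would be absorbed to first order by a change of \<open>mu\<close>.\<close>

theorem excited_candidate:
 assumes s: "s > 0"
 shows "\<exists>(z :: 'a::euclidean_space => complex) D d. nice z D \<and> d > 0 \<and>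
 (\<forall>al mu. mu > 0 \<longrightarrow> d <= mom s (%xi. z xi - al * prof s mu xi)) \<and> deficit s z D <= s * d"
proof -
 let ?N = "real DIM('a)"
 \<comment> \<open>\<open>c\<close> is the mean of |xi|^s for the density |xi|^s times the squared
   profile, so \<open>h\<close> has mean 0 for that density.\<close>
 define c where "c = (?N + s) / 2"
 have c: "c > 0" unfolding c_def using s by (simp add: add_nonneg_pos)
 define h where "h t = t powr s / c - 1" for t :: real
 define q where "q t = of_real (gl s 1 t) * (1 + \<i> * of_real (h t))" for t
 define q' where "q' t = glD s 1 t * (1 + \<i> * of_real (h t)) + of_real (gl s 1 t) * (\<i> * of_real (s * t powr (s - 1) / c))" for t
 have [measurable]: "h \<in> bmeas" "glD s 1 \<in> bmeas"
 unfolding h_def[abs_def] glD_def[abs_def] by measurable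
 let ?g = "prof s 1 :: 'a => complex"
 have rg: "rapid ?g" by (rule rapid_prof[OF s]) simp
 have qe: "q (norm xi) = (1 - \<i>) * ?g xi + (\<i> / of_real c) * (of_real (norm xi powr s) * ?g xi)" for xi :: 'a
 by (simp add: q_def h_def prof_def algebra_simps)
 have ts: "t powr s = t * t powr (s - 1)" if "t > 0" for t :: real using that by (simp add: powr_mult_base)
 \<comment> \<open>R + |xi|^s annihilates the profile, so only the derivative of \<open>h\<close>
   survives.\<close>
 have q'e: "of_real t * q' t + of_real (t powr s) * q t = \<i> * of_real (s / c * t powr s * gl s 1 t)" if "t >= 0" for t
 using ts[of t] that by (cases "t = 0") (simp_all add: q'_def q_def glD_def algebra_simps)
 define v :: "'a => complex" where "v xi = q (norm xi)" for xi
 define D :: "'a => 'a => complex" where "D = radD q'"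
 have n: "nice v D"
 unfolding v_def D_def
 proof (rule nice_radial)
 show "continuous_on {0..} q"
 proof -
 have "continuous_on {0..} (%t. t powr s)" by (intro continuous_on_powr' continuous_intros) (use s in auto)
 then show ?thesis
 unfolding q_def h_def using s c
 by (intro continuous_on_mult continuous_on_add continuous_on_diff continuous_on_divide continuous_on_const continuous_on_of_real continuous_on_gl) auto
 qed
 show rq: "rapid (%xi::'a. q (norm xi))"
 unfolding qe using s by (intro rapid_add rapid_cmult rapid_powr_mult rg) auto
 show "q' \<in> bmeas" unfolding q'_def by measurable
 show "(q has_vector_derivative q' t) (at t)" if t: "t > 0" for t
 proof -
 have "(h has_real_derivative s * t powr (s - 1) / c) (at t)"
 unfolding h_def[abs_def] using DERIV_diff[OF DERIV_cdivide[OF has_real_derivative_powr[OF t, of s], of c] DERIV_const[of 1]] by simp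
 then have d: "((%t. 1 + \<i> * complex_of_real (h t)) has_vector_derivative 0 + \<i> * of_real (s * t powr (s - 1) / c)) (at t)"
 by (intro has_vector_derivative_add has_vector_derivative_const has_vector_derivative_mult_right has_vector_derivative_of_real)
 have g: "((%t. complex_of_real (gl s 1 t)) has_vector_derivative glD s 1 t) (at t)"
 unfolding glD_def by (intro has_vector_derivative_of_real gl_has_derivative s t)
 show ?thesis using has_vector_derivative_mult[OF g d] unfolding q_def q'_def by (simp add: algebra_simps)
 qed
 have "of_real t * q' t = \<i> * of_real (s / c * t powr s * gl s 1 t) - of_real (t powr s) * q t" if "t >= 0" for t
 using q'e[OF that] by (simp add: algebra_simps)
 then have "(%xi::'a. of_real (norm xi) * q' (norm xi)) = (%xi. (\<i> * of_real (s / c)) * (of_real (norm xi powr s) * ?g xi) - of_real (norm xi powr s) * q (norm xi))"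
 by (simp add: fun_eq_iff prof_def)
 then show "rapid (%xi::'a. of_real (norm xi) * q' (norm xi))"
 using s by (simp only:) (intro rapid_diff rapid_cmult rapid_powr_mult rg rq, auto)
 qed
 define m where "m p = mom p ?g" for p
 have im: "integ (%xi::'a. norm xi powr p * csq (prof s mu xi))" if "p >= 0" "mu > 0" for p mu
 using that by (intro integrable_powr_norm2 rapid_prof s) auto
 have m1: "m s > 0" unfolding m_def using s by (intro mom_prof_pos) auto
 have m2: "m (2 * s) = c * m s" and m3: "m (3 * s) = (c + s / 2) * m (2 * s)"
 using mom_prof_recurrence[OF s zero_less_one, of s, where 'a='a] mom_prof_recurrence[OF s zero_less_one, of "2 * s", where 'a='a] s
 by (simp_all add: m_def c_def field_simps)
 have pw: "norm xi powr (2 * s) = norm xi powr s * norm xi powr s" "norm xi powr (3 * s) = norm xi powr s * norm xi powr s * norm xi powr s" for xi :: 'a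
 by (simp_all add: powr_add[symmetric])
 \<comment> \<open>\<open>W\<close> is the weighted mass of the excited part and serves as the bound
   \<open>d\<close> on the distance.\<close>
 define W where "W = (LI xi. norm (xi::'a) powr s * ((h (norm xi))\<^sup>2 * csq (?g xi)))"
 have W: "W = s / 2 * m s / c"
 and iW: "integ (%xi::'a. norm xi powr s * ((h (norm xi))\<^sup>2 * csq (?g xi)))"
 proof -
 have e: "norm xi powr s * ((h (norm xi))\<^sup>2 * csq (?g xi))
 = norm xi powr (3 * s) * csq (?g xi) / c\<^sup>2 - 2 / c * (norm xi powr (2 * s) * csq (?g xi)) + norm xi powr s * csq (?g xi)" for xi :: 'a
 unfolding pw h_def using c by (simp add: power2_eq_square field_simps)
 show "integ (%xi::'a. norm xi powr s * ((h (norm xi))\<^sup>2 * csq (?g xi)))"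
 unfolding e using im s by simp
 have "W = m (3 * s) / c\<^sup>2 - 2 / c * m (2 * s) + m s"
 unfolding W_def e m_def mom_def using im s by simp
 also have "... = s / 2 * m s / c" unfolding m3 m2 using c by (simp add: power2_eq_square field_simps)
 finally show "W = s / 2 * m s / c" .
 qed
 have W0: "W > 0" unfolding W using s m1 c by simp
 have "gradB D + mom (2 * s) v - (?N + s) * mom s v = 2 * (s * W)"
 proof -
 have e: "eul D xi + of_real (1 * norm xi powr s) * v xi = \<i> * of_real (s / c * norm xi powr s * gl s 1 (norm xi))" for xi
 using q'e[of "norm xi"] by (simp add: D_def v_def eul_radD)
 have "csq (\<i> * of_real (s / c * norm xi powr s * gl s 1 (norm xi))) = (s / c)\<^sup>2 * (norm xi powr (2 * s) * csq (?g xi))" for xi :: 'a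
 unfolding norm_mult norm_ii norm_of_real mult_1 power2_abs power_mult_distrib prof_def powr_mult_self by simp
 then have "(LI xi. csq (eul D xi + of_real (1 * norm xi powr s) * v xi)) = (s / c)\<^sup>2 * m (2 * s)"
 unfolding e by (simp add: m_def mom_def)
 moreover have "ang D xi = 0" for xi
 unfolding ang_def D_def grad2_radD eul_radD by (simp add: norm_mult power_mult_distrib)
 ultimately have "(s / c)\<^sup>2 * m (2 * s) = gradB D + mom (2 * s) v - (?N + s) * mom s v"
 using deficit_identity[OF n s, of 1] by simp
 then show ?thesis unfolding W m2 using c by (simp add: power2_eq_square field_simps)
 qed
 from deficit_le[of s v D, unfolded this] have def: "deficit s v D <= s * W" by simp
 have "W <= mom s (%xi. v xi - al * prof s mu xi)" if mu: "mu > 0" for al mu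
 proof -
 \<comment> \<open>The product of the profiles with parameters 1 and \<open>mu\<close> is the square
   of the profile with the mean parameter \<open>\<nu>\<close>; the number \<open>t\<close> below is
   the mean of \<open>h\<close> for |xi|^s times that square.\<close>
 define \<nu> where "\<nu> = (1 + mu) / 2"
 have \<nu>: "\<nu> > 0" using mu by (simp add: \<nu>_def)
 define t where "t = 1 / \<nu> - 1"
 let ?k = "prof s \<nu> :: 'a => complex"
 define X where "X = mom s ?k"
 define Mm where "Mm = mom s (prof s mu :: 'a => complex)"
 have gg: "gl s 1 r * gl s mu r = (gl s \<nu> r)\<^sup>2" for r
 by (simp add: gl_def \<nu>_def power2_eq_square exp_add[symmetric] add_divide_distrib[symmetric] algebra_simps)
 have Y: "mom (2 * s) ?k = c / \<nu> * X"
 using mom_prof_recurrence[OF s \<nu>, of s, where 'a='a] s \<nu> by (simp add: X_def c_def field_simps)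
 have e: "norm xi powr s * csq (v xi - al * prof s mu xi)
 = norm xi powr s * csq (?g xi) + norm xi powr s * ((h (norm xi))\<^sup>2 * csq (?g xi))
 - 2 * ((Re al - Im al) * (norm xi powr s * csq (?k xi)) + Im al / c * (norm xi powr (2 * s) * csq (?k xi)))
 + csq al * (norm xi powr s * csq (prof s mu xi))" for xi :: 'a
 proof -
 let ?r = "norm xi" and ?G = "gl s 1 (norm xi)" and ?H = "gl s mu (norm xi)" and ?h = "h (norm xi)"
 have "csq (v xi - al * prof s mu xi) = (?G - Re al * ?H)\<^sup>2 + (?G * ?h - Im al * ?H)\<^sup>2"
 by (simp add: cmod_power2 v_def q_def prof_def)
 also have "... = ?G\<^sup>2 + ?h\<^sup>2 * ?G\<^sup>2 - 2 * (Re al + Im al * ?h) * (?G * ?H) + csq al * ?H\<^sup>2"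
 unfolding cmod_power2[of al] by (simp add: power2_eq_square algebra_simps)
 also have "Re al + Im al * ?h = (Re al - Im al) + Im al / c * ?r powr s" by (simp add: h_def algebra_simps)
 finally have f: "csq (v xi - al * prof s mu xi) = ?G\<^sup>2 + ?h\<^sup>2 * ?G\<^sup>2 - 2 * ((Re al - Im al) + Im al / c * ?r powr s) * (?G * ?H) + csq al * ?H\<^sup>2" .
 show ?thesis unfolding f gg pw by (simp add: prof_def algebra_simps)
 qed
 have "mom s (%xi. v xi - al * prof s mu xi) = m s + W - 2 * ((Re al - Im al) * X + Im al / c * mom (2 * s) ?k) + csq al * Mm"
 unfolding mom_def[of s "%xi. v xi - al * prof s mu xi"] e
 using im[of s 1] im[of s \<nu>] im[of "2 * s" \<nu>] im[of s mu] s \<nu> mu iW by (simp add: m_def W_def X_def Mm_def mom_def)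
 also have "(Re al - Im al) * X + Im al / c * mom (2 * s) ?k = (Re al + t * Im al) * X"
 unfolding Y t_def using c by (simp add: algebra_simps)
 finally have mm: "mom s (%xi. v xi - al * prof s mu xi) = m s + W - 2 * ((Re al + t * Im al) * X) + csq al * Mm" .
 define p where "p = (?N + s) / s"
 have p: "p >= 1" using s by (simp add: p_def)
 have X: "X = \<nu> powr (- p) * m s" and Mm: "Mm = mu powr (- p) * m s"
 using mom_prof_scaling[OF s \<nu>, where 'a='a] mom_prof_scaling[OF s mu, where 'a='a] by (simp_all add: X_def Mm_def m_def p_def)
 \<comment> \<open>Since mu / \<nu>^2 = 1 - t^2, the claim amounts to (1 - t^2)^p (1 + t^2) <= 1,
   which holds because p >= 1 and 0 < 1 - t^2 <= 1. As this covers every \<open>mu\<close>, the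
   excitation may have amplitude 1 and need not be small.\<close>
 have "X\<^sup>2 * (1 + t\<^sup>2) <= m s * Mm"
 proof -
 have w: "mu / \<nu>\<^sup>2 = 1 - t\<^sup>2"
 proof -
 have n0: "1 + mu ~= 0" using mu by simp
 have tt: "t = (1 - mu) / (1 + mu)" unfolding t_def \<nu>_def using n0 by (simp add: field_simps)
 have "1 - t\<^sup>2 = ((1 + mu)\<^sup>2 - (1 - mu)\<^sup>2) / (1 + mu)\<^sup>2"
 unfolding tt diff_divide_distrib[of "(1 + mu)\<^sup>2"] power_divide using n0 by simp
 also have "(1 + mu)\<^sup>2 - (1 - mu)\<^sup>2 = 4 * mu" by (simp add: power2_eq_square algebra_simps)
 finally show ?thesis by (simp add: \<nu>_def power_divide)
 qed
 have w01: "0 < 1 - t\<^sup>2" "1 - t\<^sup>2 <= 1" unfolding w[symmetric] using mu \<nu> by simp (simp add: w)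
 have "(mu powr p) * (\<nu> powr (- p))\<^sup>2 = (1 - t\<^sup>2) powr p"
 proof -
 have "1 / \<nu>\<^sup>2 = \<nu> powr (- 2)" using \<nu> by (simp add: powr_minus_divide)
 then have "(\<nu> powr (- p))\<^sup>2 = (1 / \<nu>\<^sup>2) powr p" by (simp add: powr_mult_self powr_powr)
 then show ?thesis unfolding w[symmetric] using mu \<nu> by (simp add: powr_mult[symmetric])
 qed
 also have "... <= (1 - t\<^sup>2) powr 1" using p w01 by (intro powr_mono') auto
 finally have "(mu powr p) * (\<nu> powr (- p))\<^sup>2 * (1 + t\<^sup>2) <= (1 - t\<^sup>2) * (1 + t\<^sup>2)" using w01 by (intro mult_right_mono) auto
 also have "... <= 1" by (simp add: algebra_simps)
 finally have "mu powr (- p) * ((mu powr p) * (\<nu> powr (- p))\<^sup>2 * (1 + t\<^sup>2)) <= mu powr (- p) * 1" by (intro mult_left_mono) auto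
 then have "(mu powr (- p) * mu powr p) * ((\<nu> powr (- p))\<^sup>2 * (1 + t\<^sup>2)) <= mu powr (- p)" by (simp only: mult.assoc mult_1_right)
 moreover have "mu powr (- p) * mu powr p = 1" using mu by (simp add: powr_add[symmetric])
 ultimately have "(\<nu> powr (- p))\<^sup>2 * (1 + t\<^sup>2) <= mu powr (- p)" by simp
 from mult_right_mono[OF this, of "(m s)\<^sup>2"] show ?thesis unfolding X Mm by (simp add: power2_eq_square mult_ac)
 qed
 \<comment> \<open>Cauchy-Schwarz for the pairs (Re al, Im al) and (1, t). The arithmetic-geometric
   inequality then lets the masses of the two profiles absorb the cross term, and \<open>W\<close>
   remains.\<close>
 then have key: "((Re al + t * Im al) * X)\<^sup>2 <= m s * (csq al * Mm)"
 proof -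
 have "(Re al + t * Im al)\<^sup>2 <= csq al * (1 + t\<^sup>2)"
 unfolding cmod_power2 using zero_le_power2[of "Im al - t * Re al"] by (simp add: power2_eq_square algebra_simps)
 then have "((Re al + t * Im al) * X)\<^sup>2 <= csq al * (1 + t\<^sup>2) * X\<^sup>2"
 unfolding power_mult_distrib by (intro mult_right_mono) auto
 also have "... = csq al * (X\<^sup>2 * (1 + t\<^sup>2))" by simp
 also have "... <= csq al * (m s * Mm)" by (intro mult_left_mono \<open>X\<^sup>2 * (1 + t\<^sup>2) <= m s * Mm\<close>) simp
 finally show ?thesis by (simp add: mult_ac)
 qed
 have "(2 * y) <= a + b" if "y\<^sup>2 <= a * b" "a >= 0" "b >= 0" for a b y :: real
 proof -
 have "y <= sqrt (a * b)" by (rule real_le_rsqrt[OF that(1)])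
 also have "... <= (a + b) / 2" using that by (intro arith_geo_mean_sqrt)
 finally show ?thesis by simp
 qed
 from this[OF key] have "2 * ((Re al + t * Im al) * X) <= m s + csq al * Mm"
 using m1 by (simp add: Mm_def)
 then show ?thesis unfolding mm by linarith
 qed
 with n W0 def show ?thesis by blast
qed

theorem theorem1p2:
  fixes s :: real and N :: real and \<Lambda> :: real
  assumes "CARD('n::finite) \<ge> 2" and "s > 0"
  defines "N \<equiv> real CARD('n)"
  defines "\<Lambda> \<equiv> min (2 * s) (sqrt (N\<^sup>2 + 4 * N - 4) - N)"
  shows
    "(\<forall>u :: real ^ 'n \<Rightarrow> complex. test_fun u \<longrightarrow>
        sqrt (lap_energy (s / 2) u) * sqrt (grad_energy u) \<ge> (N + s) / 2 * lap_energy (s / 4) u) \<and>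
     (\<forall>C > (N + s) / 2. \<exists>u :: real ^ 'n \<Rightarrow> complex. test_fun u \<and>
        sqrt (lap_energy (s / 2) u) * sqrt (grad_energy u) < C * lap_energy (s / 4) u) \<and>
     (\<forall>\<alpha> \<mu>. \<alpha> \<noteq> 0 \<and> \<mu> > 0 \<longrightarrow>
        equality_case s ((N + s) / 2) (\<lambda>x :: real ^ 'n. \<alpha> * G s \<mu> x)) \<and>
     (\<forall>u :: real ^ 'n \<Rightarrow> complex. equality_case s ((N + s) / 2) u \<longrightarrow>
        (\<exists>\<alpha> \<mu>. \<alpha> \<noteq> 0 \<and> \<mu> > 0 \<and> (AE x in lborel. u x = \<alpha> * G s \<mu> x))) \<and>
     (\<forall>u :: real ^ 'n \<Rightarrow> complex. test_fun u \<longrightarrow>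
        sqrt (lap_energy (s / 2) u) * sqrt (grad_energy u) - (N + s) / 2 * lap_energy (s / 4) u
          \<ge> \<Lambda> / 2 * dist_to_profiles s u) \<and>
     (\<forall>C > \<Lambda> / 2. \<exists>u :: real ^ 'n \<Rightarrow> complex. test_fun u \<and>
        sqrt (lap_energy (s / 2) u) * sqrt (grad_energy u) - (N + s) / 2 * lap_energy (s / 4) u
          < C * dist_to_profiles s u)"
proof -
 have D: "N = real DIM(real ^ 'n)" by (simp add: N_def)
 have dim: "DIM(real ^ 'n) >= 2" using assms(1) by simp
 note s = \<open>s > 0\<close>
 define a where "a = (sqrt (N\<^sup>2 + 4 * N - 4) - N) / 2"
 have a: "a > 0" "a < 1" "a\<^sup>2 + a * N = N - 1"
 unfolding a_def using spectral_gap_root[of N] assms(1) by (auto simp: N_def)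
 have L: "\<Lambda> / 2 = min s a" by (simp add: \<Lambda>_def a_def min_def)
 have deficit: "sqrt (lap_energy (s / 2) u) * sqrt (grad_energy u) - (N + s) / 2 * lap_energy (s / 4) u = (2 * pi) powr s * deficit s (fourier u) (fD u)"
 if "test_fun u" for u :: "real ^ 'n => complex"
 using energies_inv_fourier(3)[OF nice_test[OF that] s] by (simp add: D test_fun_inversion[OF that])
 show ?thesis
 proof (intro conjI allI impI)
 fix u :: "real ^ 'n => complex" assume u: "test_fun u"
 have "(2 * pi) powr s * deficit s (fourier u) (fD u) >= 0"
 by (intro mult_nonneg_nonneg deficit_nonneg[OF nice_test[OF u] s]) simp
 then show "(N + s) / 2 * lap_energy (s / 4) u <= sqrt (lap_energy (s / 2) u) * sqrt (grad_energy u)"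
 using deficit[OF u] by linarith
 show "\<Lambda> / 2 * dist_to_profiles s u <= sqrt (lap_energy (s / 2) u) * sqrt (grad_energy u) - (N + s) / 2 * lap_energy (s / 4) u"
 using stability_inv_fourier[OF nice_test[OF u] s dim] unfolding deficit[OF u] unfolding \<Lambda>_def D test_fun_inversion[OF u] .
 next
 fix C assume "C > (N + s) / 2"
 then show "\<exists>u :: real ^ 'n => complex. test_fun u \<and> sqrt (lap_energy (s / 2) u) * sqrt (grad_energy u) < C * lap_energy (s / 4) u"
 using sharp_constant[OF s] unfolding D by blast
 next
 fix al :: complex and mu :: real assume "al ~= 0 \<and> mu > 0"
 then show "equality_case s ((N + s) / 2) (%x :: real ^ 'n. al * G s mu x)"
 unfolding D by (intro equality_case_profile s) auto
 next
 fix u :: "real ^ 'n => complex" assume "equality_case s ((N + s) / 2) u"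
 then show "\<exists>al mu. al ~= 0 \<and> mu > 0 \<and> (AE x in lborel. u x = al * G s mu x)"
 using equality_case_imp_profile[OF _ s dim] unfolding D by blast
 next
 fix C assume C: "C > \<Lambda> / 2"
 \<comment> \<open>The smaller of the two gaps decides the candidate: the radial excitation for
   \<open>s <= a\<close>, the dipole otherwise.\<close>
 have "\<exists>(z :: real ^ 'n => complex) E d. nice z E \<and> d > 0 \<and>
 (\<forall>al mu. mu > 0 \<longrightarrow> d <= mom s (%xi. z xi - al * prof s mu xi)) \<and> deficit s z E <= \<Lambda> / 2 * d"
 proof (cases "s <= a")
 case True
 then show ?thesis using excited_candidate[OF s, where 'a="real ^ 'n"] unfolding L by simp
 next
 case False
 then show ?thesis using dipole_candidate[OF s dim a(1,2)] a(3) unfolding L D by (simp add: min_def)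
 qed
 then obtain z :: "real ^ 'n => complex" and E d where z: "nice z E" "d > 0"
 "!!al mu. mu > 0 ==> d <= mom s (%xi. z xi - al * prof s mu xi)" "deficit s z E <= \<Lambda> / 2 * d" by blast
 have "\<Lambda> / 2 >= 0" unfolding L using s a(1) by simp
 from sharp_stability_candidate[OF z(1) s z(2) this C z(3,4)]
 show "\<exists>u :: real ^ 'n => complex. test_fun u \<and>
 sqrt (lap_energy (s / 2) u) * sqrt (grad_energy u) - (N + s) / 2 * lap_energy (s / 4) u < C * dist_to_profiles s u"
 unfolding D .
 qed
qed

end
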